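(* Let $M$ be a graded $S$-module, and let $\widetilde M$ be the corresponding sheaf on the weighted projective space $\mathbb P_{\mathrm{var}}(\mathbf a)=\operatorname{Proj}(S)$. Let $j\in\mathbb Z$, and let $\Phi_j\colon G_j\to F_j$ be the map of graded free $S$-modules obtained from a presentation of the Veronese module $S(j)^{(\ell)}$ over $S^{(\ell)}$ as described in the context. Set $$M':=\operatorname{coker}\left(M\otimes_S G_j\xrightarrow{\,M\otimes\Phi_j\,}M\otimes_S F_j\right).$$ Then there is an isomorphism $\widetilde{M'}\cong\widetilde M(j)$ of sheaves on $\mathbb P_{\mathrm{var}}(\mathbf a)$, where $\widetilde M(j)=\widetilde M\otimes\mathcal O_{\mathbb P_{\mathrm{var}}(\mathbf a)}(j)$.
   Context: Let $\mathbf k$ be a field and $S=\mathbf k[x_0,\dots,x_n]$ the $\mathbb Z$-graded polynomial ring with $\deg(x_i)=a_i\ge1$; $\mathbf a=(a_0,\dots,a_n)$; $\ell=\operatorname{lcm}(a_0,\dots,a_n)$. $\mathbb P_{\mathrm{var}}(\mathbf a)=\operatorname{Proj}(S)$ is the weighted projective variety; $\widetilde M$ is the quasi-coherent sheaf on $\operatorname{Proj}(S)$ associated to a graded $S$-module $M$, and $\mathcal O_{\mathbb P_{\mathrm{var}}(\mathbf a)}(j)=\widetilde{S(j)}$. (In general $\widetilde M(j)\ne\widetilde{M(j)}$ here.) The Veronese ring is $S^{(\ell)}=\bigoplus_{e}S_{e\ell}$, with $S_{e\ell}$ in degree $e$, and $S(j)^{(\ell)}=\bigoplus_{e\in\mathbb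 Z}S_{j+e\ell}$ is the degree $\ell$ Veronese submodule of $S(j)$, a graded $S^{(\ell)}$-module with degree $e$ part $S_{j+e\ell}$. Let $\phi_j\colon G'_j\to F'_j$ be a presentation matrix of $S(j)^{(\ell)}$ over $S^{(\ell)}$, with $G'_j=\bigoplus_{t}S^{(\ell)}(c_t)$ and $F'_j=\bigoplus_{s}S^{(\ell)}(b_s)$ graded free $S^{(\ell)}$-modules (finite sums, $c_t,b_s\in\mathbb Z$). Then $\Phi_j\colon G_j=\bigoplus_t S(c_t\ell)\to F_j=\bigoplus_s S(b_s\ell)$ is the same matrix, regarded as a map of graded free $S$-modules. *)

theory Defs
  imports "HOL-Algebra.Module" "HOL-Algebra.Ideal" "HOL-Algebra.Generated_Groups"
    "HOL-Algebra.Free_Abelian_Groups" "HOL-Analysis.Abstract_Topology"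
begin

text \<open>
  Rings and modules are the record structures of HOL-Algebra.  The fields \<open>mult\<close> and \<open>one\<close>,
  which every module record inherits, carry no meaning and are left undefined below.
\<close>

section \<open>Graded rings and modules\<close>

record 'a graded_ring = "'a ring" +
  rdeg :: "int \<Rightarrow> 'a set"

record ('a, 'b) graded_module = "('a, 'b) module" +
  mdeg :: "int \<Rightarrow> 'b set"

locale graded_module = Module.module R M
  for R :: "('a, 'c) graded_ring_scheme" (structure)
    and M :: "('a, 'b, 'd) graded_module_scheme" (structure) +
  assumes mdeg_subgroup: "additive_subgroup (mdeg M d) M"
    and mdeg_smult: "\<lbrakk>r \<in> rdeg R d; x \<in> mdeg M e\<rbrakk> \<Longrightarrow> r \<odot>\<^bsub>M\<^esub> x \<in> mdeg M (d + e)"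
    and mdeg_direct_sum: "x \<in> carrier M \<Longrightarrow>
      \<exists>!f. (\<forall>d. f d \<in> mdeg M d) \<and> finite {d. f d \<noteq> \<zero>\<^bsub>M\<^esub>} \<and> x = finsum M f {d. f d \<noteq> \<zero>\<^bsub>M\<^esub>}"

definition homogeneous :: "('a, 'c) graded_ring_scheme \<Rightarrow> 'a set" where
  "homogeneous R = (\<Union>d. rdeg R d)"

definition self_module :: "('a, 'c) graded_ring_scheme \<Rightarrow> ('a, 'a) graded_module" where
  "self_module R = \<lparr>carrier = carrier R, monoid.mult = undefined, one = undefined,
     ring.zero = \<zero>\<^bsub>R\<^esub>, add = add R, smult = monoid.mult R, mdeg = rdeg R\<rparr>"

definition shift :: "('a, 'b) graded_module \<Rightarrow> int \<Rightarrow> ('a, 'b) graded_module" where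
  "shift M j = M\<lparr>mdeg := (\<lambda>d. mdeg M (j + d))\<rparr>"

definition mod_hom ::
  "('a, 'c) ring_scheme \<Rightarrow> ('a, 'b, 'd) module_scheme \<Rightarrow> ('a, 'e, 'f) module_scheme \<Rightarrow> ('b \<Rightarrow> 'e) set"
where
  "mod_hom R M N = {f \<in> carrier M \<rightarrow> carrier N.
     (\<forall>x\<in>carrier M. \<forall>y\<in>carrier M. f (x \<oplus>\<^bsub>M\<^esub> y) = f x \<oplus>\<^bsub>N\<^esub> f y) \<and>
     (\<forall>r\<in>carrier R. \<forall>x\<in>carrier M. f (r \<odot>\<^bsub>M\<^esub> x) = r \<odot>\<^bsub>N\<^esub> f x)}"

definition graded_hom ::
  "('a, 'c) ring_scheme \<Rightarrow> ('a, 'b) graded_module \<Rightarrow> ('a, 'e) graded_module \<Rightarrow> ('b \<Rightarrow> 'e) set"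
where
  "graded_hom R M N = {f \<in> mod_hom R M N. \<forall>d. f ` mdeg M d \<subseteq> mdeg N d}"

subsection \<open>Veronese rings and modules\<close>

definition veronese_ring :: "nat \<Rightarrow> 'a graded_ring \<Rightarrow> 'a graded_ring" where
  "veronese_ring l R = R\<lparr>carrier := generate (add_monoid R) (\<Union>e. rdeg R (e * int l)),
     rdeg := (\<lambda>e. rdeg R (e * int l))\<rparr>"

definition veronese :: "nat \<Rightarrow> ('a, 'b) graded_module \<Rightarrow> ('a, 'b) graded_module" where
  "veronese l M = M\<lparr>carrier := generate (add_monoid M) (\<Union>e. mdeg M (e * int l)),
     mdeg := (\<lambda>e. mdeg M (e * int l))\<rparr>"

subsection \<open>Graded free modules, matrices and presentations\<close>

text \<open>\<open>free_module R q c\<close> is \<open>R(c 0) \<oplus> \<dots> \<oplus> R(c (q - 1))\<close>.\<close>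

definition free_module :: "'a graded_ring \<Rightarrow> nat \<Rightarrow> (nat \<Rightarrow> int) \<Rightarrow> ('a, nat \<Rightarrow> 'a) graded_module" where
  "free_module R q c = \<lparr>carrier = {..<q} \<rightarrow>\<^sub>E carrier R, monoid.mult = undefined, one = undefined,
     ring.zero = (\<lambda>t\<in>{..<q}. \<zero>\<^bsub>R\<^esub>),
     add = (\<lambda>v w. \<lambda>t\<in>{..<q}. v t \<oplus>\<^bsub>R\<^esub> w t),
     smult = (\<lambda>r v. \<lambda>t\<in>{..<q}. r \<otimes>\<^bsub>R\<^esub> v t),
     mdeg = (\<lambda>d. \<Pi>\<^sub>E t\<in>{..<q}. rdeg R (c t + d))\<rparr>"

definition matrix_map ::
  "('a, 'c) ring_scheme \<Rightarrow> nat \<Rightarrow> nat \<Rightarrow> (nat \<Rightarrow> nat \<Rightarrow> 'a) \<Rightarrow> (nat \<Rightarrow> 'a) \<Rightarrow> (nat \<Rightarrow> 'a)"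
where
  "matrix_map R p q A v = (\<lambda>s\<in>{..<p}. finsum R (\<lambda>t. A s t \<otimes>\<^bsub>R\<^esub> v t) {..<q})"

text \<open>The \<open>p \<times> q\<close> matrix \<open>A\<close> presents \<open>N\<close>: there is an exact sequence of graded \<open>R\<close>-modules
  \<open>\<Oplus>\<^sub>t R(c t) \<rightarrow> \<Oplus>\<^sub>s R(b s) \<rightarrow> N \<rightarrow> 0\<close> with degree 0 maps, the first one given by \<open>A\<close>.\<close>

definition presentation_matrix ::
  "'a graded_ring \<Rightarrow> ('a, 'b) graded_module \<Rightarrow> nat \<Rightarrow> (nat \<Rightarrow> int) \<Rightarrow> nat \<Rightarrow> (nat \<Rightarrow> int) \<Rightarrow>
    (nat \<Rightarrow> nat \<Rightarrow> 'a) \<Rightarrow> bool"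
where
  "presentation_matrix R N p b q c A \<longleftrightarrow>
     (\<forall>s<p. \<forall>t<q. A s t \<in> carrier R) \<and>
     matrix_map R p q A \<in> graded_hom R (free_module R q c) (free_module R p b) \<and>
     (\<exists>\<pi>\<in>graded_hom R (free_module R p b) N.
        \<pi> ` carrier (free_module R p b) = carrier N \<and>
        {v \<in> carrier (free_module R p b). \<pi> v = \<zero>\<^bsub>N\<^esub>}
          = matrix_map R p q A ` carrier (free_module R q c))"

subsection \<open>Cokernels\<close>

definition graded_coker ::
  "('a, 'b) graded_module \<Rightarrow> ('a, 'e) graded_module \<Rightarrow> ('b \<Rightarrow> 'e) \<Rightarrow> ('a, 'e set) graded_module"
where
  "graded_coker M N f = (let L = f ` carrier M in
     \<lparr>carrier = a_rcosets\<^bsub>N\<^esub> L, monoid.mult = undefined, one = undefined,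
      ring.zero = L, add = set_add N,
      smult = (\<lambda>r C. \<Union>x\<in>C. L +>\<^bsub>N\<^esub> (r \<odot>\<^bsub>N\<^esub> x)),
      mdeg = (\<lambda>d. (\<lambda>x. L +>\<^bsub>N\<^esub> x) ` mdeg N d)\<rparr>)"

subsection \<open>Tensor products\<close>

text \<open>\<open>M \<otimes>\<^sub>R N\<close> is the free abelian group on \<open>M \<times> N\<close> modulo the bilinearity and balancing
  relations.  Its elements are cosets.\<close>

definition tensor_relations ::
  "('a, 'c) ring_scheme \<Rightarrow> ('a, 'm, 'd) module_scheme \<Rightarrow> ('a, 'n, 'e) module_scheme \<Rightarrow>
    (('m \<times> 'n) \<Rightarrow>\<^sub>0 int) set"
where
  "tensor_relations R M N =
     {frag_of (x \<oplus>\<^bsub>M\<^esub> x', y) - frag_of (x, y) - frag_of (x', y) |x x' y.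
        x \<in> carrier M \<and> x' \<in> carrier M \<and> y \<in> carrier N} \<union>
     {frag_of (x, y \<oplus>\<^bsub>N\<^esub> y') - frag_of (x, y) - frag_of (x, y') |x y y'.
        x \<in> carrier M \<and> y \<in> carrier N \<and> y' \<in> carrier N} \<union>
     {frag_of (r \<odot>\<^bsub>M\<^esub> x, y) - frag_of (x, r \<odot>\<^bsub>N\<^esub> y) |r x y.
        r \<in> carrier R \<and> x \<in> carrier M \<and> y \<in> carrier N}"

definition tensor_kernel ::
  "('a, 'c) ring_scheme \<Rightarrow> ('a, 'm, 'd) module_scheme \<Rightarrow> ('a, 'n, 'e) module_scheme \<Rightarrow>
    (('m \<times> 'n) \<Rightarrow>\<^sub>0 int) set"
where
  "tensor_kernel R M N =
     generate (free_Abelian_group (carrier M \<times> carrier N)) (tensor_relations R M N)"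

definition tensor_class ::
  "('a, 'c) ring_scheme \<Rightarrow> ('a, 'm, 'd) module_scheme \<Rightarrow> ('a, 'n, 'e) module_scheme \<Rightarrow>
    (('m \<times> 'n) \<Rightarrow>\<^sub>0 int) \<Rightarrow> (('m \<times> 'n) \<Rightarrow>\<^sub>0 int) set"
where
  "tensor_class R M N z =
     tensor_kernel R M N #>\<^bsub>free_Abelian_group (carrier M \<times> carrier N)\<^esub> z"

text \<open>The map \<open>f \<otimes> g\<close> into \<open>M \<otimes>\<^sub>R N\<close>, sending \<open>x \<otimes> y\<close> to \<open>f x \<otimes> g y\<close>; \<open>R\<close>, \<open>M\<close>, \<open>N\<close> are
  those of the target.\<close>

definition tensor_map ::
  "('a, 'c) ring_scheme \<Rightarrow> ('a, 'm, 'd) module_scheme \<Rightarrow> ('a, 'n, 'e) module_scheme \<Rightarrow>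
    ('m0 \<Rightarrow> 'm) \<Rightarrow> ('n0 \<Rightarrow> 'n) \<Rightarrow> (('m0 \<times> 'n0) \<Rightarrow>\<^sub>0 int) set \<Rightarrow> (('m \<times> 'n) \<Rightarrow>\<^sub>0 int) set"
where
  "tensor_map R M N f g C =
     (\<Union>z\<in>C. tensor_class R M N (frag_extend (\<lambda>(x, y). frag_of (f x, g y)) z))"

definition tensor ::
  "('a, 'c) ring_scheme \<Rightarrow> ('a, 'm, 'd) module_scheme \<Rightarrow> ('a, 'n, 'e) module_scheme \<Rightarrow>
    ('a, (('m \<times> 'n) \<Rightarrow>\<^sub>0 int) set) module"
where
  "tensor R M N = (let A = free_Abelian_group (carrier M \<times> carrier N) Mod tensor_kernel R M N in
     \<lparr>carrier = carrier A, monoid.mult = undefined, one = undefined,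
      ring.zero = monoid.one A, add = monoid.mult A,
      smult = (\<lambda>r. tensor_map R M N (\<lambda>x. r \<odot>\<^bsub>M\<^esub> x) id)\<rparr>)"

definition graded_tensor ::
  "('a, 'c) ring_scheme \<Rightarrow> ('a, 'm) graded_module \<Rightarrow> ('a, 'n) graded_module \<Rightarrow>
    ('a, (('m \<times> 'n) \<Rightarrow>\<^sub>0 int) set) graded_module"
where
  "graded_tensor R M N = (let T = tensor R M N in
     \<lparr>carrier = carrier T, monoid.mult = undefined, one = undefined,
      ring.zero = ring.zero T, add = add T, smult = smult T,
      mdeg = (\<lambda>d. generate (add_monoid T)
        {tensor_class R M N (frag_of (x, y)) |x y. \<exists>e. x \<in> mdeg M e \<and> y \<in> mdeg N (d - e)})\<rparr>)"

section \<open>Sheaves of modules on ringed spaces\<close>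

text \<open>Only the values on open sets are meaningful.\<close>

record ('x, 'r) ringed_space =
  topo :: "'x topology"
  fun_ring :: "'x set \<Rightarrow> 'r ring"
  fun_res :: "'x set \<Rightarrow> 'x set \<Rightarrow> 'r \<Rightarrow> 'r"

record ('x, 'r, 'm) mod_presheaf =
  sect :: "'x set \<Rightarrow> ('r, 'm) module"
  res :: "'x set \<Rightarrow> 'x set \<Rightarrow> 'm \<Rightarrow> 'm"

definition sheaf_isomorphic ::
  "('x, 'r) ringed_space \<Rightarrow> ('x, 'r, 'm) mod_presheaf \<Rightarrow> ('x, 'r, 'n) mod_presheaf \<Rightarrow> bool"
where
  "sheaf_isomorphic X F G \<longleftrightarrow> (\<exists>\<eta>. \<forall>U. openin (topo X) U \<longrightarrow>
     \<eta> U \<in> mod_hom (fun_ring X U) (sect F U) (sect G U) \<and>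
     bij_betw (\<eta> U) (carrier (sect F U)) (carrier (sect G U)) \<and>
     (\<forall>V. openin (topo X) V \<and> V \<subseteq> U \<longrightarrow>
        (\<forall>\<sigma>\<in>carrier (sect F U). \<eta> V (res F U V \<sigma>) = res G U V (\<eta> U \<sigma>))))"

definition germ ::
  "('x, 'r) ringed_space \<Rightarrow> ('x, 'r, 'm) mod_presheaf \<Rightarrow> 'x \<Rightarrow> 'x set \<Rightarrow> 'm \<Rightarrow> ('x set \<times> 'm) set"
where
  "germ X F P U \<sigma> = {(V, \<tau>). openin (topo X) V \<and> P \<in> V \<and> \<tau> \<in> carrier (sect F V) \<and>
     (\<exists>W. openin (topo X) W \<and> P \<in> W \<and> W \<subseteq> U \<inter> V \<and> res F U W \<sigma> = res F V W \<tau>)}"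

definition stalk ::
  "('x, 'r) ringed_space \<Rightarrow> ('x, 'r, 'm) mod_presheaf \<Rightarrow> 'x \<Rightarrow> ('x set \<times> 'm) set set"
where
  "stalk X F P = {germ X F P U \<sigma> |U \<sigma>. openin (topo X) U \<and> P \<in> U \<and> \<sigma> \<in> carrier (sect F U)}"

definition stalk_add ::
  "('x, 'r) ringed_space \<Rightarrow> ('x, 'r, 'm) mod_presheaf \<Rightarrow> 'x \<Rightarrow>
    ('x set \<times> 'm) set \<Rightarrow> ('x set \<times> 'm) set \<Rightarrow> ('x set \<times> 'm) set"
where
  "stalk_add X F P g h = (\<Union>(U, \<sigma>)\<in>g. \<Union>(V, \<tau>)\<in>h.
     germ X F P (U \<inter> V) (res F U (U \<inter> V) \<sigma> \<oplus>\<^bsub>sect F (U \<inter> V)\<^esub> res F V (U \<inter> V) \<tau>))"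

text \<open>The action of a function \<open>r \<in> \<O>(U)\<close> on the stalk at a point \<open>P \<in> U\<close>.\<close>

definition stalk_smult ::
  "('x, 'r) ringed_space \<Rightarrow> ('x, 'r, 'm) mod_presheaf \<Rightarrow> 'x \<Rightarrow> 'x set \<Rightarrow> 'r \<Rightarrow>
    ('x set \<times> 'm) set \<Rightarrow> ('x set \<times> 'm) set"
where
  "stalk_smult X F P U r g = (\<Union>(V, \<tau>)\<in>g.
     germ X F P (U \<inter> V) (fun_res X U (U \<inter> V) r \<odot>\<^bsub>sect F (U \<inter> V)\<^esub> res F V (U \<inter> V) \<tau>))"

text \<open>Sections of the associated sheaf over \<open>U\<close> are the families of germs that locally come from
  sections of the presheaf.\<close>

definition sheafification ::
  "('x, 'r) ringed_space \<Rightarrow> ('x, 'r, 'm) mod_presheaf \<Rightarrow>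
    ('x, 'r, 'x \<Rightarrow> ('x set \<times> 'm) set) mod_presheaf"
where
  "sheafification X F =
     \<lparr>sect = (\<lambda>U. \<lparr>carrier = {\<sigma> \<in> \<Pi>\<^sub>E P\<in>U. stalk X F P.
          \<forall>P\<in>U. \<exists>V. openin (topo X) V \<and> P \<in> V \<and> V \<subseteq> U \<and>
            (\<exists>\<tau>\<in>carrier (sect F V). \<forall>Q\<in>V. \<sigma> Q = germ X F Q V \<tau>)},
        monoid.mult = undefined, one = undefined,
        ring.zero = (\<lambda>P\<in>U. germ X F P U \<zero>\<^bsub>sect F U\<^esub>),
        add = (\<lambda>\<sigma> \<tau>. \<lambda>P\<in>U. stalk_add X F P (\<sigma> P) (\<tau> P)),
        smult = (\<lambda>r \<sigma>. \<lambda>P\<in>U. stalk_smult X F P U r (\<sigma> P))\<rparr>),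
      res = (\<lambda>U V \<sigma>. restrict \<sigma> V)\<rparr>"

definition presheaf_tensor ::
  "('x, 'r) ringed_space \<Rightarrow> ('x, 'r, 'm) mod_presheaf \<Rightarrow> ('x, 'r, 'n) mod_presheaf \<Rightarrow>
    ('x, 'r, (('m \<times> 'n) \<Rightarrow>\<^sub>0 int) set) mod_presheaf"
where
  "presheaf_tensor X F G =
     \<lparr>sect = (\<lambda>U. tensor (fun_ring X U) (sect F U) (sect G U)),
      res = (\<lambda>U V. tensor_map (fun_ring X V) (sect F V) (sect G V) (res F U V) (res G U V))\<rparr>"

definition sheaf_tensor ::
  "('x, 'r) ringed_space \<Rightarrow> ('x, 'r, 'm) mod_presheaf \<Rightarrow> ('x, 'r, 'n) mod_presheaf \<Rightarrow>
    ('x, 'r, 'x \<Rightarrow> ('x set \<times> (('m \<times> 'n) \<Rightarrow>\<^sub>0 int) set) set) mod_presheaf"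
where
  "sheaf_tensor X F G = sheafification X (presheaf_tensor X F G)"

section \<open>Proj and the sheaf associated to a graded module\<close>

definition irrelevant_ideal :: "('a, 'c) graded_ring_scheme \<Rightarrow> 'a set" where
  "irrelevant_ideal R = Idl\<^bsub>R\<^esub> (\<Union>d\<in>{0<..}. rdeg R d)"

definition Proj_set :: "('a, 'c) graded_ring_scheme \<Rightarrow> 'a set set" where
  "Proj_set R = {P. primeideal P R \<and> P = Idl\<^bsub>R\<^esub> (P \<inter> homogeneous R) \<and> \<not> irrelevant_ideal R \<subseteq> P}"

definition zariski :: "('a, 'c) graded_ring_scheme \<Rightarrow> 'a set topology" where
  "zariski R = topology_generated_by ((\<lambda>f. {P \<in> Proj_set R. f \<notin> P}) ` homogeneous R)"

text \<open>The degree 0 part \<open>M\<^bsub>(P)\<^esub>\<close> of the localization of \<open>M\<close> at the homogeneous elements outside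
  \<open>P\<close>; its elements are classes of pairs (numerator, denominator) of equal degree.\<close>

definition frac_pairs ::
  "('a, 'c) graded_ring_scheme \<Rightarrow> ('a, 'b, 'd) graded_module_scheme \<Rightarrow> 'a set \<Rightarrow> ('b \<times> 'a) set"
where
  "frac_pairs R M P = {(x, s). \<exists>d. x \<in> mdeg M d \<and> s \<in> rdeg R d \<and> s \<notin> P}"

definition frac ::
  "('a, 'c) graded_ring_scheme \<Rightarrow> ('a, 'b, 'd) graded_module_scheme \<Rightarrow> 'a set \<Rightarrow> 'b \<Rightarrow> 'a \<Rightarrow> ('b \<times> 'a) set"
where
  "frac R M P x s = {(y, t) \<in> frac_pairs R M P.
     \<exists>u\<in>homogeneous R - P. (u \<otimes>\<^bsub>R\<^esub> t) \<odot>\<^bsub>M\<^esub> x = (u \<otimes>\<^bsub>R\<^esub> s) \<odot>\<^bsub>M\<^esub> y}"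

definition local_carrier ::
  "('a, 'c) graded_ring_scheme \<Rightarrow> ('a, 'b, 'd) graded_module_scheme \<Rightarrow> 'a set \<Rightarrow> ('b \<times> 'a) set set"
where
  "local_carrier R M P = (\<lambda>(x, s). frac R M P x s) ` frac_pairs R M P"

definition local_add ::
  "('a, 'c) graded_ring_scheme \<Rightarrow> ('a, 'b, 'd) graded_module_scheme \<Rightarrow> 'a set \<Rightarrow>
    ('b \<times> 'a) set \<Rightarrow> ('b \<times> 'a) set \<Rightarrow> ('b \<times> 'a) set"
where
  "local_add R M P A B = (\<Union>(x, s)\<in>A. \<Union>(y, t)\<in>B.
     frac R M P ((t \<odot>\<^bsub>M\<^esub> x) \<oplus>\<^bsub>M\<^esub> (s \<odot>\<^bsub>M\<^esub> y)) (s \<otimes>\<^bsub>R\<^esub> t))"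

text \<open>The action of \<open>R\<^bsub>(P)\<^esub>\<close> on \<open>M\<^bsub>(P)\<^esub>\<close>; for \<open>M = R\<close> it is the multiplication of \<open>R\<^bsub>(P)\<^esub>\<close>.\<close>

definition local_smult ::
  "('a, 'c) graded_ring_scheme \<Rightarrow> ('a, 'b, 'd) graded_module_scheme \<Rightarrow> 'a set \<Rightarrow>
    ('a \<times> 'a) set \<Rightarrow> ('b \<times> 'a) set \<Rightarrow> ('b \<times> 'a) set"
where
  "local_smult R M P A B = (\<Union>(r, s)\<in>A. \<Union>(x, t)\<in>B. frac R M P (r \<odot>\<^bsub>M\<^esub> x) (s \<otimes>\<^bsub>R\<^esub> t))"

definition regular_sections ::
  "('a, 'c) graded_ring_scheme \<Rightarrow> ('a, 'b, 'd) graded_module_scheme \<Rightarrow> 'a set set \<Rightarrow>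
    ('a set \<Rightarrow> ('b \<times> 'a) set) set"
where
  "regular_sections R M U = {\<sigma> \<in> \<Pi>\<^sub>E P\<in>U. local_carrier R M P.
     \<forall>P\<in>U. \<exists>V. openin (zariski R) V \<and> P \<in> V \<and> V \<subseteq> U \<and>
       (\<exists>d. \<exists>x\<in>mdeg M d. \<exists>s\<in>rdeg R d. \<forall>Q\<in>V. s \<notin> Q \<and> \<sigma> Q = frac R M Q x s)}"

definition Proj :: "'a graded_ring \<Rightarrow> ('a set, 'a set \<Rightarrow> ('a \<times> 'a) set) ringed_space" where
  "Proj R =
     \<lparr>topo = zariski R,
      fun_ring = (\<lambda>U. \<lparr>carrier = regular_sections R (self_module R) U,
        monoid.mult = (\<lambda>\<sigma> \<tau>. \<lambda>P\<in>U. local_smult R (self_module R) P (\<sigma> P) (\<tau> P)),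
        one = (\<lambda>P\<in>U. frac R (self_module R) P \<one>\<^bsub>R\<^esub> \<one>\<^bsub>R\<^esub>),
        ring.zero = (\<lambda>P\<in>U. frac R (self_module R) P \<zero>\<^bsub>R\<^esub> \<one>\<^bsub>R\<^esub>),
        add = (\<lambda>\<sigma> \<tau>. \<lambda>P\<in>U. local_add R (self_module R) P (\<sigma> P) (\<tau> P))\<rparr>),
      fun_res = (\<lambda>U V \<sigma>. restrict \<sigma> V)\<rparr>"

definition tilde ::
  "'a graded_ring \<Rightarrow> ('a, 'b) graded_module \<Rightarrow>
    ('a set, 'a set \<Rightarrow> ('a \<times> 'a) set, 'a set \<Rightarrow> ('b \<times> 'a) set) mod_presheaf"
where
  "tilde R M =
     \<lparr>sect = (\<lambda>U. \<lparr>carrier = regular_sections R M U, monoid.mult = undefined, one = undefined,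
        ring.zero = (\<lambda>P\<in>U. frac R M P \<zero>\<^bsub>M\<^esub> \<one>\<^bsub>R\<^esub>),
        add = (\<lambda>\<sigma> \<tau>. \<lambda>P\<in>U. local_add R M P (\<sigma> P) (\<tau> P)),
        smult = (\<lambda>\<sigma> \<tau>. \<lambda>P\<in>U. local_smult R M P (\<sigma> P) (\<tau> P))\<rparr>),
      res = (\<lambda>U V \<sigma>. restrict \<sigma> V)\<rparr>"

definition twisting_sheaf ::
  "'a graded_ring \<Rightarrow> int \<Rightarrow>
    ('a set, 'a set \<Rightarrow> ('a \<times> 'a) set, 'a set \<Rightarrow> ('a \<times> 'a) set) mod_presheaf"
where
  "twisting_sheaf R j = tilde R (shift (self_module R) j)"

definition twist ::
  "'a graded_ring \<Rightarrow> ('a set, 'a set \<Rightarrow> ('a \<times> 'a) set, 'm) mod_presheaf \<Rightarrow> int \<Rightarrow>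
    ('a set, 'a set \<Rightarrow> ('a \<times> 'a) set,
     'a set \<Rightarrow> ('a set set \<times> (('m \<times> ('a set \<Rightarrow> ('a \<times> 'a) set)) \<Rightarrow>\<^sub>0 int) set) set) mod_presheaf"
where
  "twist R F j = sheaf_tensor (Proj R) F (twisting_sheaf R j)"

section \<open>The weighted polynomial ring\<close>

text \<open>A monomial is its exponent vector \<open>nat \<Rightarrow>\<^sub>0 nat\<close>, so the variable \<open>x\<^sub>i\<close> has index \<open>i\<close>.\<close>

type_synonym 'k polynomial = "(nat \<Rightarrow>\<^sub>0 nat) \<Rightarrow>\<^sub>0 'k"

definition weight :: "(nat \<Rightarrow> nat) \<Rightarrow> (nat \<Rightarrow>\<^sub>0 nat) \<Rightarrow> nat" where
  "weight a \<mu> = (\<Sum>i\<in>Poly_Mapping.keys \<mu>. a i * Poly_Mapping.lookup \<mu> i)"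

definition weighted_poly_ring :: "nat \<Rightarrow> (nat \<Rightarrow> nat) \<Rightarrow> ('k::field) polynomial graded_ring" where
  "weighted_poly_ring n a =
     \<lparr>carrier = {f. \<forall>\<mu>\<in>Poly_Mapping.keys f. Poly_Mapping.keys \<mu> \<subseteq> {..n}},
      monoid.mult = (*), one = 1, ring.zero = 0, add = (+),
      rdeg = (\<lambda>d. {f. \<forall>\<mu>\<in>Poly_Mapping.keys f.
                         Poly_Mapping.keys \<mu> \<subseteq> {..n} \<and> int (weight a \<mu>) = d})\<rparr>"

end

theory Submission
  imports Defs
begin

text \<open>
  Every point of Proj has a neighbourhood on which some element \<open>u\<close> of degree \<open>l\<close>, a power of a
  variable, does not vanish.  There a twist by a multiple of \<open>l\<close> changes a graded module only by
  powers of \<open>u\<close>.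

  Let \<open>m s\<close>, of degree \<open>j - b s * l\<close>, be the generators of the Veronese module given by the
  presentation, and let \<open>\<kappa>\<close> be the projection of the \<open>p\<close>-tuples over \<open>M\<close> onto \<open>M'\<close>; its kernel consists
  of the tuples \<open>A y\<close>.  A section of \<open>O(j)\<close> near a point has the form \<open>(\<Sigma>s. r s * m s) / t\<close> with \<open>t\<close> of
  degree divisible by \<open>l\<close>, because a fraction can be expanded by a power of its denominator.  So
  \<open>x / s \<otimes> (\<Sigma>i. r i * m i) / t \<mapsto> \<kappa> (\<lambda>i. r i x) / (s t)\<close> pairs the local modules; the result does not
  depend on \<open>r\<close>, since two choices differ by a combination of the columns of \<open>A\<close>.

  With \<open>u\<close> available, every local section of the presheaf tensor product is a sum
  \<open>\<Sigma>s. z s / w \<otimes> u ^ (N + b s) m s / u ^ N\<close>.  If its image vanishes at a point, then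
  \<open>h u ^ (N + b s) z s = (A y) s\<close> for some \<open>h\<close> not vanishing there, and the relations
  \<open>(\<Sigma>s. A s t * m s) = 0\<close> make the sum zero nearby.  Hence the pairing is locally bijective and
  induces an isomorphism from the sheafification to the sheaf of \<open>M'\<close>.
\<close>

section \<open>Tensor products\<close>

text \<open>On a weighted projective space O(j) need not be invertible, so the twist cannot be
  computed by shifting M or by trivializing O(j) near a point. The generators \<open>m s\<close> do
  not have the degrees of sections of O(j): in S(j) the degree of \<open>m s\<close> is - b s * l,
  and powers of u have to compensate for that. Only nonnegative powers of u exist, which is why
  every exponent is offset by a single bound N for all b s and c t. Two further obstacles shape the
  proof. The presheaf tensor product over U is formed over the functions on U and not over a local
  ring, so vanishing at one point has to become an identity on a neighbourhood; a single h and
  finitely many y t are enough data for that. These y t must be homogeneous, while membership in the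
  image of M \<otimes> \<Phi> supplies arbitrary elements of M; this is where the decomposition of M
  into graded pieces enters. The isomorphism is built from the sheaf of M' to the twist: a local
  fraction goes to the germ that the pairing sends to it. Being defined point by point, it commutes
  with restriction.\<close>

locale premodule =
  fixes R :: "('a, 'c) ring_scheme" and M :: "('a, 'b, 'd) module_scheme"
  assumes add_closed: "\<lbrakk>x \<in> carrier M; y \<in> carrier M\<rbrakk> \<Longrightarrow> x \<oplus>\<^bsub>M\<^esub> y \<in> carrier M"
    and smult_closed: "\<lbrakk>r \<in> carrier R; x \<in> carrier M\<rbrakk> \<Longrightarrow> r \<odot>\<^bsub>M\<^esub> x \<in> carrier M"
    and smult_add: "\<lbrakk>r \<in> carrier R; x \<in> carrier M; y \<in> carrier M\<rbrakk> \<Longrightarrow>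
      r \<odot>\<^bsub>M\<^esub> (x \<oplus>\<^bsub>M\<^esub> y) = r \<odot>\<^bsub>M\<^esub> x \<oplus>\<^bsub>M\<^esub> r \<odot>\<^bsub>M\<^esub> y"
    and smult_comm: "\<lbrakk>r \<in> carrier R; s \<in> carrier R; x \<in> carrier M\<rbrakk> \<Longrightarrow>
      r \<odot>\<^bsub>M\<^esub> (s \<odot>\<^bsub>M\<^esub> x) = s \<odot>\<^bsub>M\<^esub> (r \<odot>\<^bsub>M\<^esub> x)"

definition pure ::
  "('a, 'c) ring_scheme \<Rightarrow> ('a, 'm, 'd) module_scheme \<Rightarrow> ('a, 'n, 'e) module_scheme \<Rightarrow>
    'm \<Rightarrow> 'n \<Rightarrow> (('m \<times> 'n) \<Rightarrow>\<^sub>0 int) set"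
where "pure R M N x y = tensor_class R M N (frag_of (x, y))"

locale tensor_product = M: premodule R M + N: premodule R N
  for R :: "('a, 'c) ring_scheme" and M :: "('a, 'm, 'd) module_scheme"
    and N :: "('a, 'n, 'e) module_scheme"
begin

abbreviation "FA \<equiv> free_Abelian_group (carrier M \<times> carrier N)"

sublocale FA: comm_group FA
  by (rule abelian_free_Abelian_group)

lemma relations_carrier: "tensor_relations R M N \<subseteq> carrier FA"
proof -
  have *: "frag_of a - frag_of b - frag_of c \<in> carrier FA"
    if "a \<in> carrier M \<times> carrier N" "b \<in> carrier M \<times> carrier N" "c \<in> carrier M \<times> carrier N" for a b c
    using that keys_diff[of "frag_of a - frag_of b" "frag_of c"] keys_diff[of "frag_of a" "frag_of b"]
    by (auto simp del: SigmaE)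
  have **: "frag_of a - frag_of b \<in> carrier FA"
    if "a \<in> carrier M \<times> carrier N" "b \<in> carrier M \<times> carrier N" for a b
    using that keys_diff[of "frag_of a" "frag_of b"] by auto
  show ?thesis
    unfolding tensor_relations_def
    by (intro Un_least subsetI; (elim CollectE exE conjE); simp only:)
      (rule * **; simp add: M.add_closed N.add_closed M.smult_closed N.smult_closed)+
qed

lemma kernel_subgroup: "subgroup (tensor_kernel R M N) FA"
  unfolding tensor_kernel_def by (rule FA.generate_is_subgroup[OF relations_carrier])

lemma kernel_normal: "tensor_kernel R M N \<lhd> FA"
  using kernel_subgroup FA.normal_iff_subgroup by simp

interpretation K: normal "tensor_kernel R M N" FA
  by (rule kernel_normal)

lemma carrier_tensor: "carrier (tensor R M N) = tensor_class R M N ` carrier FA"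
  unfolding tensor_def Let_def tensor_class_def[abs_def] by (simp add: carrier_FactGroup)

lemma class_closed: "z \<in> carrier FA \<Longrightarrow> tensor_class R M N z \<in> carrier (tensor R M N)"
  unfolding carrier_tensor by blast

lemma class_add: "\<lbrakk>z \<in> carrier FA; w \<in> carrier FA\<rbrakk> \<Longrightarrow>
    tensor_class R M N z \<oplus>\<^bsub>tensor R M N\<^esub> tensor_class R M N w = tensor_class R M N (z + w)"
  unfolding tensor_class_def tensor_def Let_def using K.rcos_sum[of z w] by simp

lemma class_zero: "\<zero>\<^bsub>tensor R M N\<^esub> = tensor_class R M N 0"
  unfolding tensor_class_def tensor_def Let_def
  using FA.coset_mult_one[OF K.subset] by simp

lemma class_eqI: "\<lbrakk>z \<in> carrier FA; w \<in> carrier FA; z - w \<in> tensor_kernel R M N\<rbrakk> \<Longrightarrow>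
    tensor_class R M N z = tensor_class R M N w"
  unfolding tensor_class_def
  using FA.repr_independence[OF _ _ kernel_subgroup, of z w] K.rcos_module[of w z] FA.is_group
  by simp

lemma self_in_class: "z \<in> carrier FA \<Longrightarrow> z \<in> tensor_class R M N z"
  unfolding tensor_class_def using FA.rcos_self[OF _ kernel_subgroup] .

lemma in_classD:
  assumes "z \<in> carrier FA" "w \<in> tensor_class R M N z"
  shows "w \<in> carrier FA" "tensor_class R M N w = tensor_class R M N z" "w - z \<in> tensor_kernel R M N"
proof -
  obtain k where k: "k \<in> tensor_kernel R M N" "w = k + z"
    using assms unfolding tensor_class_def r_coset_def by auto
  have "k \<in> carrier FA" using k K.subset by blast
  from FA.m_closed[OF this assms(1)] show 1: "w \<in> carrier FA" using k(2) by simp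
  show 2: "w - z \<in> tensor_kernel R M N" using k by simp
  show "tensor_class R M N w = tensor_class R M N z"
    by (rule class_eqI[OF 1 assms(1) 2])
qed

sublocale T: abelian_group "tensor R M N"
proof (rule abelian_groupI)
  show "\<zero>\<^bsub>tensor R M N\<^esub> \<in> carrier (tensor R M N)"
    unfolding class_zero by (rule class_closed) simp
next
  fix x assume "x \<in> carrier (tensor R M N)"
  then obtain z where z: "z \<in> carrier FA" "x = tensor_class R M N z" unfolding carrier_tensor by blast
  show "\<zero>\<^bsub>tensor R M N\<^esub> \<oplus>\<^bsub>tensor R M N\<^esub> x = x"
    unfolding class_zero z(2) using z(1) by (subst class_add) auto
  show "\<exists>y\<in>carrier (tensor R M N). y \<oplus>\<^bsub>tensor R M N\<^esub> x = \<zero>\<^bsub>tensor R M N\<^esub>"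
    using z class_closed[of "-z"] class_add[of "-z" z] class_zero by auto
next
  fix x y
  assume "x \<in> carrier (tensor R M N)" "y \<in> carrier (tensor R M N)"
  then obtain z w where z: "z \<in> carrier FA" "x = tensor_class R M N z"
    and w: "w \<in> carrier FA" "y = tensor_class R M N w" unfolding carrier_tensor by blast
  have zw: "z + w \<in> carrier FA" using FA.m_closed[of z w] z w by simp
  show "x \<oplus>\<^bsub>tensor R M N\<^esub> y \<in> carrier (tensor R M N)"
    using class_closed[OF zw] z w class_add[of z w] by simp
  show "x \<oplus>\<^bsub>tensor R M N\<^esub> y = y \<oplus>\<^bsub>tensor R M N\<^esub> x"
    using z w class_add[of z w] class_add[of w z] by (simp add: add.commute)
  fix u assume "u \<in> carrier (tensor R M N)"
  then obtain v where v: "v \<in> carrier FA" "u = tensor_class R M N v" unfolding carrier_tensor by blast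
  have wv: "w + v \<in> carrier FA" using FA.m_closed[of w v] v w by simp
  show "x \<oplus>\<^bsub>tensor R M N\<^esub> y \<oplus>\<^bsub>tensor R M N\<^esub> u = x \<oplus>\<^bsub>tensor R M N\<^esub> (y \<oplus>\<^bsub>tensor R M N\<^esub> u)"
    unfolding z(2) w(2) v(2) class_add[OF z(1) w(1)] class_add[OF w(1) v(1)]
      class_add[OF zw v(1)] class_add[OF z(1) wv] by (simp add: add.assoc)
qed

lemma class_diff:
  assumes "z \<in> carrier FA" "w \<in> carrier FA"
  shows "tensor_class R M N (z - w) = tensor_class R M N z \<ominus>\<^bsub>tensor R M N\<^esub> tensor_class R M N w"
proof -
  have d: "z - w \<in> carrier FA" using FA.m_closed[of z "-w"] assms by simp
  have "tensor_class R M N (z - w) \<oplus>\<^bsub>tensor R M N\<^esub> tensor_class R M N w = tensor_class R M N z"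
    using class_add[OF d assms(2)] by simp
  then show ?thesis
    using class_closed[OF assms(1)] class_closed[OF assms(2)] class_closed[OF d]
    by (simp add: a_minus_def T.add.inv_solve_right)
qed

lemma pure_closed: "\<lbrakk>x \<in> carrier M; y \<in> carrier N\<rbrakk> \<Longrightarrow> pure R M N x y \<in> carrier (tensor R M N)"
  unfolding pure_def by (rule class_closed) simp

text \<open>Induction over the free abelian group closes its predicate under differences, so a
  single \<open>diff\<close> case takes care of sums and negatives together.\<close>

lemma tensor_induct [consumes 1, case_names zero pure diff]:
  assumes "t \<in> carrier (tensor R M N)"
    and zero: "P \<zero>\<^bsub>tensor R M N\<^esub>"
    and pure: "\<And>x y. \<lbrakk>x \<in> carrier M; y \<in> carrier N\<rbrakk> \<Longrightarrow> P (pure R M N x y)"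
    and diff: "\<And>a b. \<lbrakk>a \<in> carrier (tensor R M N); b \<in> carrier (tensor R M N); P a; P b\<rbrakk> \<Longrightarrow>
      P (a \<ominus>\<^bsub>tensor R M N\<^esub> b)"
  shows "P t"
proof -
  obtain z where z: "z \<in> carrier FA" "t = tensor_class R M N z"
    using assms(1) unfolding carrier_tensor by blast
  have "P (tensor_class R M N z)"
  proof (rule free_Abelian_group_induct[of z "carrier M \<times> carrier N"])
    show "Poly_Mapping.keys z \<subseteq> carrier M \<times> carrier N" using z(1) by simp
    show "P (tensor_class R M N 0)" using zero class_zero by simp
    show "P (tensor_class R M N (frag_of u))" if "u \<in> carrier M \<times> carrier N" for u
      using pure[of "fst u" "snd u"] that unfolding pure_def by auto
    show "P (tensor_class R M N (x - y))"
      if "Poly_Mapping.keys x \<subseteq> carrier M \<times> carrier N" "Poly_Mapping.keys y \<subseteq> carrier M \<times> carrier N"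
        "P (tensor_class R M N x)" "P (tensor_class R M N y)" for x y
      using diff[of "tensor_class R M N x" "tensor_class R M N y"] class_diff[of x y]
        class_closed[of x] class_closed[of y] that by simp
  qed
  then show ?thesis using z(2) by simp
qed

lemma pure_add_left:
  assumes "x \<in> carrier M" "x' \<in> carrier M" "y \<in> carrier N"
  shows "pure R M N (x \<oplus>\<^bsub>M\<^esub> x') y = pure R M N x y \<oplus>\<^bsub>tensor R M N\<^esub> pure R M N x' y"
proof -
  have "frag_of (x \<oplus>\<^bsub>M\<^esub> x', y) - frag_of (x, y) - frag_of (x', y) \<in> tensor_kernel R M N"
    unfolding tensor_kernel_def tensor_relations_def using assms by (blast intro: generate.incl)
  then have "pure R M N (x \<oplus>\<^bsub>M\<^esub> x') y = tensor_class R M N (frag_of (x, y) + frag_of (x', y))"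
    unfolding pure_def using assms M.add_closed FA.m_closed[of "frag_of (x, y)" "frag_of (x', y)"]
    by (intro class_eqI) (auto simp: diff_diff_add)
  then show ?thesis using class_add[of "frag_of (x, y)" "frag_of (x', y)"] assms by (simp add: pure_def)
qed

lemma pure_add_right:
  assumes "x \<in> carrier M" "y \<in> carrier N" "y' \<in> carrier N"
  shows "pure R M N x (y \<oplus>\<^bsub>N\<^esub> y') = pure R M N x y \<oplus>\<^bsub>tensor R M N\<^esub> pure R M N x y'"
proof -
  have "frag_of (x, y \<oplus>\<^bsub>N\<^esub> y') - frag_of (x, y) - frag_of (x, y') \<in> tensor_kernel R M N"
    unfolding tensor_kernel_def tensor_relations_def using assms by (blast intro: generate.incl)
  then have "pure R M N x (y \<oplus>\<^bsub>N\<^esub> y') = tensor_class R M N (frag_of (x, y) + frag_of (x, y'))"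
    unfolding pure_def using assms N.add_closed FA.m_closed[of "frag_of (x, y)" "frag_of (x, y')"]
    by (intro class_eqI) (auto simp: diff_diff_add)
  then show ?thesis using class_add[of "frag_of (x, y)" "frag_of (x, y')"] assms by (simp add: pure_def)
qed

lemma pure_balanced:
  assumes "r \<in> carrier R" "x \<in> carrier M" "y \<in> carrier N"
  shows "pure R M N (r \<odot>\<^bsub>M\<^esub> x) y = pure R M N x (r \<odot>\<^bsub>N\<^esub> y)"
proof -
  have "frag_of (r \<odot>\<^bsub>M\<^esub> x, y) - frag_of (x, r \<odot>\<^bsub>N\<^esub> y) \<in> tensor_kernel R M N"
    unfolding tensor_kernel_def tensor_relations_def using assms by (blast intro: generate.incl)
  then show ?thesis
    unfolding pure_def using assms M.smult_closed N.smult_closed by (intro class_eqI) auto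
qed

text \<open>The universal property. The extension g of f to the free abelian group is trivial on the
  relations, hence on the subgroup they generate, and so factors through the quotient. The target is
  a multiplicative record because local modules and modules of tuples are packaged as
  monoids.\<close>

lemma tensor_lift:
  assumes K: "comm_group K"
    and closed: "\<And>x y. \<lbrakk>x \<in> carrier M; y \<in> carrier N\<rbrakk> \<Longrightarrow> f x y \<in> carrier K"
    and add_left: "\<And>x x' y. \<lbrakk>x \<in> carrier M; x' \<in> carrier M; y \<in> carrier N\<rbrakk> \<Longrightarrow>
      f (x \<oplus>\<^bsub>M\<^esub> x') y = f x y \<otimes>\<^bsub>K\<^esub> f x' y"
    and add_right: "\<And>x y y'. \<lbrakk>x \<in> carrier M; y \<in> carrier N; y' \<in> carrier N\<rbrakk> \<Longrightarrow>
      f x (y \<oplus>\<^bsub>N\<^esub> y') = f x y \<otimes>\<^bsub>K\<^esub> f x y'"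
    and balanced: "\<And>r x y. \<lbrakk>r \<in> carrier R; x \<in> carrier M; y \<in> carrier N\<rbrakk> \<Longrightarrow>
      f (r \<odot>\<^bsub>M\<^esub> x) y = f x (r \<odot>\<^bsub>N\<^esub> y)"
  obtains h where "h \<in> hom (add_monoid (tensor R M N)) K"
    "\<And>x y. \<lbrakk>x \<in> carrier M; y \<in> carrier N\<rbrakk> \<Longrightarrow> h (pure R M N x y) = f x y"
proof -
  interpret K: comm_group K by (rule K)
  obtain g where g: "g \<in> hom FA K"
    and g_of: "\<And>u. u \<in> carrier M \<times> carrier N \<Longrightarrow> g (frag_of u) = (\<lambda>(x, y). f x y) u"
  proof (rule K.free_Abelian_group_universal)
    show "(\<lambda>(x, y). f x y) ` (carrier M \<times> carrier N) \<subseteq> carrier K" using closed by auto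
  qed (rule that)
  interpret g: group_hom FA K g
    using g by (simp add: group_hom_def group_hom_axioms_def)
  have g_add: "g (a + b) = g a \<otimes>\<^bsub>K\<^esub> g b" if "a \<in> carrier FA" "b \<in> carrier FA" for a b
    using g.hom_mult[OF that] by simp
  have g_eq: "g a = g b" if "a \<in> carrier FA" "b \<in> carrier FA" "g (a - b) = \<one>\<^bsub>K\<^esub>" for a b
  proof -
    have "a - b \<in> carrier FA" using FA.m_closed[of a "-b"] that by simp
    then have "g (a - b) \<otimes>\<^bsub>K\<^esub> g b = g a" using g_add[of "a - b" b] that by simp
    then show ?thesis using that by simp
  qed
  have g_eq': "g (a - b) = \<one>\<^bsub>K\<^esub>" if "a \<in> carrier FA" "b \<in> carrier FA" "g a = g b" for a b
  proof -
    have "a - b \<in> carrier FA" using FA.m_closed[of a "-b"] that by simp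
    then have "g (a - b) \<otimes>\<^bsub>K\<^esub> g b = g a" using g_add[of "a - b" b] that by simp
    then show ?thesis using that \<open>a - b \<in> carrier FA\<close>
      by (metis K.one_closed K.l_one K.right_cancel g.hom_closed)
  qed
  \<comment> \<open>Each relation is a difference of two elements on which g agrees by one of the
    bilinearity laws; \<open>g_eq'\<close> turns this agreement into triviality of the
    difference.\<close>
  have "r \<in> kernel FA K g" if "r \<in> tensor_relations R M N" for r
  proof -
    have rc: "r \<in> carrier FA" using that relations_carrier by blast
    have fc: "frag_of (x, y) \<in> carrier FA" if "x \<in> carrier M" "y \<in> carrier N" for x y
      using that by simp
    have ac: "frag_of (x, y) + frag_of (x', y') \<in> carrier FA"
      if "x \<in> carrier M" "y \<in> carrier N" "x' \<in> carrier M" "y' \<in> carrier N" for x y x' y'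
      using FA.m_closed[OF fc[OF that(1,2)] fc[OF that(3,4)]] by simp
    have gf: "g (frag_of (x, y)) = f x y" if "x \<in> carrier M" "y \<in> carrier N" for x y
      using g_of[of "(x, y)"] that by simp
    have "g r = \<one>\<^bsub>K\<^esub>"
      using that unfolding tensor_relations_def
    proof (elim UnE CollectE exE conjE)
      fix x x' y assume "r = frag_of (x \<oplus>\<^bsub>M\<^esub> x', y) - frag_of (x, y) - frag_of (x', y)"
        "x \<in> carrier M" "x' \<in> carrier M" "y \<in> carrier N"
      then show ?thesis
        using g_eq'[of "frag_of (x \<oplus>\<^bsub>M\<^esub> x', y)" "frag_of (x, y) + frag_of (x', y)"]
        by (simp only: diff_diff_add fc ac M.add_closed g_add gf add_left)
    next
      fix x y y' assume "r = frag_of (x, y \<oplus>\<^bsub>N\<^esub> y') - frag_of (x, y) - frag_of (x, y')"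
        "x \<in> carrier M" "y \<in> carrier N" "y' \<in> carrier N"
      then show ?thesis
        using g_eq'[of "frag_of (x, y \<oplus>\<^bsub>N\<^esub> y')" "frag_of (x, y) + frag_of (x, y')"]
        by (simp only: diff_diff_add fc ac N.add_closed g_add gf add_right)
    next
      fix a x y assume "r = frag_of (a \<odot>\<^bsub>M\<^esub> x, y) - frag_of (x, a \<odot>\<^bsub>N\<^esub> y)"
        "a \<in> carrier R" "x \<in> carrier M" "y \<in> carrier N"
      then show ?thesis
        using g_eq'[of "frag_of (a \<odot>\<^bsub>M\<^esub> x, y)" "frag_of (x, a \<odot>\<^bsub>N\<^esub> y)"]
        by (simp only: fc M.smult_closed N.smult_closed gf balanced)
    qed
    then show ?thesis using rc by (simp add: kernel_def)
  qed
  then have sub: "tensor_kernel R M N \<subseteq> kernel FA K g"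
    unfolding tensor_kernel_def
    by (intro FA.generate_subgroup_incl g.subgroup_kernel) blast
  obtain h where h: "h \<in> hom (FA Mod tensor_kernel R M N) K"
    "\<And>z. z \<in> carrier FA \<Longrightarrow> h (tensor_kernel R M N #>\<^bsub>FA\<^esub> z) = g z"
  proof (rule FactGroup_universal[OF g kernel_normal])
    fix x y assume xy: "x \<in> carrier FA" "y \<in> carrier FA"
      "tensor_kernel R M N #>\<^bsub>FA\<^esub> x = tensor_kernel R M N #>\<^bsub>FA\<^esub> y"
    have "x \<in> tensor_class R M N y"
      using self_in_class[OF xy(1)] xy(3) unfolding tensor_class_def by simp
    from in_classD(3)[OF xy(2) this] have "g (x - y) = \<one>\<^bsub>K\<^esub>" using sub by (auto simp: kernel_def)
    then show "g x = g y" using g_eq xy by blast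
  qed (rule that)
  have "h \<in> hom (add_monoid (tensor R M N)) K"
    using h(1) unfolding hom_def by (simp add: tensor_def Let_def)
  moreover have "h (pure R M N x y) = f x y" if "x \<in> carrier M" "y \<in> carrier N" for x y
    unfolding pure_def tensor_class_def using h(2)[of "frag_of (x, y)"] g_of[of "(x, y)"] that by simp
  ultimately show thesis using that by blast
qed

end

text \<open>The maps are semilinear along a map \<phi> of scalars, since restriction from U to V
  changes the base ring from functions on U to functions on V. With \<phi> the identity the locale
  covers the action of a scalar and the map induced by a matrix.\<close>

locale tensor_product_map =
  T: tensor_product R M N + T': tensor_product R' M' N'
  for R :: "('a, 'c) ring_scheme" and M :: "('a, 'm, 'd) module_scheme"
    and N :: "('a, 'n, 'e) module_scheme" and R' :: "('a1, 'c1) ring_scheme"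
    and M' :: "('a1, 'm1, 'd1) module_scheme" and N' :: "('a1, 'n1, 'e1) module_scheme" +
  fixes \<phi> :: "'a \<Rightarrow> 'a1" and f :: "'m \<Rightarrow> 'm1" and g :: "'n \<Rightarrow> 'n1"
  assumes \<phi>_closed: "r \<in> carrier R \<Longrightarrow> \<phi> r \<in> carrier R'"
    and f_closed: "x \<in> carrier M \<Longrightarrow> f x \<in> carrier M'"
    and g_closed: "y \<in> carrier N \<Longrightarrow> g y \<in> carrier N'"
    and f_add: "\<lbrakk>x \<in> carrier M; x' \<in> carrier M\<rbrakk> \<Longrightarrow> f (x \<oplus>\<^bsub>M\<^esub> x') = f x \<oplus>\<^bsub>M'\<^esub> f x'"
    and g_add: "\<lbrakk>y \<in> carrier N; y' \<in> carrier N\<rbrakk> \<Longrightarrow> g (y \<oplus>\<^bsub>N\<^esub> y') = g y \<oplus>\<^bsub>N'\<^esub> g y'"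
    and f_smult: "\<lbrakk>r \<in> carrier R; x \<in> carrier M\<rbrakk> \<Longrightarrow> f (r \<odot>\<^bsub>M\<^esub> x) = \<phi> r \<odot>\<^bsub>M'\<^esub> f x"
    and g_smult: "\<lbrakk>r \<in> carrier R; y \<in> carrier N\<rbrakk> \<Longrightarrow> g (r \<odot>\<^bsub>N\<^esub> y) = \<phi> r \<odot>\<^bsub>N'\<^esub> g y"
begin

abbreviation "ext \<equiv> frag_extend (\<lambda>(x, y). frag_of (f x, g y))"

lemma ext_closed: "z \<in> carrier T.FA \<Longrightarrow> ext z \<in> carrier T'.FA"
  using keys_frag_extend[of "\<lambda>(x, y). frag_of (f x, g y)" z] f_closed g_closed by fastforce

text \<open>Semilinearity carries relations to relations, and a homomorphism carries the subgroup
  generated by a set to the subgroup generated by its image.\<close>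

lemma ext_kernel:
  assumes "k \<in> tensor_kernel R M N"
  shows "ext k \<in> tensor_kernel R' M' N'"
proof -
  have hom: "ext \<in> hom T.FA T'.FA"
    by (rule homI) (use ext_closed in \<open>auto simp: frag_extend_add\<close>)
  interpret e: group_hom T.FA T'.FA ext
    using hom by (simp add: group_hom_def group_hom_axioms_def)
  have "ext ` tensor_relations R M N \<subseteq> tensor_relations R' M' N'"
  proof (intro image_subsetI)
    fix r assume "r \<in> tensor_relations R M N"
    then show "ext r \<in> tensor_relations R' M' N'"
      unfolding tensor_relations_def[of R M N]
    proof (elim UnE CollectE exE conjE)
      fix x x' y assume "r = frag_of (x \<oplus>\<^bsub>M\<^esub> x', y) - frag_of (x, y) - frag_of (x', y)"
        "x \<in> carrier M" "x' \<in> carrier M" "y \<in> carrier N"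
      then show ?thesis
        unfolding tensor_relations_def
        by (intro UnI1) (force simp: frag_extend_diff f_add intro!: f_closed g_closed)
    next
      fix x y y' assume "r = frag_of (x, y \<oplus>\<^bsub>N\<^esub> y') - frag_of (x, y) - frag_of (x, y')"
        "x \<in> carrier M" "y \<in> carrier N" "y' \<in> carrier N"
      then show ?thesis
        unfolding tensor_relations_def
        by (intro UnI1[OF UnI2]) (force simp: frag_extend_diff g_add intro!: f_closed g_closed)
    next
      fix a x y assume "r = frag_of (a \<odot>\<^bsub>M\<^esub> x, y) - frag_of (x, a \<odot>\<^bsub>N\<^esub> y)"
        "a \<in> carrier R" "x \<in> carrier M" "y \<in> carrier N"
      then show ?thesis
        unfolding tensor_relations_def
        by (intro UnI2) (force simp: frag_extend_diff f_smult g_smult intro!: \<phi>_closed f_closed g_closed)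
    qed
  qed
  then have "ext ` tensor_kernel R M N \<subseteq> tensor_kernel R' M' N'"
    unfolding tensor_kernel_def e.generate_img[OF T.relations_carrier, symmetric]
    using T'.relations_carrier by (intro T'.FA.mono_generate) auto
  then show ?thesis using assms by blast
qed

text \<open>\<open>tensor_map\<close> is a union over all representatives of a coset; by
  \<open>ext_kernel\<close> each of them contributes the same coset.\<close>

lemma tensor_map_class:
  assumes "z \<in> carrier T.FA"
  shows "tensor_map R' M' N' f g (tensor_class R M N z) = tensor_class R' M' N' (ext z)"
proof -
  have "tensor_class R' M' N' (ext w) = tensor_class R' M' N' (ext z)"
    if "w \<in> tensor_class R M N z" for w
    using T.in_classD[OF assms that] assms ext_kernel[of "w - z"]
    by (intro T'.class_eqI ext_closed) (auto simp: frag_extend_diff)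
  then show ?thesis
    unfolding tensor_map_def using T.self_in_class[OF assms] by blast
qed

lemma tensor_map_pure:
  "\<lbrakk>x \<in> carrier M; y \<in> carrier N\<rbrakk> \<Longrightarrow>
    tensor_map R' M' N' f g (pure R M N x y) = pure R' M' N' (f x) (g y)"
  unfolding pure_def using tensor_map_class[of "frag_of (x, y)"] by simp

lemma tensor_map_closed:
  "t \<in> carrier (tensor R M N) \<Longrightarrow> tensor_map R' M' N' f g t \<in> carrier (tensor R' M' N')"
  unfolding T.carrier_tensor using tensor_map_class ext_closed T'.class_closed by auto

lemma tensor_map_add:
  assumes "t \<in> carrier (tensor R M N)" "t' \<in> carrier (tensor R M N)"
  shows "tensor_map R' M' N' f g (t \<oplus>\<^bsub>tensor R M N\<^esub> t') =
    tensor_map R' M' N' f g t \<oplus>\<^bsub>tensor R' M' N'\<^esub> tensor_map R' M' N' f g t'"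
proof -
  obtain z w where z: "z \<in> carrier T.FA" "t = tensor_class R M N z"
    and w: "w \<in> carrier T.FA" "t' = tensor_class R M N w"
    using assms unfolding T.carrier_tensor by blast
  have zw: "z + w \<in> carrier T.FA" using T.FA.m_closed[OF z(1) w(1)] by simp
  show ?thesis
    unfolding z(2) w(2) T.class_add[OF z(1) w(1)] tensor_map_class[OF zw] tensor_map_class[OF z(1)]
      tensor_map_class[OF w(1)] T'.class_add[OF ext_closed[OF z(1)] ext_closed[OF w(1)]]
    by (simp add: frag_extend_add)
qed

sublocale map: abelian_group_hom "tensor R M N" "tensor R' M' N'" "tensor_map R' M' N' f g"
  by (intro abelian_group_homI T.T.abelian_group_axioms T'.T.abelian_group_axioms group_hom.intro
      group_hom_axioms.intro T.T.a_group T'.T.a_group homI)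
    (simp_all add: tensor_map_closed tensor_map_add)

end

context tensor_product
begin

lemma smult_tensor: "r \<odot>\<^bsub>tensor R M N\<^esub> t = tensor_map R M N (\<lambda>x. r \<odot>\<^bsub>M\<^esub> x) id t"
  by (simp add: tensor_def Let_def)

text \<open>Multiplication by r on the first factor is linear because scalars act by commuting
  operators, which is the content of \<open>smult_comm\<close>. The action on a tensor product
  thereby becomes an instance of functoriality.\<close>

lemma smult_map: "r \<in> carrier R \<Longrightarrow> tensor_product_map R M N R M N id (\<lambda>x. r \<odot>\<^bsub>M\<^esub> x) id"
  by (unfold_locales)
    (simp_all add: M.smult_closed M.smult_add M.smult_comm)

lemma smult_pure:
  "\<lbrakk>r \<in> carrier R; x \<in> carrier M; y \<in> carrier N\<rbrakk> \<Longrightarrow>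
    r \<odot>\<^bsub>tensor R M N\<^esub> pure R M N x y = pure R M N (r \<odot>\<^bsub>M\<^esub> x) y"
  unfolding smult_tensor using tensor_product_map.tensor_map_pure[OF smult_map] by simp

lemma smult_hom:
  assumes "r \<in> carrier R"
  shows "abelian_group_hom (tensor R M N) (tensor R M N) (\<lambda>t. r \<odot>\<^bsub>tensor R M N\<^esub> t)"
proof -
  interpret tensor_product_map R M N R M N id "\<lambda>x. r \<odot>\<^bsub>M\<^esub> x" id
    by (rule smult_map[OF assms])
  show ?thesis unfolding smult_tensor by (rule map.abelian_group_hom_axioms)
qed

lemma smult_closed: "\<lbrakk>r \<in> carrier R; t \<in> carrier (tensor R M N)\<rbrakk> \<Longrightarrow>
    r \<odot>\<^bsub>tensor R M N\<^esub> t \<in> carrier (tensor R M N)"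
  using abelian_group_hom.hom_closed[OF smult_hom] .

end

lemma (in abelian_group_hom) hom_diff:
  assumes "x \<in> carrier G" "y \<in> carrier G"
  shows "h (x \<ominus>\<^bsub>G\<^esub> y) = h x \<ominus>\<^bsub>H\<^esub> h y"
  using assms by (simp add: a_minus_def)

section \<open>Homogeneous localization\<close>

text \<open>Operations on classes are unions over all representatives, so evaluating one at a chosen
  representative amounts to showing that the choice does not matter.\<close>

lemma UN_const: "\<lbrakk>a \<in> A; \<And>b. b \<in> A \<Longrightarrow> f b = c\<rbrakk> \<Longrightarrow> (\<Union>b\<in>A. f b) = c"
  by auto

locale graded_cring = cring R for R :: "'a graded_ring" (structure) +
  assumes rdeg_subgroup: "additive_subgroup (rdeg R d) R"
    and rdeg_mult: "\<lbrakk>r \<in> rdeg R d; s \<in> rdeg R e\<rbrakk> \<Longrightarrow> r \<otimes> s \<in> rdeg R (d + e)"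
    and rdeg_one: "\<one> \<in> rdeg R 0"
begin

lemma rdeg_carrier: "r \<in> rdeg R d \<Longrightarrow> r \<in> carrier R"
  using additive_subgroup.a_subset[OF rdeg_subgroup] by blast

lemma rdeg_zero: "\<zero> \<in> rdeg R d"
  using additive_subgroup.zero_closed[OF rdeg_subgroup] .

lemma rdeg_add: "\<lbrakk>r \<in> rdeg R d; s \<in> rdeg R d\<rbrakk> \<Longrightarrow> r \<oplus> s \<in> rdeg R d"
  using additive_subgroup.a_closed[OF rdeg_subgroup] .

lemma rdeg_minus: "r \<in> rdeg R d \<Longrightarrow> \<ominus> r \<in> rdeg R d"
  using additive_subgroup.a_inv_closed[OF rdeg_subgroup] .

lemma rdeg_pow: "r \<in> rdeg R d \<Longrightarrow> r [^] (n::nat) \<in> rdeg R (int n * d)"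
proof (induction n)
  case (Suc n)
  then show ?case using rdeg_mult[of "r [^] n" "int n * d" r d] by (simp add: algebra_simps)
qed (simp add: rdeg_one)

lemma rdeg_finsum: "\<lbrakk>finite I; \<And>i. i \<in> I \<Longrightarrow> f i \<in> rdeg R d\<rbrakk> \<Longrightarrow> finsum R f I \<in> rdeg R d"
proof (induction I rule: finite_induct)
  case (insert i I)
  then have "f \<in> I \<rightarrow> carrier R" "f i \<in> carrier R" using rdeg_carrier by blast+
  then show ?case using insert rdeg_add by simp
qed (simp add: rdeg_zero)

lemma homogeneousI: "r \<in> rdeg R d \<Longrightarrow> r \<in> homogeneous R"
  unfolding homogeneous_def by blast

text \<open>Aliases that stay unambiguous when the ring is combined with its modules.\<close>

lemmas ring_finsum_cong = finsum_cong'
  and ring_finsum_addf = finsum_addf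
  and ring_finsum_singleton = add.finprod_singleton
  and ring_a_assoc = a_assoc
  and ring_a_closed = a_closed
  and ring_l_neg = l_neg
  and ring_cancel = add.r_cancel_one'

context
  fixes P assumes prime: "primeideal P R"
begin

interpretation primeideal P R by (rule prime)

lemma den_one: "\<one> \<in> rdeg R 0 - P"
  using rdeg_one I_notcarr one_imp_carrier by blast

lemma den_mult: "\<lbrakk>s \<in> rdeg R d - P; t \<in> rdeg R e - P\<rbrakk> \<Longrightarrow> s \<otimes> t \<in> rdeg R (d + e) - P"
  using I_prime[of s t] rdeg_mult rdeg_carrier by blast

lemma den_pow: "s \<in> rdeg R d - P \<Longrightarrow> s [^] (n::nat) \<in> rdeg R (int n * d) - P"
proof (induction n)
  case (Suc n)
  then show ?case using den_mult[of "s [^] n" "int n * d" s d] by (simp add: algebra_simps)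
qed (use den_one in simp)

end

end

text \<open>These are the laws on which fractions and their sections rest. The module M, the shifts
  of R and the cokernel M' are all instances, so one theory of localization serves the three of
  them.\<close>

locale graded_ring_module = graded_cring R + Module.module R M
  for R :: "'a graded_ring" (structure) and M :: "('a, 'b) graded_module" +
  assumes mdeg_subgroup: "additive_subgroup (mdeg M d) M"
    and mdeg_smult: "\<lbrakk>r \<in> rdeg R d; x \<in> mdeg M e\<rbrakk> \<Longrightarrow> r \<odot>\<^bsub>M\<^esub> x \<in> mdeg M (d + e)"
begin

lemma mdeg_carrier: "x \<in> mdeg M d \<Longrightarrow> x \<in> carrier M"
  using additive_subgroup.a_subset[OF mdeg_subgroup] by blast

lemma mdeg_zero: "\<zero>\<^bsub>M\<^esub> \<in> mdeg M d"
  using additive_subgroup.zero_closed[OF mdeg_subgroup] .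

lemma mdeg_add: "\<lbrakk>x \<in> mdeg M d; y \<in> mdeg M d\<rbrakk> \<Longrightarrow> x \<oplus>\<^bsub>M\<^esub> y \<in> mdeg M d"
  using additive_subgroup.a_closed[OF mdeg_subgroup] .

lemma mdeg_minus: "x \<in> mdeg M d \<Longrightarrow> \<ominus>\<^bsub>M\<^esub> x \<in> mdeg M d"
  using additive_subgroup.a_inv_closed[OF mdeg_subgroup] .

lemma mdeg_finsum: "\<lbrakk>finite I; \<And>i. i \<in> I \<Longrightarrow> f i \<in> mdeg M d\<rbrakk> \<Longrightarrow> finsum M f I \<in> mdeg M d"
proof (induction I rule: finite_induct)
  case (insert i I)
  then have "f \<in> I \<rightarrow> carrier M" "f i \<in> carrier M" using mdeg_carrier by blast+
  then show ?case using insert mdeg_add by simp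
qed (simp add: mdeg_zero)

lemma smult_lcomm: "\<lbrakk>a \<in> carrier R; b \<in> carrier R; x \<in> carrier M\<rbrakk> \<Longrightarrow>
    a \<odot>\<^bsub>M\<^esub> (b \<odot>\<^bsub>M\<^esub> x) = b \<odot>\<^bsub>M\<^esub> (a \<odot>\<^bsub>M\<^esub> x)"
  by (metis smult_assoc1 m_comm)

lemmas smult_ac = smult_assoc1 smult_lcomm smult_r_distr

lemma frac_pairs_iff: "(x, s) \<in> frac_pairs R M P \<longleftrightarrow> (\<exists>d. x \<in> mdeg M d \<and> s \<in> rdeg R d - P)"
  unfolding frac_pairs_def by auto

text \<open>The additive group of the local module at P, written as a monoid because
  \<open>tensor_lift\<close> expects a target of that form.\<close>

definition local_group :: "'a set \<Rightarrow> ('b \<times> 'a) set monoid" where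
  "local_group P = \<lparr>carrier = local_carrier R M P, monoid.mult = local_add R M P,
     one = frac R M P \<zero>\<^bsub>M\<^esub> \<one>\<rparr>"

context
  fixes P assumes prime: "primeideal P R"
begin

text \<open>Transitivity of equality of fractions: if v witnesses x / s = z / w and u witnesses x /
  s = y / t, then v u s witnesses y / t = z / w. Equality of the two classes follows by exchanging
  the roles of the fractions.\<close>

lemma frac_subset:
  assumes x: "x \<in> mdeg M d" "s \<in> rdeg R d - P" and y: "y \<in> mdeg M e" "t \<in> rdeg R e - P"
    and u: "u \<in> rdeg R k - P" and eq: "(u \<otimes> t) \<odot>\<^bsub>M\<^esub> x = (u \<otimes> s) \<odot>\<^bsub>M\<^esub> y"
  shows "frac R M P x s \<subseteq> frac R M P y t"
proof clarify
  fix z w assume "(z, w) \<in> frac R M P x s"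
  then obtain f v k' where zw: "z \<in> mdeg M f" "w \<in> rdeg R f - P" and v: "v \<in> rdeg R k' - P"
    and vq: "(v \<otimes> w) \<odot>\<^bsub>M\<^esub> x = (v \<otimes> s) \<odot>\<^bsub>M\<^esub> z"
    unfolding frac_def frac_pairs_iff homogeneous_def by blast
  have c: "x \<in> carrier M" "y \<in> carrier M" "z \<in> carrier M" "s \<in> carrier R" "t \<in> carrier R"
    "w \<in> carrier R" "u \<in> carrier R" "v \<in> carrier R"
    using x y zw u v mdeg_carrier rdeg_carrier by blast+
  let ?v = "v \<otimes> (u \<otimes> s)"
  have "(?v \<otimes> w) \<odot>\<^bsub>M\<^esub> y = (v \<otimes> w) \<odot>\<^bsub>M\<^esub> ((u \<otimes> s) \<odot>\<^bsub>M\<^esub> y)"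
    using c by (simp add: smult_ac)
  also have "\<dots> = (v \<otimes> w) \<odot>\<^bsub>M\<^esub> ((u \<otimes> t) \<odot>\<^bsub>M\<^esub> x)" by (simp add: eq)
  also have "\<dots> = (u \<otimes> t) \<odot>\<^bsub>M\<^esub> ((v \<otimes> w) \<odot>\<^bsub>M\<^esub> x)" using c by (simp add: smult_lcomm)
  also have "\<dots> = (u \<otimes> t) \<odot>\<^bsub>M\<^esub> ((v \<otimes> s) \<odot>\<^bsub>M\<^esub> z)" by (simp add: vq)
  also have "\<dots> = (?v \<otimes> t) \<odot>\<^bsub>M\<^esub> z" using c by (simp add: smult_ac)
  finally have "(?v \<otimes> w) \<odot>\<^bsub>M\<^esub> y = (?v \<otimes> t) \<odot>\<^bsub>M\<^esub> z" .
  moreover have "?v \<in> homogeneous R - P"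
    using den_mult[OF prime v den_mult[OF prime u x(2)]] homogeneousI by blast
  ultimately show "(z, w) \<in> frac R M P y t"
    unfolding frac_def using zw frac_pairs_iff by blast
qed

lemma frac_eqI:
  assumes "x \<in> mdeg M d" "s \<in> rdeg R d - P" "y \<in> mdeg M e" "t \<in> rdeg R e - P"
    "u \<in> rdeg R k - P" "(u \<otimes> t) \<odot>\<^bsub>M\<^esub> x = (u \<otimes> s) \<odot>\<^bsub>M\<^esub> y"
  shows "frac R M P x s = frac R M P y t"
  using frac_subset[OF assms] frac_subset[OF assms(3,4,1,2,5) assms(6)[symmetric]] by blast

lemma frac_self:
  assumes "x \<in> mdeg M d" "s \<in> rdeg R d - P"
  shows "(x, s) \<in> frac R M P x s"
  using assms frac_pairs_iff den_one[OF prime] homogeneousI unfolding frac_def by blast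

lemma frac_memD:
  assumes "x \<in> mdeg M d" "s \<in> rdeg R d - P" "(y, t) \<in> frac R M P x s"
  obtains e where "y \<in> mdeg M e" "t \<in> rdeg R e - P" "frac R M P y t = frac R M P x s"
proof -
  obtain e u k where e: "y \<in> mdeg M e" "t \<in> rdeg R e - P" and u: "u \<in> rdeg R k - P"
    and eq: "(u \<otimes> t) \<odot>\<^bsub>M\<^esub> x = (u \<otimes> s) \<odot>\<^bsub>M\<^esub> y"
    using assms(3) unfolding frac_def frac_pairs_iff homogeneous_def by blast
  show thesis using that[OF e frac_eqI[OF assms(1,2) e u eq, symmetric]] .
qed

lemma frac_eqD:
  assumes "x \<in> mdeg M d" "s \<in> rdeg R d - P" "y \<in> mdeg M e" "t \<in> rdeg R e - P"
    "frac R M P x s = frac R M P y t"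
  obtains u k where "u \<in> rdeg R k - P" "(u \<otimes> t) \<odot>\<^bsub>M\<^esub> x = (u \<otimes> s) \<odot>\<^bsub>M\<^esub> y"
proof -
  have "(y, t) \<in> frac R M P x s" using frac_self[OF assms(3,4)] assms(5) by simp
  then show thesis using that unfolding frac_def homogeneous_def by blast
qed

lemma frac_cancel:
  assumes "x \<in> mdeg M d" "s \<in> rdeg R d - P" "v \<in> rdeg R k - P"
  shows "frac R M P (v \<odot>\<^bsub>M\<^esub> x) (v \<otimes> s) = frac R M P x s"
  by (rule frac_eqI[OF mdeg_smult den_mult[OF prime] assms(1,2) den_one[OF prime]])
    (use assms mdeg_carrier rdeg_carrier in \<open>auto simp: smult_ac\<close>)

lemma frac_zero_eq:
  assumes "s \<in> rdeg R d - P"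
  shows "frac R M P \<zero>\<^bsub>M\<^esub> s = frac R M P \<zero>\<^bsub>M\<^esub> \<one>"
  by (rule frac_eqI[OF mdeg_zero assms mdeg_zero den_one[OF prime] den_one[OF prime]])
    (use assms rdeg_carrier in auto)

lemma frac_eq_zeroD:
  assumes "x \<in> mdeg M d" "s \<in> rdeg R d - P" "frac R M P x s = frac R M P \<zero>\<^bsub>M\<^esub> \<one>"
  obtains u k where "u \<in> rdeg R k - P" "u \<odot>\<^bsub>M\<^esub> x = \<zero>\<^bsub>M\<^esub>"
proof -
  obtain u k where "u \<in> rdeg R k - P" "(u \<otimes> \<one>) \<odot>\<^bsub>M\<^esub> x = (u \<otimes> s) \<odot>\<^bsub>M\<^esub> \<zero>\<^bsub>M\<^esub>"
    using frac_eqD[OF assms(1,2) mdeg_zero den_one[OF prime] assms(3)] by blast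
  then show thesis using that assms rdeg_carrier by fastforce
qed

lemma local_carrierI: "\<lbrakk>x \<in> mdeg M d; s \<in> rdeg R d - P\<rbrakk> \<Longrightarrow> frac R M P x s \<in> local_carrier R M P"
  unfolding local_carrier_def using frac_pairs_iff by force

lemma local_carrierE:
  assumes "B \<in> local_carrier R M P"
  obtains d x s where "x \<in> mdeg M d" "s \<in> rdeg R d - P" "B = frac R M P x s"
  using assms frac_pairs_iff unfolding local_carrier_def by auto

text \<open>If u and v witness the equalities of the two pairs of summands, the product u v
  witnesses the equality of the sums.\<close>

lemma local_add_cong:
  assumes x: "x \<in> mdeg M d" "s \<in> rdeg R d - P" and x': "x' \<in> mdeg M d'" "s' \<in> rdeg R d' - P"
    and y: "y \<in> mdeg M e" "t \<in> rdeg R e - P" and y': "y' \<in> mdeg M e'" "t' \<in> rdeg R e' - P"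
    and eq: "frac R M P x s = frac R M P x' s'" "frac R M P y t = frac R M P y' t'"
  shows "frac R M P ((t \<odot>\<^bsub>M\<^esub> x) \<oplus>\<^bsub>M\<^esub> (s \<odot>\<^bsub>M\<^esub> y)) (s \<otimes> t) =
    frac R M P ((t' \<odot>\<^bsub>M\<^esub> x') \<oplus>\<^bsub>M\<^esub> (s' \<odot>\<^bsub>M\<^esub> y')) (s' \<otimes> t')"
proof -
  obtain u k where u: "u \<in> rdeg R k - P" and uq: "(u \<otimes> s') \<odot>\<^bsub>M\<^esub> x = (u \<otimes> s) \<odot>\<^bsub>M\<^esub> x'"
    using frac_eqD[OF x x' eq(1)] by blast
  obtain v l where v: "v \<in> rdeg R l - P" and vq: "(v \<otimes> t') \<odot>\<^bsub>M\<^esub> y = (v \<otimes> t) \<odot>\<^bsub>M\<^esub> y'"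
    using frac_eqD[OF y y' eq(2)] by blast
  have c: "x \<in> carrier M" "y \<in> carrier M" "x' \<in> carrier M" "y' \<in> carrier M" "s \<in> carrier R"
    "t \<in> carrier R" "s' \<in> carrier R" "t' \<in> carrier R" "u \<in> carrier R" "v \<in> carrier R"
    using x y x' y' u v mdeg_carrier rdeg_carrier by blast+
  show ?thesis
  proof (rule frac_eqI)
    show "t \<odot>\<^bsub>M\<^esub> x \<oplus>\<^bsub>M\<^esub> s \<odot>\<^bsub>M\<^esub> y \<in> mdeg M (d + e)"
      using mdeg_smult[of t e x d] mdeg_smult[of s d y e] x y mdeg_add by (simp add: add.commute)
    show "t' \<odot>\<^bsub>M\<^esub> x' \<oplus>\<^bsub>M\<^esub> s' \<odot>\<^bsub>M\<^esub> y' \<in> mdeg M (d' + e')"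
      using mdeg_smult[of t' e' x' d'] mdeg_smult[of s' d' y' e'] x' y' mdeg_add by (simp add: add.commute)
    show "s \<otimes> t \<in> rdeg R (d + e) - P" "s' \<otimes> t' \<in> rdeg R (d' + e') - P" "u \<otimes> v \<in> rdeg R (k + l) - P"
      using den_mult[OF prime] x y x' y' u v by blast+
    have "((u \<otimes> v) \<otimes> (s' \<otimes> t')) \<odot>\<^bsub>M\<^esub> (t \<odot>\<^bsub>M\<^esub> x \<oplus>\<^bsub>M\<^esub> s \<odot>\<^bsub>M\<^esub> y) =
      (v \<otimes> t' \<otimes> t) \<odot>\<^bsub>M\<^esub> ((u \<otimes> s') \<odot>\<^bsub>M\<^esub> x) \<oplus>\<^bsub>M\<^esub> (u \<otimes> s' \<otimes> s) \<odot>\<^bsub>M\<^esub> ((v \<otimes> t') \<odot>\<^bsub>M\<^esub> y)"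
      using c by (simp add: smult_ac)
    also have "\<dots> = ((u \<otimes> v) \<otimes> (s \<otimes> t)) \<odot>\<^bsub>M\<^esub> (t' \<odot>\<^bsub>M\<^esub> x' \<oplus>\<^bsub>M\<^esub> s' \<odot>\<^bsub>M\<^esub> y')"
      unfolding uq vq using c by (simp add: smult_ac)
    finally show "((u \<otimes> v) \<otimes> (s' \<otimes> t')) \<odot>\<^bsub>M\<^esub> (t \<odot>\<^bsub>M\<^esub> x \<oplus>\<^bsub>M\<^esub> s \<odot>\<^bsub>M\<^esub> y) =
      ((u \<otimes> v) \<otimes> (s \<otimes> t)) \<odot>\<^bsub>M\<^esub> (t' \<odot>\<^bsub>M\<^esub> x' \<oplus>\<^bsub>M\<^esub> s' \<odot>\<^bsub>M\<^esub> y')" .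
  qed
qed

lemma local_add_frac:
  assumes x: "x \<in> mdeg M d" "s \<in> rdeg R d - P" and y: "y \<in> mdeg M e" "t \<in> rdeg R e - P"
  shows "local_add R M P (frac R M P x s) (frac R M P y t) =
    frac R M P ((t \<odot>\<^bsub>M\<^esub> x) \<oplus>\<^bsub>M\<^esub> (s \<odot>\<^bsub>M\<^esub> y)) (s \<otimes> t)" (is "_ = ?F")
proof -
  have "frac R M P ((t' \<odot>\<^bsub>M\<^esub> x') \<oplus>\<^bsub>M\<^esub> (s' \<odot>\<^bsub>M\<^esub> y')) (s' \<otimes> t') = ?F"
    if x': "(x', s') \<in> frac R M P x s" and y': "(y', t') \<in> frac R M P y t" for x' y' s' t'
  proof -
    obtain d' where "x' \<in> mdeg M d'" "s' \<in> rdeg R d' - P" "frac R M P x' s' = frac R M P x s"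
      using frac_memD[OF x x'] by blast
    moreover obtain e' where "y' \<in> mdeg M e'" "t' \<in> rdeg R e' - P" "frac R M P y' t' = frac R M P y t"
      using frac_memD[OF y y'] by blast
    ultimately show ?thesis using local_add_cong x y by blast
  qed
  then show ?thesis
    unfolding local_add_def
    by (intro UN_const[OF frac_self[OF x]])
      (auto intro!: UN_const[OF frac_self[OF y]])
qed

lemma local_add_common:
  assumes x: "x \<in> mdeg M d" "y \<in> mdeg M d" and s: "s \<in> rdeg R d - P"
  shows "local_add R M P (frac R M P x s) (frac R M P y s) = frac R M P (x \<oplus>\<^bsub>M\<^esub> y) s"
proof -
  have c: "x \<in> carrier M" "y \<in> carrier M" "s \<in> carrier R"
    using x s mdeg_carrier rdeg_carrier by blast+
  have "s \<odot>\<^bsub>M\<^esub> x \<oplus>\<^bsub>M\<^esub> s \<odot>\<^bsub>M\<^esub> y = s \<odot>\<^bsub>M\<^esub> (x \<oplus>\<^bsub>M\<^esub> y)" using c by (simp add: smult_r_distr)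
  then show ?thesis
    unfolding local_add_frac[OF x(1) s x(2) s] using frac_cancel[OF mdeg_add[OF x] s s] by simp
qed

text \<open>Cross-multiplication gives a common denominator, over which \<open>local_add\<close> is
  addition of numerators. The group laws of the local module reduce in this way to those of
  M.\<close>

lemma local_common2:
  assumes "B \<in> local_carrier R M P" "C \<in> local_carrier R M P"
  obtains d x y s where "x \<in> mdeg M d" "y \<in> mdeg M d" "s \<in> rdeg R d - P"
    "B = frac R M P x s" "C = frac R M P y s"
proof -
  obtain d x s where x: "x \<in> mdeg M d" "s \<in> rdeg R d - P" "B = frac R M P x s"
    using local_carrierE[OF assms(1)] .
  obtain e y t where y: "y \<in> mdeg M e" "t \<in> rdeg R e - P" "C = frac R M P y t"
    using local_carrierE[OF assms(2)] .
  have "t \<otimes> s = s \<otimes> t" using x y rdeg_carrier m_comm by blast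
  then show thesis
    using that[of "t \<odot>\<^bsub>M\<^esub> x" "d + e" "s \<odot>\<^bsub>M\<^esub> y" "s \<otimes> t"] x y den_mult[OF prime x(2) y(2)]
      mdeg_smult[of t e x d] mdeg_smult[of s d y e] frac_cancel[OF x(1,2) y(2)] frac_cancel[OF y(1,2) x(2)]
    by (simp add: add.commute)
qed

lemma local_common3:
  assumes "B \<in> local_carrier R M P" "C \<in> local_carrier R M P" "D \<in> local_carrier R M P"
  obtains d x y z s where "x \<in> mdeg M d" "y \<in> mdeg M d" "z \<in> mdeg M d" "s \<in> rdeg R d - P"
    "B = frac R M P x s" "C = frac R M P y s" "D = frac R M P z s"
proof -
  obtain d x y s where x: "x \<in> mdeg M d" "y \<in> mdeg M d" "s \<in> rdeg R d - P"
    "B = frac R M P x s" "C = frac R M P y s"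
    using local_common2[OF assms(1,2)] .
  obtain e z t where z: "z \<in> mdeg M e" "t \<in> rdeg R e - P" "D = frac R M P z t"
    using local_carrierE[OF assms(3)] .
  have "t \<otimes> s = s \<otimes> t" using x z rdeg_carrier m_comm by blast
  then show thesis
    using that[of "t \<odot>\<^bsub>M\<^esub> x" "d + e" "t \<odot>\<^bsub>M\<^esub> y" "s \<odot>\<^bsub>M\<^esub> z" "s \<otimes> t"] x z den_mult[OF prime x(3) z(2)]
      mdeg_smult[of t e x d] mdeg_smult[of t e y d] mdeg_smult[of s d z e] frac_cancel[OF x(1,3) z(2)]
      frac_cancel[OF x(2,3) z(2)] frac_cancel[OF z(1,2) x(3)]
    by (simp add: add.commute)
qed

lemma local_add_closed: "\<lbrakk>B \<in> local_carrier R M P; C \<in> local_carrier R M P\<rbrakk> \<Longrightarrow>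
    local_add R M P B C \<in> local_carrier R M P"
  by (rule local_common2[of B C], assumption, assumption) (metis local_add_common local_carrierI mdeg_add)

lemma local_group: "comm_group (local_group P)"
proof (rule comm_groupI)
  show "\<one>\<^bsub>local_group P\<^esub> \<in> carrier (local_group P)"
    unfolding local_group_def using local_carrierI[OF mdeg_zero den_one[OF prime]] by simp
next
  fix B assume "B \<in> carrier (local_group P)"
  then obtain d x s where x: "x \<in> mdeg M d" "s \<in> rdeg R d - P" "B = frac R M P x s"
    using local_carrierE[of B] unfolding local_group_def by (metis partial_object.select_convs(1))
  have xc: "x \<in> carrier M" using x mdeg_carrier by blast
  show "\<one>\<^bsub>local_group P\<^esub> \<otimes>\<^bsub>local_group P\<^esub> B = B"
    unfolding local_group_def using local_add_common[OF mdeg_zero x(1,2)] frac_zero_eq[OF x(2)] x(3) xc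
    by simp
  show "\<exists>C\<in>carrier (local_group P). C \<otimes>\<^bsub>local_group P\<^esub> B = \<one>\<^bsub>local_group P\<^esub>"
    unfolding local_group_def
    using local_add_common[OF mdeg_minus[OF x(1)] x(1,2)] frac_zero_eq[OF x(2)] x(3) xc
      local_carrierI[OF mdeg_minus[OF x(1)] x(2)] by (auto simp: M.l_neg)
next
  fix B C assume "B \<in> carrier (local_group P)" "C \<in> carrier (local_group P)"
  then have BC: "B \<in> local_carrier R M P" "C \<in> local_carrier R M P" by (simp_all add: local_group_def)
  then show "B \<otimes>\<^bsub>local_group P\<^esub> C \<in> carrier (local_group P)"
    by (simp add: local_group_def local_add_closed)
  show "B \<otimes>\<^bsub>local_group P\<^esub> C = C \<otimes>\<^bsub>local_group P\<^esub> B"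
    using local_common2[OF BC] by (metis local_group_def monoid.simps(1) local_add_common M.a_comm mdeg_carrier)
  fix D assume "D \<in> carrier (local_group P)"
  then have D: "D \<in> local_carrier R M P" by (simp add: local_group_def)
  obtain d x y z s where "x \<in> mdeg M d" "y \<in> mdeg M d" "z \<in> mdeg M d" "s \<in> rdeg R d - P"
    "B = frac R M P x s" "C = frac R M P y s" "D = frac R M P z s"
    using local_common3[OF BC D] .
  then show "B \<otimes>\<^bsub>local_group P\<^esub> C \<otimes>\<^bsub>local_group P\<^esub> D = B \<otimes>\<^bsub>local_group P\<^esub> (C \<otimes>\<^bsub>local_group P\<^esub> D)"
    by (simp add: local_group_def local_add_common[where d=d] mdeg_add M.a_assoc mdeg_carrier[where d=d]
        del: Diff_iff)
qed

end

end

lemma self_module_simps [simp]: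
  "carrier (self_module R) = carrier R" "\<zero>\<^bsub>self_module R\<^esub> = \<zero>\<^bsub>R\<^esub>"
  "x \<oplus>\<^bsub>self_module R\<^esub> y = x \<oplus>\<^bsub>R\<^esub> y" "r \<odot>\<^bsub>self_module R\<^esub> x = r \<otimes>\<^bsub>R\<^esub> x"
  "mdeg (self_module R) = rdeg R"
  by (simp_all add: self_module_def)

lemma shift_simps [simp]:
  "carrier (shift M j) = carrier M" "\<zero>\<^bsub>shift M j\<^esub> = \<zero>\<^bsub>M\<^esub>"
  "x \<oplus>\<^bsub>shift M j\<^esub> y = x \<oplus>\<^bsub>M\<^esub> y" "r \<odot>\<^bsub>shift M j\<^esub> x = r \<odot>\<^bsub>M\<^esub> x"
  "mdeg (shift M j) d = mdeg M (j + d)"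
  by (simp_all add: shift_def)

text \<open>Self modules and shifts live in records of their own. Equal carrier, zero and addition
  force equal inverses, by uniqueness of inverses, and with them the subgroup property is
  transported.\<close>

lemma additive_subgroup_cong:
  assumes "additive_subgroup H G" "abelian_group G'"
    "carrier G' = carrier G" "\<zero>\<^bsub>G'\<^esub> = \<zero>\<^bsub>G\<^esub>" "add G' = add G" "abelian_group G"
  shows "additive_subgroup H G'"
proof -
  interpret G: abelian_group G by fact
  interpret G': abelian_group G' by fact
  interpret H: additive_subgroup H G by fact
  have "\<ominus>\<^bsub>G'\<^esub> x \<in> H" if "x \<in> H" for x
  proof -
    have x: "x \<in> carrier G" using that H.a_subset by blast
    have "\<ominus>\<^bsub>G\<^esub> x \<oplus>\<^bsub>G'\<^esub> x = \<zero>\<^bsub>G'\<^esub>" using G.l_neg[OF x] assms by simp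
    then have "\<ominus>\<^bsub>G'\<^esub> x = \<ominus>\<^bsub>G\<^esub> x" using x assms by (intro G'.minus_equality) auto
    then show ?thesis using that by simp
  qed
  then show ?thesis
    unfolding additive_subgroup_def subgroup_def
    using H.a_subset H.a_closed H.zero_closed by (simp add: assms(3-5) a_inv_def)
qed

lemma (in graded_cring) graded_self_module: "graded_ring_module R (self_module R)"
proof -
  have ab: "abelian_group (self_module R)"
    by (rule abelian_groupI) (auto simp: a_ac intro: bexI[of _ "\<ominus> _"] l_neg)
  have "Module.module R (self_module R)"
    by (rule moduleI) (auto simp: ab is_cring l_distr r_distr m_assoc)
  then show ?thesis
    by (intro graded_ring_module.intro graded_ring_module_axioms.intro graded_cring_axioms)
      (auto simp: rdeg_mult self_module_def
        intro!: additive_subgroup_cong[OF rdeg_subgroup, OF ab[unfolded self_module_def]] is_abelian_group)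
qed

lemma (in graded_ring_module) graded_shift: "graded_ring_module R (shift M j)"
proof -
  have ab: "abelian_group (shift M j)"
    by (rule abelian_groupI) (auto simp: M.a_ac intro: bexI[of _ "\<ominus>\<^bsub>M\<^esub> _"] M.l_neg)
  have "Module.module R (shift M j)"
    by (rule moduleI) (auto simp: ab is_cring smult_l_distr smult_r_distr smult_assoc1)
  moreover have "additive_subgroup (mdeg M e) (shift M j)" for e
    by (rule additive_subgroup_cong[OF mdeg_subgroup ab])
      (auto simp: shift_def M.abelian_group_axioms)
  ultimately show ?thesis
    using mdeg_smult
    by (intro graded_ring_module.intro graded_ring_module_axioms.intro graded_cring_axioms)
      (auto simp: add.left_commute)
qed

section \<open>The action of degree 0 fractions on local modules\<close>

context graded_ring_module
begin

interpretation self: graded_ring_module R "self_module R"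
  by (rule graded_self_module)

text \<open>A witness v for the scalar fraction and a witness u for the module fraction multiply to
  a witness for the product, so the union defining \<open>local_smult\<close> has a single
  value.\<close>

lemma local_smult_frac:
  assumes P: "primeideal P R"
    and r: "r \<in> rdeg R d" "w \<in> rdeg R d - P" and x: "x \<in> mdeg M e" "s \<in> rdeg R e - P"
  shows "local_smult R M P (frac R (self_module R) P r w) (frac R M P x s) =
    frac R M P (r \<odot>\<^bsub>M\<^esub> x) (w \<otimes> s)" (is "_ = ?F")
proof -
  have r0: "r \<in> mdeg (self_module R) d" using r by simp
  have "frac R M P (r' \<odot>\<^bsub>M\<^esub> x') (w' \<otimes> s') = ?F"
    if r': "(r', w') \<in> frac R (self_module R) P r w" and x': "(x', s') \<in> frac R M P x s" for x' s' r' w'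
  proof -
    obtain e' where e': "x' \<in> mdeg M e'" "s' \<in> rdeg R e' - P" and eq: "frac R M P x' s' = frac R M P x s"
      using frac_memD[OF P x x'] by blast
    obtain d' where d': "r' \<in> rdeg R d'" "w' \<in> rdeg R d' - P"
      and eq': "frac R (self_module R) P r' w' = frac R (self_module R) P r w"
      using self.frac_memD[OF P r0 r(2) r'] by auto
    obtain u k where u: "u \<in> rdeg R k - P" and uq: "(u \<otimes> s) \<odot>\<^bsub>M\<^esub> x' = (u \<otimes> s') \<odot>\<^bsub>M\<^esub> x"
      using frac_eqD[OF P e' x eq] by blast
    obtain v l where v: "v \<in> rdeg R l - P" and vq: "(v \<otimes> w) \<otimes> r' = (v \<otimes> w') \<otimes> r"
      using self.frac_eqD[OF P _ d'(2) r0 r(2) eq'] d'(1) by auto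
    have c: "x \<in> carrier M" "x' \<in> carrier M" "s \<in> carrier R" "s' \<in> carrier R" "r \<in> carrier R"
      "r' \<in> carrier R" "w \<in> carrier R" "w' \<in> carrier R" "u \<in> carrier R" "v \<in> carrier R"
      using x e' d' r u v mdeg_carrier rdeg_carrier by blast+
    show ?thesis
    proof (rule frac_eqI[OF P mdeg_smult[OF d'(1) e'(1)] den_mult[OF P d'(2) e'(2)]
          mdeg_smult[OF r(1) x(1)] den_mult[OF P r(2) x(2)] den_mult[OF P u v]])
      have "(u \<otimes> v \<otimes> (w \<otimes> s)) \<odot>\<^bsub>M\<^esub> (r' \<odot>\<^bsub>M\<^esub> x') = ((v \<otimes> w) \<otimes> r') \<odot>\<^bsub>M\<^esub> ((u \<otimes> s) \<odot>\<^bsub>M\<^esub> x')"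
        using c by (simp add: smult_ac)
      also have "\<dots> = ((v \<otimes> w') \<otimes> r) \<odot>\<^bsub>M\<^esub> ((u \<otimes> s') \<odot>\<^bsub>M\<^esub> x)" unfolding uq vq ..
      also have "\<dots> = (u \<otimes> v \<otimes> (w' \<otimes> s')) \<odot>\<^bsub>M\<^esub> (r \<odot>\<^bsub>M\<^esub> x)" using c by (simp add: smult_ac)
      finally show "(u \<otimes> v \<otimes> (w \<otimes> s)) \<odot>\<^bsub>M\<^esub> (r' \<odot>\<^bsub>M\<^esub> x') = (u \<otimes> v \<otimes> (w' \<otimes> s')) \<odot>\<^bsub>M\<^esub> (r \<odot>\<^bsub>M\<^esub> x)" .
    qed
  qed
  then show ?thesis
    unfolding local_smult_def
    by (intro UN_const[OF self.frac_self[OF P r0 r(2)]]) (auto intro!: UN_const[OF frac_self[OF P x]])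
qed

context
  fixes P assumes P: "primeideal P R"
begin

lemma self_carrierE:
  assumes "B \<in> local_carrier R (self_module R) P"
  obtains d r w where "r \<in> rdeg R d" "w \<in> rdeg R d - P" "B = frac R (self_module R) P r w"
  using self.local_carrierE[OF P assms] unfolding self_module_simps .

lemma local_smult_closed:
  assumes "B \<in> local_carrier R (self_module R) P" "C \<in> local_carrier R M P"
  shows "local_smult R M P B C \<in> local_carrier R M P"
proof -
  obtain d r w where "r \<in> rdeg R d" "w \<in> rdeg R d - P" "B = frac R (self_module R) P r w"
    using self_carrierE[OF assms(1)] .
  moreover obtain e x s where "x \<in> mdeg M e" "s \<in> rdeg R e - P" "C = frac R M P x s"
    using local_carrierE[OF P assms(2)] .
  ultimately show ?thesis
    using local_smult_frac[OF P] local_carrierI[OF P mdeg_smult den_mult[OF P]] by metis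
qed

lemma local_smult_add:
  assumes "B \<in> local_carrier R (self_module R) P" "C \<in> local_carrier R M P" "D \<in> local_carrier R M P"
  shows "local_smult R M P B (local_add R M P C D) =
    local_add R M P (local_smult R M P B C) (local_smult R M P B D)"
proof -
  obtain d r w where r: "r \<in> rdeg R d" "w \<in> rdeg R d - P" "B = frac R (self_module R) P r w"
    using self_carrierE[OF assms(1)] .
  obtain e x y s where x: "x \<in> mdeg M e" "y \<in> mdeg M e" "s \<in> rdeg R e - P" "C = frac R M P x s"
    "D = frac R M P y s"
    using local_common2[OF P assms(2,3)] .
  have c: "r \<in> carrier R" "x \<in> carrier M" "y \<in> carrier M" using r x mdeg_carrier rdeg_carrier by blast+
  have "local_smult R M P B (local_add R M P C D) = frac R M P (r \<odot>\<^bsub>M\<^esub> (x \<oplus>\<^bsub>M\<^esub> y)) (w \<otimes> s)"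
    unfolding r(3) x(4,5) local_add_common[OF P x(1-3)] local_smult_frac[OF P r(1,2) mdeg_add[OF x(1,2)] x(3)] ..
  also have "\<dots> = local_add R M P (local_smult R M P B C) (local_smult R M P B D)"
    unfolding r(3) x(4,5) local_smult_frac[OF P r(1,2) x(1,3)] local_smult_frac[OF P r(1,2) x(2,3)]
      local_add_common[OF P mdeg_smult[OF r(1) x(1)] mdeg_smult[OF r(1) x(2)] den_mult[OF P r(2) x(3)]]
    using c by (simp add: smult_r_distr)
  finally show ?thesis .
qed

lemma local_smult_comm:
  assumes "B \<in> local_carrier R (self_module R) P" "C \<in> local_carrier R (self_module R) P"
    "D \<in> local_carrier R M P"
  shows "local_smult R M P B (local_smult R M P C D) = local_smult R M P C (local_smult R M P B D)"
proof -
  obtain d r w where r: "r \<in> rdeg R d" "w \<in> rdeg R d - P" "B = frac R (self_module R) P r w"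
    using self_carrierE[OF assms(1)] .
  obtain d' r' w' where r': "r' \<in> rdeg R d'" "w' \<in> rdeg R d' - P" "C = frac R (self_module R) P r' w'"
    using self_carrierE[OF assms(2)] .
  obtain e x s where x: "x \<in> mdeg M e" "s \<in> rdeg R e - P" "D = frac R M P x s"
    using local_carrierE[OF P assms(3)] .
  have c: "r \<in> carrier R" "r' \<in> carrier R" "x \<in> carrier M" "w \<in> carrier R" "w' \<in> carrier R" "s \<in> carrier R"
    using r x r' mdeg_carrier rdeg_carrier by blast+
  show ?thesis
    unfolding r(3) r'(3) x(3) local_smult_frac[OF P r(1,2) x(1,2)] local_smult_frac[OF P r'(1,2) x(1,2)]
      local_smult_frac[OF P r(1,2) mdeg_smult[OF r'(1) x(1)] den_mult[OF P r'(2) x(2)]]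
      local_smult_frac[OF P r'(1,2) mdeg_smult[OF r(1) x(1)] den_mult[OF P r(2) x(2)]]
    using c by (simp add: smult_lcomm m_lcomm)
qed

end

end

section \<open>Regular sections\<close>

lemma openin_Proj_set: "openin (zariski R) U \<Longrightarrow> U \<subseteq> Proj_set R"
  using openin_subset[of "zariski R" U] unfolding zariski_def topology_generated_by_topspace by auto

lemma Proj_set_prime: "P \<in> Proj_set R \<Longrightarrow> primeideal P R"
  unfolding Proj_set_def by blast

lemma openin_prime: "\<lbrakk>openin (zariski R) U; P \<in> U\<rbrakk> \<Longrightarrow> primeideal P R"
  using openin_Proj_set Proj_set_prime by blast

lemma openin_basic: "f \<in> homogeneous R \<Longrightarrow> openin (zariski R) {P \<in> Proj_set R. f \<notin> P}"
  unfolding zariski_def by (rule topology_generated_by_Basis) blast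

lemma Proj_simps [simp]:
  "topo (Proj R) = zariski R"
  "carrier (fun_ring (Proj R) U) = regular_sections R (self_module R) U"
  "fun_res (Proj R) U V \<sigma> = restrict \<sigma> V"
  by (simp_all add: Proj_def)

lemma tilde_simps [simp]:
  "carrier (sect (tilde R M) U) = regular_sections R M U"
  "\<sigma> \<oplus>\<^bsub>sect (tilde R M) U\<^esub> \<tau> = (\<lambda>P\<in>U. local_add R M P (\<sigma> P) (\<tau> P))"
  "\<rho> \<odot>\<^bsub>sect (tilde R M) U\<^esub> \<tau> = (\<lambda>P\<in>U. local_smult R M P (\<rho> P) (\<tau> P))"
  "res (tilde R M) U V \<sigma> = restrict \<sigma> V"
  by (simp_all add: tilde_def)

text \<open>A local representation by a fraction already places each value in its local module, so
  extensionality and the local condition determine membership.\<close>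

lemma regular_sectionsI:
  assumes "\<sigma> \<in> extensional U"
    and "\<And>P. P \<in> U \<Longrightarrow> \<exists>V. openin (zariski R) V \<and> P \<in> V \<and> V \<subseteq> U \<and>
      (\<exists>d. \<exists>x\<in>mdeg M d. \<exists>s\<in>rdeg R d. \<forall>Q\<in>V. s \<notin> Q \<and> \<sigma> Q = frac R M Q x s)"
  shows "\<sigma> \<in> regular_sections R M U"
proof -
  have "\<sigma> P \<in> local_carrier R M P" if P: "P \<in> U" for P
  proof -
    obtain d x s where "x \<in> mdeg M d" "s \<in> rdeg R d" "s \<notin> P \<and> \<sigma> P = frac R M P x s"
      using assms(2)[OF P] by (elim exE conjE bexE) (drule (1) bspec)
    then show ?thesis unfolding local_carrier_def frac_pairs_def by force
  qed
  then have "\<sigma> \<in> (\<Pi>\<^sub>E P\<in>U. local_carrier R M P)" using assms(1) by (simp add: PiE_iff)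
  then show ?thesis unfolding regular_sections_def using assms(2) by (intro CollectI conjI ballI)
qed

lemma regular_atI:
  assumes "openin (zariski R) V" "P \<in> V" "V \<subseteq> U" "x \<in> mdeg M d" "s \<in> rdeg R d"
    "\<And>Q. Q \<in> V \<Longrightarrow> s \<notin> Q" "\<And>Q. Q \<in> V \<Longrightarrow> \<sigma> Q = frac R M Q x s"
  shows "\<exists>V. openin (zariski R) V \<and> P \<in> V \<and> V \<subseteq> U \<and>
      (\<exists>d. \<exists>x\<in>mdeg M d. \<exists>s\<in>rdeg R d. \<forall>Q\<in>V. s \<notin> Q \<and> \<sigma> Q = frac R M Q x s)"
  by (intro exI[of _ V] conjI exI[of _ d] bexI[of _ x] bexI[of _ s] ballI assms)

lemma regular_sectionsD:
  assumes "\<sigma> \<in> regular_sections R M U" "P \<in> U"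
  obtains V d x s where "openin (zariski R) V" "P \<in> V" "V \<subseteq> U" "x \<in> mdeg M d" "s \<in> rdeg R d"
    "\<And>Q. Q \<in> V \<Longrightarrow> s \<notin> Q" "\<And>Q. Q \<in> V \<Longrightarrow> \<sigma> Q = frac R M Q x s"
proof -
  have "\<exists>V. openin (zariski R) V \<and> P \<in> V \<and> V \<subseteq> U \<and>
      (\<exists>d. \<exists>x\<in>mdeg M d. \<exists>s\<in>rdeg R d. \<forall>Q\<in>V. s \<notin> Q \<and> \<sigma> Q = frac R M Q x s)"
    using bspec[OF conjunct2[OF CollectD[OF assms(1)[unfolded regular_sections_def]]] assms(2)] .
  then obtain V d x s where V: "openin (zariski R) V" "P \<in> V" "V \<subseteq> U" "x \<in> mdeg M d" "s \<in> rdeg R d"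
    "\<forall>Q\<in>V. s \<notin> Q \<and> \<sigma> Q = frac R M Q x s"
    by (elim exE conjE bexE)
  show thesis
    by (rule that[OF V(1-5)]) (use V(6) in \<open>simp_all\<close>)
qed

lemma regular_sections_local: "\<lbrakk>\<sigma> \<in> regular_sections R M U; P \<in> U\<rbrakk> \<Longrightarrow> \<sigma> P \<in> local_carrier R M P"
  unfolding regular_sections_def by blast

lemma regular_sections_extensional: "\<sigma> \<in> regular_sections R M U \<Longrightarrow> \<sigma> \<in> extensional U"
  unfolding regular_sections_def by (auto simp: PiE_iff)

lemma regular_sections_restrict:
  assumes "\<sigma> \<in> regular_sections R M U" "openin (zariski R) V" "V \<subseteq> U"
  shows "restrict \<sigma> V \<in> regular_sections R M V"
proof (rule regular_sectionsI)
  fix P assume "P \<in> V"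
  then have P: "P \<in> U" using assms(3) by blast
  obtain W d x s where W: "openin (zariski R) W" "P \<in> W" "W \<subseteq> U" "x \<in> mdeg M d" "s \<in> rdeg R d"
    "\<And>Q. Q \<in> W \<Longrightarrow> s \<notin> Q" "\<And>Q. Q \<in> W \<Longrightarrow> \<sigma> Q = frac R M Q x s"
    by (rule regular_sectionsD[OF assms(1) P]) (rule that)
  then show "\<exists>W. openin (zariski R) W \<and> P \<in> W \<and> W \<subseteq> V \<and>
      (\<exists>d. \<exists>x\<in>mdeg M d. \<exists>s\<in>rdeg R d. \<forall>Q\<in>W. s \<notin> Q \<and> restrict \<sigma> V Q = frac R M Q x s)"
    using \<open>P \<in> V\<close> assms(2) by (intro regular_atI[of _ "V \<inter> W" _ _ x _ d s]) auto
qed simp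

lemma regular_sections_glue:
  assumes "\<sigma> \<in> extensional U"
    and "\<And>P. P \<in> U \<Longrightarrow> \<exists>V \<tau>. openin (zariski R) V \<and> P \<in> V \<and> V \<subseteq> U \<and>
      \<tau> \<in> regular_sections R M V \<and> (\<forall>Q\<in>V. \<sigma> Q = \<tau> Q)"
  shows "\<sigma> \<in> regular_sections R M U"
proof (rule regular_sectionsI[OF assms(1)])
  fix P assume P: "P \<in> U"
  obtain V \<tau> where V: "openin (zariski R) V" "P \<in> V" "V \<subseteq> U" "\<tau> \<in> regular_sections R M V"
    "\<forall>Q\<in>V. \<sigma> Q = \<tau> Q"
    using assms(2)[OF P] by (elim exE conjE)
  obtain W d x s where "openin (zariski R) W" "P \<in> W" "W \<subseteq> V" "x \<in> mdeg M d" "s \<in> rdeg R d"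
    "\<And>Q. Q \<in> W \<Longrightarrow> s \<notin> Q" "\<And>Q. Q \<in> W \<Longrightarrow> \<tau> Q = frac R M Q x s"
    by (rule regular_sectionsD[OF V(4,2)]) (rule that)
  then show "\<exists>W. openin (zariski R) W \<and> P \<in> W \<and> W \<subseteq> U \<and>
      (\<exists>d. \<exists>x\<in>mdeg M d. \<exists>s\<in>rdeg R d. \<forall>Q\<in>W. s \<notin> Q \<and> \<sigma> Q = frac R M Q x s)"
    using V by (intro regular_atI[of _ W _ _ x _ d s]) auto
qed

lemma regular_sections_frac:
  assumes "openin (zariski R) U" "x \<in> mdeg M d" "s \<in> rdeg R d" "\<And>Q. Q \<in> U \<Longrightarrow> s \<notin> Q"
  shows "(\<lambda>Q\<in>U. frac R M Q x s) \<in> regular_sections R M U"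
  using assms by (intro regular_sectionsI regular_atI[of _ U _ _ x _ d s]) auto

context graded_ring_module
begin

interpretation self: graded_ring_module R "self_module R"
  by (rule graded_self_module)

lemma regular_sections_add:
  assumes U: "openin (zariski R) U" and \<sigma>: "\<sigma> \<in> regular_sections R M U" "\<tau> \<in> regular_sections R M U"
  shows "(\<lambda>P\<in>U. local_add R M P (\<sigma> P) (\<tau> P)) \<in> regular_sections R M U"
proof (rule regular_sectionsI)
  fix P assume P: "P \<in> U"
  obtain V d x s where V: "openin (zariski R) V" "P \<in> V" "V \<subseteq> U" "x \<in> mdeg M d" "s \<in> rdeg R d"
    "\<And>Q. Q \<in> V \<Longrightarrow> s \<notin> Q" "\<And>Q. Q \<in> V \<Longrightarrow> \<sigma> Q = frac R M Q x s"
    by (rule regular_sectionsD[OF \<sigma>(1) P]) (rule that)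
  obtain W e y t where W: "openin (zariski R) W" "P \<in> W" "W \<subseteq> U" "y \<in> mdeg M e" "t \<in> rdeg R e"
    "\<And>Q. Q \<in> W \<Longrightarrow> t \<notin> Q" "\<And>Q. Q \<in> W \<Longrightarrow> \<tau> Q = frac R M Q y t"
    by (rule regular_sectionsD[OF \<sigma>(2) P]) (rule that)
  have "s \<otimes> t \<notin> Q \<and> local_add R M Q (\<sigma> Q) (\<tau> Q) = frac R M Q (t \<odot>\<^bsub>M\<^esub> x \<oplus>\<^bsub>M\<^esub> s \<odot>\<^bsub>M\<^esub> y) (s \<otimes> t)"
    if "Q \<in> V \<inter> W" for Q
  proof -
    have Q: "primeideal Q R" using that openin_prime[OF V(1)] by blast
    show ?thesis
      using local_add_frac[OF Q V(4) _ W(4), of s t] den_mult[OF Q, of s d t e] that V W by auto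
  qed
  moreover have "t \<odot>\<^bsub>M\<^esub> x \<oplus>\<^bsub>M\<^esub> s \<odot>\<^bsub>M\<^esub> y \<in> mdeg M (d + e)"
    using mdeg_smult[OF W(5) V(4)] mdeg_smult[OF V(5) W(4)] mdeg_add by (simp add: add.commute)
  ultimately show "\<exists>V. openin (zariski R) V \<and> P \<in> V \<and> V \<subseteq> U \<and>
      (\<exists>d. \<exists>x\<in>mdeg M d. \<exists>s\<in>rdeg R d. \<forall>Q\<in>V. s \<notin> Q \<and>
        (\<lambda>P\<in>U. local_add R M P (\<sigma> P) (\<tau> P)) Q = frac R M Q x s)"
    using V W rdeg_mult[OF V(5) W(5)]
    by (intro regular_atI[of _ "V \<inter> W" _ _ "t \<odot>\<^bsub>M\<^esub> x \<oplus>\<^bsub>M\<^esub> s \<odot>\<^bsub>M\<^esub> y" _ "d + e" "s \<otimes> t"]) auto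
qed simp

lemma regular_sections_smult:
  assumes U: "openin (zariski R) U" and \<sigma>: "\<sigma> \<in> regular_sections R (self_module R) U"
    and \<tau>: "\<tau> \<in> regular_sections R M U"
  shows "(\<lambda>P\<in>U. local_smult R M P (\<sigma> P) (\<tau> P)) \<in> regular_sections R M U"
proof (rule regular_sectionsI)
  fix P assume P: "P \<in> U"
  obtain V d x s where V: "openin (zariski R) V" "P \<in> V" "V \<subseteq> U" "x \<in> rdeg R d" "s \<in> rdeg R d"
    "\<And>Q. Q \<in> V \<Longrightarrow> s \<notin> Q" "\<And>Q. Q \<in> V \<Longrightarrow> \<sigma> Q = frac R (self_module R) Q x s"
    by (rule regular_sectionsD[OF \<sigma>(1) P], unfold self_module_simps) (rule that)
  obtain W e y t where W: "openin (zariski R) W" "P \<in> W" "W \<subseteq> U" "y \<in> mdeg M e" "t \<in> rdeg R e"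
    "\<And>Q. Q \<in> W \<Longrightarrow> t \<notin> Q" "\<And>Q. Q \<in> W \<Longrightarrow> \<tau> Q = frac R M Q y t"
    by (rule regular_sectionsD[OF \<tau> P]) (rule that)
  have "s \<otimes> t \<notin> Q \<and> local_smult R M Q (\<sigma> Q) (\<tau> Q) = frac R M Q (x \<odot>\<^bsub>M\<^esub> y) (s \<otimes> t)"
    if "Q \<in> V \<inter> W" for Q
  proof -
    have Q: "primeideal Q R" using that openin_prime[OF V(1)] by blast
    show ?thesis
      using local_smult_frac[OF Q V(4) _ W(4), of s t] den_mult[OF Q, of s d t e] that V W by auto
  qed
  then show "\<exists>V. openin (zariski R) V \<and> P \<in> V \<and> V \<subseteq> U \<and>
      (\<exists>d. \<exists>x\<in>mdeg M d. \<exists>s\<in>rdeg R d. \<forall>Q\<in>V. s \<notin> Q \<and>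
        (\<lambda>P\<in>U. local_smult R M P (\<sigma> P) (\<tau> P)) Q = frac R M Q x s)"
    using V W rdeg_mult[OF V(5) W(5)] mdeg_smult[OF V(4) W(4)]
    by (intro regular_atI[of _ "V \<inter> W" _ _ "x \<odot>\<^bsub>M\<^esub> y" _ "d + e" "s \<otimes> t"]) auto
qed simp

text \<open>All four laws hold point by point in the local modules over U; with them the tensor
  product of sections over U is an abelian group with an action of the functions on U.\<close>

lemma premodule_sections:
  assumes U: "openin (zariski R) U"
  shows "premodule (fun_ring (Proj R) U) (sect (tilde R M) U)"
proof
  note loc = openin_prime[OF U] regular_sections_local[where U = U]
  show "\<sigma> \<oplus>\<^bsub>sect (tilde R M) U\<^esub> \<tau> \<in> carrier (sect (tilde R M) U)"
    if "\<sigma> \<in> carrier (sect (tilde R M) U)" "\<tau> \<in> carrier (sect (tilde R M) U)" for \<sigma> \<tau>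
    using that regular_sections_add[OF U] by simp
  show "\<rho> \<odot>\<^bsub>sect (tilde R M) U\<^esub> \<tau> \<in> carrier (sect (tilde R M) U)"
    if "\<rho> \<in> carrier (fun_ring (Proj R) U)" "\<tau> \<in> carrier (sect (tilde R M) U)" for \<rho> \<tau>
    using that regular_sections_smult[OF U] by simp
  show "\<rho> \<odot>\<^bsub>sect (tilde R M) U\<^esub> (\<sigma> \<oplus>\<^bsub>sect (tilde R M) U\<^esub> \<tau>) =
      \<rho> \<odot>\<^bsub>sect (tilde R M) U\<^esub> \<sigma> \<oplus>\<^bsub>sect (tilde R M) U\<^esub> \<rho> \<odot>\<^bsub>sect (tilde R M) U\<^esub> \<tau>"
    if "\<rho> \<in> carrier (fun_ring (Proj R) U)" "\<sigma> \<in> carrier (sect (tilde R M) U)"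
      "\<tau> \<in> carrier (sect (tilde R M) U)" for \<rho> \<sigma> \<tau>
    unfolding tilde_simps
    by (intro restrict_ext) (use that in \<open>simp add: local_smult_add[OF loc(1)] loc(2)\<close>)
  show "\<rho> \<odot>\<^bsub>sect (tilde R M) U\<^esub> (\<rho>' \<odot>\<^bsub>sect (tilde R M) U\<^esub> \<tau>) =
      \<rho>' \<odot>\<^bsub>sect (tilde R M) U\<^esub> (\<rho> \<odot>\<^bsub>sect (tilde R M) U\<^esub> \<tau>)"
    if "\<rho> \<in> carrier (fun_ring (Proj R) U)" "\<rho>' \<in> carrier (fun_ring (Proj R) U)"
      "\<tau> \<in> carrier (sect (tilde R M) U)" for \<rho> \<rho>' \<tau>
    unfolding tilde_simps
    by (intro restrict_ext) (use that in \<open>simp add: local_smult_comm[OF loc(1)] loc(2)\<close>)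
qed

end

section \<open>Comparison of a sheafification with an associated sheaf\<close>

lemma sheafification_simps [simp]:
  "carrier (sect (sheafification X F) U) = {\<sigma> \<in> \<Pi>\<^sub>E P\<in>U. stalk X F P.
     \<forall>P\<in>U. \<exists>V. openin (topo X) V \<and> P \<in> V \<and> V \<subseteq> U \<and> (\<exists>\<tau>\<in>carrier (sect F V). \<forall>Q\<in>V. \<sigma> Q = germ X F Q V \<tau>)}"
  "s \<oplus>\<^bsub>sect (sheafification X F) U\<^esub> t = (\<lambda>P\<in>U. stalk_add X F P (s P) (t P))"
  "r \<odot>\<^bsub>sect (sheafification X F) U\<^esub> s = (\<lambda>P\<in>U. stalk_smult X F P U r (s P))"
  "res (sheafification X F) U V s = restrict s V"
  by (simp_all add: sheafification_def)

text \<open>A presheaf \<open>F\<close> with values \<open>\<psi> P U \<tau>\<close> of its sections in the local modules of \<open>N\<close>, locally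
  injective and locally surjective onto regular sections.\<close>

locale presheaf_comparison = graded_ring_module R N
  for R :: "'a graded_ring" (structure) and N :: "('a, 'b) graded_module" +
  fixes F :: "('a set, 'a set \<Rightarrow> ('a \<times> 'a) set, 'm) mod_presheaf"
    and \<psi> :: "'a set \<Rightarrow> 'a set set \<Rightarrow> 'm \<Rightarrow> ('b \<times> 'a) set"
  assumes res_closed: "\<lbrakk>openin (zariski R) U; openin (zariski R) V; V \<subseteq> U; \<sigma> \<in> carrier (sect F U)\<rbrakk> \<Longrightarrow>
      res F U V \<sigma> \<in> carrier (sect F V)"
    and res_res: "\<lbrakk>openin (zariski R) U; openin (zariski R) V; openin (zariski R) W; W \<subseteq> V; V \<subseteq> U;
      \<sigma> \<in> carrier (sect F U)\<rbrakk> \<Longrightarrow> res F V W (res F U V \<sigma>) = res F U W \<sigma>"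
    and sect_add_closed: "\<lbrakk>openin (zariski R) U; \<sigma> \<in> carrier (sect F U); \<tau> \<in> carrier (sect F U)\<rbrakk> \<Longrightarrow>
      \<sigma> \<oplus>\<^bsub>sect F U\<^esub> \<tau> \<in> carrier (sect F U)"
    and sect_smult_closed: "\<lbrakk>openin (zariski R) U; r \<in> regular_sections R (self_module R) U;
      \<sigma> \<in> carrier (sect F U)\<rbrakk> \<Longrightarrow> r \<odot>\<^bsub>sect F U\<^esub> \<sigma> \<in> carrier (sect F U)"
    and \<psi>_regular: "\<lbrakk>openin (zariski R) U; \<sigma> \<in> carrier (sect F U)\<rbrakk> \<Longrightarrow>
      (\<lambda>P\<in>U. \<psi> P U \<sigma>) \<in> regular_sections R N U"
    and \<psi>_res: "\<lbrakk>openin (zariski R) U; openin (zariski R) V; V \<subseteq> U; P \<in> V; \<sigma> \<in> carrier (sect F U)\<rbrakk> \<Longrightarrow>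
      \<psi> P V (res F U V \<sigma>) = \<psi> P U \<sigma>"
    and \<psi>_add: "\<lbrakk>openin (zariski R) U; P \<in> U; \<sigma> \<in> carrier (sect F U); \<tau> \<in> carrier (sect F U)\<rbrakk> \<Longrightarrow>
      \<psi> P U (\<sigma> \<oplus>\<^bsub>sect F U\<^esub> \<tau>) = local_add R N P (\<psi> P U \<sigma>) (\<psi> P U \<tau>)"
    and \<psi>_smult: "\<lbrakk>openin (zariski R) U; P \<in> U; r \<in> regular_sections R (self_module R) U;
      \<sigma> \<in> carrier (sect F U)\<rbrakk> \<Longrightarrow> \<psi> P U (r \<odot>\<^bsub>sect F U\<^esub> \<sigma>) = local_smult R N P (r P) (\<psi> P U \<sigma>)"
    and \<psi>_inj: "\<lbrakk>openin (zariski R) U; P \<in> U; \<sigma> \<in> carrier (sect F U); \<tau> \<in> carrier (sect F U);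
      \<psi> P U \<sigma> = \<psi> P U \<tau>\<rbrakk> \<Longrightarrow> \<exists>W. openin (zariski R) W \<and> P \<in> W \<and> W \<subseteq> U \<and> res F U W \<sigma> = res F U W \<tau>"
    and \<psi>_surj: "\<lbrakk>openin (zariski R) U; P \<in> U; \<rho> \<in> regular_sections R N U\<rbrakk> \<Longrightarrow>
      \<exists>V \<tau>. openin (zariski R) V \<and> P \<in> V \<and> V \<subseteq> U \<and> \<tau> \<in> carrier (sect F V) \<and> (\<forall>Q\<in>V. \<psi> Q V \<tau> = \<rho> Q)"
begin

abbreviation sect_at :: "'a set \<Rightarrow> 'a set set \<Rightarrow> 'm \<Rightarrow> bool" where
  "sect_at P U \<sigma> \<equiv> openin (zariski R) U \<and> P \<in> U \<and> \<sigma> \<in> carrier (sect F U)"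

abbreviation germ_at :: "'a set \<Rightarrow> 'a set set \<Rightarrow> 'm \<Rightarrow> ('a set set \<times> 'm) set" where
  "germ_at \<equiv> germ (Proj R) F"

lemma germ_self: "sect_at P U \<sigma> \<Longrightarrow> (U, \<sigma>) \<in> germ_at P U \<sigma>"
  unfolding germ_def by auto

lemma germ_memD:
  assumes \<sigma>: "sect_at P U \<sigma>" and "(V, \<tau>) \<in> germ_at P U \<sigma>"
  shows "sect_at P V \<tau>" "\<psi> P V \<tau> = \<psi> P U \<sigma>"
proof -
  obtain W where *: "sect_at P V \<tau>" "openin (zariski R) W" "P \<in> W" "W \<subseteq> U \<inter> V" "res F U W \<sigma> = res F V W \<tau>"
    using assms(2) unfolding germ_def by auto
  show "sect_at P V \<tau>" by fact
  show "\<psi> P V \<tau> = \<psi> P U \<sigma>"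
    using \<psi>_res[of U W P \<sigma>] \<psi>_res[of V W P \<tau>] * \<sigma> by auto
qed

text \<open>Agreement of \<sigma> with \<tau> on W and of \<sigma> with a third section on W' gives
  agreement of \<tau> with the third section on the intersection of W and W'.\<close>

lemma germ_subset:
  assumes \<sigma>: "sect_at P U \<sigma>" "sect_at P V \<tau>"
    and W: "openin (zariski R) W" "P \<in> W" "W \<subseteq> U \<inter> V" "res F U W \<sigma> = res F V W \<tau>"
  shows "germ_at P U \<sigma> \<subseteq> germ_at P V \<tau>"
proof clarify
  fix V' \<tau>' assume "(V', \<tau>') \<in> germ_at P U \<sigma>"
  then obtain W' where *: "sect_at P V' \<tau>'" "openin (zariski R) W'" "P \<in> W'" "W' \<subseteq> U \<inter> V'"
    "res F U W' \<sigma> = res F V' W' \<tau>'"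
    unfolding germ_def by auto
  have o: "openin (zariski R) (W \<inter> W')" using W * by blast
  have "res F V (W \<inter> W') \<tau> = res F W (W \<inter> W') (res F U W \<sigma>)"
    unfolding W(4) using W \<sigma> o by (intro res_res[symmetric]) auto
  also have "\<dots> = res F W' (W \<inter> W') (res F U W' \<sigma>)"
    using W \<sigma> o * by (subst (1 2) res_res) auto
  also have "\<dots> = res F V' (W \<inter> W') \<tau>'"
    unfolding *(5) using * o by (intro res_res) auto
  finally show "(V', \<tau>') \<in> germ_at P V \<tau>"
    unfolding germ_def using * W o by (intro CollectI case_prodI conjI exI[of _ "W \<inter> W'"]) auto
qed

text \<open>After restriction to the common domain, equal values force agreement near P by
  \<open>\<psi>_inj\<close>. The stalks of F thereby embed into the local modules of N.\<close>

lemma germ_eq_iff: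
  assumes \<sigma>: "sect_at P U \<sigma>" and \<tau>: "sect_at P V \<tau>"
  shows "germ_at P U \<sigma> = germ_at P V \<tau> \<longleftrightarrow> \<psi> P U \<sigma> = \<psi> P V \<tau>"
proof
  assume "germ_at P U \<sigma> = germ_at P V \<tau>"
  then show "\<psi> P U \<sigma> = \<psi> P V \<tau>" using germ_memD(2)[OF \<tau>, of U \<sigma>] germ_self[OF \<sigma>] by simp
next
  assume eq: "\<psi> P U \<sigma> = \<psi> P V \<tau>"
  have o: "openin (zariski R) (U \<inter> V)" using \<sigma> \<tau> by blast
  have "\<psi> P (U \<inter> V) (res F U (U \<inter> V) \<sigma>) = \<psi> P (U \<inter> V) (res F V (U \<inter> V) \<tau>)"
    using \<psi>_res[of U "U \<inter> V" P \<sigma>] \<psi>_res[of V "U \<inter> V" P \<tau>] \<sigma> \<tau> o eq by simp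
  moreover have "res F U (U \<inter> V) \<sigma> \<in> carrier (sect F (U \<inter> V))" "res F V (U \<inter> V) \<tau> \<in> carrier (sect F (U \<inter> V))"
    using res_closed[of U "U \<inter> V"] res_closed[of V "U \<inter> V"] \<sigma> \<tau> o by auto
  moreover have "P \<in> U \<inter> V" using \<sigma> \<tau> by blast
  ultimately obtain W where W: "openin (zariski R) W" "P \<in> W" "W \<subseteq> U \<inter> V"
    "res F (U \<inter> V) W (res F U (U \<inter> V) \<sigma>) = res F (U \<inter> V) W (res F V (U \<inter> V) \<tau>)"
    using \<psi>_inj[OF o, of P "res F U (U \<inter> V) \<sigma>" "res F V (U \<inter> V) \<tau>"] by metis
  then have "res F U W \<sigma> = res F V W \<tau>"
    using res_res[of U "U \<inter> V" W \<sigma>] res_res[of V "U \<inter> V" W \<tau>] o \<sigma> \<tau> by simp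
  then show "germ_at P U \<sigma> = germ_at P V \<tau>"
    using germ_subset[OF \<sigma> \<tau> W(1-3)] germ_subset[OF \<tau> \<sigma> W(1,2)] W(3) by (intro equalityI) auto
qed

text \<open>The inverse of the embedding of stalks into local modules. It is meaningful for values
  that some section attains, and \<open>\<psi>_surj\<close> guarantees this for the values of
  regular sections.\<close>

definition germ_of :: "'a set \<Rightarrow> ('b \<times> 'a) set \<Rightarrow> ('a set set \<times> 'm) set" where
  "germ_of P C = (THE g. \<exists>V \<sigma>. sect_at P V \<sigma> \<and> \<psi> P V \<sigma> = C \<and> g = germ_at P V \<sigma>)"

lemma germ_of: "sect_at P U \<sigma> \<Longrightarrow> germ_of P (\<psi> P U \<sigma>) = germ_at P U \<sigma>"
  unfolding germ_of_def by (rule the_equality) (use germ_eq_iff in blast)+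

lemma inter_sections:
  assumes "sect_at P U \<sigma>" "sect_at P V \<tau>"
  shows "sect_at P (U \<inter> V) (res F U (U \<inter> V) \<sigma>)" "sect_at P (U \<inter> V) (res F V (U \<inter> V) \<tau>)"
    "\<psi> P (U \<inter> V) (res F U (U \<inter> V) \<sigma>) = \<psi> P U \<sigma>" "\<psi> P (U \<inter> V) (res F V (U \<inter> V) \<tau>) = \<psi> P V \<tau>"
proof -
  have o: "openin (zariski R) (U \<inter> V)" using assms by blast
  show "sect_at P (U \<inter> V) (res F U (U \<inter> V) \<sigma>)" "sect_at P (U \<inter> V) (res F V (U \<inter> V) \<tau>)"
    "\<psi> P (U \<inter> V) (res F U (U \<inter> V) \<sigma>) = \<psi> P U \<sigma>" "\<psi> P (U \<inter> V) (res F V (U \<inter> V) \<tau>) = \<psi> P V \<tau>"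
    using o assms res_closed[OF _ o] \<psi>_res[OF _ o] by auto
qed

lemma sum_section:
  assumes "sect_at P U \<sigma>" "sect_at P V \<tau>"
  shows "sect_at P (U \<inter> V) (res F U (U \<inter> V) \<sigma> \<oplus>\<^bsub>sect F (U \<inter> V)\<^esub> res F V (U \<inter> V) \<tau>)"
    "\<psi> P (U \<inter> V) (res F U (U \<inter> V) \<sigma> \<oplus>\<^bsub>sect F (U \<inter> V)\<^esub> res F V (U \<inter> V) \<tau>) =
      local_add R N P (\<psi> P U \<sigma>) (\<psi> P V \<tau>)"
  using inter_sections[OF assms] sect_add_closed \<psi>_add by auto

lemma smult_section:
  assumes U: "openin (zariski R) U" "P \<in> U" "r \<in> regular_sections R (self_module R) U" and \<tau>: "sect_at P V \<tau>"
  shows "sect_at P (U \<inter> V) (restrict r (U \<inter> V) \<odot>\<^bsub>sect F (U \<inter> V)\<^esub> res F V (U \<inter> V) \<tau>)"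
    "\<psi> P (U \<inter> V) (restrict r (U \<inter> V) \<odot>\<^bsub>sect F (U \<inter> V)\<^esub> res F V (U \<inter> V) \<tau>) =
      local_smult R N P (r P) (\<psi> P V \<tau>)"
proof -
  have o: "openin (zariski R) (U \<inter> V)" and PUV: "P \<in> U \<inter> V" using U \<tau> by blast+
  have r: "restrict r (U \<inter> V) \<in> regular_sections R (self_module R) (U \<inter> V)"
    using regular_sections_restrict[OF U(3) o] by simp
  have t: "res F V (U \<inter> V) \<tau> \<in> carrier (sect F (U \<inter> V))" "\<psi> P (U \<inter> V) (res F V (U \<inter> V) \<tau>) = \<psi> P V \<tau>"
    using res_closed[OF _ o] \<psi>_res[OF _ o _ PUV] \<tau> by auto
  show "sect_at P (U \<inter> V) (restrict r (U \<inter> V) \<odot>\<^bsub>sect F (U \<inter> V)\<^esub> res F V (U \<inter> V) \<tau>)"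
    using o PUV sect_smult_closed[OF o r t(1)] by blast
  show "\<psi> P (U \<inter> V) (restrict r (U \<inter> V) \<odot>\<^bsub>sect F (U \<inter> V)\<^esub> res F V (U \<inter> V) \<tau>) =
      local_smult R N P (r P) (\<psi> P V \<tau>)"
    using \<psi>_smult[OF o PUV r t(1)] t(2) PUV by simp
qed

text \<open>Every choice of representatives yields a sum with the same value, and a germ is
  determined by its value; so the union over representatives collapses to one germ.\<close>

lemma stalk_add_germ:
  assumes \<sigma>: "sect_at P U \<sigma>" and \<tau>: "sect_at P V \<tau>"
  shows "stalk_add (Proj R) F P (germ_at P U \<sigma>) (germ_at P V \<tau>) =
    germ_of P (local_add R N P (\<psi> P U \<sigma>) (\<psi> P V \<tau>))"
proof -
  have "germ_at P (U' \<inter> V') (res F U' (U' \<inter> V') \<sigma>' \<oplus>\<^bsub>sect F (U' \<inter> V')\<^esub> res F V' (U' \<inter> V') \<tau>') =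
      germ_of P (local_add R N P (\<psi> P U \<sigma>) (\<psi> P V \<tau>))"
    if "(U', \<sigma>') \<in> germ_at P U \<sigma>" "(V', \<tau>') \<in> germ_at P V \<tau>" for U' \<sigma>' V' \<tau>'
  proof -
    note a = germ_memD[OF \<sigma> that(1)] and b = germ_memD[OF \<tau> that(2)]
    show ?thesis
      using germ_of[OF sum_section(1)[OF a(1) b(1)]]
      unfolding sum_section(2)[OF a(1) b(1)] a(2) b(2) by (rule sym)
  qed
  then show ?thesis
    unfolding stalk_add_def
    by (intro UN_const[OF germ_self[OF \<sigma>]]) (auto intro!: UN_const[OF germ_self[OF \<tau>]])
qed

lemma stalk_smult_germ:
  assumes U: "openin (zariski R) U" "P \<in> U" "r \<in> regular_sections R (self_module R) U" and \<tau>: "sect_at P V \<tau>"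
  shows "stalk_smult (Proj R) F P U r (germ_at P V \<tau>) = germ_of P (local_smult R N P (r P) (\<psi> P V \<tau>))"
proof -
  have "germ_at P (U \<inter> V') (restrict r (U \<inter> V') \<odot>\<^bsub>sect F (U \<inter> V')\<^esub> res F V' (U \<inter> V') \<tau>') =
      germ_of P (local_smult R N P (r P) (\<psi> P V \<tau>))"
    if "(V', \<tau>') \<in> germ_at P V \<tau>" for V' \<tau>'
  proof -
    note a = germ_memD[OF \<tau> that]
    show ?thesis
      using germ_of[OF smult_section(1)[OF U a(1)]] unfolding smult_section(2)[OF U a(1)] a(2) by (rule sym)
  qed
  then show ?thesis
    unfolding stalk_smult_def Proj_simps by (intro UN_const[OF germ_self[OF \<tau>]]) auto
qed

lemma surjE:
  assumes "openin (zariski R) U" "P \<in> U" "\<rho> \<in> regular_sections R N U"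
  obtains V \<tau> where "openin (zariski R) V" "P \<in> V" "V \<subseteq> U" "\<tau> \<in> carrier (sect F V)"
    "\<And>Q. Q \<in> V \<Longrightarrow> \<psi> Q V \<tau> = \<rho> Q"
  using \<psi>_surj[OF assms] by (elim exE conjE) (rule that, assumption+, erule (1) bspec)

text \<open>A regular section is sent to the family of germs with the same values; by
  \<open>\<psi>_surj\<close> this family comes locally from sections of F. Since germs correspond to
  values, additivity, linearity and injectivity are read off in the local modules of N.\<close>

theorem tilde_iso_sheafification:
  "sheaf_isomorphic (Proj R) (tilde R N) (sheafification (Proj R) F)"
proof -
  define \<eta> where "\<eta> U \<rho> = (\<lambda>P\<in>U. germ_of P (\<rho> P))" for U :: "'a set set" and \<rho> :: "'a set \<Rightarrow> ('b \<times> 'a) set"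
  have "\<eta> U \<in> mod_hom (fun_ring (Proj R) U) (sect (tilde R N) U) (sect (sheafification (Proj R) F) U)"
    (is ?hom)
    and "bij_betw (\<eta> U) (carrier (sect (tilde R N) U)) (carrier (sect (sheafification (Proj R) F) U))"
    (is ?bij)
    and "\<And>V \<rho>. \<lbrakk>openin (zariski R) V; V \<subseteq> U\<rbrakk> \<Longrightarrow> \<eta> V (restrict \<rho> V) = restrict (\<eta> U \<rho>) V"
    if U: "openin (zariski R) U" for U
  proof -
    have closed: "\<eta> U \<rho> \<in> carrier (sect (sheafification (Proj R) F) U)"
      if \<rho>: "\<rho> \<in> regular_sections R N U" for \<rho>
    proof -
      have local: "\<exists>V. openin (zariski R) V \<and> P \<in> V \<and> V \<subseteq> U \<and>
          (\<exists>\<tau>\<in>carrier (sect F V). \<forall>Q\<in>V. \<eta> U \<rho> Q = germ_at Q V \<tau>)" if P: "P \<in> U" for P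
      proof -
        obtain V \<tau> where V: "openin (zariski R) V" "P \<in> V" "V \<subseteq> U" "\<tau> \<in> carrier (sect F V)"
          "\<And>Q. Q \<in> V \<Longrightarrow> \<psi> Q V \<tau> = \<rho> Q"
          by (rule surjE[OF U P \<rho>]) (rule that)
        have "\<eta> U \<rho> Q = germ_at Q V \<tau>" if "Q \<in> V" for Q
          using germ_of[of V Q \<tau>] V that by (auto simp: \<eta>_def)
        then show ?thesis using V by (intro exI[of _ V] conjI bexI[of _ \<tau>] ballI) simp_all
      qed
      have "\<eta> U \<rho> P \<in> stalk (Proj R) F P" if P: "P \<in> U" for P
        using local[OF P] P U unfolding stalk_def Proj_simps by blast
      then have "\<eta> U \<rho> \<in> (\<Pi>\<^sub>E P\<in>U. stalk (Proj R) F P)" by (simp add: PiE_iff \<eta>_def)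
      then show ?thesis using local by simp
    qed
    have add: "\<eta> U (\<lambda>P\<in>U. local_add R N P (\<rho> P) (\<rho>' P)) =
        (\<lambda>P\<in>U. stalk_add (Proj R) F P (\<eta> U \<rho> P) (\<eta> U \<rho>' P))"
      if \<rho>: "\<rho> \<in> regular_sections R N U" "\<rho>' \<in> regular_sections R N U" for \<rho> \<rho>'
      unfolding \<eta>_def
    proof (rule restrict_ext)
      fix P assume P: "P \<in> U"
      obtain V \<tau> where V: "openin (zariski R) V" "P \<in> V" "V \<subseteq> U" "\<tau> \<in> carrier (sect F V)"
        "\<And>Q. Q \<in> V \<Longrightarrow> \<psi> Q V \<tau> = \<rho> Q"
        by (rule surjE[OF U P \<rho>(1)]) (rule that)
      obtain V' \<tau>' where V': "openin (zariski R) V'" "P \<in> V'" "V' \<subseteq> U" "\<tau>' \<in> carrier (sect F V')"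
        "\<And>Q. Q \<in> V' \<Longrightarrow> \<psi> Q V' \<tau>' = \<rho>' Q"
        by (rule surjE[OF U P \<rho>(2)]) (rule that)
      show "germ_of P ((\<lambda>P\<in>U. local_add R N P (\<rho> P) (\<rho>' P)) P) = stalk_add (Proj R) F P
          ((\<lambda>P\<in>U. germ_of P (\<rho> P)) P) ((\<lambda>P\<in>U. germ_of P (\<rho>' P)) P)"
        using P stalk_add_germ[of V P \<tau> V' \<tau>'] germ_of[of V P \<tau>] germ_of[of V' P \<tau>'] V V' by simp
    qed
    have smult: "\<eta> U (\<lambda>P\<in>U. local_smult R N P (r P) (\<rho> P)) =
        (\<lambda>P\<in>U. stalk_smult (Proj R) F P U r (\<eta> U \<rho> P))"
      if r: "r \<in> regular_sections R (self_module R) U" and \<rho>: "\<rho> \<in> regular_sections R N U" for r \<rho>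
      unfolding \<eta>_def
    proof (rule restrict_ext)
      fix P assume P: "P \<in> U"
      obtain V \<tau> where V: "openin (zariski R) V" "P \<in> V" "V \<subseteq> U" "\<tau> \<in> carrier (sect F V)"
        "\<And>Q. Q \<in> V \<Longrightarrow> \<psi> Q V \<tau> = \<rho> Q"
        by (rule surjE[OF U P \<rho>]) (rule that)
      show "germ_of P ((\<lambda>P\<in>U. local_smult R N P (r P) (\<rho> P)) P) = stalk_smult (Proj R) F P U r
          ((\<lambda>P\<in>U. germ_of P (\<rho> P)) P)"
        using P stalk_smult_germ[OF U P r, of V \<tau>] germ_of[of V P \<tau>] V by simp
    qed
    show ?hom
      unfolding mod_hom_def using closed add smult by (simp del: sheafification_simps(1))
    have inj: "\<rho> = \<rho>'" if \<rho>: "\<rho> \<in> regular_sections R N U" "\<rho>' \<in> regular_sections R N U"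
      and eq: "\<eta> U \<rho> = \<eta> U \<rho>'" for \<rho> \<rho>'
    proof (rule extensionalityI)
      fix P assume P: "P \<in> U"
      obtain V \<tau> where V: "openin (zariski R) V" "P \<in> V" "V \<subseteq> U" "\<tau> \<in> carrier (sect F V)"
        "\<And>Q. Q \<in> V \<Longrightarrow> \<psi> Q V \<tau> = \<rho> Q"
        by (rule surjE[OF U P \<rho>(1)]) (rule that)
      obtain V' \<tau>' where V': "openin (zariski R) V'" "P \<in> V'" "V' \<subseteq> U" "\<tau>' \<in> carrier (sect F V')"
        "\<And>Q. Q \<in> V' \<Longrightarrow> \<psi> Q V' \<tau>' = \<rho>' Q"
        by (rule surjE[OF U P \<rho>(2)]) (rule that)
      have "germ_of P (\<rho> P) = germ_of P (\<rho>' P)" using fun_cong[OF eq, of P] P by (simp add: \<eta>_def)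
      then show "\<rho> P = \<rho>' P"
        using germ_of[of V P \<tau>] germ_of[of V' P \<tau>'] germ_eq_iff[of V P \<tau> V' \<tau>'] V V' by simp
    qed (use \<rho> regular_sections_extensional in blast)+
    have surj: "\<exists>\<rho>\<in>regular_sections R N U. \<eta> U \<rho> = s"
      if s: "s \<in> carrier (sect (sheafification (Proj R) F) U)" for s
    proof -
      have s1: "s \<in> (\<Pi>\<^sub>E P\<in>U. stalk (Proj R) F P)"
        and s2: "\<forall>P\<in>U. \<exists>V. openin (zariski R) V \<and> P \<in> V \<and> V \<subseteq> U \<and>
          (\<exists>\<tau>\<in>carrier (sect F V). \<forall>Q\<in>V. s Q = germ_at Q V \<tau>)"
        using s by simp_all
      \<comment> \<open>For surjectivity, each germ s P is replaced by its value. The value does not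
        depend on the representing section, so near every point the function C is the family of
        values of one section, which makes it regular.\<close>
      have "\<forall>P\<in>U. \<exists>C. \<exists>V \<sigma>. sect_at P V \<sigma> \<and> s P = germ_at P V \<sigma> \<and> C = \<psi> P V \<sigma>"
      proof
        fix P assume "P \<in> U"
        then have "s P \<in> stalk (Proj R) F P" using s1 by blast
        then show "\<exists>C. \<exists>V \<sigma>. sect_at P V \<sigma> \<and> s P = germ_at P V \<sigma> \<and> C = \<psi> P V \<sigma>"
          unfolding stalk_def by auto
      qed
      from bchoice[OF this] obtain C where
        C: "\<forall>P\<in>U. \<exists>V \<sigma>. sect_at P V \<sigma> \<and> s P = germ_at P V \<sigma> \<and> C P = \<psi> P V \<sigma>" ..
      have C': "C Q = \<psi> Q V \<tau>" if "sect_at Q V \<tau>" "s Q = germ_at Q V \<tau>" "Q \<in> U" for Q V \<tau>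
        using bspec[OF C that(3)] germ_eq_iff[OF _ that(1)] that(2) by (elim exE conjE) simp
      have reg: "restrict C U \<in> regular_sections R N U"
      proof (rule regular_sections_glue)
        fix P assume P: "P \<in> U"
        from bspec[OF s2 this] obtain V \<tau> where V: "openin (zariski R) V" "P \<in> V" "V \<subseteq> U"
          "\<tau> \<in> carrier (sect F V)" "\<forall>Q\<in>V. s Q = germ_at Q V \<tau>"
          by (elim exE conjE bexE)
        have "\<forall>Q\<in>V. restrict C U Q = (\<lambda>P\<in>V. \<psi> P V \<tau>) Q"
        proof
          fix Q assume Q: "Q \<in> V"
          then show "restrict C U Q = (\<lambda>P\<in>V. \<psi> P V \<tau>) Q"
            using C'[of V Q \<tau>] V by auto
        qed
        then show "\<exists>V \<tau>. openin (zariski R) V \<and> P \<in> V \<and> V \<subseteq> U \<and>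
            \<tau> \<in> regular_sections R N V \<and> (\<forall>Q\<in>V. restrict C U Q = \<tau> Q)"
          using V(1-3) \<psi>_regular[OF V(1,4)] by (intro exI conjI)
      qed simp
      have "\<eta> U (restrict C U) = s"
      proof (rule extensionalityI)
        fix P assume P: "P \<in> U"
        from bspec[OF C this] obtain V \<sigma> where "sect_at P V \<sigma>" "s P = germ_at P V \<sigma>" "C P = \<psi> P V \<sigma>"
          by (elim exE conjE) blast
        then show "\<eta> U (restrict C U) P = s P" using P germ_of by (simp add: \<eta>_def)
      qed (use s1 in \<open>auto simp: \<eta>_def PiE_iff\<close>)
      then show ?thesis using reg by blast
    qed
    show ?bij
      unfolding bij_betw_def inj_on_def tilde_simps(1)
      using inj closed surj by (intro conjI ballI impI equalityI subsetI) blast+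
    show "\<And>V \<rho>. \<lbrakk>openin (zariski R) V; V \<subseteq> U\<rbrakk> \<Longrightarrow> \<eta> V (restrict \<rho> V) = restrict (\<eta> U \<rho>) V"
      by (auto simp: \<eta>_def restrict_def fun_eq_iff)
  qed
  then show ?thesis
    unfolding sheaf_isomorphic_def Proj_simps by (intro exI[of _ \<eta>]) simp
qed

end

section \<open>Pairings of associated sheaves\<close>

text \<open>Homomorphisms respect differences, so agreement on pure tensors spreads to all tensors
  by \<open>tensor_induct\<close>.\<close>

lemma (in tensor_product) group_hom_eqI:
  assumes "group K" "f \<in> hom (add_monoid (tensor R M N)) K" "g \<in> hom (add_monoid (tensor R M N)) K"
    and eq: "\<And>x y. \<lbrakk>x \<in> carrier M; y \<in> carrier N\<rbrakk> \<Longrightarrow> f (pure R M N x y) = g (pure R M N x y)"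
    and "t \<in> carrier (tensor R M N)"
  shows "f t = g t"
proof -
  interpret f: group_hom "add_monoid (tensor R M N)" K f
    using assms(1,2) T.a_group by (simp add: group_hom_def group_hom_axioms_def)
  interpret g: group_hom "add_monoid (tensor R M N)" K g
    using assms(1,3) T.a_group by (simp add: group_hom_def group_hom_axioms_def)
  show ?thesis using assms(5)
  proof (induction t rule: tensor_induct)
    case zero
    then show ?case using f.hom_one g.hom_one by simp
  next
    case (pure x y)
    then show ?case by (rule eq)
  next
    case (diff a b)
    then show ?case
      using f.hom_mult[of a "\<ominus>\<^bsub>tensor R M N\<^esub> b"] g.hom_mult[of a "\<ominus>\<^bsub>tensor R M N\<^esub> b"]
        f.hom_inv[of b] g.hom_inv[of b] unfolding a_minus_def a_inv_def by simp
  qed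
qed

context graded_ring_module
begin

lemma local_inv_frac:
  assumes P: "primeideal P R" and x: "x \<in> mdeg M d" "s \<in> rdeg R d - P"
  shows "inv\<^bsub>local_group P\<^esub> (frac R M P x s) = frac R M P (\<ominus>\<^bsub>M\<^esub> x) s"
proof -
  interpret comm_group "local_group P" by (rule local_group[OF P])
  show ?thesis
    by (rule inv_equality)
      (use local_add_common[OF P mdeg_minus[OF x(1)] x] frac_zero_eq[OF P x(2)] mdeg_carrier[OF x(1)]
        local_carrierI[OF P x] local_carrierI[OF P mdeg_minus[OF x(1)] x(2)] in
        \<open>simp_all add: local_group_def M.l_neg\<close>)
qed

lemma regular_sections_minus:
  assumes U: "openin (zariski R) U" and \<sigma>: "\<sigma> \<in> regular_sections R M U"
  shows "(\<lambda>P\<in>U. inv\<^bsub>local_group P\<^esub> (\<sigma> P)) \<in> regular_sections R M U"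
proof (rule regular_sectionsI)
  fix P assume P: "P \<in> U"
  obtain V d x s where V: "openin (zariski R) V" "P \<in> V" "V \<subseteq> U" "x \<in> mdeg M d" "s \<in> rdeg R d"
    "\<And>Q. Q \<in> V \<Longrightarrow> s \<notin> Q" "\<And>Q. Q \<in> V \<Longrightarrow> \<sigma> Q = frac R M Q x s"
    by (rule regular_sectionsD[OF \<sigma>(1) P]) (rule that)
  have "(\<lambda>P\<in>U. inv\<^bsub>local_group P\<^esub> (\<sigma> P)) Q = frac R M Q (\<ominus>\<^bsub>M\<^esub> x) s" if Q: "Q \<in> V" for Q
    using local_inv_frac[OF openin_prime[OF V(1) Q] V(4), of s] V Q by auto
  then show "\<exists>V. openin (zariski R) V \<and> P \<in> V \<and> V \<subseteq> U \<and>
      (\<exists>d. \<exists>x\<in>mdeg M d. \<exists>s\<in>rdeg R d. \<forall>Q\<in>V. s \<notin> Q \<and>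
        (\<lambda>P\<in>U. inv\<^bsub>local_group P\<^esub> (\<sigma> P)) Q = frac R M Q x s)"
    using V mdeg_minus by (intro regular_atI[of _ V _ _ "\<ominus>\<^bsub>M\<^esub> x" _ d s])
qed simp

lemma local_group_simps [simp]:
  "carrier (local_group P) = local_carrier R M P"
  "B \<otimes>\<^bsub>local_group P\<^esub> C = local_add R M P B C"
  "\<one>\<^bsub>local_group P\<^esub> = frac R M P \<zero>\<^bsub>M\<^esub> \<one>"
  by (simp_all add: local_group_def)

lemma local_smult_hom:
  assumes "primeideal P R" "B \<in> local_carrier R (self_module R) P"
  shows "local_smult R M P B \<in> hom (local_group P) (local_group P)"
  by (rule homI) (use local_smult_closed[OF assms] local_smult_add[OF assms] in simp_all)

end

locale tilde_product = M: graded_ring_module R M + L: graded_ring_module R L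
  for R :: "'a graded_ring" (structure) and M :: "('a, 'm) graded_module"
    and L :: "('a, 'n) graded_module"
begin

abbreviation T where
  "T U \<equiv> tensor (fun_ring (Proj R) U) (sect (tilde R M) U) (sect (tilde R L) U)"

abbreviation pt where
  "pt U \<equiv> pure (fun_ring (Proj R) U) (sect (tilde R M) U) (sect (tilde R L) U)"

definition rs where
  "rs U V = tensor_map (fun_ring (Proj R) V) (sect (tilde R M) V) (sect (tilde R L) V)
     (\<lambda>\<sigma>. restrict \<sigma> V) (\<lambda>\<sigma>. restrict \<sigma> V)"

lemma res_eta: "res (tilde R' M') U V = (\<lambda>\<sigma>. restrict \<sigma> V)"
  by (simp add: fun_eq_iff)

lemma presheaf_simps [simp]:
  "sect (presheaf_tensor (Proj R) (tilde R M) (tilde R L)) U = T U"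
  "res (presheaf_tensor (Proj R) (tilde R M) (tilde R L)) U V = rs U V"
  by (simp_all add: presheaf_tensor_def res_eta rs_def)

lemma product: "openin (zariski R) U \<Longrightarrow>
    tensor_product (fun_ring (Proj R) U) (sect (tilde R M) U) (sect (tilde R L) U)"
  by (intro tensor_product.intro M.premodule_sections L.premodule_sections)

lemma restriction:
  assumes U: "openin (zariski R) U" and V: "openin (zariski R) V" "V \<subseteq> U"
  shows "tensor_product_map (fun_ring (Proj R) U) (sect (tilde R M) U) (sect (tilde R L) U)
    (fun_ring (Proj R) V) (sect (tilde R M) V) (sect (tilde R L) V)
    (\<lambda>\<sigma>. restrict \<sigma> V) (\<lambda>\<sigma>. restrict \<sigma> V) (\<lambda>\<sigma>. restrict \<sigma> V)"
proof -
  have inV: "P \<in> V \<Longrightarrow> P \<in> U" for P using V by blast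
  show ?thesis
    by (intro tensor_product_map.intro product U V tensor_product_map_axioms.intro)
      (use inV in \<open>auto intro!: regular_sections_restrict[OF _ V] restrict_ext simp: V(2) Int_absorb1\<close>)
qed

lemma rs_hom: "\<lbrakk>openin (zariski R) U; openin (zariski R) V; V \<subseteq> U\<rbrakk> \<Longrightarrow>
    abelian_group_hom (T U) (T V) (rs U V)"
proof -
  assume "openin (zariski R) U" "openin (zariski R) V" "V \<subseteq> U"
  then interpret tensor_product_map "fun_ring (Proj R) U" "sect (tilde R M) U" "sect (tilde R L) U"
    "fun_ring (Proj R) V" "sect (tilde R M) V" "sect (tilde R L) V"
    "\<lambda>\<sigma>. restrict \<sigma> V" "\<lambda>\<sigma>. restrict \<sigma> V" "\<lambda>\<sigma>. restrict \<sigma> V"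
    by (rule restriction)
  show ?thesis unfolding rs_def by (rule map.abelian_group_hom_axioms)
qed

lemma rs_closed: "\<lbrakk>openin (zariski R) U; openin (zariski R) V; V \<subseteq> U; t \<in> carrier (T U)\<rbrakk> \<Longrightarrow>
    rs U V t \<in> carrier (T V)"
  using abelian_group_hom.hom_closed[OF rs_hom] .

lemma rs_pure: "\<lbrakk>openin (zariski R) U; openin (zariski R) V; V \<subseteq> U;
    x \<in> regular_sections R M U; y \<in> regular_sections R L U\<rbrakk> \<Longrightarrow>
    rs U V (pt U x y) = pt V (restrict x V) (restrict y V)"
  unfolding rs_def using tensor_product_map.tensor_map_pure[OF restriction] by simp

lemma rs_rs:
  assumes U: "openin (zariski R) U" and V: "openin (zariski R) V" "V \<subseteq> U"
    and W: "openin (zariski R) W" "W \<subseteq> V" and t: "t \<in> carrier (T U)"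
  shows "rs V W (rs U V t) = rs U W t"
proof -
  have WU: "W \<subseteq> U" using V W by blast
  interpret U: tensor_product "fun_ring (Proj R) U" "sect (tilde R M) U" "sect (tilde R L) U"
    by (rule product[OF U])
  interpret a: abelian_group_hom "T U" "T V" "rs U V" by (rule rs_hom[OF U V])
  interpret b: abelian_group_hom "T V" "T W" "rs V W" by (rule rs_hom[OF V(1) W])
  interpret c: abelian_group_hom "T U" "T W" "rs U W" by (rule rs_hom[OF U W(1) WU])
  show ?thesis using t
  proof (induction t rule: U.tensor_induct)
    case (pure x y)
    then have xy: "x \<in> regular_sections R M U" "y \<in> regular_sections R L U" by simp_all
    have "restrict (restrict x V) W = restrict x W" "restrict (restrict y V) W = restrict y W"
      using W(2) by (simp_all add: Int_absorb1)
    then show ?case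
      unfolding rs_pure[OF U V xy] rs_pure[OF U W(1) WU xy]
        rs_pure[OF V(1) W regular_sections_restrict[OF xy(1) V] regular_sections_restrict[OF xy(2) V]]
      by simp
  qed (simp_all add: a.hom_diff b.hom_diff c.hom_diff)
qed

end

text \<open>Bilinear maps of local modules, one for each point, tied together by
  \<open>\<beta>_regular\<close>. Linearity over local functions in both arguments provides the
  balancing needed to pass to tensor products, and linearity of the induced maps.\<close>

locale tilde_pairing = tilde_product R M L + N: graded_ring_module R N
  for R :: "'a graded_ring" (structure) and M :: "('a, 'm) graded_module"
    and L :: "('a, 'n) graded_module" and N :: "('a, 'p) graded_module" +
  fixes \<beta> :: "'a set \<Rightarrow> ('m \<times> 'a) set \<Rightarrow> ('n \<times> 'a) set \<Rightarrow> ('p \<times> 'a) set"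
  assumes \<beta>_closed: "\<lbrakk>P \<in> Proj_set R; B \<in> local_carrier R M P; C \<in> local_carrier R L P\<rbrakk> \<Longrightarrow>
      \<beta> P B C \<in> local_carrier R N P"
    and \<beta>_add_left: "\<lbrakk>P \<in> Proj_set R; B \<in> local_carrier R M P; B' \<in> local_carrier R M P;
      C \<in> local_carrier R L P\<rbrakk> \<Longrightarrow>
      \<beta> P (local_add R M P B B') C = local_add R N P (\<beta> P B C) (\<beta> P B' C)"
    and \<beta>_add_right: "\<lbrakk>P \<in> Proj_set R; B \<in> local_carrier R M P; C \<in> local_carrier R L P;
      C' \<in> local_carrier R L P\<rbrakk> \<Longrightarrow>
      \<beta> P B (local_add R L P C C') = local_add R N P (\<beta> P B C) (\<beta> P B C')"
    and \<beta>_smult_left: "\<lbrakk>P \<in> Proj_set R; r \<in> local_carrier R (self_module R) P;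
      B \<in> local_carrier R M P; C \<in> local_carrier R L P\<rbrakk> \<Longrightarrow>
      \<beta> P (local_smult R M P r B) C = local_smult R N P r (\<beta> P B C)"
    and \<beta>_smult_right: "\<lbrakk>P \<in> Proj_set R; r \<in> local_carrier R (self_module R) P;
      B \<in> local_carrier R M P; C \<in> local_carrier R L P\<rbrakk> \<Longrightarrow>
      \<beta> P B (local_smult R L P r C) = local_smult R N P r (\<beta> P B C)"
    and \<beta>_regular: "\<lbrakk>openin (zariski R) U; \<sigma> \<in> regular_sections R M U; \<tau> \<in> regular_sections R L U\<rbrakk> \<Longrightarrow>
      (\<lambda>P\<in>U. \<beta> P (\<sigma> P) (\<tau> P)) \<in> regular_sections R N U"
begin

text \<open>The homomorphism that the universal property yields at P. The choice is determined on
  the carrier of the tensor product, because pure tensors generate it.\<close>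

definition \<psi> where
  "\<psi> P U = (SOME h. h \<in> hom (add_monoid (T U)) (N.local_group P) \<and>
     (\<forall>x\<in>regular_sections R M U. \<forall>y\<in>regular_sections R L U. h (pt U x y) = \<beta> P (x P) (y P)))"

lemma \<psi>_spec:
  assumes U: "openin (zariski R) U" and P: "P \<in> U"
  shows "\<psi> P U \<in> hom (add_monoid (T U)) (N.local_group P) \<and>
    (\<forall>x\<in>regular_sections R M U. \<forall>y\<in>regular_sections R L U. \<psi> P U (pt U x y) = \<beta> P (x P) (y P))"
proof -
  have PP: "P \<in> Proj_set R" and prime: "primeideal P R"
    using openin_Proj_set[OF U] P openin_prime[OF U P] by blast+
  interpret U: tensor_product "fun_ring (Proj R) U" "sect (tilde R M) U" "sect (tilde R L) U"
    by (rule product[OF U])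
  note loc = regular_sections_local[OF _ P]
  obtain h where "h \<in> hom (add_monoid (T U)) (N.local_group P)"
    "\<And>x y. \<lbrakk>x \<in> carrier (sect (tilde R M) U); y \<in> carrier (sect (tilde R L) U)\<rbrakk> \<Longrightarrow>
      h (pt U x y) = \<beta> P (x P) (y P)"
    by (rule U.tensor_lift[OF N.local_group[OF prime], of "\<lambda>x y. \<beta> P (x P) (y P)"])
      (use P in \<open>simp_all add: loc \<beta>_closed[OF PP] \<beta>_add_left[OF PP] \<beta>_add_right[OF PP]
        \<beta>_smult_left[OF PP] \<beta>_smult_right[OF PP]\<close>)
  then have "\<exists>h. h \<in> hom (add_monoid (T U)) (N.local_group P) \<and>
     (\<forall>x\<in>regular_sections R M U. \<forall>y\<in>regular_sections R L U. h (pt U x y) = \<beta> P (x P) (y P))"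
    by (intro exI[of _ h]) simp
  from someI_ex[OF this] show ?thesis by (fold \<psi>_def)
qed

context
  fixes U P assumes U: "openin (zariski R) U" and P: "P \<in> U"
begin

lemma \<psi>_hom: "group_hom (add_monoid (T U)) (N.local_group P) (\<psi> P U)"
  using \<psi>_spec[OF U P] N.local_group[OF openin_prime[OF U P]] tensor_product.axioms
    abelian_group.a_group[OF abelian_group_hom.axioms(1)[OF rs_hom[OF U U order_refl]]]
  by (simp add: group_hom_def group_hom_axioms_def comm_group.axioms)

lemma \<psi>_pure: "\<lbrakk>x \<in> regular_sections R M U; y \<in> regular_sections R L U\<rbrakk> \<Longrightarrow>
    \<psi> P U (pt U x y) = \<beta> P (x P) (y P)"
  using \<psi>_spec[OF U P] by blast

lemma \<psi>_closed: "t \<in> carrier (T U) \<Longrightarrow> \<psi> P U t \<in> local_carrier R N P"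
  using group_hom.hom_closed[OF \<psi>_hom, of t] by simp

lemma \<psi>_add: "\<lbrakk>s \<in> carrier (T U); t \<in> carrier (T U)\<rbrakk> \<Longrightarrow>
    \<psi> P U (s \<oplus>\<^bsub>T U\<^esub> t) = local_add R N P (\<psi> P U s) (\<psi> P U t)"
  using group_hom.hom_mult[OF \<psi>_hom, of s t] by simp

lemma \<psi>_zero: "\<psi> P U \<zero>\<^bsub>T U\<^esub> = frac R N P \<zero>\<^bsub>N\<^esub> \<one>"
  using group_hom.hom_one[OF \<psi>_hom] by simp

lemma \<psi>_diff: "\<lbrakk>s \<in> carrier (T U); t \<in> carrier (T U)\<rbrakk> \<Longrightarrow>
    \<psi> P U (s \<ominus>\<^bsub>T U\<^esub> t) = local_add R N P (\<psi> P U s) (inv\<^bsub>N.local_group P\<^esub> (\<psi> P U t))"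
  using group_hom.hom_mult[OF \<psi>_hom, of s "\<ominus>\<^bsub>T U\<^esub> t"] group_hom.hom_inv[OF \<psi>_hom, of t]
    abelian_group.a_inv_closed[OF abelian_group_hom.axioms(1)[OF rs_hom[OF U U order_refl]], of t]
  by (simp add: a_minus_def a_inv_def)

text \<open>Both sides are homomorphisms on the tensor product over U with the same values on pure
  tensors. The properties of \<psi> over V appear as premises because U is fixed in the surrounding
  context; \<open>\<psi>_restrict\<close> discharges them.\<close>

lemma \<psi>_res:
  assumes V: "openin (zariski R) V" "V \<subseteq> U" "P \<in> V" and t: "t \<in> carrier (T U)"
  shows "group_hom (add_monoid (T V)) (N.local_group P) (\<psi> P V) \<Longrightarrow> 
    (\<And>x y. \<lbrakk>x \<in> regular_sections R M V; y \<in> regular_sections R L V\<rbrakk> \<Longrightarrow>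
    \<psi> P V (pt V x y) = \<beta> P (x P) (y P)) \<Longrightarrow> \<psi> P V (rs U V t) = \<psi> P U t"
proof -
  assume V_hom: "group_hom (add_monoid (T V)) (N.local_group P) (\<psi> P V)"
    and V_pure: "\<And>x y. \<lbrakk>x \<in> regular_sections R M V; y \<in> regular_sections R L V\<rbrakk> \<Longrightarrow>
      \<psi> P V (pt V x y) = \<beta> P (x P) (y P)"
  interpret U: tensor_product "fun_ring (Proj R) U" "sect (tilde R M) U" "sect (tilde R L) U"
    by (rule product[OF U])
  interpret a: abelian_group_hom "T U" "T V" "rs U V" by (rule rs_hom[OF U V(1,2)])
  have "(\<lambda>t. \<psi> P V (rs U V t)) \<in> hom (add_monoid (T U)) (N.local_group P)"
    using hom_compose[OF group_hom.homh[OF a.a_group_hom] group_hom.homh[OF V_hom]] by (simp add: o_def)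
  then show "\<psi> P V (rs U V t) = \<psi> P U t"
  proof (rule U.group_hom_eqI[OF comm_group.axioms(2)[OF N.local_group[OF openin_prime[OF U P]]]
        _ group_hom.homh[OF \<psi>_hom] _ t])
    fix x y assume xy: "x \<in> carrier (sect (tilde R M) U)" "y \<in> carrier (sect (tilde R L) U)"
    then have xy': "x \<in> regular_sections R M U" "y \<in> regular_sections R L U" by simp_all
    show "\<psi> P V (rs U V (pt U x y)) = \<psi> P U (pt U x y)"
      unfolding rs_pure[OF U V(1,2) xy'] \<psi>_pure[OF xy']
      using V_pure[OF xy'[THEN regular_sections_restrict[OF _ V(1,2)]]] V(3) by simp
  qed
qed

lemma \<psi>_smult:
  assumes r: "r \<in> regular_sections R (self_module R) U" and t: "t \<in> carrier (T U)"
  shows "\<psi> P U (r \<odot>\<^bsub>T U\<^esub> t) = local_smult R N P (r P) (\<psi> P U t)"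
proof -
  have r': "r \<in> carrier (fun_ring (Proj R) U)" using r by simp
  have prime: "primeideal P R" and PP: "P \<in> Proj_set R"
    using openin_prime[OF U P] openin_Proj_set[OF U] P by blast+
  interpret U: tensor_product "fun_ring (Proj R) U" "sect (tilde R M) U" "sect (tilde R L) U"
    by (rule product[OF U])
  interpret b: abelian_group_hom "T U" "T U" "\<lambda>t. r \<odot>\<^bsub>T U\<^esub> t" by (rule U.smult_hom[OF r'])
  have 1: "(\<lambda>t. \<psi> P U (r \<odot>\<^bsub>T U\<^esub> t)) \<in> hom (add_monoid (T U)) (N.local_group P)"
    using hom_compose[OF group_hom.homh[OF b.a_group_hom] group_hom.homh[OF \<psi>_hom]] by (simp add: o_def)
  have 2: "(\<lambda>t. local_smult R N P (r P) (\<psi> P U t)) \<in> hom (add_monoid (T U)) (N.local_group P)"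
    using hom_compose[OF group_hom.homh[OF \<psi>_hom]
      N.local_smult_hom[OF prime regular_sections_local[OF r P]]] by (simp add: o_def)
  show ?thesis
  proof (rule U.group_hom_eqI[OF comm_group.axioms(2)[OF N.local_group[OF prime]] 1 2 _ t])
    fix x y assume xy: "x \<in> carrier (sect (tilde R M) U)" "y \<in> carrier (sect (tilde R L) U)"
    then have xy': "x \<in> regular_sections R M U" "y \<in> regular_sections R L U" by simp_all
    have rx: "r \<odot>\<^bsub>sect (tilde R M) U\<^esub> x \<in> regular_sections R M U"
      using U.M.smult_closed[OF r' xy(1)] by simp
    have "\<psi> P U (r \<odot>\<^bsub>T U\<^esub> pt U x y) = \<beta> P ((r \<odot>\<^bsub>sect (tilde R M) U\<^esub> x) P) (y P)"
      unfolding U.smult_pure[OF r' xy] \<psi>_pure[OF rx xy'(2)] ..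
    also have "\<dots> = local_smult R N P (r P) (\<psi> P U (pt U x y))"
      unfolding \<psi>_pure[OF xy'] tilde_simps
      using \<beta>_smult_left[OF PP regular_sections_local[OF r P] regular_sections_local[OF xy'(1) P]
          regular_sections_local[OF xy'(2) P]] P by simp
    finally show "\<psi> P U (r \<odot>\<^bsub>T U\<^esub> pt U x y) = local_smult R N P (r P) (\<psi> P U (pt U x y))" .
  qed
qed

end

lemma \<psi>_restrict:
  assumes "openin (zariski R) U" "openin (zariski R) V" "V \<subseteq> U" "P \<in> V" "t \<in> carrier (T U)"
  shows "\<psi> P V (rs U V t) = \<psi> P U t"
  using assms \<psi>_res[OF assms(1) _ assms(2-5) \<psi>_hom[OF assms(2,4)] \<psi>_pure[OF assms(2,4)]] by blast

text \<open>Pure tensors give regular families by \<open>\<beta>_regular\<close>, and regular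
  families are closed under addition and inverses in the local groups; induction over tensors does
  the rest.\<close>

lemma \<psi>_regular:
  assumes U: "openin (zariski R) U" and t: "t \<in> carrier (T U)"
  shows "(\<lambda>P\<in>U. \<psi> P U t) \<in> regular_sections R N U"
proof -
  interpret U: tensor_product "fun_ring (Proj R) U" "sect (tilde R M) U" "sect (tilde R L) U"
    by (rule product[OF U])
  show ?thesis using t
  proof (induction t rule: U.tensor_induct)
    case zero
    have "(\<lambda>P\<in>U. \<psi> P U \<zero>\<^bsub>T U\<^esub>) = (\<lambda>P\<in>U. frac R N P \<zero>\<^bsub>N\<^esub> \<one>)"
      by (rule restrict_ext) (simp add: \<psi>_zero[OF U])
    then show ?case
      using regular_sections_frac[OF U N.mdeg_zero M.rdeg_one]
        M.den_one[OF openin_prime[OF U]] by (simp del: restrict_apply)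
  next
    case (pure x y)
    then have xy: "x \<in> regular_sections R M U" "y \<in> regular_sections R L U" by simp_all
    have "(\<lambda>P\<in>U. \<psi> P U (pt U x y)) = (\<lambda>P\<in>U. \<beta> P (x P) (y P))"
      by (rule restrict_ext) (simp add: \<psi>_pure[OF U _ xy])
    then show ?case using \<beta>_regular[OF U xy] by (simp del: restrict_apply)
  next
    case (diff s t)
    have "(\<lambda>P\<in>U. \<psi> P U (s \<ominus>\<^bsub>T U\<^esub> t)) = (\<lambda>P\<in>U. local_add R N P ((\<lambda>P\<in>U. \<psi> P U s) P)
        ((\<lambda>P\<in>U. inv\<^bsub>N.local_group P\<^esub> ((\<lambda>P\<in>U. \<psi> P U t) P)) P))"
      by (rule restrict_ext) (simp add: \<psi>_diff[OF U _ diff(1,2)])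
    then show ?case
      using N.regular_sections_add[OF U diff(3) N.regular_sections_minus[OF U diff(4)]]
      by (simp only:)
  qed
qed

text \<open>Values are additive, so injectivity reduces to sections of value zero:
  \<open>inj\<close> is applied to the difference of two sections with equal values.\<close>

lemma presheaf_comparisonI:
  assumes inj: "\<And>U P t. \<lbrakk>openin (zariski R) U; P \<in> U; t \<in> carrier (T U);
      \<psi> P U t = frac R N P \<zero>\<^bsub>N\<^esub> \<one>\<rbrakk> \<Longrightarrow>
      \<exists>W. openin (zariski R) W \<and> P \<in> W \<and> W \<subseteq> U \<and> rs U W t = \<zero>\<^bsub>T W\<^esub>"
    and surj: "\<And>U P \<rho>. \<lbrakk>openin (zariski R) U; P \<in> U; \<rho> \<in> regular_sections R N U\<rbrakk> \<Longrightarrow>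
      \<exists>V t. openin (zariski R) V \<and> P \<in> V \<and> V \<subseteq> U \<and> t \<in> carrier (T V) \<and> (\<forall>Q\<in>V. \<psi> Q V t = \<rho> Q)"
  shows "presheaf_comparison R N (presheaf_tensor (Proj R) (tilde R M) (tilde R L)) \<psi>"
proof (intro presheaf_comparison.intro N.graded_ring_module_axioms presheaf_comparison_axioms.intro,
    unfold presheaf_simps)
  fix U P s t assume U: "openin (zariski R) U" and P: "P \<in> U" and st: "s \<in> carrier (T U)" "t \<in> carrier (T U)"
    and eq: "\<psi> P U s = \<psi> P U t"
  interpret U: tensor_product "fun_ring (Proj R) U" "sect (tilde R M) U" "sect (tilde R L) U"
    by (rule product[OF U])
  interpret K: comm_group "N.local_group P" by (rule N.local_group[OF openin_prime[OF U P]])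
  have "\<psi> P U (s \<ominus>\<^bsub>T U\<^esub> t) = frac R N P \<zero>\<^bsub>N\<^esub> \<one>"
    unfolding \<psi>_diff[OF U P st] eq using K.r_inv[of "\<psi> P U t"] \<psi>_closed[OF U P st(2)] by simp
  with inj[OF U P U.T.minus_closed[OF st]]
  obtain W where W: "openin (zariski R) W" "P \<in> W" "W \<subseteq> U" "rs U W (s \<ominus>\<^bsub>T U\<^esub> t) = \<zero>\<^bsub>T W\<^esub>" by blast
  interpret a: abelian_group_hom "T U" "T W" "rs U W" by (rule rs_hom[OF U W(1,3)])
  have "rs U W s = rs U W t"
    using W(4) a.hom_diff[OF st] a.hom_closed[OF st(1)] a.hom_closed[OF st(2)]
    by (metis a.H.add.inv_closed a.H.minus_equality a.H.minus_minus a_minus_def)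
  then show "\<exists>W. openin (zariski R) W \<and> P \<in> W \<and> W \<subseteq> U \<and> rs U W s = rs U W t" using W by blast
qed (fact rs_closed | rule rs_rs; assumption | fact \<psi>_regular | fact \<psi>_restrict | fact \<psi>_add | fact \<psi>_smult
  | fact surj
  | blast intro: abelian_monoid.a_closed abelian_group.axioms abelian_group_hom.axioms(1)[OF rs_hom]
  | (rule tensor_product.smult_closed[OF product]; simp))+

end

section \<open>Sections given by a single fraction\<close>

lemma (in abelian_monoid) finsum_swap:
  assumes "finite I" "finite K" "\<And>i k. \<lbrakk>i \<in> I; k \<in> K\<rbrakk> \<Longrightarrow> f i k \<in> carrier G"
  shows "finsum G (\<lambda>i. finsum G (f i) K) I = finsum G (\<lambda>k. finsum G (\<lambda>i. f i k) I) K"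
  using assms(1,3)
proof (induction I rule: finite_induct)
  case (insert i I)
  then have "(\<lambda>i. finsum G (f i) K) \<in> I \<rightarrow> carrier G" "f i \<in> K \<rightarrow> carrier G"
    "(\<lambda>k. finsum G (\<lambda>i. f i k) I) \<in> K \<rightarrow> carrier G"
    by (auto intro!: finsum_closed)
  moreover have "finsum G (\<lambda>k. finsum G (\<lambda>i. f i k) (insert i I)) K =
      finsum G (\<lambda>k. f i k \<oplus> finsum G (\<lambda>i. f i k) I) K"
    using insert by (intro finsum_cong') (auto intro!: finsum_closed)
  ultimately show ?case using insert by (simp add: finsum_addf)
qed simp

lemma (in abelian_group_hom) hom_finsum:
  assumes "finite I" "\<And>i. i \<in> I \<Longrightarrow> f i \<in> carrier G"
  shows "h (finsum G f I) = finsum H (\<lambda>i. h (f i)) I"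
  using assms by (induction I rule: finite_induct) (auto simp: Pi_iff)

section \<open>Denominators valid on a whole open set\<close>

context graded_cring
begin

definition dens :: "'a set set \<Rightarrow> int \<Rightarrow> 'a set" where
  "dens W d = {s \<in> rdeg R d. \<forall>Q\<in>W. s \<notin> Q}"

lemma dens_rdeg: "s \<in> dens W d \<Longrightarrow> s \<in> rdeg R d"
  by (simp add: dens_def)

lemma dens_at: "\<lbrakk>s \<in> dens W d; Q \<in> W\<rbrakk> \<Longrightarrow> s \<in> rdeg R d - Q"
  by (simp add: dens_def)

lemma dens_mono: "\<lbrakk>s \<in> dens W d; V \<subseteq> W\<rbrakk> \<Longrightarrow> s \<in> dens V d"
  by (auto simp: dens_def)

lemma dens_mult: "\<lbrakk>openin (zariski R) W; s \<in> dens W d; t \<in> dens W e\<rbrakk> \<Longrightarrow> s \<otimes> t \<in> dens W (d + e)"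
  unfolding dens_def using den_mult[OF openin_prime] rdeg_mult by fastforce

lemma dens_one: "openin (zariski R) W \<Longrightarrow> \<one> \<in> dens W 0"
  unfolding dens_def using den_one[OF openin_prime] rdeg_one by fastforce

lemma dens_pow: "\<lbrakk>openin (zariski R) W; s \<in> dens W d\<rbrakk> \<Longrightarrow> s [^] (k::nat) \<in> dens W (int k * d)"
  unfolding dens_def using den_pow[OF openin_prime] rdeg_pow by fastforce

end

context graded_ring_module
begin

definition frac_section :: "'a set set \<Rightarrow> 'b \<Rightarrow> 'a \<Rightarrow> 'a set \<Rightarrow> ('b \<times> 'a) set" where
  "frac_section W x s = (\<lambda>Q\<in>W. frac R M Q x s)"

context
  fixes W assumes W: "openin (zariski R) W"
begin

lemma frac_section_regular: "\<lbrakk>x \<in> mdeg M d; s \<in> dens W d\<rbrakk> \<Longrightarrow> frac_section W x s \<in> regular_sections R M W"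
  unfolding frac_section_def by (rule regular_sections_frac[OF W, where d = d]) (simp_all add: dens_def)

lemma frac_section_cancel:
  "\<lbrakk>x \<in> mdeg M d; s \<in> dens W d; v \<in> dens W k\<rbrakk> \<Longrightarrow> frac_section W (v \<odot>\<^bsub>M\<^esub> x) (v \<otimes> s) = frac_section W x s"
  unfolding frac_section_def
  by (rule restrict_ext) (rule frac_cancel[OF openin_prime[OF W] _ dens_at dens_at])

lemma frac_section_add:
  "\<lbrakk>x \<in> mdeg M d; y \<in> mdeg M d; s \<in> dens W d\<rbrakk> \<Longrightarrow>
    frac_section W x s \<oplus>\<^bsub>sect (tilde R M) W\<^esub> frac_section W y s = frac_section W (x \<oplus>\<^bsub>M\<^esub> y) s"
  unfolding frac_section_def tilde_simps
  by (rule restrict_ext) (simp add: local_add_common[OF openin_prime[OF W] _ _ dens_at])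

lemma frac_section_smult:
  "\<lbrakk>r \<in> rdeg R d; w \<in> dens W d; x \<in> mdeg M e; s \<in> dens W e\<rbrakk> \<Longrightarrow>
    (\<lambda>Q\<in>W. frac R (self_module R) Q r w) \<odot>\<^bsub>sect (tilde R M) W\<^esub> frac_section W x s =
      frac_section W (r \<odot>\<^bsub>M\<^esub> x) (w \<otimes> s)"
  unfolding frac_section_def tilde_simps
  by (rule restrict_ext) (simp add: local_smult_frac[OF openin_prime[OF W] _ dens_at _ dens_at])

end

lemma frac_section_restrict: "V \<subseteq> W \<Longrightarrow> restrict (frac_section W x s) V = frac_section V x s"
  unfolding frac_section_def by (simp add: Int_absorb1)

lemma frac_sectionE:
  assumes "\<sigma> \<in> regular_sections R M U" "P \<in> U"
  obtains V d x s where "openin (zariski R) V" "P \<in> V" "V \<subseteq> U" "x \<in> mdeg M d" "s \<in> dens V d"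
    "\<And>Q. Q \<in> V \<Longrightarrow> \<sigma> Q = frac R M Q x s"
proof (rule regular_sectionsD[OF assms])
  fix V d x s assume "openin (zariski R) V" "P \<in> V" "V \<subseteq> U" "x \<in> mdeg M d" "s \<in> rdeg R d"
    "\<And>Q. Q \<in> V \<Longrightarrow> s \<notin> Q" "\<And>Q. Q \<in> V \<Longrightarrow> \<sigma> Q = frac R M Q x s"
  then show thesis by (intro that[of V x d s]) (simp_all add: dens_def)
qed

end

section \<open>Tensor calculus with sections given by single fractions\<close>

context tilde_product
begin

context
  fixes W assumes W: "openin (zariski R) W"
begin

interpretation W: tensor_product "fun_ring (Proj R) W" "sect (tilde R M) W" "sect (tilde R L) W"
  by (rule product[OF W])

lemma pt_closed: "\<lbrakk>x \<in> regular_sections R M W; y \<in> regular_sections R L W\<rbrakk> \<Longrightarrow> pt W x y \<in> carrier (T W)"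
  using W.pure_closed by simp

lemma pt_add_left:
  assumes "x \<in> mdeg M d" "x' \<in> mdeg M d" "s \<in> M.dens W d" "y \<in> regular_sections R L W"
  shows "pt W (M.frac_section W (x \<oplus>\<^bsub>M\<^esub> x') s) y =
    pt W (M.frac_section W x s) y \<oplus>\<^bsub>T W\<^esub> pt W (M.frac_section W x' s) y"
  using W.pure_add_left[of "M.frac_section W x s" "M.frac_section W x' s" y] assms
  by (simp add: M.frac_section_regular[OF W] M.frac_section_add[OF W] del: tilde_simps(2))

lemma pt_add_right:
  assumes "y \<in> mdeg L d" "y' \<in> mdeg L d" "s \<in> M.dens W d" "x \<in> regular_sections R M W"
  shows "pt W x (L.frac_section W (y \<oplus>\<^bsub>L\<^esub> y') s) =
    pt W x (L.frac_section W y s) \<oplus>\<^bsub>T W\<^esub> pt W x (L.frac_section W y' s)"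
  using W.pure_add_right[of x "L.frac_section W y s" "L.frac_section W y' s"] assms
  by (simp add: L.frac_section_regular[OF W] L.frac_section_add[OF W] del: tilde_simps(2))

text \<open>Additivity makes this pure tensor equal to its own double, so it vanishes.\<close>

lemma pt_zero_left:
  assumes "s \<in> M.dens W d" "y \<in> regular_sections R L W"
  shows "pt W (M.frac_section W \<zero>\<^bsub>M\<^esub> s) y = \<zero>\<^bsub>T W\<^esub>"
  using pt_add_left[OF M.mdeg_zero M.mdeg_zero assms] pt_closed[OF M.frac_section_regular[OF W M.mdeg_zero assms(1)] assms(2)]
  by simp

lemma pt_zero_right:
  assumes "s \<in> M.dens W d" "x \<in> regular_sections R M W"
  shows "pt W x (L.frac_section W \<zero>\<^bsub>L\<^esub> s) = \<zero>\<^bsub>T W\<^esub>"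
  using pt_add_right[OF L.mdeg_zero L.mdeg_zero assms] pt_closed[OF assms(2) L.frac_section_regular[OF W L.mdeg_zero assms(1)]]
  by simp

lemma pt_finsum_left:
  assumes "finite I" "\<And>i. i \<in> I \<Longrightarrow> x i \<in> mdeg M d" "s \<in> M.dens W d" "y \<in> regular_sections R L W"
  shows "pt W (M.frac_section W (finsum M x I) s) y = (\<Oplus>\<^bsub>T W\<^esub>i\<in>I. pt W (M.frac_section W (x i) s) y)"
  using assms(1,2)
proof (induction I rule: finite_induct)
  case empty
  then show ?case using pt_zero_left[OF assms(3,4)] by simp
next
  case (insert i I)
  have deg: "finsum M x I \<in> mdeg M d" "x i \<in> mdeg M d"
    using insert by (auto intro: M.mdeg_finsum)
  moreover have "x \<in> I \<rightarrow> carrier M" "x i \<in> carrier M"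
    using insert M.mdeg_carrier by auto
  moreover have "(\<lambda>i. pt W (M.frac_section W (x i) s) y) \<in> I \<rightarrow> carrier (T W)"
    using insert by (intro funcsetI pt_closed M.frac_section_regular[OF W _ assms(3)] assms(4)) auto
  ultimately show ?case
    using insert pt_closed[OF M.frac_section_regular[OF W _ assms(3)] assms(4)]
    by (simp add: pt_add_left[OF _ _ assms(3,4)])
qed

lemma pt_finsum_right:
  assumes "finite I" "\<And>i. i \<in> I \<Longrightarrow> y i \<in> mdeg L d" "s \<in> M.dens W d" "x \<in> regular_sections R M W"
  shows "pt W x (L.frac_section W (finsum L y I) s) = (\<Oplus>\<^bsub>T W\<^esub>i\<in>I. pt W x (L.frac_section W (y i) s))"
  using assms(1,2)
proof (induction I rule: finite_induct)
  case empty
  then show ?case using pt_zero_right[OF assms(3,4)] by simp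
next
  case (insert i I)
  have deg: "finsum L y I \<in> mdeg L d" "y i \<in> mdeg L d"
    using insert by (auto intro: L.mdeg_finsum)
  moreover have "y \<in> I \<rightarrow> carrier L" "y i \<in> carrier L"
    using insert L.mdeg_carrier by auto
  moreover have "(\<lambda>i. pt W x (L.frac_section W (y i) s)) \<in> I \<rightarrow> carrier (T W)"
    using insert by (intro funcsetI pt_closed L.frac_section_regular[OF W _ assms(3)] assms(4)) auto
  ultimately show ?case
    using insert pt_closed[OF assms(4) L.frac_section_regular[OF W _ assms(3)]]
    by (simp add: pt_add_right[OF _ _ assms(3,4)])
qed

text \<open>What crosses the tensor sign is the regular function r / v, so a numerator can move only
  together with a denominator of the same degree. This explains the powers of u that accompany every
  move in the normal form computations.\<close>

lemma pt_balanced: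
  assumes r: "r \<in> rdeg R k" "v \<in> M.dens W k" and x: "x \<in> mdeg M d" "s \<in> M.dens W d"
    and y: "y \<in> mdeg L e" "t \<in> M.dens W e"
  shows "pt W (M.frac_section W (r \<odot>\<^bsub>M\<^esub> x) (v \<otimes> s)) (L.frac_section W y t) =
    pt W (M.frac_section W x s) (L.frac_section W (r \<odot>\<^bsub>L\<^esub> y) (v \<otimes> t))"
proof -
  have "(\<lambda>Q\<in>W. frac R (self_module R) Q r v) \<in> carrier (fun_ring (Proj R) W)"
    using regular_sections_frac[OF W, of r "self_module R" k v] r by (simp add: M.dens_def)
  from W.pure_balanced[OF this, of "M.frac_section W x s" "L.frac_section W y t"]
  show ?thesis
    unfolding M.frac_section_smult[OF W r x] L.frac_section_smult[OF W r y]
    using M.frac_section_regular[OF W x] L.frac_section_regular[OF W y] by simp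
qed

end

end

section \<open>Twisting by a presented Veronese module\<close>

text \<open>\<open>m\<close> lists generators of the Veronese module with relation matrix \<open>A\<close>, and \<open>\<kappa>\<close> is the
  projection of \<open>M\<^sup>p\<close> onto \<open>N = coker (M \<otimes> \<Phi>)\<close>.\<close>

locale twisted_presentation =
  M: graded_ring_module R M + N: graded_ring_module R N
  for R :: "'a graded_ring" (structure) and M :: "('a, 'm) graded_module"
    and N :: "('a, 'n) graded_module" +
  fixes l :: nat and j :: int and p q :: nat and b c :: "nat \<Rightarrow> int" and A :: "nat \<Rightarrow> nat \<Rightarrow> 'a"
    and m :: "nat \<Rightarrow> 'a" and \<kappa> :: "(nat \<Rightarrow> 'm) \<Rightarrow> 'n"
  assumes l_pos: "0 < l"
    and unit: "P \<in> Proj_set R \<Longrightarrow> \<exists>u\<in>rdeg R (int l). u \<notin> P"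
    and m_deg: "s < p \<Longrightarrow> m s \<in> rdeg R (j - b s * int l)"
    and A_deg: "\<lbrakk>s < p; t < q\<rbrakk> \<Longrightarrow> A s t \<in> rdeg R ((b s - c t) * int l)"
    and A_m: "t < q \<Longrightarrow> (\<Oplus>s\<in>{..<p}. A s t \<otimes> m s) = \<zero>"
    and gen: "g \<in> rdeg R (j + e * int l) \<Longrightarrow>
      \<exists>r. (\<forall>s<p. r s \<in> rdeg R ((e + b s) * int l)) \<and> g = (\<Oplus>s\<in>{..<p}. r s \<otimes> m s)"
    and syz: "\<lbrakk>\<forall>s<p. v s \<in> rdeg R ((e + b s) * int l); (\<Oplus>s\<in>{..<p}. v s \<otimes> m s) = \<zero>\<rbrakk> \<Longrightarrow>
      \<exists>w. (\<forall>t<q. w t \<in> carrier R) \<and> (\<forall>s<p. v s = (\<Oplus>t\<in>{..<q}. A s t \<otimes> w t))"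
    and \<kappa>_cong: "(\<And>s. s < p \<Longrightarrow> x s = y s) \<Longrightarrow> \<kappa> x = \<kappa> y"
    and \<kappa>_add: "\<lbrakk>\<forall>s<p. x s \<in> carrier M; \<forall>s<p. y s \<in> carrier M\<rbrakk> \<Longrightarrow>
      \<kappa> (\<lambda>s. x s \<oplus>\<^bsub>M\<^esub> y s) = \<kappa> x \<oplus>\<^bsub>N\<^esub> \<kappa> y"
    and \<kappa>_smult: "\<lbrakk>r \<in> carrier R; \<forall>s<p. x s \<in> carrier M\<rbrakk> \<Longrightarrow> \<kappa> (\<lambda>s. r \<odot>\<^bsub>M\<^esub> x s) = r \<odot>\<^bsub>N\<^esub> \<kappa> x"
    and \<kappa>_closed: "\<forall>s<p. x s \<in> carrier M \<Longrightarrow> \<kappa> x \<in> carrier N"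
    and \<kappa>_mdeg: "mdeg N d = \<kappa> ` {x. \<forall>s<p. x s \<in> mdeg M (d + b s * int l)}"
    and \<kappa>_rel: "\<forall>t<q. w t \<in> carrier M \<Longrightarrow> \<kappa> (\<lambda>s. \<Oplus>\<^bsub>M\<^esub>t\<in>{..<q}. A s t \<odot>\<^bsub>M\<^esub> w t) = \<zero>\<^bsub>N\<^esub>"
    and \<kappa>_zeroD: "\<lbrakk>\<forall>s<p. x s \<in> mdeg M (d + b s * int l); \<kappa> x = \<zero>\<^bsub>N\<^esub>\<rbrakk> \<Longrightarrow>
      \<exists>w. (\<forall>t<q. w t \<in> mdeg M (d + c t * int l)) \<and>
        (\<forall>s<p. x s = (\<Oplus>\<^bsub>M\<^esub>t\<in>{..<q}. A s t \<odot>\<^bsub>M\<^esub> w t))"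
begin

abbreviation "L \<equiv> shift (self_module R) j"

sublocale L: graded_ring_module R L
  by (intro graded_ring_module.graded_shift M.graded_self_module)

definition comb :: "(nat \<Rightarrow> 'a) \<Rightarrow> 'a" where
  "comb r = (\<Oplus>s\<in>{..<p}. r s \<otimes> m s)"

text \<open>The degrees are those for which \<open>comb r\<close> has degree j + e * l, given that
  \<open>m s\<close> has degree j - b s * l. In \<open>L\<close> this is degree e * l, so the
  matching denominators have degree divisible by l.\<close>

definition coef :: "int \<Rightarrow> (nat \<Rightarrow> 'a) \<Rightarrow> bool" where
  "coef e r \<longleftrightarrow> (\<forall>s<p. r s \<in> rdeg R ((e + b s) * int l))"

lemma m_carrier: "s < p \<Longrightarrow> m s \<in> carrier R"
  using m_deg M.rdeg_carrier by blast

lemma A_carrier: "\<lbrakk>s < p; t < q\<rbrakk> \<Longrightarrow> A s t \<in> carrier R"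
  using A_deg M.rdeg_carrier by blast

lemma coef_carrier: "\<lbrakk>coef e r; s < p\<rbrakk> \<Longrightarrow> r s \<in> carrier R"
  unfolding coef_def using M.rdeg_carrier by blast

lemma comb_deg:
  assumes "coef e r"
  shows "comb r \<in> rdeg R (j + e * int l)"
  unfolding comb_def
proof (rule M.rdeg_finsum)
  fix s assume "s \<in> {..<p}"
  then show "r s \<otimes> m s \<in> rdeg R (j + e * int l)"
    using M.rdeg_mult[of "r s" "(e + b s) * int l" "m s" "j - b s * int l"] m_deg[of s] assms
    by (simp add: coef_def algebra_simps)
qed simp

lemma comb_deg_L: "coef e r \<Longrightarrow> comb r \<in> mdeg L (e * int l)"
  using comb_deg by simp

lemma coef_add: "\<lbrakk>coef e r; coef e r'\<rbrakk> \<Longrightarrow> coef e (\<lambda>s. r s \<oplus> r' s)"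
  unfolding coef_def using M.rdeg_add by blast

lemma coef_minus: "coef e r \<Longrightarrow> coef e (\<lambda>s. \<ominus> r s)"
  unfolding coef_def using M.rdeg_minus by blast

lemma coef_smult: "\<lbrakk>v \<in> rdeg R (k * int l); coef e r\<rbrakk> \<Longrightarrow> coef (k + e) (\<lambda>s. v \<otimes> r s)"
  unfolding coef_def using M.rdeg_mult[of v "k * int l"] by (fastforce simp: algebra_simps)

lemma comb_add:
  assumes "coef e r" "coef e r'"
  shows "comb (\<lambda>s. r s \<oplus> r' s) = comb r \<oplus> comb r'"
proof -
  have "comb (\<lambda>s. r s \<oplus> r' s) = (\<Oplus>s\<in>{..<p}. (r s \<otimes> m s) \<oplus> (r' s \<otimes> m s))"
    unfolding comb_def using assms coef_carrier m_carrier
    by (intro M.ring_finsum_cong) (auto simp: M.l_distr)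
  also have "\<dots> = comb r \<oplus> comb r'"
    unfolding comb_def using assms coef_carrier m_carrier by (intro M.ring_finsum_addf) auto
  finally show ?thesis .
qed

lemma comb_smult:
  assumes "v \<in> carrier R" "coef e r"
  shows "comb (\<lambda>s. v \<otimes> r s) = v \<otimes> comb r"
proof -
  have "v \<otimes> comb r = (\<Oplus>s\<in>{..<p}. v \<otimes> (r s \<otimes> m s))"
    unfolding comb_def using assms coef_carrier m_carrier
    by (intro M.finsum_rdistr) auto
  also have "\<dots> = comb (\<lambda>s. v \<otimes> r s)"
    unfolding comb_def using assms coef_carrier m_carrier
    by (intro M.ring_finsum_cong) (auto simp: M.m_assoc)
  finally show ?thesis ..
qed

lemma \<kappa>_comb_deg:
  assumes "coef e r" "x \<in> mdeg M d"
  shows "\<kappa> (\<lambda>s. r s \<odot>\<^bsub>M\<^esub> x) \<in> mdeg N (e * int l + d)"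
  unfolding \<kappa>_mdeg
proof (intro imageI CollectI allI impI)
  fix s assume "s < p"
  then show "r s \<odot>\<^bsub>M\<^esub> x \<in> mdeg M (e * int l + d + b s * int l)"
    using M.mdeg_smult[of "r s" "(e + b s) * int l" x d] assms by (simp add: coef_def algebra_simps)
qed

lemma \<kappa>_comb_smult:
  assumes "a \<in> carrier R" "coef e r" "x \<in> carrier M"
  shows "a \<odot>\<^bsub>N\<^esub> \<kappa> (\<lambda>s. r s \<odot>\<^bsub>M\<^esub> x) = \<kappa> (\<lambda>s. (a \<otimes> r s) \<odot>\<^bsub>M\<^esub> x)"
    and "a \<odot>\<^bsub>N\<^esub> \<kappa> (\<lambda>s. r s \<odot>\<^bsub>M\<^esub> x) = \<kappa> (\<lambda>s. r s \<odot>\<^bsub>M\<^esub> (a \<odot>\<^bsub>M\<^esub> x))"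
proof -
  have *: "a \<odot>\<^bsub>N\<^esub> \<kappa> (\<lambda>s. r s \<odot>\<^bsub>M\<^esub> x) = \<kappa> (\<lambda>s. a \<odot>\<^bsub>M\<^esub> (r s \<odot>\<^bsub>M\<^esub> x))"
    using assms coef_carrier by (intro \<kappa>_smult[symmetric]) auto
  show "a \<odot>\<^bsub>N\<^esub> \<kappa> (\<lambda>s. r s \<odot>\<^bsub>M\<^esub> x) = \<kappa> (\<lambda>s. (a \<otimes> r s) \<odot>\<^bsub>M\<^esub> x)"
    unfolding * using assms coef_carrier by (intro \<kappa>_cong) (simp add: M.smult_assoc1)
  show "a \<odot>\<^bsub>N\<^esub> \<kappa> (\<lambda>s. r s \<odot>\<^bsub>M\<^esub> x) = \<kappa> (\<lambda>s. r s \<odot>\<^bsub>M\<^esub> (a \<odot>\<^bsub>M\<^esub> x))"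
    unfolding * using assms coef_carrier by (intro \<kappa>_cong) (simp add: M.smult_lcomm)
qed

lemma \<kappa>_zero: "\<kappa> (\<lambda>s. \<zero>\<^bsub>M\<^esub>) = \<zero>\<^bsub>N\<^esub>"
  using \<kappa>_smult[of \<zero> "\<lambda>s. \<zero>\<^bsub>M\<^esub>"] \<kappa>_closed[of "\<lambda>s. \<zero>\<^bsub>M\<^esub>"] by simp

text \<open>The difference y of the two coefficient tuples is a syzygy of the generators, so y = A w
  for some w, and the tuple y x = A (w x) is a relation in N. The entries of w may be inhomogeneous,
  as \<open>\<kappa>_rel\<close> accepts arbitrary tuples.\<close>

lemma \<kappa>_syz:
  assumes v: "coef e v" "coef e v'" "comb v = comb v'" and x: "x \<in> carrier M"
  shows "\<kappa> (\<lambda>s. v s \<odot>\<^bsub>M\<^esub> x) = \<kappa> (\<lambda>s. v' s \<odot>\<^bsub>M\<^esub> x)"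
proof -
  define y where "y s = v s \<oplus> \<ominus> v' s" for s
  have y: "coef e y" unfolding y_def by (intro coef_add coef_minus v)
  have yc: "\<And>s. s < p \<Longrightarrow> y s \<in> carrier R" using y coef_carrier by blast
  have "comb y \<oplus> comb v' = comb (\<lambda>s. y s \<oplus> v' s)" using comb_add[OF y v(2)] by simp
  also have "\<dots> = comb v"
    unfolding comb_def y_def
    using v coef_carrier m_carrier by (intro M.ring_finsum_cong) (auto simp: M.ring_a_assoc M.ring_l_neg)
  finally have "comb y = \<zero>"
    using comb_deg[OF y] comb_deg[OF v(1)] comb_deg[OF v(2)] M.rdeg_carrier v(3)
    by (metis M.ring_cancel)
  then obtain w where w: "\<forall>t<q. w t \<in> carrier R" "\<forall>s<p. y s = (\<Oplus>t\<in>{..<q}. A s t \<otimes> w t)"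
    using syz[of y e] y unfolding comb_def coef_def by blast
  have "\<kappa> (\<lambda>s. y s \<odot>\<^bsub>M\<^esub> x) = \<kappa> (\<lambda>s. \<Oplus>\<^bsub>M\<^esub>t\<in>{..<q}. A s t \<odot>\<^bsub>M\<^esub> (w t \<odot>\<^bsub>M\<^esub> x))"
  proof (rule \<kappa>_cong)
    fix s assume s: "s < p"
    have Aw: "A s t \<otimes> w t \<in> carrier R" if "t < q" for t using w A_carrier s that by simp
    have "(\<Oplus>t\<in>I. A s t \<otimes> w t) \<odot>\<^bsub>M\<^esub> x = (\<Oplus>\<^bsub>M\<^esub>t\<in>I. A s t \<odot>\<^bsub>M\<^esub> (w t \<odot>\<^bsub>M\<^esub> x))"
      if "finite I" "I \<subseteq> {..<q}" for I
      using that
    proof (induction I rule: finite_induct)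
      case (insert i I)
      then have "(\<lambda>t. A s t \<otimes> w t) \<in> I \<rightarrow> carrier R" "(\<lambda>t. A s t \<odot>\<^bsub>M\<^esub> (w t \<odot>\<^bsub>M\<^esub> x)) \<in> I \<rightarrow> carrier M"
        using Aw w A_carrier s x by auto
      then show ?case
        using insert Aw[of i] w A_carrier[OF s, of i] x by (simp add: M.smult_l_distr M.smult_assoc1)
    qed (simp add: x)
    then show "y s \<odot>\<^bsub>M\<^esub> x = (\<Oplus>\<^bsub>M\<^esub>t\<in>{..<q}. A s t \<odot>\<^bsub>M\<^esub> (w t \<odot>\<^bsub>M\<^esub> x))"
      using w(2) s by simp
  qed
  also have "\<dots> = \<zero>\<^bsub>N\<^esub>" using w x by (intro \<kappa>_rel) simp
  finally have y0: "\<kappa> (\<lambda>s. y s \<odot>\<^bsub>M\<^esub> x) = \<zero>\<^bsub>N\<^esub>" .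
  have "\<kappa> (\<lambda>s. v s \<odot>\<^bsub>M\<^esub> x) = \<kappa> (\<lambda>s. y s \<odot>\<^bsub>M\<^esub> x \<oplus>\<^bsub>M\<^esub> v' s \<odot>\<^bsub>M\<^esub> x)"
    unfolding y_def using v x coef_carrier
    by (intro \<kappa>_cong) (simp add: M.smult_l_distr[symmetric] M.ring_a_assoc M.ring_l_neg)
  also have "\<dots> = \<kappa> (\<lambda>s. y s \<odot>\<^bsub>M\<^esub> x) \<oplus>\<^bsub>N\<^esub> \<kappa> (\<lambda>s. v' s \<odot>\<^bsub>M\<^esub> x)"
    using yc v coef_carrier x by (intro \<kappa>_add) auto
  also have "\<dots> = \<kappa> (\<lambda>s. v' s \<odot>\<^bsub>M\<^esub> x)"
    unfolding y0 using \<kappa>_closed[of "\<lambda>s. v' s \<odot>\<^bsub>M\<^esub> x"] v coef_carrier x by simp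
  finally show ?thesis .
qed

subsection \<open>The local pairing\<close>

text \<open>\<open>(x/s) \<otimes> (\<Sigma> r\<^sub>i m\<^sub>i / t) \<mapsto> \<kappa>(r\<^sub>i x) / (st)\<close>, where the degree of \<open>t\<close> is a multiple of \<open>l\<close>.\<close>

definition pairing_rel where
  "pairing_rel P B C D \<longleftrightarrow> (\<exists>d e x s t r. x \<in> mdeg M d \<and> s \<in> rdeg R d - P \<and>
     t \<in> rdeg R (e * int l) - P \<and> coef e r \<and> B = frac R M P x s \<and> C = frac R L P (comb r) t \<and>
     D = frac R N P (\<kappa> (\<lambda>i. r i \<odot>\<^bsub>M\<^esub> x)) (t \<otimes> s))"

definition pairing where
  "pairing P B C = (THE D. pairing_rel P B C D)"

context
  fixes P assumes prime: "primeideal P R"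
begin

text \<open>Cross-multiplying by witnesses for the two equalities of fractions leaves two
  replacements inside \<kappa>: x by x', which is linearity of \<kappa>, and r by r', which is
  \<open>\<kappa>_syz\<close>.\<close>

lemma pairing_wd:
  assumes x: "x \<in> mdeg M d" "s \<in> rdeg R d - P" and x': "x' \<in> mdeg M d'" "s' \<in> rdeg R d' - P"
    and t: "t \<in> rdeg R (e * int l) - P" "coef e r" and t': "t' \<in> rdeg R (e' * int l) - P" "coef e' r'"
    and eq: "frac R M P x s = frac R M P x' s'" "frac R L P (comb r) t = frac R L P (comb r') t'"
  shows "frac R N P (\<kappa> (\<lambda>i. r i \<odot>\<^bsub>M\<^esub> x)) (t \<otimes> s) = frac R N P (\<kappa> (\<lambda>i. r' i \<odot>\<^bsub>M\<^esub> x')) (t' \<otimes> s')"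
proof -
  obtain u k where u: "u \<in> rdeg R k - P" and uq: "(u \<otimes> s') \<odot>\<^bsub>M\<^esub> x = (u \<otimes> s) \<odot>\<^bsub>M\<^esub> x'"
    by (rule M.frac_eqD[OF prime x x' eq(1)]) (rule that)
  obtain v k' where v: "v \<in> rdeg R k' - P" and vq: "(v \<otimes> t') \<odot>\<^bsub>L\<^esub> comb r = (v \<otimes> t) \<odot>\<^bsub>L\<^esub> comb r'"
    by (rule L.frac_eqD[OF prime comb_deg_L[OF t(2)] t(1) comb_deg_L[OF t'(2)] t'(1) eq(2)]) (rule that)
  \<comment> \<open>The witness v has an arbitrary degree k', but coefficient tuples stay
    coefficient tuples only under scalars of degree divisible by l. The l-th power of v has degree
    k' * l; the single factor v split off is the one to which \<open>vq\<close> applies.\<close>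
  define V where "V = v [^] (l - 1) \<otimes> v"
  have lk: "int (l - 1) * k' + k' = k' * int l"
    using l_pos by (simp add: of_nat_diff algebra_simps)
  have V: "V \<in> rdeg R (k' * int l) - P"
    unfolding V_def using M.den_mult[OF prime M.den_pow[OF prime v] v, of "l - 1"] unfolding lk .
  have c: "x \<in> carrier M" "x' \<in> carrier M" "s \<in> carrier R" "s' \<in> carrier R" "t \<in> carrier R"
    "t' \<in> carrier R" "u \<in> carrier R" "v \<in> carrier R" "V \<in> carrier R"
    "comb r \<in> carrier R" "comb r' \<in> carrier R"
    using x x' t t' u v V comb_deg M.mdeg_carrier M.rdeg_carrier by blast+
  have Vt: "coef (k' + e' + e) (\<lambda>i. (V \<otimes> t') \<otimes> r i)" "coef (k' + e' + e) (\<lambda>i. (V \<otimes> t) \<otimes> r' i)"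
    using coef_smult[of "V \<otimes> t'" "k' + e'" e r] coef_smult[of "V \<otimes> t" "k' + e" e' r'] t t' V
      M.rdeg_mult[of V "k' * int l" t' "e' * int l"] M.rdeg_mult[of V "k' * int l" t "e * int l"]
    by (simp_all add: algebra_simps)
  have "comb (\<lambda>i. (V \<otimes> t') \<otimes> r i) = v [^] (l - 1) \<otimes> ((v \<otimes> t') \<otimes> comb r)"
    using comb_smult[OF _ t(2), of "V \<otimes> t'"] c by (simp add: V_def M.m_assoc)
  also have "\<dots> = v [^] (l - 1) \<otimes> ((v \<otimes> t) \<otimes> comb r')" using vq by simp
  also have "\<dots> = comb (\<lambda>i. (V \<otimes> t) \<otimes> r' i)"
    using comb_smult[OF _ t'(2), of "V \<otimes> t"] c by (simp add: V_def M.m_assoc)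
  finally have syz: "\<kappa> (\<lambda>i. ((V \<otimes> t') \<otimes> r i) \<odot>\<^bsub>M\<^esub> x') = \<kappa> (\<lambda>i. ((V \<otimes> t) \<otimes> r' i) \<odot>\<^bsub>M\<^esub> x')"
    by (rule \<kappa>_syz[OF Vt _ c(2)])
  have closed: "\<kappa> (\<lambda>i. r i \<odot>\<^bsub>M\<^esub> x) \<in> carrier N" "\<kappa> (\<lambda>i. r' i \<odot>\<^bsub>M\<^esub> x') \<in> carrier N"
    "\<kappa> (\<lambda>i. r i \<odot>\<^bsub>M\<^esub> x') \<in> carrier N"
    using \<kappa>_comb_deg[OF t(2) x(1)] \<kappa>_comb_deg[OF t'(2) x'(1)] \<kappa>_comb_deg[OF t(2) x'(1)] N.mdeg_carrier
    by blast+
  show ?thesis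
  proof (rule N.frac_eqI[OF prime \<kappa>_comb_deg[OF t(2) x(1)] M.den_mult[OF prime t(1) x(2)]
        \<kappa>_comb_deg[OF t'(2) x'(1)] M.den_mult[OF prime t'(1) x'(2)] M.den_mult[OF prime u V]])
    have "((u \<otimes> V) \<otimes> (t' \<otimes> s')) \<odot>\<^bsub>N\<^esub> \<kappa> (\<lambda>i. r i \<odot>\<^bsub>M\<^esub> x) =
        (V \<otimes> t') \<odot>\<^bsub>N\<^esub> ((u \<otimes> s') \<odot>\<^bsub>N\<^esub> \<kappa> (\<lambda>i. r i \<odot>\<^bsub>M\<^esub> x))"
      using c closed by (simp add: N.smult_ac)
    also have "(u \<otimes> s') \<odot>\<^bsub>N\<^esub> \<kappa> (\<lambda>i. r i \<odot>\<^bsub>M\<^esub> x) = (u \<otimes> s) \<odot>\<^bsub>N\<^esub> \<kappa> (\<lambda>i. r i \<odot>\<^bsub>M\<^esub> x')"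
      using \<kappa>_comb_smult(2)[OF _ t(2), of "u \<otimes> s'" x] \<kappa>_comb_smult(2)[OF _ t(2), of "u \<otimes> s" x'] c uq
      by simp
    also have "(V \<otimes> t') \<odot>\<^bsub>N\<^esub> ((u \<otimes> s) \<odot>\<^bsub>N\<^esub> \<kappa> (\<lambda>i. r i \<odot>\<^bsub>M\<^esub> x')) =
        (u \<otimes> s) \<odot>\<^bsub>N\<^esub> ((V \<otimes> t') \<odot>\<^bsub>N\<^esub> \<kappa> (\<lambda>i. r i \<odot>\<^bsub>M\<^esub> x'))"
      using c closed by (intro N.smult_lcomm) auto
    also have "(V \<otimes> t') \<odot>\<^bsub>N\<^esub> \<kappa> (\<lambda>i. r i \<odot>\<^bsub>M\<^esub> x') = (V \<otimes> t) \<odot>\<^bsub>N\<^esub> \<kappa> (\<lambda>i. r' i \<odot>\<^bsub>M\<^esub> x')"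
      using \<kappa>_comb_smult(1)[OF _ t(2), of "V \<otimes> t'" x'] \<kappa>_comb_smult(1)[OF _ t'(2), of "V \<otimes> t" x'] c syz
      by simp
    also have "(u \<otimes> s) \<odot>\<^bsub>N\<^esub> ((V \<otimes> t) \<odot>\<^bsub>N\<^esub> \<kappa> (\<lambda>i. r' i \<odot>\<^bsub>M\<^esub> x')) =
        ((u \<otimes> V) \<otimes> (t \<otimes> s)) \<odot>\<^bsub>N\<^esub> \<kappa> (\<lambda>i. r' i \<odot>\<^bsub>M\<^esub> x')"
      using c closed by (simp add: N.smult_ac)
    finally show "((u \<otimes> V) \<otimes> (t' \<otimes> s')) \<odot>\<^bsub>N\<^esub> \<kappa> (\<lambda>i. r i \<odot>\<^bsub>M\<^esub> x) =
        ((u \<otimes> V) \<otimes> (t \<otimes> s)) \<odot>\<^bsub>N\<^esub> \<kappa> (\<lambda>i. r' i \<odot>\<^bsub>M\<^esub> x')" .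
  qed
qed

lemma pairing_eq:
  assumes x: "x \<in> mdeg M d" "s \<in> rdeg R d - P" and t: "t \<in> rdeg R (e * int l) - P" "coef e r"
  shows "pairing P (frac R M P x s) (frac R L P (comb r) t) =
    frac R N P (\<kappa> (\<lambda>i. r i \<odot>\<^bsub>M\<^esub> x)) (t \<otimes> s)"
  unfolding pairing_def
proof (rule the_equality)
  show "pairing_rel P (frac R M P x s) (frac R L P (comb r) t) (frac R N P (\<kappa> (\<lambda>i. r i \<odot>\<^bsub>M\<^esub> x)) (t \<otimes> s))"
    unfolding pairing_rel_def
    by (rule exI[of _ d], rule exI[of _ e], rule exI[of _ x], rule exI[of _ s], rule exI[of _ t],
        rule exI[of _ r]) (intro conjI refl assms)
next
  fix D assume "pairing_rel P (frac R M P x s) (frac R L P (comb r) t) D"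
  then obtain d' e' x' s' t' r' where x': "x' \<in> mdeg M d'" "s' \<in> rdeg R d' - P"
    and t': "t' \<in> rdeg R (e' * int l) - P" "coef e' r'"
    and eq: "frac R M P x s = frac R M P x' s'" "frac R L P (comb r) t = frac R L P (comb r') t'"
    and D: "D = frac R N P (\<kappa> (\<lambda>i. r' i \<odot>\<^bsub>M\<^esub> x')) (t' \<otimes> s')"
    unfolding pairing_rel_def by (elim exE conjE)
  show "D = frac R N P (\<kappa> (\<lambda>i. r i \<odot>\<^bsub>M\<^esub> x)) (t \<otimes> s)"
    unfolding D by (rule pairing_wd[OF x x' t t' eq, symmetric])
qed

text \<open>Besides the equality of fractions at P, the identity
  \<open>comb r = t [^] (l - 1) \<otimes> g\<close> is recorded in R itself. It does not mention P,
  so the same r serves at all points where t does not vanish.\<close>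

lemma L_repr:
  assumes "g \<in> mdeg L d" "t \<in> rdeg R d - P"
  obtains r where "coef d r" "comb r = t [^] (l - 1) \<otimes> g"
    "t [^] (l - 1) \<otimes> t \<in> rdeg R (d * int l) - P"
    "frac R L P g t = frac R L P (comb r) (t [^] (l - 1) \<otimes> t)"
proof -
  have lk: "int (l - 1) * d + d = d * int l" "int (l - 1) * d + (j + d) = j + d * int l"
    using l_pos by (simp_all add: of_nat_diff algebra_simps)
  have "t [^] (l - 1) \<otimes> g \<in> rdeg R (j + d * int l)"
    unfolding lk(2)[symmetric] using M.rdeg_mult[OF M.rdeg_pow] assms by simp
  then obtain r where r: "coef d r" "t [^] (l - 1) \<otimes> g = comb r"
    using gen unfolding coef_def comb_def by blast
  have "frac R L P g t = frac R L P (comb r) (t [^] (l - 1) \<otimes> t)"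
    using L.frac_cancel[OF prime assms M.den_pow[OF prime assms(2)], of "l - 1"] r(2) by simp
  with r M.den_mult[OF prime M.den_pow[OF prime assms(2)] assms(2), of "l - 1", unfolded lk(1)] that
  show thesis by simp
qed

lemma L_cases:
  assumes "C \<in> local_carrier R L P"
  obtains e t r where "t \<in> rdeg R (e * int l) - P" "coef e r" "C = frac R L P (comb r) t"
proof -
  obtain d g t where g: "g \<in> mdeg L d" "t \<in> rdeg R d - P" "C = frac R L P g t"
    by (rule L.local_carrierE[OF prime assms]) (rule that)
  obtain r where "coef d r" "t [^] (l - 1) \<otimes> t \<in> rdeg R (d * int l) - P"
    "frac R L P g t = frac R L P (comb r) (t [^] (l - 1) \<otimes> t)"
    by (rule L_repr[OF g(1,2)]) (rule that)
  then show thesis using that g(3) by simp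
qed

lemma pairing_closed:
  assumes "B \<in> local_carrier R M P" "C \<in> local_carrier R L P"
  shows "pairing P B C \<in> local_carrier R N P"
proof -
  obtain d x s where x: "x \<in> mdeg M d" "s \<in> rdeg R d - P" "B = frac R M P x s"
    by (rule M.local_carrierE[OF prime assms(1)]) (rule that)
  obtain e t r where t: "t \<in> rdeg R (e * int l) - P" "coef e r" "C = frac R L P (comb r) t"
    by (rule L_cases[OF assms(2)]) (rule that)
  show ?thesis
    unfolding x(3) t(3) pairing_eq[OF x(1,2) t(1,2)]
    by (rule N.local_carrierI[OF prime \<kappa>_comb_deg[OF t(2) x(1)] M.den_mult[OF prime t(1) x(2)]])
qed

lemma pairing_add_left:
  assumes "B \<in> local_carrier R M P" "B' \<in> local_carrier R M P" "C \<in> local_carrier R L P"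
  shows "pairing P (local_add R M P B B') C = local_add R N P (pairing P B C) (pairing P B' C)"
proof -
  obtain d x y s where x: "x \<in> mdeg M d" "y \<in> mdeg M d" "s \<in> rdeg R d - P" "B = frac R M P x s"
    "B' = frac R M P y s"
    by (rule M.local_common2[OF prime assms(1,2)]) (rule that)
  obtain e t r where t: "t \<in> rdeg R (e * int l) - P" "coef e r" "C = frac R L P (comb r) t"
    by (rule L_cases[OF assms(3)]) (rule that)
  have c: "x \<in> carrier M" "y \<in> carrier M" using x M.mdeg_carrier by blast+
  have "\<kappa> (\<lambda>i. r i \<odot>\<^bsub>M\<^esub> (x \<oplus>\<^bsub>M\<^esub> y)) = \<kappa> (\<lambda>i. r i \<odot>\<^bsub>M\<^esub> x \<oplus>\<^bsub>M\<^esub> r i \<odot>\<^bsub>M\<^esub> y)"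
    using c t(2) coef_carrier by (intro \<kappa>_cong) (simp add: M.smult_r_distr)
  also have "\<dots> = \<kappa> (\<lambda>i. r i \<odot>\<^bsub>M\<^esub> x) \<oplus>\<^bsub>N\<^esub> \<kappa> (\<lambda>i. r i \<odot>\<^bsub>M\<^esub> y)"
    using c t(2) coef_carrier by (intro \<kappa>_add) auto
  finally have \<kappa>: "\<kappa> (\<lambda>i. r i \<odot>\<^bsub>M\<^esub> (x \<oplus>\<^bsub>M\<^esub> y)) = \<kappa> (\<lambda>i. r i \<odot>\<^bsub>M\<^esub> x) \<oplus>\<^bsub>N\<^esub> \<kappa> (\<lambda>i. r i \<odot>\<^bsub>M\<^esub> y)" .
  show ?thesis
    unfolding x(4,5) t(3) M.local_add_common[OF prime x(1-3)]
      pairing_eq[OF M.mdeg_add[OF x(1,2)] x(3) t(1,2)] pairing_eq[OF x(1,3) t(1,2)]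
      pairing_eq[OF x(2,3) t(1,2)]
      N.local_add_common[OF prime \<kappa>_comb_deg[OF t(2) x(1)] \<kappa>_comb_deg[OF t(2) x(2)]
        M.den_mult[OF prime t(1) x(3)]] \<kappa> ..
qed

lemma pairing_add_right:
  assumes "B \<in> local_carrier R M P" "C \<in> local_carrier R L P" "C' \<in> local_carrier R L P"
  shows "pairing P B (local_add R L P C C') = local_add R N P (pairing P B C) (pairing P B C')"
proof -
  obtain d x s where x: "x \<in> mdeg M d" "s \<in> rdeg R d - P" "B = frac R M P x s"
    by (rule M.local_carrierE[OF prime assms(1)]) (rule that)
  obtain d' g g' t where g: "g \<in> mdeg L d'" "g' \<in> mdeg L d'" "t \<in> rdeg R d' - P" "C = frac R L P g t"
    "C' = frac R L P g' t"
    by (rule L.local_common2[OF prime assms(2,3)]) (rule that)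
  \<comment> \<open>Expanding both fractions by the same power of t keeps their denominators equal,
    so the two coefficient tuples have the same degree and can be added.\<close>
  define T where "T = t [^] (l - 1) \<otimes> t"
  obtain r where r: "coef d' r" "T \<in> rdeg R (d' * int l) - P" "frac R L P g t = frac R L P (comb r) T"
    by (rule L_repr[OF g(1,3), folded T_def]) (rule that)
  obtain r' where r': "coef d' r'" "frac R L P g' t = frac R L P (comb r') T"
    by (rule L_repr[OF g(2,3), folded T_def]) (rule that)
  have c: "x \<in> carrier M" using x M.mdeg_carrier by blast
  have "\<kappa> (\<lambda>i. (r i \<oplus> r' i) \<odot>\<^bsub>M\<^esub> x) = \<kappa> (\<lambda>i. r i \<odot>\<^bsub>M\<^esub> x \<oplus>\<^bsub>M\<^esub> r' i \<odot>\<^bsub>M\<^esub> x)"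
    using c r r' coef_carrier by (intro \<kappa>_cong) (simp add: M.smult_l_distr)
  also have "\<dots> = \<kappa> (\<lambda>i. r i \<odot>\<^bsub>M\<^esub> x) \<oplus>\<^bsub>N\<^esub> \<kappa> (\<lambda>i. r' i \<odot>\<^bsub>M\<^esub> x)"
    using c r r' coef_carrier by (intro \<kappa>_add) auto
  finally have \<kappa>: "\<kappa> (\<lambda>i. (r i \<oplus> r' i) \<odot>\<^bsub>M\<^esub> x) = \<kappa> (\<lambda>i. r i \<odot>\<^bsub>M\<^esub> x) \<oplus>\<^bsub>N\<^esub> \<kappa> (\<lambda>i. r' i \<odot>\<^bsub>M\<^esub> x)" .
  have CC: "local_add R L P (frac R L P (comb r) T) (frac R L P (comb r') T) =
      frac R L P (comb (\<lambda>i. r i \<oplus> r' i)) T"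
    using L.local_add_common[OF prime comb_deg_L[OF r(1)] comb_deg_L[OF r'(1)] r(2)]
    by (simp add: comb_add[OF r(1) r'(1)])
  show ?thesis
    unfolding x(3) g(4,5) r(3) r'(2) CC pairing_eq[OF x(1,2) r(2) coef_add[OF r(1) r'(1)]]
      pairing_eq[OF x(1,2) r(2,1)] pairing_eq[OF x(1,2) r(2) r'(1)]
      N.local_add_common[OF prime \<kappa>_comb_deg[OF r(1) x(1)] \<kappa>_comb_deg[OF r'(1) x(1)]
        M.den_mult[OF prime r(2) x(2)]] \<kappa> ..
qed

text \<open>The scalar fraction is also expanded by a power of its denominator, so that numerator a
  and denominator w have degree d0 * l. Only then is a r again a coefficient tuple and w t a
  denominator of the required kind.\<close>

lemma pairing_smult:
  assumes "B \<in> local_carrier R (self_module R) P" "C \<in> local_carrier R M P" "D \<in> local_carrier R L P"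
  shows "pairing P (local_smult R M P B C) D = local_smult R N P B (pairing P C D)"
    and "pairing P C (local_smult R L P B D) = local_smult R N P B (pairing P C D)"
proof -
  interpret self: graded_ring_module R "self_module R" by (rule M.graded_self_module)
  obtain d0 a0 w0 where a0: "a0 \<in> rdeg R d0" "w0 \<in> rdeg R d0 - P"
    and B0: "B = frac R (self_module R) P a0 w0"
    by (rule M.self_carrierE[OF prime assms(1)]) (rule that)
  have lk: "int (l - 1) * d0 + d0 = d0 * int l"
    using l_pos by (simp add: of_nat_diff algebra_simps)
  define a where "a = w0 [^] (l - 1) \<otimes> a0"
  define w where "w = w0 [^] (l - 1) \<otimes> w0"
  have a: "a \<in> rdeg R (d0 * int l)"
    unfolding a_def lk[symmetric] using a0 by (intro M.rdeg_mult M.rdeg_pow) auto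
  have w: "w \<in> rdeg R (d0 * int l) - P"
    unfolding w_def lk[symmetric] by (intro M.den_mult[OF prime] M.den_pow[OF prime] a0)
  have B: "B = frac R (self_module R) P a w"
    using self.frac_cancel[OF prime _ a0(2) M.den_pow[OF prime a0(2)], of a0 "l - 1"] a0 B0
    unfolding a_def w_def by simp
  obtain d x s where x: "x \<in> mdeg M d" "s \<in> rdeg R d - P" "C = frac R M P x s"
    by (rule M.local_carrierE[OF prime assms(2)]) (rule that)
  obtain e t r where t: "t \<in> rdeg R (e * int l) - P" "coef e r" "D = frac R L P (comb r) t"
    by (rule L_cases[OF assms(3)]) (rule that)
  have c: "a \<in> carrier R" "w \<in> carrier R" "s \<in> carrier R" "t \<in> carrier R" "x \<in> carrier M"
    using x a w t M.mdeg_carrier M.rdeg_carrier by blast+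
  have rhs: "local_smult R N P B (pairing P C D) = frac R N P (a \<odot>\<^bsub>N\<^esub> \<kappa> (\<lambda>i. r i \<odot>\<^bsub>M\<^esub> x)) (w \<otimes> (t \<otimes> s))"
    unfolding B x(3) t(3) pairing_eq[OF x(1,2) t(1,2)]
    by (rule N.local_smult_frac[OF prime a w \<kappa>_comb_deg[OF t(2) x(1)] M.den_mult[OF prime t(1) x(2)]])
  have den: "t \<otimes> (w \<otimes> s) = w \<otimes> (t \<otimes> s)" "(w \<otimes> t) \<otimes> s = w \<otimes> (t \<otimes> s)"
    using c by (simp_all add: M.m_lcomm M.m_assoc)
  show "pairing P (local_smult R M P B C) D = local_smult R N P B (pairing P C D)"
    unfolding rhs unfolding B x(3) t(3) M.local_smult_frac[OF prime a w x(1,2)]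
      pairing_eq[OF M.mdeg_smult[OF a x(1)] M.den_mult[OF prime w x(2)] t(1,2)]
      \<kappa>_comb_smult(2)[OF c(1) t(2) c(5)] den ..
  have wt: "w \<otimes> t \<in> rdeg R ((d0 + e) * int l) - P"
    using M.den_mult[OF prime w t(1)] by (simp add: algebra_simps)
  have "local_smult R L P (frac R (self_module R) P a w) (frac R L P (comb r) t) =
      frac R L P (comb (\<lambda>i. a \<otimes> r i)) (w \<otimes> t)"
    using L.local_smult_frac[OF prime a w comb_deg_L[OF t(2)] t(1)] comb_smult[OF c(1) t(2)] by simp
  then show "pairing P C (local_smult R L P B D) = local_smult R N P B (pairing P C D)"
    unfolding rhs unfolding B x(3) t(3)
    using pairing_eq[OF x(1,2) wt coef_smult[OF a t(2)]] \<kappa>_comb_smult(1)[OF c(1) t(2) c(5)] den(2) by simp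
qed

end

text \<open>Near P both sections are single fractions, and one tuple r represents the second of them
  on the whole neighbourhood. The pairing is then a single fraction there as well.\<close>

lemma pairing_regular:
  assumes U: "openin (zariski R) U" and \<sigma>: "\<sigma> \<in> regular_sections R M U" and \<tau>: "\<tau> \<in> regular_sections R L U"
  shows "(\<lambda>P\<in>U. pairing P (\<sigma> P) (\<tau> P)) \<in> regular_sections R N U"
proof (rule regular_sections_glue)
  fix P assume P: "P \<in> U"
  obtain V d x s where V: "openin (zariski R) V" "P \<in> V" "V \<subseteq> U" "x \<in> mdeg M d" "s \<in> M.dens V d"
    "\<And>Q. Q \<in> V \<Longrightarrow> \<sigma> Q = frac R M Q x s"
    by (rule M.frac_sectionE[OF \<sigma> P]) (rule that)
  obtain V' d' g t where V': "openin (zariski R) V'" "P \<in> V'" "V' \<subseteq> U" "g \<in> mdeg L d'" "t \<in> M.dens V' d'"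
    "\<And>Q. Q \<in> V' \<Longrightarrow> \<tau> Q = frac R L Q g t"
    by (rule L.frac_sectionE[OF \<tau> P]) (rule that)
  obtain r where r: "coef d' r" "comb r = t [^] (l - 1) \<otimes> g"
    by (rule L_repr[OF openin_prime[OF V'(1,2)] V'(4) M.dens_at[OF V'(5,2)]]) (rule that)
  let ?W = "V \<inter> V'" and ?T = "t [^] (l - 1) \<otimes> t"
  have W: "openin (zariski R) ?W" using V V' by blast
  have lk: "int (l - 1) * d' + d' = d' * int l"
    using l_pos by (simp add: of_nat_diff algebra_simps)
  have t: "t \<in> M.dens ?W d'" and s: "s \<in> M.dens ?W d" using M.dens_mono V V' by blast+
  have T: "?T \<in> M.dens ?W (d' * int l)"
    unfolding lk[symmetric] by (intro M.dens_mult M.dens_pow W t)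
  have "pairing Q (\<sigma> Q) (\<tau> Q) = frac R N Q (\<kappa> (\<lambda>i. r i \<odot>\<^bsub>M\<^esub> x)) (?T \<otimes> s)" if Q: "Q \<in> ?W" for Q
  proof -
    have prime: "primeideal Q R" using openin_prime[OF W Q] .
    have "\<tau> Q = frac R L Q (comb r) ?T"
      using L.frac_cancel[OF prime V'(4) M.dens_at[OF t Q] M.den_pow[OF prime M.dens_at[OF t Q]], of "l - 1"]
        V'(6) Q r(2) by simp
    then show ?thesis
      using pairing_eq[OF prime V(4) M.dens_at[OF s Q] M.dens_at[OF T Q] r(1)] V(6) Q by simp
  qed
  then have "\<forall>Q\<in>?W. (\<lambda>P\<in>U. pairing P (\<sigma> P) (\<tau> P)) Q = N.frac_section ?W (\<kappa> (\<lambda>i. r i \<odot>\<^bsub>M\<^esub> x)) (?T \<otimes> s) Q"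
    using V(3) by (auto simp: N.frac_section_def)
  then show "\<exists>V \<rho>. openin (zariski R) V \<and> P \<in> V \<and> V \<subseteq> U \<and> \<rho> \<in> regular_sections R N V \<and>
      (\<forall>Q\<in>V. (\<lambda>P\<in>U. pairing P (\<sigma> P) (\<tau> P)) Q = \<rho> Q)"
    using W V(2,3) V'(2) N.frac_section_regular[OF W \<kappa>_comb_deg[OF r(1) V(4)] M.dens_mult[OF W T s]]
    by (intro exI[of _ ?W] exI[of _ "N.frac_section ?W (\<kappa> (\<lambda>i. r i \<odot>\<^bsub>M\<^esub> x)) (?T \<otimes> s)"] conjI) auto
qed simp

sublocale tilde_pairing R M L N pairing
  by (intro tilde_pairing.intro tilde_product.intro M.graded_ring_module_axioms L.graded_ring_module_axioms
      N.graded_ring_module_axioms tilde_pairing_axioms.intro)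
    (rule pairing_closed[OF Proj_set_prime] pairing_add_left[OF Proj_set_prime]
      pairing_add_right[OF Proj_set_prime] pairing_smult[OF Proj_set_prime] pairing_regular; assumption)+

end

context twisted_presentation
begin

end

section \<open>Normal forms for local sections of the presheaf tensor product\<close>

context twisted_presentation
begin

lemma finsum_L:
  assumes "finite I" "\<And>i. i \<in> I \<Longrightarrow> f i \<in> carrier R"
  shows "finsum L f I = (\<Oplus>i\<in>I. f i)"
  using assms
proof (induction I rule: finite_induct)
  case (insert i I)
  then have "f \<in> I \<rightarrow> carrier L" "f i \<in> carrier L" "f \<in> I \<rightarrow> carrier R" "f i \<in> carrier R" by auto
  then show ?case using insert by simp
qed simp

text \<open>The N of the overview. It dominates all absolute values of b s and c t, so bd + b s, bd
  - b s, bd + c t and bd - c t are nonnegative and can serve as exponents of u. A sum, unlike a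
  maximum, needs no special case for p = 0 or q = 0.\<close>

definition bd :: int where
  "bd = (\<Sum>s<p. \<bar>b s\<bar>) + (\<Sum>t<q. \<bar>c t\<bar>)"

lemma bd_ge: "0 \<le> bd" "s < p \<Longrightarrow> \<bar>b s\<bar> \<le> bd" "t < q \<Longrightarrow> \<bar>c t\<bar> \<le> bd"
proof -
  have nonneg: "0 \<le> (\<Sum>s<p. \<bar>b s\<bar>)" "0 \<le> (\<Sum>t<q. \<bar>c t\<bar>)" by (simp_all add: sum_nonneg)
  then show "0 \<le> bd" by (simp add: bd_def)
  show "\<bar>b s\<bar> \<le> bd" if "s < p"
  proof -
    have "\<bar>b s\<bar> \<le> (\<Sum>s<p. \<bar>b s\<bar>)" using member_le_sum[of s "{..<p}" "\<lambda>s. \<bar>b s\<bar>"] that by simp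
    then show ?thesis using nonneg(2) unfolding bd_def by linarith
  qed
  show "\<bar>c t\<bar> \<le> bd" if "t < q"
  proof -
    have "\<bar>c t\<bar> \<le> (\<Sum>t<q. \<bar>c t\<bar>)" using member_le_sum[of t "{..<q}" "\<lambda>t. \<bar>c t\<bar>"] that by simp
    then show ?thesis using nonneg(1) unfolding bd_def by linarith
  qed
qed

lemma b_range: "s < p \<Longrightarrow> 0 \<le> bd + b s" "s < p \<Longrightarrow> 0 \<le> bd - b s"
  using bd_ge(2)[of s] by auto

lemma c_range: "t < q \<Longrightarrow> 0 \<le> bd + c t" "t < q \<Longrightarrow> 0 \<le> bd - c t"
  using bd_ge(3)[of t] by auto

context
  fixes u assumes u: "u \<in> rdeg R (int l)"
begin

text \<open>Exponents are integers because the twists are. As \<open>nat\<close> sends negative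
  integers to 0, the laws for degrees and products carry nonnegativity conditions, which are met
  through \<open>bd\<close>.\<close>

definition up :: "int \<Rightarrow> 'a" where
  "up i = u [^] nat i"

definition Du :: "'a set set" where
  "Du = {Q \<in> Proj_set R. u \<notin> Q}"

lemma u_carrier: "u \<in> carrier R"
  using M.rdeg_carrier[OF u] .

lemma up_carrier: "up i \<in> carrier R"
  unfolding up_def using u_carrier by simp

lemma up_deg: "0 \<le> i \<Longrightarrow> up i \<in> rdeg R (i * int l)"
  unfolding up_def using M.rdeg_pow[OF u, of "nat i"] by simp

lemma up_mult: "\<lbrakk>0 \<le> i; 0 \<le> k\<rbrakk> \<Longrightarrow> up i \<otimes> up k = up (i + k)"
  unfolding up_def by (simp only: nat_add_distrib M.nat_pow_mult[OF u_carrier])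

lemma open_Du: "openin (zariski R) Du"
  unfolding Du_def using openin_basic[of u R] M.homogeneousI[OF u] by simp

lemma up_dens: "\<lbrakk>openin (zariski R) W; W \<subseteq> Du; 0 \<le> i\<rbrakk> \<Longrightarrow> up i \<in> M.dens W (i * int l)"
  using M.dens_pow[of W u "int l" "nat i"] u unfolding up_def by (auto simp: M.dens_def Du_def)

text \<open>The generator \<open>m s\<close> turned into a section of O(j) where u does not vanish:
  its degree in \<open>L\<close> is - b s * l, and the factor u^(bd + b s) raises this to bd * l,
  the degree of the denominator u^bd.\<close>

definition gsec :: "'a set set \<Rightarrow> nat \<Rightarrow> 'a set \<Rightarrow> ('a \<times> 'a) set" where
  "gsec W s = L.frac_section W (up (bd + b s) \<otimes> m s) (up bd)"

text \<open>All coefficients z s share one degree and one denominator w. Such sums are closed under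
  differences, and their value is a single fraction of N.\<close>

definition nf_sum where
  "nf_sum W z w = (\<Oplus>\<^bsub>T W\<^esub>s\<in>{..<p}. pt W (M.frac_section W (z s) w) (gsec W s))"

lemma gen_deg: "s < p \<Longrightarrow> up (bd + b s) \<otimes> m s \<in> mdeg L (bd * int l)"
  using M.rdeg_mult[OF up_deg[OF b_range(1)] m_deg, of s s] by (simp add: algebra_simps)

lemma restrict_gsec: "V \<subseteq> W \<Longrightarrow> restrict (gsec W s) V = gsec V s"
  unfolding gsec_def by (rule L.frac_section_restrict)

context
  fixes W assumes W: "openin (zariski R) W" and WD: "W \<subseteq> Du"
begin

interpretation TW: abelian_group "T W"
  using abelian_group_hom.axioms(1)[OF rs_hom[OF W W order_refl]] .

lemma gsec_regular: "s < p \<Longrightarrow> gsec W s \<in> regular_sections R L W"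
  unfolding gsec_def using L.frac_section_regular[OF W gen_deg up_dens[OF W WD bd_ge(1)]] .

lemma nf_term_closed: "\<lbrakk>s < p; z s \<in> mdeg M d; w \<in> M.dens W d\<rbrakk> \<Longrightarrow>
    pt W (M.frac_section W (z s) w) (gsec W s) \<in> carrier (T W)"
  by (intro pt_closed[OF W] M.frac_section_regular[OF W] gsec_regular)

lemma nf_closed: "\<lbrakk>\<forall>s<p. z s \<in> mdeg M d; w \<in> M.dens W d\<rbrakk> \<Longrightarrow> nf_sum W z w \<in> carrier (T W)"
  unfolding nf_sum_def using nf_term_closed by (intro TW.finsum_closed) auto

text \<open>On W the section r s m s / t is the multiple of \<open>gsec W s\<close> by u^(bd - b s)
  r s / (t u^bd). Numerator and denominator of this factor have degree (e + bd) * l, so it is a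
  function and crosses the tensor sign to act on x / s0.\<close>

lemma pure_nf:
  assumes x: "x \<in> mdeg M d" "s0 \<in> M.dens W d" and t: "t \<in> M.dens W (e * int l)" "coef e r"
  shows "pt W (M.frac_section W x s0) (L.frac_section W (comb r) t) =
    nf_sum W (\<lambda>s. (up (bd - b s) \<otimes> r s) \<odot>\<^bsub>M\<^esub> x) ((t \<otimes> up bd) \<otimes> s0)"
proof -
  have rm: "r s \<otimes> m s \<in> mdeg L (e * int l)" if "s < p" for s
    using M.rdeg_mult[of "r s" "(e + b s) * int l" "m s" "j - b s * int l"] m_deg[OF that] t(2) that
    by (simp add: coef_def algebra_simps)
  have term_eq: "pt W (M.frac_section W x s0) (L.frac_section W (r s \<otimes> m s) t) =
      pt W (M.frac_section W ((up (bd - b s) \<otimes> r s) \<odot>\<^bsub>M\<^esub> x) ((t \<otimes> up bd) \<otimes> s0)) (gsec W s)"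
    if s: "s < p" for s
  proof -
    have c: "r s \<in> carrier R" "m s \<in> carrier R" "t \<in> carrier R"
      using coef_carrier[OF t(2) s] m_carrier[OF s] M.rdeg_carrier[OF M.dens_rdeg[OF t(1)]] .
    have deg: "up (bd - b s) \<otimes> r s \<in> rdeg R ((e + bd) * int l)"
      using M.rdeg_mult[OF up_deg[OF b_range(2)[OF s]], of "r s" "(e + b s) * int l"] t(2) s
      by (simp add: coef_def algebra_simps)
    have den: "t \<otimes> up bd \<in> M.dens W ((e + bd) * int l)"
      using M.dens_mult[OF W t(1) up_dens[OF W WD bd_ge(1)]] by (simp add: algebra_simps)
    have "pt W (M.frac_section W ((up (bd - b s) \<otimes> r s) \<odot>\<^bsub>M\<^esub> x) ((t \<otimes> up bd) \<otimes> s0)) (gsec W s) =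
      pt W (M.frac_section W x s0)
        (L.frac_section W ((up (bd - b s) \<otimes> r s) \<odot>\<^bsub>L\<^esub> (up (bd + b s) \<otimes> m s)) ((t \<otimes> up bd) \<otimes> up bd))"
      unfolding gsec_def
      by (rule pt_balanced[OF W deg den x gen_deg[OF s] up_dens[OF W WD bd_ge(1)]])
    also have "(up (bd - b s) \<otimes> r s) \<odot>\<^bsub>L\<^esub> (up (bd + b s) \<otimes> m s) =
        (up (bd - b s) \<otimes> up (bd + b s)) \<otimes> (r s \<otimes> m s)"
      using c up_carrier by (simp add: M.m_ac)
    also have "up (bd - b s) \<otimes> up (bd + b s) = up bd \<otimes> up bd"
      using up_mult b_range[OF s] bd_ge(1) by simp
    also have "(t \<otimes> up bd) \<otimes> up bd = (up bd \<otimes> up bd) \<otimes> t"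
      using c up_carrier by (simp add: M.m_ac)
    also have "L.frac_section W ((up bd \<otimes> up bd) \<otimes> (r s \<otimes> m s)) ((up bd \<otimes> up bd) \<otimes> t) =
        L.frac_section W (r s \<otimes> m s) t"
      using L.frac_section_cancel[OF W rm[OF s] t(1)
        M.dens_mult[OF W up_dens[OF W WD bd_ge(1)] up_dens[OF W WD bd_ge(1)]]] by simp
    finally show ?thesis ..
  qed
  have "comb r = finsum L (\<lambda>s. r s \<otimes> m s) {..<p}"
    unfolding comb_def using coef_carrier[OF t(2)] m_carrier by (intro finsum_L[symmetric]) auto
  then have "pt W (M.frac_section W x s0) (L.frac_section W (comb r) t) =
      (\<Oplus>\<^bsub>T W\<^esub>s\<in>{..<p}. pt W (M.frac_section W x s0) (L.frac_section W (r s \<otimes> m s) t))"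
    using pt_finsum_right[OF W _ _ t(1) M.frac_section_regular[OF W x], of "{..<p}" "\<lambda>s. r s \<otimes> m s"] rm
    by simp
  also have "\<dots> = nf_sum W (\<lambda>s. (up (bd - b s) \<otimes> r s) \<odot>\<^bsub>M\<^esub> x) ((t \<otimes> up bd) \<otimes> s0)"
    unfolding nf_sum_def
    using term_eq pt_closed[OF W M.frac_section_regular[OF W x] L.frac_section_regular[OF W rm t(1)]]
    by (intro TW.finsum_cong') (auto simp: Pi_iff)
  finally show ?thesis .
qed

text \<open>Numerators subtract over the common denominator w w'. The proof writes each term of the
  first sum as a term of the difference plus a term of the second sum, which needs only additivity
  in the left factor.\<close>

lemma nf_diff:
  assumes z: "\<forall>s<p. z s \<in> mdeg M d" "w \<in> M.dens W d" and z': "\<forall>s<p. z' s \<in> mdeg M d'" "w' \<in> M.dens W d'"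
  shows "nf_sum W z w \<ominus>\<^bsub>T W\<^esub> nf_sum W z' w' =
    nf_sum W (\<lambda>s. w' \<odot>\<^bsub>M\<^esub> z s \<oplus>\<^bsub>M\<^esub> \<ominus>\<^bsub>M\<^esub> (w \<odot>\<^bsub>M\<^esub> z' s)) (w \<otimes> w')"
proof -
  let ?y = "\<lambda>s. w' \<odot>\<^bsub>M\<^esub> z s \<oplus>\<^bsub>M\<^esub> \<ominus>\<^bsub>M\<^esub> (w \<odot>\<^bsub>M\<^esub> z' s)"
  have w: "w \<in> rdeg R d" "w' \<in> rdeg R d'" using z z' M.dens_rdeg by blast+
  have ww: "w \<otimes> w' \<in> M.dens W (d + d')" "w' \<otimes> w = w \<otimes> w'"
    using M.dens_mult[OF W z(2) z'(2)] w M.rdeg_carrier M.m_comm by blast+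
  have deg: "w' \<odot>\<^bsub>M\<^esub> z s \<in> mdeg M (d + d')" "w \<odot>\<^bsub>M\<^esub> z' s \<in> mdeg M (d + d')" "?y s \<in> mdeg M (d + d')"
    if "s < p" for s
  proof -
    show 1: "w' \<odot>\<^bsub>M\<^esub> z s \<in> mdeg M (d + d')" using M.mdeg_smult[OF w(2), of "z s" d] z that by (simp add: add.commute)
    show 2: "w \<odot>\<^bsub>M\<^esub> z' s \<in> mdeg M (d + d')" using M.mdeg_smult[OF w(1)] z' that by simp
    show "?y s \<in> mdeg M (d + d')" by (rule M.mdeg_add[OF 1 M.mdeg_minus[OF 2]])
  qed
  have term_eq: "pt W (M.frac_section W (z s) w) (gsec W s) =
      pt W (M.frac_section W (?y s) (w \<otimes> w')) (gsec W s) \<oplus>\<^bsub>T W\<^esub> pt W (M.frac_section W (z' s) w') (gsec W s)"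
    if s: "s < p" for s
  proof -
    have "?y s \<oplus>\<^bsub>M\<^esub> w \<odot>\<^bsub>M\<^esub> z' s = w' \<odot>\<^bsub>M\<^esub> z s"
      using deg[OF s, THEN M.mdeg_carrier] by (simp add: M.M.a_assoc M.M.l_neg)
    then have "pt W (M.frac_section W (w' \<odot>\<^bsub>M\<^esub> z s) (w \<otimes> w')) (gsec W s) =
        pt W (M.frac_section W (?y s) (w \<otimes> w')) (gsec W s) \<oplus>\<^bsub>T W\<^esub>
        pt W (M.frac_section W (w \<odot>\<^bsub>M\<^esub> z' s) (w \<otimes> w')) (gsec W s)"
      using pt_add_left[OF W deg(3)[OF s] deg(2)[OF s] ww(1) gsec_regular[OF s]] by simp
    moreover have "M.frac_section W (w' \<odot>\<^bsub>M\<^esub> z s) (w \<otimes> w') = M.frac_section W (z s) w"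
      using M.frac_section_cancel[OF W _ z(2) z'(2), of "z s"] z s ww(2) by simp
    moreover have "M.frac_section W (w \<odot>\<^bsub>M\<^esub> z' s) (w \<otimes> w') = M.frac_section W (z' s) w'"
      using M.frac_section_cancel[OF W _ z'(2) z(2), of "z' s"] z' s by simp
    ultimately show ?thesis by simp
  qed
  have y: "nf_sum W ?y (w \<otimes> w') \<in> carrier (T W)" using deg(3) ww(1) by (intro nf_closed) auto
  have zc: "nf_sum W z' w' \<in> carrier (T W)" using nf_closed[OF z'] .
  have cl: "pt W (M.frac_section W (?y s) (w \<otimes> w')) (gsec W s) \<in> carrier (T W)"
    "pt W (M.frac_section W (z' s) w') (gsec W s) \<in> carrier (T W)" if "s < p" for s
    using nf_term_closed[where z = ?y, OF that deg(3)[OF that] ww(1)]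
      nf_term_closed[where z = z', OF that _ z'(2)] z'(1) that by simp_all
  have "nf_sum W z w = (\<Oplus>\<^bsub>T W\<^esub>s\<in>{..<p}. pt W (M.frac_section W (?y s) (w \<otimes> w')) (gsec W s) \<oplus>\<^bsub>T W\<^esub>
      pt W (M.frac_section W (z' s) w') (gsec W s))"
    unfolding nf_sum_def using cl term_eq by (intro TW.finsum_cong') auto
  also have "\<dots> = nf_sum W ?y (w \<otimes> w') \<oplus>\<^bsub>T W\<^esub> nf_sum W z' w'"
    unfolding nf_sum_def using cl by (intro TW.finsum_addf) auto
  finally have "nf_sum W z w = nf_sum W ?y (w \<otimes> w') \<oplus>\<^bsub>T W\<^esub> nf_sum W z' w'" .
  then show ?thesis
    using y zc by (simp add: a_minus_def TW.a_assoc TW.r_neg)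
qed

text \<open>\<open>gsec W k\<close> is represented by the coefficient tuple with the single nonzero
  entry u^(bd + b k), so pairing it with z k / w puts u^(bd + b k) z k into coordinate k. All
  contributions have denominator u^bd w and are added inside \<kappa>.\<close>

lemma \<psi>_nf:
  assumes z: "\<forall>s<p. z s \<in> mdeg M d" "w \<in> M.dens W d" and Q: "Q \<in> W"
  shows "\<psi> Q W (nf_sum W z w) = frac R N Q (\<kappa> (\<lambda>s. up (bd + b s) \<odot>\<^bsub>M\<^esub> z s)) (up bd \<otimes> w)"
proof -
  have prime: "primeideal Q R" using openin_prime[OF W Q] .
  have den: "up bd \<otimes> w \<in> rdeg R (bd * int l + d) - Q"
    using M.dens_at[OF M.dens_mult[OF W up_dens[OF W WD bd_ge(1)] z(2)] Q] .
  have zc: "z s \<in> carrier M" if "s < p" for s using z that M.mdeg_carrier by blast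
  \<comment> \<open>The first k contributions, padded with zeros: \<kappa> of this tuple is the
    numerator of the k-th partial sum.\<close>
  define y where "y k s = (if s < k then up (bd + b s) \<odot>\<^bsub>M\<^esub> z s else \<zero>\<^bsub>M\<^esub>)" for k s :: nat
  define o' where "o' k s = (if s = k then up (bd + b s) else \<zero>)" for k s :: nat
  have o': "coef bd (o' k)" for k
    unfolding coef_def o'_def using up_deg b_range M.rdeg_zero by auto
  have comb_o': "comb (o' k) = up (bd + b k) \<otimes> m k" if "k < p" for k
  proof -
    have "comb (o' k) = (\<Oplus>s\<in>{..<p}. if k = s then up (bd + b s) \<otimes> m s else \<zero>)"
      unfolding comb_def o'_def using up_carrier m_carrier by (intro M.ring_finsum_cong) auto
    also have "\<dots> = up (bd + b k) \<otimes> m k"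
      using M.ring_finsum_singleton[of k "{..<p}" "\<lambda>s. up (bd + b s) \<otimes> m s"] that up_carrier m_carrier
      by simp
    finally show ?thesis .
  qed
  have ydeg: "y k s \<in> mdeg M (bd * int l + d + b s * int l)" if "s < p" for k s
    unfolding y_def using M.mdeg_smult[OF up_deg[OF b_range(1)[OF that]], of "z s" d] z that M.mdeg_zero
    by (simp add: algebra_simps)
  have \<kappa>y: "\<kappa> (y k) \<in> mdeg N (bd * int l + d)" for k
    unfolding \<kappa>_mdeg using ydeg by blast
  have "\<psi> Q W (\<Oplus>\<^bsub>T W\<^esub>s\<in>{..<k}. pt W (M.frac_section W (z s) w) (gsec W s)) =
      frac R N Q (\<kappa> (y k)) (up bd \<otimes> w)" if "k \<le> p" for k
    using that
  proof (induction k)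
    case 0
    have "\<kappa> (y 0) = \<zero>\<^bsub>N\<^esub>" unfolding y_def using \<kappa>_zero by simp
    then show ?case using \<psi>_zero[OF W Q] N.frac_zero_eq[OF prime den] by simp
  next
    case (Suc k)
    then have k: "k < p" "z k \<in> mdeg M d" using z by auto
    have "\<psi> Q W (pt W (M.frac_section W (z k) w) (gsec W k)) =
        pairing Q (frac R M Q (z k) w) (frac R L Q (comb (o' k)) (up bd))"
      unfolding \<psi>_pure[OF W Q M.frac_section_regular[OF W k(2) z(2)] gsec_regular[OF k(1)]]
      using Q by (simp add: M.frac_section_def gsec_def L.frac_section_def comb_o'[OF k(1)])
    also have "\<dots> = frac R N Q (\<kappa> (\<lambda>s. o' k s \<odot>\<^bsub>M\<^esub> z k)) (up bd \<otimes> w)"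
      by (rule pairing_eq[OF prime k(2) M.dens_at[OF z(2) Q]
          M.dens_at[OF up_dens[OF W WD bd_ge(1)] Q] o'])
    finally have term_eq: "\<psi> Q W (pt W (M.frac_section W (z k) w) (gsec W k)) =
        frac R N Q (\<kappa> (\<lambda>s. o' k s \<odot>\<^bsub>M\<^esub> z k)) (up bd \<otimes> w)" .
    have "\<kappa> (\<lambda>s. o' k s \<odot>\<^bsub>M\<^esub> z k) \<oplus>\<^bsub>N\<^esub> \<kappa> (y k) = \<kappa> (\<lambda>s. o' k s \<odot>\<^bsub>M\<^esub> z k \<oplus>\<^bsub>M\<^esub> y k s)"
      using ydeg M.mdeg_carrier coef_carrier[OF o'] zc[OF k(1)] by (intro \<kappa>_add[symmetric]) blast+
    also have "\<dots> = \<kappa> (y (Suc k))"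
      using zc up_carrier k by (intro \<kappa>_cong) (auto simp: o'_def y_def less_Suc_eq)
    finally have \<kappa>: "\<kappa> (\<lambda>s. o' k s \<odot>\<^bsub>M\<^esub> z k) \<oplus>\<^bsub>N\<^esub> \<kappa> (y k) = \<kappa> (y (Suc k))" .
    have c: "(\<lambda>s. pt W (M.frac_section W (z s) w) (gsec W s)) \<in> {..<k} \<rightarrow> carrier (T W)"
      "pt W (M.frac_section W (z k) w) (gsec W k) \<in> carrier (T W)"
      using nf_term_closed[OF _ _ z(2)] z k by auto
    then have "(\<Oplus>\<^bsub>T W\<^esub>s\<in>{..<Suc k}. pt W (M.frac_section W (z s) w) (gsec W s)) =
        pt W (M.frac_section W (z k) w) (gsec W k) \<oplus>\<^bsub>T W\<^esub>
        (\<Oplus>\<^bsub>T W\<^esub>s\<in>{..<k}. pt W (M.frac_section W (z s) w) (gsec W s))"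
      by (simp add: lessThan_Suc)
    then have "\<psi> Q W (\<Oplus>\<^bsub>T W\<^esub>s\<in>{..<Suc k}. pt W (M.frac_section W (z s) w) (gsec W s)) =
        local_add R N Q (frac R N Q (\<kappa> (\<lambda>s. o' k s \<odot>\<^bsub>M\<^esub> z k)) (up bd \<otimes> w))
          (frac R N Q (\<kappa> (y k)) (up bd \<otimes> w))"
      using \<psi>_add[OF W Q c(2) TW.finsum_closed[OF c(1)]] Suc term_eq by simp
    also have "\<dots> = frac R N Q (\<kappa> (y (Suc k))) (up bd \<otimes> w)"
      unfolding N.local_add_common[OF prime \<kappa>_comb_deg[OF o' k(2)] \<kappa>y den] \<kappa> ..
    finally show ?case .
  qed
  from this[of p] have "\<psi> Q W (nf_sum W z w) = frac R N Q (\<kappa> (y p)) (up bd \<otimes> w)"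
    unfolding nf_sum_def by simp
  also have "\<kappa> (y p) = \<kappa> (\<lambda>s. up (bd + b s) \<odot>\<^bsub>M\<^esub> z s)"
    by (rule \<kappa>_cong) (simp add: y_def)
  finally show ?thesis .
qed

text \<open>Every term of the normal form is moved across the tensor sign until the relations
  \<open>(\<Sigma>s. A s t * m s) = 0\<close> appear on the right.\<close>

lemma nf_eq_zero:
  assumes z: "\<forall>s<p. z s \<in> mdeg M d" "w \<in> M.dens W d" and h: "h \<in> M.dens W k"
    and y: "\<forall>t<q. y t \<in> mdeg M (k + bd * int l + d + c t * int l)"
    and eq: "\<And>s. s < p \<Longrightarrow> (h \<otimes> up (bd + b s)) \<odot>\<^bsub>M\<^esub> z s = (\<Oplus>\<^bsub>M\<^esub>t\<in>{..<q}. A s t \<odot>\<^bsub>M\<^esub> y t)"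
  shows "nf_sum W z w = \<zero>\<^bsub>T W\<^esub>"
proof -
  \<comment> \<open>The denominator after expanding z s / w by h u^(2 bd). Of this power of u, the
    factor u^(bd + b s) makes \<open>eq\<close> applicable and u^(bd - b s) stays in front of the
    resulting sum.\<close>
  define E where "E = (h \<otimes> w) \<otimes> (up bd \<otimes> up bd)"
  define Y where "Y t = M.frac_section W (up (bd - c t) \<odot>\<^bsub>M\<^esub> y t) E" for t
  \<comment> \<open>The exponent is dictated by degrees: \<open>A s t\<close> has degree (b s - c t)
    * l, so \<open>a s t\<close> has degree 2 * bd * l like v, and their quotient is a function that
    may cross the tensor sign. What remains on the left, \<open>Y t\<close>, is free of s.\<close>
  define a where "a s t = A s t \<otimes> up (2 * bd - b s + c t)" for s t
  define v where "v = up bd \<otimes> up bd"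
  have upd: "up bd \<in> M.dens W (bd * int l)" by (rule up_dens[OF W WD bd_ge(1)])
  have vd: "v \<in> M.dens W (2 * bd * int l)"
    unfolding v_def using M.dens_mult[OF W upd upd] by (simp add: algebra_simps)
  have Ed: "E \<in> M.dens W (k + d + 2 * bd * int l)"
    unfolding E_def using M.dens_mult[OF W M.dens_mult[OF W h z(2)] vd[unfolded v_def]] .
  have hc: "h \<in> carrier R" "w \<in> carrier R" "E \<in> carrier R" "v \<in> carrier R"
    using h z(2) Ed vd M.dens_rdeg M.rdeg_carrier by blast+
  have yc: "y t \<in> carrier M" if "t < q" for t using y that M.mdeg_carrier by blast
  have zc: "z s \<in> carrier M" if "s < p" for s using z that M.mdeg_carrier by blast
  have Ydeg: "up (bd - c t) \<odot>\<^bsub>M\<^esub> y t \<in> mdeg M (k + d + 2 * bd * int l)" if "t < q" for t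
    using M.mdeg_smult[OF up_deg[OF c_range(2)[OF that]], of "y t"] y that by (fastforce simp: algebra_simps)
  have range: "0 \<le> 2 * bd - b s + c t" if "s < p" "t < q" for s t
    using b_range[OF that(1)] c_range[OF that(2)] by simp
  have adeg: "a s t \<in> rdeg R (2 * bd * int l)" if "s < p" "t < q" for s t
    unfolding a_def using M.rdeg_mult[OF A_deg[OF that] up_deg[OF range[OF that]]] by (simp add: algebra_simps)
  have summand_deg: "(up (bd - b s) \<otimes> A s t) \<odot>\<^bsub>M\<^esub> y t \<in> mdeg M (k + d + 2 * bd * int l)"
    if "s < p" "t < q" for s t
    using M.mdeg_smult[OF M.rdeg_mult[OF up_deg[OF b_range(2)[OF that(1)]] A_deg[OF that]], of "y t"] y that
    by (fastforce simp: algebra_simps)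
  have num: "M.frac_section W (z s) w =
      M.frac_section W (\<Oplus>\<^bsub>M\<^esub>t\<in>{..<q}. (up (bd - b s) \<otimes> A s t) \<odot>\<^bsub>M\<^esub> y t) E" if s: "s < p" for s
  proof -
    have "M.frac_section W (z s) w = M.frac_section W ((h \<otimes> v) \<odot>\<^bsub>M\<^esub> z s) ((h \<otimes> v) \<otimes> w)"
      using M.frac_section_cancel[OF W _ z(2) M.dens_mult[OF W h vd], of "z s"] z s by simp
    also have "(h \<otimes> v) \<otimes> w = E"
      unfolding E_def v_def[symmetric] using hc by (simp add: M.m_ac)
    also have "(h \<otimes> v) \<odot>\<^bsub>M\<^esub> z s = up (bd - b s) \<odot>\<^bsub>M\<^esub> ((h \<otimes> up (bd + b s)) \<odot>\<^bsub>M\<^esub> z s)"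
    proof -
      have "v = up (bd - b s) \<otimes> up (bd + b s)"
        unfolding v_def using up_mult b_range[OF s] bd_ge(1) by simp
      then show ?thesis using hc up_carrier zc[OF s] by (simp add: M.smult_ac)
    qed
    also have "\<dots> = (\<Oplus>\<^bsub>M\<^esub>t\<in>{..<q}. up (bd - b s) \<odot>\<^bsub>M\<^esub> (A s t \<odot>\<^bsub>M\<^esub> y t))"
      unfolding eq[OF s] using up_carrier A_carrier[OF s] yc by (intro M.finsum_smult_ldistr) auto
    also have "\<dots> = (\<Oplus>\<^bsub>M\<^esub>t\<in>{..<q}. (up (bd - b s) \<otimes> A s t) \<odot>\<^bsub>M\<^esub> y t)"
      using up_carrier A_carrier[OF s] yc by (intro M.M.finsum_cong') (auto simp: M.smult_assoc1)
    finally show ?thesis .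
  qed
  have move: "pt W (M.frac_section W ((up (bd - b s) \<otimes> A s t) \<odot>\<^bsub>M\<^esub> y t) E) (gsec W s) =
      pt W (Y t) (L.frac_section W (up (3 * bd + c t) \<otimes> (A s t \<otimes> m s)) (v \<otimes> up bd))"
    if s: "s < p" and t: "t < q" for s t
  proof -
    have Ac: "A s t \<in> carrier R" "m s \<in> carrier R" using A_carrier[OF s t] m_carrier[OF s] .
    have "M.frac_section W ((up (bd - b s) \<otimes> A s t) \<odot>\<^bsub>M\<^esub> y t) E =
        M.frac_section W (v \<odot>\<^bsub>M\<^esub> ((up (bd - b s) \<otimes> A s t) \<odot>\<^bsub>M\<^esub> y t)) (v \<otimes> E)"
      using M.frac_section_cancel[OF W summand_deg[OF s t] Ed vd] by simp
    also have "v \<odot>\<^bsub>M\<^esub> ((up (bd - b s) \<otimes> A s t) \<odot>\<^bsub>M\<^esub> y t) = a s t \<odot>\<^bsub>M\<^esub> (up (bd - c t) \<odot>\<^bsub>M\<^esub> y t)"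
    proof -
      have "v \<otimes> up (bd - b s) = up (2 * bd - b s + c t) \<otimes> up (bd - c t)"
        unfolding v_def using up_mult b_range[OF s] bd_ge(1) c_range[OF t] range[OF s t] by simp
      then have "v \<odot>\<^bsub>M\<^esub> (up (bd - b s) \<odot>\<^bsub>M\<^esub> (A s t \<odot>\<^bsub>M\<^esub> y t)) =
          up (2 * bd - b s + c t) \<odot>\<^bsub>M\<^esub> (up (bd - c t) \<odot>\<^bsub>M\<^esub> (A s t \<odot>\<^bsub>M\<^esub> y t))"
        using up_carrier Ac yc[OF t] hc by (metis M.smult_assoc1 M.smult_closed)
      then show ?thesis
        unfolding a_def using up_carrier Ac yc[OF t] hc by (simp add: M.smult_ac)
    qed
    finally have "pt W (M.frac_section W ((up (bd - b s) \<otimes> A s t) \<odot>\<^bsub>M\<^esub> y t) E) (gsec W s) =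
        pt W (M.frac_section W (a s t \<odot>\<^bsub>M\<^esub> (up (bd - c t) \<odot>\<^bsub>M\<^esub> y t)) (v \<otimes> E)) (gsec W s)"
      by simp
    also have "\<dots> = pt W (Y t) (L.frac_section W (a s t \<odot>\<^bsub>L\<^esub> (up (bd + b s) \<otimes> m s)) (v \<otimes> up bd))"
      unfolding gsec_def Y_def by (rule pt_balanced[OF W adeg[OF s t] vd Ydeg[OF t] Ed gen_deg[OF s] upd])
    also have "a s t \<odot>\<^bsub>L\<^esub> (up (bd + b s) \<otimes> m s) = (up (2 * bd - b s + c t) \<otimes> up (bd + b s)) \<otimes> (A s t \<otimes> m s)"
      unfolding a_def using up_carrier Ac by (simp add: M.m_ac)
    \<comment> \<open>Together with the power of u contained in \<open>gsec W s\<close>, the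
      exponent becomes independent of s, so this power can later be taken out of the sum over
      s.\<close>
    also have "up (2 * bd - b s + c t) \<otimes> up (bd + b s) = up (3 * bd + c t)"
      using up_mult[OF range[OF s t] b_range(1)[OF s]] by simp
    finally show ?thesis .
  qed
  have rel_deg: "up (3 * bd + c t) \<otimes> (A s t \<otimes> m s) \<in> mdeg L (3 * bd * int l)" if "s < p" "t < q" for s t
  proof -
    have "0 \<le> 3 * bd + c t" using c_range[OF that(2)] bd_ge(1) by simp
    from M.rdeg_mult[OF up_deg[OF this] M.rdeg_mult[OF A_deg[OF that] m_deg[OF that(1)]]]
    show ?thesis by (simp add: algebra_simps)
  qed
  have vupd: "v \<otimes> up bd \<in> M.dens W (3 * bd * int l)"
    using M.dens_mult[OF W vd upd] by (simp add: algebra_simps)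
  have Yreg: "Y t \<in> regular_sections R M W" if "t < q" for t
    unfolding Y_def by (rule M.frac_section_regular[OF W Ydeg[OF that] Ed])
  have closed: "pt W (Y t) (L.frac_section W (up (3 * bd + c t) \<otimes> (A s t \<otimes> m s)) (v \<otimes> up bd)) \<in> carrier (T W)"
    if "s < p" "t < q" for s t
    by (rule pt_closed[OF W Yreg[OF that(2)] L.frac_section_regular[OF W rel_deg[OF that] vupd]])
  have "nf_sum W z w = (\<Oplus>\<^bsub>T W\<^esub>s\<in>{..<p}. \<Oplus>\<^bsub>T W\<^esub>t\<in>{..<q}.
      pt W (Y t) (L.frac_section W (up (3 * bd + c t) \<otimes> (A s t \<otimes> m s)) (v \<otimes> up bd)))"
    unfolding nf_sum_def
  proof (rule TW.finsum_cong'[OF refl])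
    show "(\<lambda>s. \<Oplus>\<^bsub>T W\<^esub>t\<in>{..<q}. pt W (Y t) (L.frac_section W (up (3 * bd + c t) \<otimes> (A s t \<otimes> m s)) (v \<otimes> up bd)))
        \<in> {..<p} \<rightarrow> carrier (T W)"
      using closed by (auto intro!: TW.finsum_closed)
    fix s assume "s \<in> {..<p}"
    then have s: "s < p" by simp
    have "pt W (M.frac_section W (z s) w) (gsec W s) =
        (\<Oplus>\<^bsub>T W\<^esub>t\<in>{..<q}. pt W (M.frac_section W ((up (bd - b s) \<otimes> A s t) \<odot>\<^bsub>M\<^esub> y t) E) (gsec W s))"
      unfolding num[OF s]
      by (rule pt_finsum_left[OF W _ _ Ed gsec_regular[OF s]]) (use summand_deg[OF s] in auto)
    also have "\<dots> = (\<Oplus>\<^bsub>T W\<^esub>t\<in>{..<q}.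
        pt W (Y t) (L.frac_section W (up (3 * bd + c t) \<otimes> (A s t \<otimes> m s)) (v \<otimes> up bd)))"
      using move[OF s] closed[OF s] by (intro TW.finsum_cong') auto
    finally show "pt W (M.frac_section W (z s) w) (gsec W s) = (\<Oplus>\<^bsub>T W\<^esub>t\<in>{..<q}.
        pt W (Y t) (L.frac_section W (up (3 * bd + c t) \<otimes> (A s t \<otimes> m s)) (v \<otimes> up bd)))" .
  qed
  \<comment> \<open>With the sums exchanged, the inner sum for fixed t is \<open>Y t\<close>
    tensored with a multiple of the t-th column relation among the generators, hence zero.\<close>
  also have "\<dots> = (\<Oplus>\<^bsub>T W\<^esub>t\<in>{..<q}. \<Oplus>\<^bsub>T W\<^esub>s\<in>{..<p}.
      pt W (Y t) (L.frac_section W (up (3 * bd + c t) \<otimes> (A s t \<otimes> m s)) (v \<otimes> up bd)))"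
    by (rule TW.finsum_swap) (use closed in auto)
  also have "\<dots> = (\<Oplus>\<^bsub>T W\<^esub>t\<in>{..<q}. \<zero>\<^bsub>T W\<^esub>)"
  proof (rule TW.finsum_cong'[OF refl])
    fix t assume "t \<in> {..<q}"
    then have t: "t < q" by simp
    have "(\<Oplus>\<^bsub>T W\<^esub>s\<in>{..<p}. pt W (Y t) (L.frac_section W (up (3 * bd + c t) \<otimes> (A s t \<otimes> m s)) (v \<otimes> up bd))) =
        pt W (Y t) (L.frac_section W (finsum L (\<lambda>s. up (3 * bd + c t) \<otimes> (A s t \<otimes> m s)) {..<p}) (v \<otimes> up bd))"
      by (rule pt_finsum_right[OF W _ _ vupd Yreg[OF t], symmetric]) (use rel_deg t in auto)
    also have "finsum L (\<lambda>s. up (3 * bd + c t) \<otimes> (A s t \<otimes> m s)) {..<p} =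
        (\<Oplus>s\<in>{..<p}. up (3 * bd + c t) \<otimes> (A s t \<otimes> m s))"
      using up_carrier A_carrier[OF _ t] m_carrier by (intro finsum_L) auto
    also have "\<dots> = up (3 * bd + c t) \<otimes> (\<Oplus>s\<in>{..<p}. A s t \<otimes> m s)"
      using up_carrier A_carrier[OF _ t] m_carrier by (intro M.finsum_rdistr[symmetric]) auto
    also have "\<dots> = \<zero>\<^bsub>L\<^esub>" using A_m[OF t] up_carrier by simp
    finally show "(\<Oplus>\<^bsub>T W\<^esub>s\<in>{..<p}. pt W (Y t)
        (L.frac_section W (up (3 * bd + c t) \<otimes> (A s t \<otimes> m s)) (v \<otimes> up bd))) = \<zero>\<^bsub>T W\<^esub>"
      using pt_zero_right[OF W vupd Yreg[OF t]] by simp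
  qed simp
  finally show ?thesis by simp
qed

end

lemma nf_restrict:
  assumes W: "openin (zariski R) W" "W \<subseteq> Du" and V: "openin (zariski R) V" "V \<subseteq> W"
    and z: "\<forall>s<p. z s \<in> mdeg M d" "w \<in> M.dens W d"
  shows "rs W V (nf_sum W z w) = nf_sum V z w"
proof -
  interpret abelian_group_hom "T W" "T V" "rs W V" by (rule rs_hom[OF W(1) V])
  have VD: "V \<subseteq> Du" using W V by blast
  have "rs W V (nf_sum W z w) = (\<Oplus>\<^bsub>T V\<^esub>s\<in>{..<p}. rs W V (pt W (M.frac_section W (z s) w) (gsec W s)))"
    unfolding nf_sum_def using z nf_term_closed[OF W] by (intro hom_finsum) auto
  also have "\<dots> = nf_sum V z w"
    unfolding nf_sum_def
    using z nf_term_closed[OF V(1) VD _ _ M.dens_mono[OF z(2) V(2)]]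
      rs_pure[OF W(1) V M.frac_section_regular[OF W(1) _ z(2)] gsec_regular[OF W]]
      M.frac_section_restrict[OF V(2)] restrict_gsec[OF V(2)]
    by (intro H.finsum_cong') auto
  finally show ?thesis .
qed

text \<open>The factors of a pure tensor are single fractions only near P, and the two terms of a
  difference bring neighbourhoods of their own. Hence the normal form holds on some smaller W,
  chosen inside the locus where u does not vanish.\<close>

lemma nf_exists:
  assumes U: "openin (zariski R) U" and P: "P \<in> U" "P \<in> Du" and t: "t \<in> carrier (T U)"
  shows "\<exists>W d z w. openin (zariski R) W \<and> P \<in> W \<and> W \<subseteq> U \<inter> Du \<and> w \<in> M.dens W d \<and>
    (\<forall>s<p. z s \<in> mdeg M d) \<and> rs U W t = nf_sum W z w"
proof -
  interpret U: tensor_product "fun_ring (Proj R) U" "sect (tilde R M) U" "sect (tilde R L) U"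
    by (rule product[OF U])
  show ?thesis using t
  proof (induction t rule: U.tensor_induct)
    case zero
    let ?W = "U \<inter> Du"
    have W: "openin (zariski R) ?W" using U open_Du by blast
    interpret abelian_group_hom "T U" "T ?W" "rs U ?W" by (rule rs_hom[OF U W]) simp
    have one: "\<one> \<in> M.dens ?W 0" by (rule M.dens_one[OF W])
    have "nf_sum ?W (\<lambda>s. \<zero>\<^bsub>M\<^esub>) \<one> = \<zero>\<^bsub>T ?W\<^esub>"
      unfolding nf_sum_def
      using pt_zero_left[OF W one gsec_regular[OF W]] by (intro H.add.finprod_one_eqI) auto
    then show ?case
      using W P one M.mdeg_zero[of 0] hom_zero
      by (intro exI[of _ ?W] exI[of _ 0] exI[of _ "\<lambda>s. \<zero>\<^bsub>M\<^esub>"] exI[of _ \<one>]) auto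
  next
    case (pure x y)
    then have x: "x \<in> regular_sections R M U" and y: "y \<in> regular_sections R L U" by simp_all
    obtain V d x0 s0 where V: "openin (zariski R) V" "P \<in> V" "V \<subseteq> U" "x0 \<in> mdeg M d" "s0 \<in> M.dens V d"
      "\<And>Q. Q \<in> V \<Longrightarrow> x Q = frac R M Q x0 s0"
      by (rule M.frac_sectionE[OF x P(1)]) (rule that)
    obtain V' e g t0 where V': "openin (zariski R) V'" "P \<in> V'" "V' \<subseteq> U" "g \<in> mdeg L e" "t0 \<in> M.dens V' e"
      "\<And>Q. Q \<in> V' \<Longrightarrow> y Q = frac R L Q g t0"
      by (rule L.frac_sectionE[OF y P(1)]) (rule that)
    \<comment> \<open>Although r is obtained at P, the identity for \<open>comb r\<close> holds in R
      and can be used over all of \<open>?W\<close>.\<close>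
    obtain r where r: "coef e r" "comb r = t0 [^] (l - 1) \<otimes> g"
      by (rule L_repr[OF openin_prime[OF V'(1,2)] V'(4) M.dens_at[OF V'(5,2)]]) (rule that)
    let ?W = "V \<inter> V' \<inter> Du" and ?t = "t0 [^] (l - 1) \<otimes> t0"
    have W: "openin (zariski R) ?W" "?W \<subseteq> U" "?W \<subseteq> Du" using V V' open_Du by blast+
    have lk: "int (l - 1) * e + e = e * int l"
      using l_pos by (simp add: of_nat_diff algebra_simps)
    have t0: "t0 \<in> M.dens ?W e" by (rule M.dens_mono[OF V'(5)]) blast
    have s0: "s0 \<in> M.dens ?W d" by (rule M.dens_mono[OF V(5)]) blast
    have td: "?t \<in> M.dens ?W (e * int l)"
      unfolding lk[symmetric] by (intro M.dens_mult M.dens_pow W t0)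
    have "restrict x ?W = M.frac_section ?W x0 s0"
      unfolding M.frac_section_def using V(6) by (intro restrict_ext) simp
    moreover have "restrict y ?W = L.frac_section ?W g t0"
      unfolding L.frac_section_def using V'(6) by (intro restrict_ext) simp
    moreover have "L.frac_section ?W g t0 = L.frac_section ?W (comb r) ?t"
      using L.frac_section_cancel[OF W(1) V'(4) t0 M.dens_pow[OF W(1) t0], of "l - 1"] r(2) by simp
    ultimately have "rs U ?W (pt U x y) =
        nf_sum ?W (\<lambda>s. (up (bd - b s) \<otimes> r s) \<odot>\<^bsub>M\<^esub> x0) ((?t \<otimes> up bd) \<otimes> s0)"
      using rs_pure[OF U W(1,2) x y] pure_nf[OF W(1,3) V(4) s0 td r(1)] by simp
    moreover have "(?t \<otimes> up bd) \<otimes> s0 \<in> M.dens ?W ((e + bd) * int l + d)"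
      using M.dens_mult[OF W(1) M.dens_mult[OF W(1) td up_dens[OF W(1,3) bd_ge(1)]] s0]
      by (simp add: algebra_simps)
    moreover have "(up (bd - b s) \<otimes> r s) \<odot>\<^bsub>M\<^esub> x0 \<in> mdeg M ((e + bd) * int l + d)" if s: "s < p" for s
      using M.mdeg_smult[OF M.rdeg_mult[OF up_deg[OF b_range(2)[OF s]]] V(4), of "r s" "(e + b s) * int l"] r(1) s
      by (simp add: coef_def algebra_simps)
    moreover have "P \<in> ?W" "?W \<subseteq> U \<inter> Du" using V V' P by blast+
    ultimately show ?case using W(1)
      by (intro exI[of _ ?W] exI[of _ "(e + bd) * int l + d"] exI[of _ "\<lambda>s. (up (bd - b s) \<otimes> r s) \<odot>\<^bsub>M\<^esub> x0"]
          exI[of _ "(?t \<otimes> up bd) \<otimes> s0"] conjI allI impI)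
  next
    case (diff t t')
    obtain V d z w where V: "openin (zariski R) V" "P \<in> V" "V \<subseteq> U \<inter> Du" "w \<in> M.dens V d"
      "\<forall>s<p. z s \<in> mdeg M d" "rs U V t = nf_sum V z w"
      using diff(3) by (elim exE conjE)
    obtain V' d' z' w' where V': "openin (zariski R) V'" "P \<in> V'" "V' \<subseteq> U \<inter> Du" "w' \<in> M.dens V' d'"
      "\<forall>s<p. z' s \<in> mdeg M d'" "rs U V' t' = nf_sum V' z' w'"
      using diff(4) by (elim exE conjE)
    let ?W = "V \<inter> V'"
    have W: "openin (zariski R) ?W" "?W \<subseteq> U" "?W \<subseteq> Du" "?W \<subseteq> V" "?W \<subseteq> V'" using V V' by blast+
    have w: "w \<in> M.dens ?W d" "w' \<in> M.dens ?W d'"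
      using M.dens_mono[OF V(4) W(4)] M.dens_mono[OF V'(4) W(5)] .
    have VU: "V \<subseteq> U" "V \<subseteq> Du" "V' \<subseteq> U" "V' \<subseteq> Du" using V(3) V'(3) by blast+
    interpret abelian_group_hom "T U" "T ?W" "rs U ?W" by (rule rs_hom[OF U W(1,2)])
    have 1: "rs U ?W t = nf_sum ?W z w"
      using rs_rs[OF U V(1) VU(1) W(1,4) diff(1)] V(6) nf_restrict[OF V(1) VU(2) W(1,4) V(5,4)] by simp
    have 2: "rs U ?W t' = nf_sum ?W z' w'"
      using rs_rs[OF U V'(1) VU(3) W(1,5) diff(2)] V'(6) nf_restrict[OF V'(1) VU(4) W(1,5) V'(5,4)] by simp
    have eq: "rs U ?W (t \<ominus>\<^bsub>T U\<^esub> t') =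
        nf_sum ?W (\<lambda>s. w' \<odot>\<^bsub>M\<^esub> z s \<oplus>\<^bsub>M\<^esub> \<ominus>\<^bsub>M\<^esub> (w \<odot>\<^bsub>M\<^esub> z' s)) (w \<otimes> w')"
      unfolding hom_diff[OF diff(1,2)] 1 2 by (rule nf_diff[OF W(1,3) V(5) w(1) V'(5) w(2)])
    have deg: "w' \<odot>\<^bsub>M\<^esub> z s \<oplus>\<^bsub>M\<^esub> \<ominus>\<^bsub>M\<^esub> (w \<odot>\<^bsub>M\<^esub> z' s) \<in> mdeg M (d + d')" if "s < p" for s
      using M.mdeg_smult[OF M.dens_rdeg[OF w(2)], of "z s" d] M.mdeg_smult[OF M.dens_rdeg[OF w(1)], of "z' s" d']
        V(5) V'(5) that
      by (intro M.mdeg_add M.mdeg_minus) (simp_all add: add.commute)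
    have "P \<in> ?W" "?W \<subseteq> U \<inter> Du" using V V' by blast+
    then show ?case using W(1) eq deg M.dens_mult[OF W(1) w]
      by (intro exI[of _ ?W] exI[of _ "d + d'"] exI[of _ "\<lambda>s. w' \<odot>\<^bsub>M\<^esub> z s \<oplus>\<^bsub>M\<^esub> \<ominus>\<^bsub>M\<^esub> (w \<odot>\<^bsub>M\<^esub> z' s)"]
          exI[of _ "w \<otimes> w'"] conjI allI impI)
  qed
qed

text \<open>If the value of a normal form is zero at P, one homogeneous h outside P annihilates its
  numerator in N. The relation this produces among the coefficients is an identity in M, so it
  forces vanishing on the whole part of V where h does not vanish.\<close>

lemma local_injective:
  assumes U: "openin (zariski R) U" and P: "P \<in> U" "P \<in> Du" and t: "t \<in> carrier (T U)"
    and zero: "\<psi> P U t = frac R N P \<zero>\<^bsub>N\<^esub> \<one>"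
  shows "\<exists>W. openin (zariski R) W \<and> P \<in> W \<and> W \<subseteq> U \<and> rs U W t = \<zero>\<^bsub>T W\<^esub>"
proof -
  obtain V d z w where V: "openin (zariski R) V" "P \<in> V" "V \<subseteq> U \<inter> Du" "w \<in> M.dens V d"
    "\<forall>s<p. z s \<in> mdeg M d" "rs U V t = nf_sum V z w"
    using nf_exists[OF U P t] by (elim exE conjE)
  have VU: "V \<subseteq> U" "V \<subseteq> Du" using V(3) by blast+
  have prime: "primeideal P R" using openin_prime[OF U P(1)] .
  have den: "up bd \<otimes> w \<in> rdeg R (bd * int l + d) - P"
    using M.dens_at[OF M.dens_mult[OF V(1) up_dens[OF V(1) VU(2) bd_ge(1)] V(4)] V(2)] .
  have zdeg: "up (bd + b s) \<odot>\<^bsub>M\<^esub> z s \<in> mdeg M (bd * int l + d + b s * int l)" if s: "s < p" for s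
    using M.mdeg_smult[OF up_deg[OF b_range(1)[OF s]], of "z s" d] V(5) s by (simp add: algebra_simps)
  then have \<kappa>deg: "\<kappa> (\<lambda>s. up (bd + b s) \<odot>\<^bsub>M\<^esub> z s) \<in> mdeg N (bd * int l + d)"
    unfolding \<kappa>_mdeg by blast
  have "frac R N P (\<kappa> (\<lambda>s. up (bd + b s) \<odot>\<^bsub>M\<^esub> z s)) (up bd \<otimes> w) = frac R N P \<zero>\<^bsub>N\<^esub> \<one>"
    using \<psi>_nf[OF V(1) VU(2) V(5,4,2)] \<psi>_restrict[OF U V(1) VU(1) V(2) t] V(6) zero by simp
  then obtain h k where h: "h \<in> rdeg R k - P" "h \<odot>\<^bsub>N\<^esub> \<kappa> (\<lambda>s. up (bd + b s) \<odot>\<^bsub>M\<^esub> z s) = \<zero>\<^bsub>N\<^esub>"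
    by (rule N.frac_eq_zeroD[OF prime \<kappa>deg den]) (rule that)
  have hc: "h \<in> carrier R" using h M.rdeg_carrier by blast
  have zc: "z s \<in> carrier M" if "s < p" for s using V(5) that M.mdeg_carrier by blast
  have "\<kappa> (\<lambda>s. (h \<otimes> up (bd + b s)) \<odot>\<^bsub>M\<^esub> z s) = \<kappa> (\<lambda>s. h \<odot>\<^bsub>M\<^esub> (up (bd + b s) \<odot>\<^bsub>M\<^esub> z s))"
    using hc up_carrier zc by (intro \<kappa>_cong) (simp add: M.smult_assoc1)
  also have "\<dots> = \<zero>\<^bsub>N\<^esub>"
    using \<kappa>_smult[OF hc, of "\<lambda>s. up (bd + b s) \<odot>\<^bsub>M\<^esub> z s"] h(2) up_carrier zc by simp
  finally have "\<kappa> (\<lambda>s. (h \<otimes> up (bd + b s)) \<odot>\<^bsub>M\<^esub> z s) = \<zero>\<^bsub>N\<^esub>" .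
  moreover have "\<forall>s<p. (h \<otimes> up (bd + b s)) \<odot>\<^bsub>M\<^esub> z s \<in> mdeg M (k + bd * int l + d + b s * int l)"
  proof (intro allI impI)
    fix s assume s: "s < p"
    have "(h \<otimes> up (bd + b s)) \<odot>\<^bsub>M\<^esub> z s = h \<odot>\<^bsub>M\<^esub> (up (bd + b s) \<odot>\<^bsub>M\<^esub> z s)"
      using hc up_carrier zc[OF s] by (simp add: M.smult_assoc1)
    then show "(h \<otimes> up (bd + b s)) \<odot>\<^bsub>M\<^esub> z s \<in> mdeg M (k + bd * int l + d + b s * int l)"
      using M.mdeg_smult[of h k, OF _ zdeg[OF s]] h(1) by (simp add: algebra_simps)
  qed
  \<comment> \<open>The y t have to be homogeneous of these degrees because they become numerators
    of fractions in \<open>nf_eq_zero\<close>.\<close>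
  ultimately obtain y where y: "\<forall>t<q. y t \<in> mdeg M (k + bd * int l + d + c t * int l)"
    "\<forall>s<p. (h \<otimes> up (bd + b s)) \<odot>\<^bsub>M\<^esub> z s = (\<Oplus>\<^bsub>M\<^esub>t\<in>{..<q}. A s t \<odot>\<^bsub>M\<^esub> y t)"
    using \<kappa>_zeroD[of "\<lambda>s. (h \<otimes> up (bd + b s)) \<odot>\<^bsub>M\<^esub> z s" "k + bd * int l + d"] by blast
  let ?W = "V \<inter> {Q \<in> Proj_set R. h \<notin> Q}"
  have "openin (zariski R) {Q \<in> Proj_set R. h \<notin> Q}"
    using openin_basic[of h R] M.homogeneousI h(1) by blast
  then have W: "openin (zariski R) ?W" "?W \<subseteq> Du" "?W \<subseteq> V" using V(1) VU by blast+
  have hd: "h \<in> M.dens ?W k" using h(1) by (auto simp: M.dens_def)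
  have "rs U ?W t = nf_sum ?W z w"
    using rs_rs[OF U V(1) VU(1) W(1,3) t] V(6) nf_restrict[OF V(1) VU(2) W(1,3) V(5,4)] by simp
  also have "\<dots> = \<zero>\<^bsub>T ?W\<^esub>"
    by (rule nf_eq_zero[OF W(1,2) V(5) M.dens_mono[OF V(4) W(3)] hd y(1)]) (use y(2) in blast)
  finally have "rs U ?W t = \<zero>\<^bsub>T ?W\<^esub>" .
  moreover have "P \<in> ?W" "?W \<subseteq> U" using V(2) VU P h(1) openin_Proj_set[OF U] by blast+
  ultimately show ?thesis using W(1) by blast
qed

text \<open>For \<kappa> x / w the coefficients u^(bd - b s) x s over u^bd w are taken: the powers
  of u bring the x s, of degree d + b s * l, to a common degree. The value of this normal form is
  u^(2 bd) \<kappa> x / (u^(2 bd) w).\<close>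

lemma local_surjective:
  assumes U: "openin (zariski R) U" and P: "P \<in> U" "P \<in> Du" and \<rho>: "\<rho> \<in> regular_sections R N U"
  shows "\<exists>V t. openin (zariski R) V \<and> P \<in> V \<and> V \<subseteq> U \<and> t \<in> carrier (T V) \<and> (\<forall>Q\<in>V. \<psi> Q V t = \<rho> Q)"
proof -
  obtain V d y w where V: "openin (zariski R) V" "P \<in> V" "V \<subseteq> U" "y \<in> mdeg N d" "w \<in> M.dens V d"
    "\<And>Q. Q \<in> V \<Longrightarrow> \<rho> Q = frac R N Q y w"
    by (rule N.frac_sectionE[OF \<rho> P(1)]) (rule that)
  obtain x where x: "\<forall>s<p. x s \<in> mdeg M (d + b s * int l)" "y = \<kappa> x"
    using V(4) unfolding \<kappa>_mdeg by blast
  let ?W = "V \<inter> Du"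
  have W: "openin (zariski R) ?W" "?W \<subseteq> Du" using V open_Du by blast+
  have upd: "up bd \<in> M.dens ?W (bd * int l)" by (rule up_dens[OF W bd_ge(1)])
  have wd: "w \<in> M.dens ?W d" by (rule M.dens_mono[OF V(5)]) blast
  have wud: "up bd \<otimes> w \<in> M.dens ?W (d + bd * int l)"
    using M.dens_mult[OF W(1) upd wd] by (simp add: add.commute)
  have xdeg: "\<forall>s<p. up (bd - b s) \<odot>\<^bsub>M\<^esub> x s \<in> mdeg M (d + bd * int l)"
  proof (intro allI impI)
    fix s assume s: "s < p"
    show "up (bd - b s) \<odot>\<^bsub>M\<^esub> x s \<in> mdeg M (d + bd * int l)"
      using M.mdeg_smult[OF up_deg[OF b_range(2)[OF s]], of "x s" "d + b s * int l"] x(1) s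
      by (simp add: algebra_simps)
  qed
  have xc: "x s \<in> carrier M" if "s < p" for s using x(1) that M.mdeg_carrier by blast
  let ?t = "nf_sum ?W (\<lambda>s. up (bd - b s) \<odot>\<^bsub>M\<^esub> x s) (up bd \<otimes> w)"
  have "\<kappa> (\<lambda>s. up (bd + b s) \<odot>\<^bsub>M\<^esub> (up (bd - b s) \<odot>\<^bsub>M\<^esub> x s)) = \<kappa> (\<lambda>s. (up bd \<otimes> up bd) \<odot>\<^bsub>M\<^esub> x s)"
  proof (rule \<kappa>_cong)
    fix s assume s: "s < p"
    have "up (bd + b s) \<otimes> up (bd - b s) = up bd \<otimes> up bd"
      using up_mult b_range[OF s] bd_ge(1) by simp
    then show "up (bd + b s) \<odot>\<^bsub>M\<^esub> (up (bd - b s) \<odot>\<^bsub>M\<^esub> x s) = (up bd \<otimes> up bd) \<odot>\<^bsub>M\<^esub> x s"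
      using up_carrier xc[OF s] by (simp add: M.smult_assoc1[symmetric])
  qed
  also have "\<dots> = (up bd \<otimes> up bd) \<odot>\<^bsub>N\<^esub> y"
    unfolding x(2) using up_carrier xc by (intro \<kappa>_smult) auto
  finally have \<kappa>: "\<kappa> (\<lambda>s. up (bd + b s) \<odot>\<^bsub>M\<^esub> (up (bd - b s) \<odot>\<^bsub>M\<^esub> x s)) = (up bd \<otimes> up bd) \<odot>\<^bsub>N\<^esub> y" .
  have wc: "w \<in> carrier R" using M.rdeg_carrier[OF M.dens_rdeg[OF wd]] .
  have "\<psi> Q ?W ?t = \<rho> Q" if Q: "Q \<in> ?W" for Q
  proof -
    have prime: "primeideal Q R" using openin_prime[OF W(1) Q] .
    have "\<psi> Q ?W ?t = frac R N Q ((up bd \<otimes> up bd) \<odot>\<^bsub>N\<^esub> y) (up bd \<otimes> (up bd \<otimes> w))"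
      unfolding \<psi>_nf[OF W xdeg wud Q] \<kappa> ..
    also have "up bd \<otimes> (up bd \<otimes> w) = (up bd \<otimes> up bd) \<otimes> w"
      using up_carrier wc by (simp add: M.m_assoc)
    also have "frac R N Q ((up bd \<otimes> up bd) \<odot>\<^bsub>N\<^esub> y) ((up bd \<otimes> up bd) \<otimes> w) = frac R N Q y w"
      by (rule N.frac_cancel[OF prime V(4) M.dens_at[OF wd Q]
          M.den_mult[OF prime M.dens_at[OF upd Q] M.dens_at[OF upd Q]]])
    also have "\<dots> = \<rho> Q" using V(6) Q by simp
    finally show ?thesis .
  qed
  moreover have "?t \<in> carrier (T ?W)" by (rule nf_closed[OF W xdeg wud])
  moreover have "P \<in> ?W" "?W \<subseteq> U" using V P by blast+
  ultimately show ?thesis using W(1) by (intro exI[of _ ?W] exI[of _ ?t] conjI ballI)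
qed

end

end

context twisted_presentation
begin

text \<open>Both conditions of the comparison concern one point at a time, so a different u may be
  used at each point.\<close>

theorem tilde_iso_twist: "sheaf_isomorphic (Proj R) (tilde R N) (twist R (tilde R M) j)"
proof -
  have Du: "\<exists>u\<in>rdeg R (int l). P \<in> Du u" if "openin (zariski R) U" "P \<in> U" for P U
  proof -
    have P: "P \<in> Proj_set R" using openin_Proj_set[OF that(1)] that(2) by blast
    from unit[OF P] obtain u where "u \<in> rdeg R (int l)" "u \<notin> P" by (rule bexE)
    then show ?thesis using P by (intro bexI[of _ u]) (simp_all add: Du_def)
  qed
  interpret comparison: presheaf_comparison R N "presheaf_tensor (Proj R) (tilde R M) (tilde R L)" \<psi>
  proof (rule presheaf_comparisonI)
    fix U P t assume U: "openin (zariski R) U" and P: "P \<in> U" and t: "t \<in> carrier (T U)"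
      "\<psi> P U t = frac R N P \<zero>\<^bsub>N\<^esub> \<one>"
    from Du[OF U P] obtain u where u: "u \<in> rdeg R (int l)" "P \<in> Du u" by (rule bexE)
    show "\<exists>W. openin (zariski R) W \<and> P \<in> W \<and> W \<subseteq> U \<and> rs U W t = \<zero>\<^bsub>T W\<^esub>"
      by (rule local_injective[OF u(1) U P u(2) t])
  next
    fix U P \<rho> assume U: "openin (zariski R) U" and P: "P \<in> U" and \<rho>: "\<rho> \<in> regular_sections R N U"
    from Du[OF U P] obtain u where u: "u \<in> rdeg R (int l)" "P \<in> Du u" by (rule bexE)
    show "\<exists>V t. openin (zariski R) V \<and> P \<in> V \<and> V \<subseteq> U \<and> t \<in> carrier (T V) \<and> (\<forall>Q\<in>V. \<psi> Q V t = \<rho> Q)"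
      by (rule local_surjective[OF u(1) U P u(2) \<rho>])
  qed
  show ?thesis
    unfolding twist_def sheaf_tensor_def twisting_sheaf_def by (rule comparison.tilde_iso_sheafification)
qed

end

section \<open>Tensor products with free modules and cokernels\<close>

lemma abelian_group_transfer:
  assumes "comm_group K" "carrier G = carrier K" "\<zero>\<^bsub>G\<^esub> = \<one>\<^bsub>K\<^esub>"
    and "\<And>x y. \<lbrakk>x \<in> carrier K; y \<in> carrier K\<rbrakk> \<Longrightarrow> x \<oplus>\<^bsub>G\<^esub> y = x \<otimes>\<^bsub>K\<^esub> y"
  shows "abelian_group G"
proof -
  interpret K: comm_group K by fact
  show ?thesis
    by (rule abelian_groupI) (auto simp: assms(2-4) K.m_ac intro: bexI[of _ "inv\<^bsub>K\<^esub> _"] K.l_inv)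
qed

lemma (in Module.module) premodule: "premodule R M"
  by unfold_locales (simp_all add: smult_r_distr smult_assoc1[symmetric] m_comm)

lemma free_module_simps [simp]:
  "carrier (free_module R p b) = {..<p} \<rightarrow>\<^sub>E carrier R"
  "v \<oplus>\<^bsub>free_module R p b\<^esub> w = (\<lambda>t\<in>{..<p}. v t \<oplus>\<^bsub>R\<^esub> w t)"
  "r \<odot>\<^bsub>free_module R p b\<^esub> v = (\<lambda>t\<in>{..<p}. r \<otimes>\<^bsub>R\<^esub> v t)"
  "mdeg (free_module R p b) d = (\<Pi>\<^sub>E t\<in>{..<p}. rdeg R (b t + d))"
  by (simp_all add: free_module_def)

lemma (in graded_cring) premodule_free: "premodule R (free_module R p b)"
  by unfold_locales (auto simp: PiE_iff r_distr m_lcomm intro!: restrict_ext)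

definition unit_vector :: "('a, 'c) ring_scheme \<Rightarrow> nat \<Rightarrow> nat \<Rightarrow> nat \<Rightarrow> 'a" where
  "unit_vector R p s = (\<lambda>t\<in>{..<p}. if t = s then \<one>\<^bsub>R\<^esub> else \<zero>\<^bsub>R\<^esub>)"

text \<open>Tensoring with a free module of rank p amounts to passing to p-tuples over M;
  \<open>coords\<close> and \<open>from_coords\<close> are the two directions of this isomorphism,
  and \<open>b\<close> records the twists that govern degrees.\<close>

locale free_tensor = graded_ring_module R M
  for R :: "'a graded_ring" (structure) and M :: "('a, 'm) graded_module" +
  fixes p :: nat and b :: "nat \<Rightarrow> int"
begin

abbreviation "F \<equiv> free_module R p b"
abbreviation "TF \<equiv> tensor R M F"
abbreviation "pt \<equiv> pure R M F"

sublocale TF: tensor_product R M F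
  by (intro tensor_product.intro premodule premodule_free)

definition power_group :: "(nat \<Rightarrow> 'm) monoid" where
  "power_group = \<lparr>carrier = {..<p} \<rightarrow>\<^sub>E carrier M, monoid.mult = (\<lambda>x y. \<lambda>s\<in>{..<p}. x s \<oplus>\<^bsub>M\<^esub> y s),
     one = (\<lambda>s\<in>{..<p}. \<zero>\<^bsub>M\<^esub>)\<rparr>"

lemma power_group: "comm_group power_group"
proof (rule comm_groupI)
  fix x assume x: "x \<in> carrier power_group"
  show "\<one>\<^bsub>power_group\<^esub> \<otimes>\<^bsub>power_group\<^esub> x = x"
    by (rule extensionalityI[of _ "{..<p}"]) (use x in \<open>auto simp: power_group_def PiE_iff\<close>)
  show "\<exists>y\<in>carrier power_group. y \<otimes>\<^bsub>power_group\<^esub> x = \<one>\<^bsub>power_group\<^esub>"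
    by (rule bexI[of _ "\<lambda>s\<in>{..<p}. \<ominus>\<^bsub>M\<^esub> x s"])
      (use x in \<open>auto simp: power_group_def PiE_iff M.l_neg intro!: restrict_ext\<close>)
qed (auto simp: power_group_def PiE_iff M.a_ac intro!: restrict_ext)

interpretation K: comm_group power_group
  by (rule power_group)

definition coords :: "(('m \<times> (nat \<Rightarrow> 'a)) \<Rightarrow>\<^sub>0 int) set \<Rightarrow> nat \<Rightarrow> 'm" where
  "coords = (SOME h. h \<in> hom (add_monoid TF) power_group \<and>
     (\<forall>x\<in>carrier M. \<forall>v\<in>carrier F. h (pt x v) = (\<lambda>s\<in>{..<p}. v s \<odot>\<^bsub>M\<^esub> x)))"

lemma coords_spec: "coords \<in> hom (add_monoid TF) power_group \<and>
    (\<forall>x\<in>carrier M. \<forall>v\<in>carrier F. coords (pt x v) = (\<lambda>s\<in>{..<p}. v s \<odot>\<^bsub>M\<^esub> x))"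
proof -
  obtain h where "h \<in> hom (add_monoid TF) power_group"
    "\<And>x v. \<lbrakk>x \<in> carrier M; v \<in> carrier F\<rbrakk> \<Longrightarrow> h (pt x v) = (\<lambda>s\<in>{..<p}. v s \<odot>\<^bsub>M\<^esub> x)"
    by (rule TF.tensor_lift[OF power_group, of "\<lambda>x v. \<lambda>s\<in>{..<p}. v s \<odot>\<^bsub>M\<^esub> x"])
      (auto simp: power_group_def PiE_iff smult_r_distr smult_l_distr smult_assoc1[symmetric] m_comm
        intro!: restrict_ext)
  then have "\<exists>h. h \<in> hom (add_monoid TF) power_group \<and>
      (\<forall>x\<in>carrier M. \<forall>v\<in>carrier F. h (pt x v) = (\<lambda>s\<in>{..<p}. v s \<odot>\<^bsub>M\<^esub> x))"
    by (intro exI[of _ h]) simp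
  from someI_ex[OF this] show ?thesis by (fold coords_def)
qed

lemma coords_hom: "group_hom (add_monoid TF) power_group coords"
  using coords_spec TF.T.a_group by (simp add: group_hom_def group_hom_axioms_def)

lemma coords_pure: "\<lbrakk>x \<in> carrier M; v \<in> carrier F\<rbrakk> \<Longrightarrow> coords (pt x v) = (\<lambda>s\<in>{..<p}. v s \<odot>\<^bsub>M\<^esub> x)"
  using coords_spec by blast

lemma coords_closed: "t \<in> carrier TF \<Longrightarrow> coords t \<in> {..<p} \<rightarrow>\<^sub>E carrier M"
  using group_hom.hom_closed[OF coords_hom, of t] by (simp add: power_group_def)

lemma coords_carrier: "\<lbrakk>t \<in> carrier TF; s < p\<rbrakk> \<Longrightarrow> coords t s \<in> carrier M"
  using coords_closed[of t] by (auto simp: PiE_iff)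

lemma coords_add: "\<lbrakk>t \<in> carrier TF; t' \<in> carrier TF\<rbrakk> \<Longrightarrow>
    coords (t \<oplus>\<^bsub>TF\<^esub> t') = (\<lambda>s\<in>{..<p}. coords t s \<oplus>\<^bsub>M\<^esub> coords t' s)"
  using group_hom.hom_mult[OF coords_hom, of t t'] by (simp add: power_group_def)

lemma coords_zero: "coords \<zero>\<^bsub>TF\<^esub> = (\<lambda>s\<in>{..<p}. \<zero>\<^bsub>M\<^esub>)"
  using group_hom.hom_one[OF coords_hom] by (simp add: power_group_def)

lemma coords_minus: "\<lbrakk>t \<in> carrier TF; s < p\<rbrakk> \<Longrightarrow> coords (\<ominus>\<^bsub>TF\<^esub> t) s = \<ominus>\<^bsub>M\<^esub> coords t s"
proof -
  assume t: "t \<in> carrier TF" and s: "s < p"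
  have "coords (\<ominus>\<^bsub>TF\<^esub> t) s \<oplus>\<^bsub>M\<^esub> coords t s = \<zero>\<^bsub>M\<^esub>"
    using fun_cong[OF coords_add[of "\<ominus>\<^bsub>TF\<^esub> t" t], of s] t s coords_zero by (simp add: TF.T.l_neg)
  then show ?thesis using coords_carrier[OF _ s] t by (intro M.minus_equality[symmetric]) auto
qed

lemma coords_smult:
  assumes r: "r \<in> carrier R" and t: "t \<in> carrier TF"
  shows "coords (r \<odot>\<^bsub>TF\<^esub> t) = (\<lambda>s\<in>{..<p}. r \<odot>\<^bsub>M\<^esub> coords t s)"
proof -
  interpret r: abelian_group_hom TF TF "\<lambda>t. r \<odot>\<^bsub>TF\<^esub> t" by (rule TF.smult_hom[OF r])
  have 1: "(\<lambda>t. coords (r \<odot>\<^bsub>TF\<^esub> t)) \<in> hom (add_monoid TF) power_group"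
    using hom_compose[OF group_hom.homh[OF r.a_group_hom] group_hom.homh[OF coords_hom]]
    by (simp add: o_def)
  have 2: "(\<lambda>t. \<lambda>s\<in>{..<p}. r \<odot>\<^bsub>M\<^esub> coords t s) \<in> hom (add_monoid TF) power_group"
    by (rule homI)
      (use r coords_carrier in \<open>auto simp: power_group_def coords_add smult_r_distr intro!: restrict_ext\<close>)
  show ?thesis
  proof (rule TF.group_hom_eqI[OF K.is_group 1 2 _ t])
    fix x v assume xv: "x \<in> carrier M" "v \<in> carrier F"
    then have "v s \<in> carrier R" if "s < p" for s using that by (auto simp: PiE_iff)
    with xv r show "coords (r \<odot>\<^bsub>TF\<^esub> pt x v) = (\<lambda>s\<in>{..<p}. r \<odot>\<^bsub>M\<^esub> coords (pt x v) s)"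
      unfolding TF.smult_pure[OF r xv] coords_pure[OF smult_closed[OF r xv(1)] xv(2)] coords_pure[OF xv]
      by (intro restrict_ext) (simp add: smult_lcomm)
  qed
qed

definition from_coords :: "(nat \<Rightarrow> 'm) \<Rightarrow> (('m \<times> (nat \<Rightarrow> 'a)) \<Rightarrow>\<^sub>0 int) set" where
  "from_coords x = (\<Oplus>\<^bsub>TF\<^esub>s\<in>{..<p}. pt (x s) (unit_vector R p s))"

lemma unit_vector_carrier: "unit_vector R p s \<in> carrier F"
  by (auto simp: unit_vector_def)

lemma summand_closed: "\<forall>s<p. x s \<in> carrier M \<Longrightarrow> s < p \<Longrightarrow> pt (x s) (unit_vector R p s) \<in> carrier TF"
  using TF.pure_closed[OF _ unit_vector_carrier] by blast

lemma from_coords_closed: "\<forall>s<p. x s \<in> carrier M \<Longrightarrow> from_coords x \<in> carrier TF"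
  unfolding from_coords_def using summand_closed by (intro TF.T.finsum_closed) auto

lemma from_coords_cong: "(\<And>s. s < p \<Longrightarrow> x s = y s) \<Longrightarrow> \<forall>s<p. y s \<in> carrier M \<Longrightarrow> from_coords x = from_coords y"
  unfolding from_coords_def using summand_closed by (intro TF.T.finsum_cong') auto

lemma from_coords_add:
  assumes "\<forall>s<p. x s \<in> carrier M" "\<forall>s<p. y s \<in> carrier M"
  shows "from_coords (\<lambda>s. x s \<oplus>\<^bsub>M\<^esub> y s) = from_coords x \<oplus>\<^bsub>TF\<^esub> from_coords y"
proof -
  have "from_coords (\<lambda>s. x s \<oplus>\<^bsub>M\<^esub> y s) =
      (\<Oplus>\<^bsub>TF\<^esub>s\<in>{..<p}. pt (x s) (unit_vector R p s) \<oplus>\<^bsub>TF\<^esub> pt (y s) (unit_vector R p s))"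
    unfolding from_coords_def using assms summand_closed
    by (intro TF.T.finsum_cong') (auto simp: TF.pure_add_left[OF _ _ unit_vector_carrier])
  also have "\<dots> = from_coords x \<oplus>\<^bsub>TF\<^esub> from_coords y"
    unfolding from_coords_def using assms summand_closed by (intro TF.T.finsum_addf) auto
  finally show ?thesis .
qed

text \<open>Induction over partial sums: the coordinates of the first k summands are the first k
  entries of x, followed by zeros.\<close>

lemma coords_from_coords:
  assumes x: "\<forall>s<p. x s \<in> carrier M"
  shows "coords (from_coords x) = restrict x {..<p}"
proof -
  have "coords (\<Oplus>\<^bsub>TF\<^esub>s\<in>{..<k}. pt (x s) (unit_vector R p s)) =
      (\<lambda>s\<in>{..<p}. if s < k then x s else \<zero>\<^bsub>M\<^esub>)" if "k \<le> p" for k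
    using that
  proof (induction k)
    case 0
    then show ?case by (simp add: coords_zero)
  next
    case (Suc k)
    then have k: "k < p" "x k \<in> carrier M" using x by auto
    have c: "(\<lambda>s. pt (x s) (unit_vector R p s)) \<in> {..<k} \<rightarrow> carrier TF"
      using summand_closed[OF x] k by auto
    have "(\<Oplus>\<^bsub>TF\<^esub>s\<in>{..<Suc k}. pt (x s) (unit_vector R p s)) =
        pt (x k) (unit_vector R p k) \<oplus>\<^bsub>TF\<^esub> (\<Oplus>\<^bsub>TF\<^esub>s\<in>{..<k}. pt (x s) (unit_vector R p s))"
      using c summand_closed[OF x k(1)] by (simp add: lessThan_Suc)
    then have "coords (\<Oplus>\<^bsub>TF\<^esub>s\<in>{..<Suc k}. pt (x s) (unit_vector R p s)) =
        (\<lambda>s\<in>{..<p}. coords (pt (x k) (unit_vector R p k)) s \<oplus>\<^bsub>M\<^esub>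
          coords (\<Oplus>\<^bsub>TF\<^esub>s\<in>{..<k}. pt (x s) (unit_vector R p s)) s)"
      using coords_add[OF summand_closed[OF x k(1)] TF.T.finsum_closed[OF c]] by (simp only:)
    also have "\<dots> = (\<lambda>s\<in>{..<p}. if s < Suc k then x s else \<zero>\<^bsub>M\<^esub>)"
      unfolding coords_pure[OF k(2) unit_vector_carrier] Suc.IH[OF less_imp_le[OF k(1)]]
      using x k by (intro restrict_ext) (auto simp: unit_vector_def less_Suc_eq)
    finally show ?case .
  qed
  from this[of p] show ?thesis unfolding from_coords_def by (auto intro!: restrict_ext)
qed

text \<open>Both sides are homomorphisms, so pure tensors suffice. There x \<otimes> v is the sum of
  the x \<otimes> (v s e s), which balancing turns into the sum of the (v s x) \<otimes> e s, for e
  s the unit vectors.\<close>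

lemma from_coords_coords:
  assumes t: "t \<in> carrier TF"
  shows "from_coords (coords t) = t"
proof -
  have 1: "(\<lambda>t. from_coords (coords t)) \<in> hom (add_monoid TF) (add_monoid TF)"
  proof (rule homI)
    fix t t' assume t: "t \<in> carrier (add_monoid TF)" "t' \<in> carrier (add_monoid TF)"
    have "from_coords (coords (t \<oplus>\<^bsub>TF\<^esub> t')) = from_coords (\<lambda>s. coords t s \<oplus>\<^bsub>M\<^esub> coords t' s)"
      using t coords_carrier by (intro from_coords_cong) (auto simp: coords_add)
    then show "from_coords (coords (t \<otimes>\<^bsub>add_monoid TF\<^esub> t')) =
        from_coords (coords t) \<otimes>\<^bsub>add_monoid TF\<^esub> from_coords (coords t')"
      using t coords_carrier by (simp add: from_coords_add)
  qed (use coords_carrier in \<open>auto intro!: from_coords_closed\<close>)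
  have 2: "(\<lambda>t. t) \<in> hom (add_monoid TF) (add_monoid TF)" by (rule homI) auto
  show ?thesis
  proof (rule TF.group_hom_eqI[OF TF.T.a_group 1 2 _ t])
    fix x v assume xv: "x \<in> carrier M" "v \<in> carrier F"
    then have vc: "v s \<in> carrier R" if "s < p" for s using that by (auto simp: PiE_iff)
    define w where "w k = (\<lambda>s\<in>{..<p}. if s < k then v s else \<zero>)" for k
    have w: "w k \<in> carrier F" for k using vc by (auto simp: w_def)
    have vx: "\<forall>s<p. v s \<odot>\<^bsub>M\<^esub> x \<in> carrier M" using vc xv by blast
    have "(\<Oplus>\<^bsub>TF\<^esub>s\<in>{..<k}. pt (v s \<odot>\<^bsub>M\<^esub> x) (unit_vector R p s)) = pt x (w k)" if "k \<le> p" for k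
      using that
    proof (induction k)
      case 0
      \<comment> \<open>\<open>w 0\<close> is the zero vector; a pure tensor with it equals its own
        double and hence is zero.\<close>
      have "w 0 \<oplus>\<^bsub>F\<^esub> w 0 = w 0" by (auto simp: w_def intro!: restrict_ext)
      then have "pt x (w 0) \<oplus>\<^bsub>TF\<^esub> pt x (w 0) = pt x (w 0)"
        using TF.pure_add_right[OF xv(1) w w, of 0 0] by simp
      then show ?case using TF.pure_closed[OF xv(1) w, of 0] by simp
    next
      case (Suc k)
      then have k: "k < p" by simp
      have c: "(\<lambda>s. pt (v s \<odot>\<^bsub>M\<^esub> x) (unit_vector R p s)) \<in> {..<k} \<rightarrow> carrier TF"
        using summand_closed[OF vx] k by auto
      have "(\<Oplus>\<^bsub>TF\<^esub>s\<in>{..<Suc k}. pt (v s \<odot>\<^bsub>M\<^esub> x) (unit_vector R p s)) =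
          pt (v k \<odot>\<^bsub>M\<^esub> x) (unit_vector R p k) \<oplus>\<^bsub>TF\<^esub> pt x (w k)"
        using c summand_closed[OF vx k] Suc by (simp add: lessThan_Suc)
      also have "pt (v k \<odot>\<^bsub>M\<^esub> x) (unit_vector R p k) = pt x (v k \<odot>\<^bsub>F\<^esub> unit_vector R p k)"
        by (rule TF.pure_balanced[OF vc[OF k] xv(1) unit_vector_carrier])
      also have "pt x (v k \<odot>\<^bsub>F\<^esub> unit_vector R p k) \<oplus>\<^bsub>TF\<^esub> pt x (w k) =
          pt x (v k \<odot>\<^bsub>F\<^esub> unit_vector R p k \<oplus>\<^bsub>F\<^esub> w k)"
        by (rule TF.pure_add_right[OF xv(1) _ w, symmetric]) (use vc[OF k] in \<open>auto simp: unit_vector_def\<close>)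
      also have "v k \<odot>\<^bsub>F\<^esub> unit_vector R p k \<oplus>\<^bsub>F\<^esub> w k = w (Suc k)"
        using vc vc[OF k] by (auto simp: w_def unit_vector_def less_Suc_eq intro!: restrict_ext)
      finally show ?case .
    qed
    from this[of p] have "(\<Oplus>\<^bsub>TF\<^esub>s\<in>{..<p}. pt (v s \<odot>\<^bsub>M\<^esub> x) (unit_vector R p s)) = pt x (w p)" by simp
    also have "w p = v" using xv(2) by (auto simp: w_def PiE_iff extensional_def)
    also have "(\<Oplus>\<^bsub>TF\<^esub>s\<in>{..<p}. pt (v s \<odot>\<^bsub>M\<^esub> x) (unit_vector R p s)) = from_coords (coords (pt x v))"
      unfolding from_coords_def coords_pure[OF xv]
      using summand_closed[OF vx] by (intro TF.T.finsum_cong') auto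
    finally show "from_coords (coords (pt x v)) = pt x v" .
  qed
qed

lemma from_coords_smult:
  assumes r: "r \<in> carrier R" and x: "\<forall>s<p. x s \<in> carrier M"
  shows "from_coords (\<lambda>s. r \<odot>\<^bsub>M\<^esub> x s) = r \<odot>\<^bsub>TF\<^esub> from_coords x"
proof -
  have "r \<odot>\<^bsub>TF\<^esub> from_coords x = from_coords (coords (r \<odot>\<^bsub>TF\<^esub> from_coords x))"
    using from_coords_coords[OF TF.smult_closed[OF r from_coords_closed[OF x]]] ..
  also have "\<dots> = from_coords (\<lambda>s. r \<odot>\<^bsub>M\<^esub> x s)"
    unfolding coords_smult[OF r from_coords_closed[OF x]] coords_from_coords[OF x]
    using r x by (intro from_coords_cong) auto
  finally show ?thesis ..
qed

abbreviation "GF \<equiv> graded_tensor R M F"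

lemma graded_tensor_simps [simp]:
  "carrier GF = carrier TF" "\<zero>\<^bsub>GF\<^esub> = \<zero>\<^bsub>TF\<^esub>" "t \<oplus>\<^bsub>GF\<^esub> t' = t \<oplus>\<^bsub>TF\<^esub> t'" "r \<odot>\<^bsub>GF\<^esub> t = r \<odot>\<^bsub>TF\<^esub> t"
  by (simp_all add: graded_tensor_def Let_def)

lemma graded_tensor_group: "abelian_group GF"
  by (rule abelian_group_transfer[OF TF.T.a_comm_group]) simp_all

text \<open>Homogeneous pure tensors of total degree d have coordinates in the stated degrees, and
  tensors with such coordinates form a subgroup. Conversely each x s \<otimes> e s is one of these
  pure tensors, because the unit vector e s has degree - b s.\<close>

lemma mdeg_graded_tensor: "mdeg GF d = from_coords ` {x. \<forall>s<p. x s \<in> mdeg M (b s + d)}"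
proof -
  let ?G = "{pt x v |x v. \<exists>e. x \<in> mdeg M e \<and> v \<in> mdeg F (d - e)}"
  let ?H = "{t \<in> carrier TF. \<forall>s<p. coords t s \<in> mdeg M (b s + d)}"
  have G: "mdeg GF d = generate (add_monoid TF) ?G"
    by (simp add: graded_tensor_def Let_def pure_def)
  have FE: "v \<in> carrier F" "\<And>s. s < p \<Longrightarrow> v s \<in> rdeg R (b s + e)" if "v \<in> mdeg F e" for v e
    using that rdeg_carrier by (auto simp: PiE_iff)
  have GH: "?G \<subseteq> ?H"
  proof clarify
    fix x v e assume x: "x \<in> mdeg M e" and v: "v \<in> mdeg F (d - e)"
    have "v s \<odot>\<^bsub>M\<^esub> x \<in> mdeg M (b s + d)" if "s < p" for s
      using mdeg_smult[OF FE(2)[OF v that] x] by simp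
    then show "pt x v \<in> carrier TF \<and> (\<forall>s<p. coords (pt x v) s \<in> mdeg M (b s + d))"
      using TF.pure_closed[OF mdeg_carrier[OF x] FE(1)[OF v]] coords_pure[OF mdeg_carrier[OF x] FE(1)[OF v]]
      by simp
  qed
  have H: "subgroup ?H (add_monoid TF)"
  proof (rule subgroup.intro)
    show "\<one>\<^bsub>add_monoid TF\<^esub> \<in> ?H" using coords_zero mdeg_zero by simp
  next
    fix t assume "t \<in> ?H"
    then show "inv\<^bsub>add_monoid TF\<^esub> t \<in> ?H"
      using coords_minus mdeg_minus by (simp add: a_inv_def[symmetric])
  qed (auto simp: coords_add mdeg_add)
  have "generate (add_monoid TF) ?G \<subseteq> ?H"
    by (rule TF.T.add.generate_subgroup_incl[OF GH H])
  moreover have "?H \<subseteq> from_coords ` {x. \<forall>s<p. x s \<in> mdeg M (b s + d)}"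
    using from_coords_coords by (force intro: image_eqI)
  moreover have "from_coords x \<in> generate (add_monoid TF) ?G"
    if x: "\<forall>s<p. x s \<in> mdeg M (b s + d)" for x
  proof -
    have sub: "subgroup (generate (add_monoid TF) ?G) (add_monoid TF)"
      using GH by (intro TF.T.add.generate_is_subgroup) auto
    have gen: "pt (x s) (unit_vector R p s) \<in> generate (add_monoid TF) ?G" if s: "s < p" for s
    proof (rule generate.incl)
      have "unit_vector R p s \<in> mdeg F (d - (b s + d))"
        using rdeg_one rdeg_zero by (auto simp: unit_vector_def)
      then show "pt (x s) (unit_vector R p s) \<in> ?G" using x s by blast
    qed
    have "(\<Oplus>\<^bsub>TF\<^esub>s\<in>I. pt (x s) (unit_vector R p s)) \<in> generate (add_monoid TF) ?G"
      if "finite I" "I \<subseteq> {..<p}" for I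
      using that
    proof (induction I rule: finite_induct)
      case empty
      then show ?case using subgroup.one_closed[OF sub] by simp
    next
      case (insert i I)
      then have "(\<lambda>s. pt (x s) (unit_vector R p s)) \<in> I \<rightarrow> carrier TF"
        "pt (x i) (unit_vector R p i) \<in> carrier TF"
        using subgroup.subset[OF sub] gen by auto
      then show ?case using insert gen[of i] subgroup.m_closed[OF sub] by simp
    qed
    then show ?thesis unfolding from_coords_def by simp
  qed
  ultimately show ?thesis unfolding G by blast
qed

end

section \<open>Homogeneous components of module elements\<close>

context graded_module
begin

definition component :: "'b \<Rightarrow> int \<Rightarrow> 'b" where
  "component x = (THE f. (\<forall>d. f d \<in> mdeg M d) \<and> finite {d. f d \<noteq> \<zero>\<^bsub>M\<^esub>} \<and> x = finsum M f {d. f d \<noteq> \<zero>\<^bsub>M\<^esub>})"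

lemma mdeg_sub: "x \<in> mdeg M d \<Longrightarrow> x \<in> carrier M"
  using additive_subgroup.a_subset[OF mdeg_subgroup] by blast

text \<open>The index set B may exceed the support, so components can be identified without knowing
  which of them vanish.\<close>

lemma component_eqI:
  assumes g: "\<And>d. g d \<in> mdeg M d" and B: "finite B" "\<And>d. d \<notin> B \<Longrightarrow> g d = \<zero>\<^bsub>M\<^esub>" and x: "x = finsum M g B"
  shows "component x = g"
proof -
  have gc: "g d \<in> carrier M" for d using g mdeg_sub by blast
  have supp: "{d. g d \<noteq> \<zero>\<^bsub>M\<^esub>} \<subseteq> B" using B(2) by auto
  have "finsum M g B = finsum M g {d. g d \<noteq> \<zero>\<^bsub>M\<^esub>}"
    using supp B(1) gc by (intro M.add.finprod_mono_neutral_cong_right) auto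
  with x have spec: "(\<forall>d. g d \<in> mdeg M d) \<and> finite {d. g d \<noteq> \<zero>\<^bsub>M\<^esub>} \<and> x = finsum M g {d. g d \<noteq> \<zero>\<^bsub>M\<^esub>}"
    using g finite_subset[OF supp B(1)] by simp
  have "x \<in> carrier M" unfolding x using gc by (intro M.finsum_closed) auto
  then show ?thesis unfolding component_def using spec by (rule the1_equality[OF mdeg_direct_sum])
qed

lemma component_spec:
  assumes "x \<in> carrier M"
  shows "component x d \<in> mdeg M d" "finite {d. component x d \<noteq> \<zero>\<^bsub>M\<^esub>}"
    "x = finsum M (component x) {d. component x d \<noteq> \<zero>\<^bsub>M\<^esub>}"
  using theI'[OF mdeg_direct_sum[OF assms]] unfolding component_def[symmetric] by blast+

lemma component_carrier: "x \<in> carrier M \<Longrightarrow> component x d \<in> carrier M"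
  using component_spec(1) mdeg_sub by blast

lemma component_homogeneous:
  assumes "x \<in> mdeg M d"
  shows "component x e = (if e = d then x else \<zero>\<^bsub>M\<^esub>)"
proof -
  have "component x = (\<lambda>e. if e = d then x else \<zero>\<^bsub>M\<^esub>)"
  proof (rule component_eqI)
    show "x = finsum M (\<lambda>e. if e = d then x else \<zero>\<^bsub>M\<^esub>) {d}"
      using mdeg_sub[OF assms] by simp
  qed (use assms additive_subgroup.zero_closed[OF mdeg_subgroup] in auto)
  then show ?thesis by simp
qed

lemma component_add:
  assumes "x \<in> carrier M" "y \<in> carrier M"
  shows "component (x \<oplus>\<^bsub>M\<^esub> y) d = component x d \<oplus>\<^bsub>M\<^esub> component y d"
proof -
  let ?B = "{d. component x d \<noteq> \<zero>\<^bsub>M\<^esub>} \<union> {d. component y d \<noteq> \<zero>\<^bsub>M\<^esub>}"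
  have B: "finite ?B" using component_spec(2)[OF assms(1)] component_spec(2)[OF assms(2)] by simp
  have *: "z = finsum M (component z) ?B" if "z \<in> carrier M" "{d. component z d \<noteq> \<zero>\<^bsub>M\<^esub>} \<subseteq> ?B" for z
  proof -
    have "finsum M (component z) {d. component z d \<noteq> \<zero>\<^bsub>M\<^esub>} = finsum M (component z) ?B"
      using that B component_carrier[OF that(1)] by (intro M.add.finprod_mono_neutral_cong_left) auto
    then show ?thesis using component_spec(3)[OF that(1)] by simp
  qed
  have "component (x \<oplus>\<^bsub>M\<^esub> y) = (\<lambda>d. component x d \<oplus>\<^bsub>M\<^esub> component y d)"
  proof (rule component_eqI[OF _ B])
    show "x \<oplus>\<^bsub>M\<^esub> y = finsum M (\<lambda>d. component x d \<oplus>\<^bsub>M\<^esub> component y d) ?B"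
      using *[OF assms(1)] *[OF assms(2)] component_carrier assms by (subst M.finsum_addf) auto
  qed (use component_spec(1) assms additive_subgroup.a_closed[OF mdeg_subgroup] in auto)
  then show ?thesis by simp
qed

text \<open>Multiplication by r moves the component of degree d - k to degree d. The index set used
  is the support of x translated by k, which may exceed the support of the product.\<close>

lemma component_smult:
  assumes r: "r \<in> rdeg R k" "r \<in> carrier R" and x: "x \<in> carrier M"
  shows "component (r \<odot>\<^bsub>M\<^esub> x) d = r \<odot>\<^bsub>M\<^esub> component x (d - k)"
proof -
  let ?S = "{d. component x d \<noteq> \<zero>\<^bsub>M\<^esub>}"
  let ?B = "(\<lambda>d. d + k) ` ?S"
  have "component (r \<odot>\<^bsub>M\<^esub> x) = (\<lambda>d. r \<odot>\<^bsub>M\<^esub> component x (d - k))"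
  proof (rule component_eqI)
    show "r \<odot>\<^bsub>M\<^esub> component x (d - k) \<in> mdeg M d" for d
      using mdeg_smult[OF r(1) component_spec(1)[OF x, of "d - k"]] by simp
    show "finite ?B" using component_spec(2)[OF x] by simp
    show "r \<odot>\<^bsub>M\<^esub> component x (d - k) = \<zero>\<^bsub>M\<^esub>" if "d \<notin> ?B" for d
    proof -
      have "d - k \<notin> ?S" using that by force
      then show ?thesis using r by simp
    qed
    have "r \<odot>\<^bsub>M\<^esub> x = r \<odot>\<^bsub>M\<^esub> finsum M (component x) ?S" using component_spec(3)[OF x] by simp
    also have "\<dots> = finsum M (\<lambda>d. r \<odot>\<^bsub>M\<^esub> component x d) ?S"
      using component_spec(2)[OF x] component_carrier[OF x] r by (intro finsum_smult_ldistr) auto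
    also have "\<dots> = finsum M (\<lambda>d. r \<odot>\<^bsub>M\<^esub> component x ((d + k) - k)) ?S" by simp
    also have "\<dots> = finsum M (\<lambda>d. r \<odot>\<^bsub>M\<^esub> component x (d - k)) ?B"
      using component_carrier[OF x] r
      by (intro M.add.finprod_reindex[symmetric, where h = "\<lambda>d. d + k"]) (auto simp: inj_on_def)
    finally show "r \<odot>\<^bsub>M\<^esub> x = finsum M (\<lambda>d. r \<odot>\<^bsub>M\<^esub> component x (d - k)) ?B" .
  qed
  then show ?thesis by simp
qed

lemma component_finsum:
  assumes "finite I" "\<And>i. i \<in> I \<Longrightarrow> f i \<in> carrier M"
  shows "component (finsum M f I) d = finsum M (\<lambda>i. component (f i) d) I"
  using assms
proof (induction I rule: finite_induct)
  case empty
  then show ?case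
    using component_homogeneous[OF additive_subgroup.zero_closed[OF mdeg_subgroup], of d d] by simp
next
  case (insert i I)
  then have "f \<in> I \<rightarrow> carrier M" "(\<lambda>i. component (f i) d) \<in> I \<rightarrow> carrier M"
    using component_carrier by auto
  then show ?case using insert component_carrier by (simp add: component_add)
qed

end

text \<open>Here b and c are the twists of the two free modules themselves; in the application they
  are the multiples b s * l and c t * l.\<close>

locale graded_cokernel = graded_ring_module R M + graded: graded_module R M
  for R :: "'a graded_ring" (structure) and M :: "('a, 'm) graded_module" +
  fixes p q :: nat and b c :: "nat \<Rightarrow> int" and A :: "nat \<Rightarrow> nat \<Rightarrow> 'a"
  assumes A_deg: "\<lbrakk>s < p; t < q\<rbrakk> \<Longrightarrow> A s t \<in> rdeg R (b s - c t)"
begin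

sublocale F: free_tensor R M p b
  by (intro free_tensor.intro graded_ring_module_axioms)

sublocale G: free_tensor R M q c
  by (intro free_tensor.intro graded_ring_module_axioms)

abbreviation "\<Phi> \<equiv> matrix_map R p q A"
abbreviation "f \<equiv> tensor_map R M F.F id \<Phi>"
abbreviation "L \<equiv> f ` carrier G.TF"
abbreviation "C \<equiv> graded_coker G.GF F.GF f"

lemma A_carrier: "\<lbrakk>s < p; t < q\<rbrakk> \<Longrightarrow> A s t \<in> carrier R"
  using A_deg rdeg_carrier by blast

lemma matrix_map_closed: "v \<in> carrier G.F \<Longrightarrow> \<Phi> v \<in> carrier F.F"
  unfolding matrix_map_def using A_carrier by (auto simp: PiE_iff intro!: finsum_closed)

lemma matrix_map_at: "s < p \<Longrightarrow> \<Phi> v s = (\<Oplus>t\<in>{..<q}. A s t \<otimes> v t)"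
  unfolding matrix_map_def by simp

sublocale f: tensor_product_map R M G.F R M F.F "\<lambda>r. r" id \<Phi>
proof
  fix v w assume vw: "v \<in> carrier G.F" "w \<in> carrier G.F"
  then have c: "v t \<in> carrier R" "w t \<in> carrier R" if "t < q" for t using that by (auto simp: PiE_iff)
  show "\<Phi> (v \<oplus>\<^bsub>G.F\<^esub> w) = \<Phi> v \<oplus>\<^bsub>F.F\<^esub> \<Phi> w"
    unfolding free_module_simps
  proof (rule extensionalityI[of _ "{..<p}"])
    fix s assume s: "s \<in> {..<p}"
    have "(\<Oplus>t\<in>{..<q}. A s t \<otimes> (v t \<oplus> w t)) = (\<Oplus>t\<in>{..<q}. (A s t \<otimes> v t) \<oplus> (A s t \<otimes> w t))"
      using c A_carrier s by (intro ring_finsum_cong) (auto simp: r_distr)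
    also have "\<dots> = (\<Oplus>t\<in>{..<q}. A s t \<otimes> v t) \<oplus> (\<Oplus>t\<in>{..<q}. A s t \<otimes> w t)"
      using c A_carrier s by (intro ring_finsum_addf) auto
    also have "(\<Oplus>t\<in>{..<q}. A s t \<otimes> (v t \<oplus> w t)) = \<Phi> (\<lambda>t\<in>{..<q}. v t \<oplus> w t) s"
      unfolding matrix_map_at[OF s[unfolded lessThan_iff]]
      using c A_carrier s by (intro ring_finsum_cong) auto
    finally show "\<Phi> (\<lambda>t\<in>{..<q}. v t \<oplus> w t) s = (\<lambda>s\<in>{..<p}. \<Phi> v s \<oplus> \<Phi> w s) s"
      using s by (simp add: matrix_map_at)
  qed (auto simp: matrix_map_def)
next
  fix r v assume r: "r \<in> carrier R" and v: "v \<in> carrier G.F"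
  then have c: "v t \<in> carrier R" if "t < q" for t using that by (auto simp: PiE_iff)
  show "\<Phi> (r \<odot>\<^bsub>G.F\<^esub> v) = r \<odot>\<^bsub>F.F\<^esub> \<Phi> v"
    unfolding free_module_simps
  proof (rule extensionalityI[of _ "{..<p}"])
    fix s assume s: "s \<in> {..<p}"
    have "r \<otimes> (\<Oplus>t\<in>{..<q}. A s t \<otimes> v t) = (\<Oplus>t\<in>{..<q}. r \<otimes> (A s t \<otimes> v t))"
      using c A_carrier s r by (intro finsum_rdistr) auto
    also have "\<dots> = (\<Oplus>t\<in>{..<q}. A s t \<otimes> (r \<otimes> v t))"
      using c A_carrier s r by (intro ring_finsum_cong) (auto simp: m_lcomm)
    also have "\<dots> = \<Phi> (\<lambda>t\<in>{..<q}. r \<otimes> v t) s"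
      unfolding matrix_map_at[OF s[unfolded lessThan_iff]]
      using c A_carrier s r by (intro ring_finsum_cong) auto
    finally show "\<Phi> (\<lambda>t\<in>{..<q}. r \<otimes> v t) s = (\<lambda>s\<in>{..<p}. r \<otimes> \<Phi> v s) s"
      using s by (simp add: matrix_map_at)
  qed (auto simp: matrix_map_def)
qed (use matrix_map_closed in auto)

text \<open>In coordinates the map M \<otimes> \<Phi> is multiplication of tuples by A. By
  additivity it is enough to look at w t \<otimes> e t, and \<Phi> sends the unit vector e t to the
  t-th column.\<close>

lemma coords_image:
  assumes w: "\<forall>t<q. w t \<in> carrier M" and s: "s < p"
  shows "F.coords (f (G.from_coords w)) s = (\<Oplus>\<^bsub>M\<^esub>t\<in>{..<q}. A s t \<odot>\<^bsub>M\<^esub> w t)"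
proof -
  have unit: "\<Phi> (unit_vector R q t) s = A s t" if "t < q" for t
  proof -
    have "\<Phi> (unit_vector R q t) s = (\<Oplus>t'\<in>{..<q}. if t = t' then A s t' else \<zero>)"
      unfolding matrix_map_at[OF s] unit_vector_def
      using A_carrier[OF s] by (intro ring_finsum_cong) auto
    also have "\<dots> = A s t"
      using ring_finsum_singleton[of t "{..<q}" "A s"] that A_carrier[OF s] by simp
    finally show ?thesis .
  qed
  have "F.coords (f (\<Oplus>\<^bsub>G.TF\<^esub>t\<in>{..<k}. G.pt (w t) (unit_vector R q t))) s = (\<Oplus>\<^bsub>M\<^esub>t\<in>{..<k}. A s t \<odot>\<^bsub>M\<^esub> w t)"
    if "k \<le> q" for k
    using that
  proof (induction k)
    case 0
    then show ?case using s F.coords_zero by (simp del: id_apply)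
  next
    case (Suc k)
    then have k: "k < q" "w k \<in> carrier M" using w by auto
    have c: "(\<lambda>t. G.pt (w t) (unit_vector R q t)) \<in> {..<k} \<rightarrow> carrier G.TF"
      "G.pt (w k) (unit_vector R q k) \<in> carrier G.TF"
      using G.summand_closed[OF w] k by auto
    have cM: "(\<lambda>t. A s t \<odot>\<^bsub>M\<^esub> w t) \<in> {..<k} \<rightarrow> carrier M" using A_carrier[OF s] w k by auto
    note fin = G.TF.T.finsum_closed[OF c(1)]
    have "f (\<Oplus>\<^bsub>G.TF\<^esub>t\<in>{..<Suc k}. G.pt (w t) (unit_vector R q t)) =
        f (G.pt (w k) (unit_vector R q k)) \<oplus>\<^bsub>F.TF\<^esub> f (\<Oplus>\<^bsub>G.TF\<^esub>t\<in>{..<k}. G.pt (w t) (unit_vector R q t))"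
      using c fin by (simp add: lessThan_Suc f.tensor_map_add)
    also have "f (G.pt (w k) (unit_vector R q k)) = F.pt (w k) (\<Phi> (unit_vector R q k))"
      using f.tensor_map_pure[OF k(2) G.unit_vector_carrier] by simp
    finally have eq: "f (\<Oplus>\<^bsub>G.TF\<^esub>t\<in>{..<Suc k}. G.pt (w t) (unit_vector R q t)) =
        F.pt (w k) (\<Phi> (unit_vector R q k)) \<oplus>\<^bsub>F.TF\<^esub> f (\<Oplus>\<^bsub>G.TF\<^esub>t\<in>{..<k}. G.pt (w t) (unit_vector R q t))" .
    note v = matrix_map_closed[OF G.unit_vector_carrier]
    show ?case
      unfolding eq F.coords_add[OF F.TF.pure_closed[OF k(2) v] f.tensor_map_closed[OF fin]]
        F.coords_pure[OF k(2) v]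
      using Suc.IH[OF less_imp_le[OF k(1)]] k s cM A_carrier[OF s k(1)] unit[OF k(1)]
      by (simp add: lessThan_Suc del: id_apply)
  qed
  from this[of q] show ?thesis unfolding G.from_coords_def by simp
qed

text \<open>It makes the image \<open>L\<close> closed under scalars, so that the action descends to
  cosets.\<close>

lemma image_smult:
  assumes r: "r \<in> carrier R" and t: "t \<in> carrier G.TF"
  shows "f (r \<odot>\<^bsub>G.TF\<^esub> t) = r \<odot>\<^bsub>F.TF\<^esub> f t"
proof -
  interpret rG: abelian_group_hom G.TF G.TF "\<lambda>t. r \<odot>\<^bsub>G.TF\<^esub> t" by (rule G.TF.smult_hom[OF r])
  interpret rF: abelian_group_hom F.TF F.TF "\<lambda>t. r \<odot>\<^bsub>F.TF\<^esub> t" by (rule F.TF.smult_hom[OF r])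
  show ?thesis using t
  proof (induction t rule: G.TF.tensor_induct)
    case (pure x v)
    show ?case
      unfolding G.TF.smult_pure[OF r pure] f.tensor_map_pure[OF pure]
        f.tensor_map_pure[OF smult_closed[OF r pure(1)] pure(2)]
      by (simp only: id_apply F.TF.smult_pure[OF r pure(1) matrix_map_closed[OF pure(2)]])
  qed (simp_all add: f.map.hom_diff rG.hom_diff rF.hom_diff del: id_apply)
qed

sublocale GF: abelian_group F.GF
  by (rule F.graded_tensor_group)

text \<open>The image of a homomorphism is a subgroup of the ungraded tensor product; the graded one
  is a different record with the same additive structure, so the property is transported.\<close>

lemma image_subgroup: "abelian_subgroup L F.GF"
proof -
  have "subgroup L (add_monoid F.TF)"
    using group_hom.img_is_subgroup[OF f.map.a_group_hom] by simp
  then have "additive_subgroup L F.TF" by (rule additive_subgroup.intro)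
  then have "additive_subgroup L F.GF"
    by (rule additive_subgroup_cong[OF _ GF.abelian_group_axioms])
      (simp_all add: F.TF.T.abelian_group_axioms graded_tensor_def Let_def)
  then show ?thesis by (rule abelian_subgroupI3[OF _ GF.abelian_group_axioms])
qed

sublocale L: abelian_subgroup L F.GF
  by (rule image_subgroup)

lemma cokernel_simps:
  "carrier C = a_rcosets\<^bsub>F.GF\<^esub> L" "\<zero>\<^bsub>C\<^esub> = L" "X \<oplus>\<^bsub>C\<^esub> Y = X <+>\<^bsub>F.GF\<^esub> Y"
  "r \<odot>\<^bsub>C\<^esub> X = (\<Union>t\<in>X. L +>\<^bsub>F.GF\<^esub> (r \<odot>\<^bsub>F.TF\<^esub> t))" "mdeg C d = (\<lambda>t. L +>\<^bsub>F.GF\<^esub> t) ` mdeg F.GF d"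
  by (simp_all add: graded_coker_def Let_def)

text \<open>Entries from index p on are overwritten by zero, so that \<open>proj_cong\<close> holds
  for arbitrary functions, without carrier conditions.\<close>

definition proj :: "(nat \<Rightarrow> 'm) \<Rightarrow> (('m \<times> (nat \<Rightarrow> 'a)) \<Rightarrow>\<^sub>0 int) set set" where
  "proj x = L +>\<^bsub>F.GF\<^esub> F.from_coords (\<lambda>s. if s < p then x s else \<zero>\<^bsub>M\<^esub>)"

abbreviation "tuples \<equiv> {x. \<forall>s<p. x s \<in> carrier M}"

lemma proj_cong: "(\<And>s. s < p \<Longrightarrow> x s = y s) \<Longrightarrow> proj x = proj y"
proof -
  assume "\<And>s. s < p \<Longrightarrow> x s = y s"
  then have "(\<lambda>s. if s < p then x s else \<zero>\<^bsub>M\<^esub>) = (\<lambda>s. if s < p then y s else \<zero>\<^bsub>M\<^esub>)" by auto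
  then show ?thesis unfolding proj_def by simp
qed

lemma proj_eq: "x \<in> tuples \<Longrightarrow> proj x = L +>\<^bsub>F.GF\<^esub> F.from_coords x"
  unfolding proj_def using F.from_coords_cong[of "\<lambda>s. if s < p then x s else \<zero>\<^bsub>M\<^esub>" x] by simp

lemma proj_closed: "x \<in> tuples \<Longrightarrow> proj x \<in> carrier C"
  unfolding cokernel_simps by (subst proj_eq, assumption)
    (rule GF.a_rcosetsI[OF L.a_subset], use F.from_coords_closed in simp)

lemma proj_add:
  assumes "x \<in> tuples" "y \<in> tuples"
  shows "proj (\<lambda>s. x s \<oplus>\<^bsub>M\<^esub> y s) = proj x \<oplus>\<^bsub>C\<^esub> proj y"
proof -
  have xy: "(\<lambda>s. x s \<oplus>\<^bsub>M\<^esub> y s) \<in> tuples" using assms by auto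
  show ?thesis
    unfolding cokernel_simps proj_eq[OF assms(1)] proj_eq[OF assms(2)] proj_eq[OF xy]
    using assms F.from_coords_closed F.from_coords_add by (subst L.a_rcos_sum) auto
qed

text \<open>Two representatives differ by an element of \<open>L\<close>, and r keeps that
  difference in \<open>L\<close>; hence the union defining the action is one coset.\<close>

lemma smult_coset:
  assumes r: "r \<in> carrier R" and t: "t \<in> carrier F.TF"
  shows "r \<odot>\<^bsub>C\<^esub> (L +>\<^bsub>F.GF\<^esub> t) = L +>\<^bsub>F.GF\<^esub> (r \<odot>\<^bsub>F.TF\<^esub> t)"
proof -
  interpret rF: abelian_group_hom F.TF F.TF "\<lambda>t. r \<odot>\<^bsub>F.TF\<^esub> t" by (rule F.TF.smult_hom[OF r])
  have eq: "L +>\<^bsub>F.GF\<^esub> (r \<odot>\<^bsub>F.TF\<^esub> t') = L +>\<^bsub>F.GF\<^esub> (r \<odot>\<^bsub>F.TF\<^esub> t)" if t': "t' \<in> L +>\<^bsub>F.GF\<^esub> t" for t'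
  proof -
    obtain y where y: "y \<in> L" "t' = y \<oplus>\<^bsub>F.TF\<^esub> t"
      using t' unfolding a_r_coset_def' by auto
    have yc: "y \<in> carrier F.TF" using y(1) f.tensor_map_closed by blast
    have "r \<odot>\<^bsub>F.TF\<^esub> t' = (r \<odot>\<^bsub>F.TF\<^esub> y) \<oplus>\<^bsub>F.TF\<^esub> (r \<odot>\<^bsub>F.TF\<^esub> t)"
      unfolding y(2) using yc t by simp
    moreover have "r \<odot>\<^bsub>F.TF\<^esub> y \<in> L"
    proof -
      obtain g where g: "g \<in> carrier G.TF" "y = f g" using y(1) by (rule imageE)
      show ?thesis unfolding g(2) image_smult[OF r g(1), symmetric]
        by (rule imageI[OF G.TF.smult_closed[OF r g(1)]])
    qed
    ultimately have "r \<odot>\<^bsub>F.TF\<^esub> t' \<in> L +>\<^bsub>F.GF\<^esub> (r \<odot>\<^bsub>F.TF\<^esub> t)" unfolding a_r_coset_def' by auto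
    then show ?thesis
      using L.a_repr_independence'[of "r \<odot>\<^bsub>F.TF\<^esub> t'" "r \<odot>\<^bsub>F.TF\<^esub> t"] F.TF.smult_closed[OF r t] by simp
  qed
  have "t \<in> L +>\<^bsub>F.GF\<^esub> t" using L.a_rcos_self[of t] t by simp
  then show ?thesis unfolding cokernel_simps(4) by (rule UN_const) (rule eq)
qed

lemma proj_smult:
  assumes r: "r \<in> carrier R" and x: "x \<in> tuples"
  shows "proj (\<lambda>s. r \<odot>\<^bsub>M\<^esub> x s) = r \<odot>\<^bsub>C\<^esub> proj x"
proof -
  have rx: "(\<lambda>s. r \<odot>\<^bsub>M\<^esub> x s) \<in> tuples" using r x by auto
  show ?thesis
    unfolding proj_eq[OF x] proj_eq[OF rx] using r x F.from_coords_closed F.from_coords_smult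
    by (subst smult_coset) auto
qed

lemma proj_surj: "carrier C = proj ` tuples"
proof
  show "proj ` tuples \<subseteq> carrier C" using proj_closed by blast
  show "carrier C \<subseteq> proj ` tuples"
  proof
    fix X assume "X \<in> carrier C"
    then obtain t where t: "t \<in> carrier F.TF" "X = L +>\<^bsub>F.GF\<^esub> t"
      unfolding cokernel_simps A_RCOSETS_def' by auto
    have ct: "F.coords t \<in> tuples" using F.coords_carrier[OF t(1)] by simp
    then show "X \<in> proj ` tuples"
      using proj_eq[OF ct] F.from_coords_coords[OF t(1)] t(2) by (intro image_eqI[of _ _ "F.coords t"]) simp_all
  qed
qed

lemma proj_zero: "proj (\<lambda>s. \<zero>\<^bsub>M\<^esub>) = \<zero>\<^bsub>C\<^esub>"
proof -
  have z: "(\<lambda>s. \<zero>\<^bsub>M\<^esub>) \<in> tuples" by simp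
  have "F.from_coords (\<lambda>s. \<zero>\<^bsub>M\<^esub>) = F.from_coords (F.coords \<zero>\<^bsub>F.TF\<^esub>)"
    by (rule F.from_coords_cong) (simp_all add: F.coords_zero)
  also have "\<dots> = \<zero>\<^bsub>F.TF\<^esub>" by (rule F.from_coords_coords) simp
  finally show ?thesis
    unfolding cokernel_simps proj_eq[OF z] using GF.a_coset_add_zero[OF L.a_subset] by simp
qed

lemma proj_rel:
  assumes w: "\<forall>t<q. w t \<in> carrier M"
  shows "proj (\<lambda>s. \<Oplus>\<^bsub>M\<^esub>t\<in>{..<q}. A s t \<odot>\<^bsub>M\<^esub> w t) = \<zero>\<^bsub>C\<^esub>"
proof -
  let ?t = "f (G.from_coords w)"
  have t: "?t \<in> carrier F.TF" by (rule f.tensor_map_closed[OF G.from_coords_closed[OF w]])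
  have tL: "?t \<in> L" using G.from_coords_closed[OF w] by blast
  have "proj (\<lambda>s. \<Oplus>\<^bsub>M\<^esub>t\<in>{..<q}. A s t \<odot>\<^bsub>M\<^esub> w t) = proj (F.coords ?t)"
    by (rule proj_cong) (simp add: coords_image[OF w])
  also have "\<dots> = L +>\<^bsub>F.GF\<^esub> ?t"
    using proj_eq[of "F.coords ?t"] F.coords_carrier[OF t] F.from_coords_coords[OF t] by simp
  also have "\<dots> = \<zero>\<^bsub>C\<^esub>"
    unfolding cokernel_simps using GF.a_coset_join2[OF _ L.a_subgroup tL] t by simp
  finally show ?thesis .
qed

text \<open>A zero coset means that the tensor with coordinates x is an image under M \<otimes>
  \<Phi>; the coordinates of a preimage serve as w.\<close>

lemma proj_eq_zeroD:
  assumes x: "x \<in> tuples" and zero: "proj x = \<zero>\<^bsub>C\<^esub>"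
  obtains w where "\<forall>t<q. w t \<in> carrier M" "\<forall>s<p. x s = (\<Oplus>\<^bsub>M\<^esub>t\<in>{..<q}. A s t \<odot>\<^bsub>M\<^esub> w t)"
proof -
  have xc: "\<forall>s<p. x s \<in> carrier M" using x by simp
  have "F.from_coords x \<in> L"
    using zero L.a_rcos_self[of "F.from_coords x"] F.from_coords_closed[OF xc]
    unfolding cokernel_simps proj_eq[OF x] by simp
  then obtain t where t: "t \<in> carrier G.TF" "F.from_coords x = f t" by blast
  have w: "\<forall>t'<q. G.coords t t' \<in> carrier M" using G.coords_carrier[OF t(1)] by blast
  have "F.from_coords x = f (G.from_coords (G.coords t))" using G.from_coords_coords[OF t(1)] t(2) by simp
  then have "\<forall>s<p. x s = (\<Oplus>\<^bsub>M\<^esub>t'\<in>{..<q}. A s t' \<odot>\<^bsub>M\<^esub> G.coords t t')"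
    using coords_image[OF w] F.coords_from_coords[OF xc] by (metis restrict_apply' lessThan_iff)
  then show thesis using that w by blast
qed

text \<open>The w given by \<open>proj_eq_zeroD\<close> may be inhomogeneous. Taking the component
  of degree d + b s in row s fixes the left side and replaces each w t by its component of degree d
  + c t, because \<open>A s t\<close> has degree b s - c t. This rests on M being the direct sum of
  its graded pieces.\<close>

lemma proj_eq_zero_homogeneousD:
  assumes x: "\<forall>s<p. x s \<in> mdeg M (d + b s)" and zero: "proj x = \<zero>\<^bsub>C\<^esub>"
  shows "\<exists>w. (\<forall>t<q. w t \<in> mdeg M (d + c t)) \<and> (\<forall>s<p. x s = (\<Oplus>\<^bsub>M\<^esub>t\<in>{..<q}. A s t \<odot>\<^bsub>M\<^esub> w t))"
proof -
  have "x \<in> tuples" using x mdeg_carrier by blast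
  from proj_eq_zeroD[OF this zero] obtain w where w: "\<forall>t<q. w t \<in> carrier M"
    "\<forall>s<p. x s = (\<Oplus>\<^bsub>M\<^esub>t\<in>{..<q}. A s t \<odot>\<^bsub>M\<^esub> w t)" .
  have "x s = (\<Oplus>\<^bsub>M\<^esub>t\<in>{..<q}. A s t \<odot>\<^bsub>M\<^esub> graded.component (w t) (d + c t))" if s: "s < p" for s
  proof -
    have "x s = graded.component (x s) (d + b s)"
      using graded.component_homogeneous[of "x s" "d + b s" "d + b s"] x s by simp
    also have "\<dots> = (\<Oplus>\<^bsub>M\<^esub>t\<in>{..<q}. graded.component (A s t \<odot>\<^bsub>M\<^esub> w t) (d + b s))"
      unfolding w(2)[rule_format, OF s] using w(1) A_carrier[OF s]
      by (intro graded.component_finsum) auto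
    also have "\<dots> = (\<Oplus>\<^bsub>M\<^esub>t\<in>{..<q}. A s t \<odot>\<^bsub>M\<^esub> graded.component (w t) (d + c t))"
    proof (rule M.finsum_cong'[OF refl])
      fix t assume "t \<in> {..<q}"
      then show "graded.component (A s t \<odot>\<^bsub>M\<^esub> w t) (d + b s) = A s t \<odot>\<^bsub>M\<^esub> graded.component (w t) (d + c t)"
        using graded.component_smult[OF A_deg[OF s] A_carrier[OF s], of t "w t" "d + b s"] w(1)
        by (simp add: algebra_simps)
    qed (use w(1) A_carrier[OF s] graded.component_carrier in auto)
    finally show ?thesis .
  qed
  then show ?thesis using w(1) graded.component_spec(1)
    by (intro exI[of _ "\<lambda>t. graded.component (w t) (d + c t)"]) blast
qed

lemma proj_mdeg: "mdeg C d = proj ` {x. \<forall>s<p. x s \<in> mdeg M (d + b s)}"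
proof -
  have "proj x = L +>\<^bsub>F.GF\<^esub> F.from_coords x" if "\<forall>s<p. x s \<in> mdeg M (d + b s)" for x
    using that mdeg_carrier by (intro proj_eq) blast
  then show ?thesis
    unfolding cokernel_simps F.mdeg_graded_tensor image_image
    by (intro image_cong) (simp_all add: add.commute)
qed

lemma proj_minus: "x \<in> tuples \<Longrightarrow> proj (\<lambda>s. \<ominus>\<^bsub>M\<^esub> x s) \<oplus>\<^bsub>C\<^esub> proj x = \<zero>\<^bsub>C\<^esub>"
proof -
  assume x: "x \<in> tuples"
  have "proj (\<lambda>s. \<ominus>\<^bsub>M\<^esub> x s) \<oplus>\<^bsub>C\<^esub> proj x = proj (\<lambda>s. \<ominus>\<^bsub>M\<^esub> x s \<oplus>\<^bsub>M\<^esub> x s)"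
    using x by (intro proj_add[symmetric]) auto
  also have "\<dots> = proj (\<lambda>s. \<zero>\<^bsub>M\<^esub>)" using x by (intro proj_cong) (simp add: M.l_neg)
  finally show ?thesis by (simp add: proj_zero)
qed

lemma cokernel_group: "abelian_group C"
  by (rule abelian_group_transfer[OF L.a_factorgroup_is_comm_group])
    (simp_all add: cokernel_simps A_FactGroup_def')

text \<open>Every element is the projection of a tuple and \<open>proj\<close> respects sums and
  scalars, so the module laws are inherited from tuples over M.\<close>

lemma cokernel_module: "Module.module R C"
proof (rule moduleI[OF is_cring cokernel_group])
  fix r X assume r: "r \<in> carrier R" and "X \<in> carrier C"
  then obtain x where x: "x \<in> tuples" "X = proj x" using proj_surj by blast
  have rx: "(\<lambda>s. r \<odot>\<^bsub>M\<^esub> x s) \<in> tuples" using r x by auto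
  show "r \<odot>\<^bsub>C\<^esub> X \<in> carrier C"
    unfolding x(2) proj_smult[OF r x(1), symmetric] by (rule proj_closed[OF rx])
  { fix r' assume r': "r' \<in> carrier R"
    have r'x: "(\<lambda>s. r' \<odot>\<^bsub>M\<^esub> x s) \<in> tuples" using r' x by auto
    have "(r \<oplus> r') \<odot>\<^bsub>C\<^esub> X = proj (\<lambda>s. r \<odot>\<^bsub>M\<^esub> x s \<oplus>\<^bsub>M\<^esub> r' \<odot>\<^bsub>M\<^esub> x s)"
      unfolding x(2) proj_smult[OF ring_a_closed[OF r r'] x(1), symmetric]
      using x r r' by (intro proj_cong) (simp add: smult_l_distr)
    then show "(r \<oplus> r') \<odot>\<^bsub>C\<^esub> X = r \<odot>\<^bsub>C\<^esub> X \<oplus>\<^bsub>C\<^esub> r' \<odot>\<^bsub>C\<^esub> X"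
      unfolding proj_add[OF rx r'x] proj_smult[OF r x(1)] proj_smult[OF r' x(1)] x(2) .
    have "(r \<otimes> r') \<odot>\<^bsub>C\<^esub> X = proj (\<lambda>s. r \<odot>\<^bsub>M\<^esub> (r' \<odot>\<^bsub>M\<^esub> x s))"
      unfolding x(2) proj_smult[OF m_closed[OF r r'] x(1), symmetric]
      using x r r' by (intro proj_cong) (simp add: smult_assoc1)
    then show "(r \<otimes> r') \<odot>\<^bsub>C\<^esub> X = r \<odot>\<^bsub>C\<^esub> (r' \<odot>\<^bsub>C\<^esub> X)"
      unfolding proj_smult[OF r r'x] proj_smult[OF r' x(1)] x(2) . }
  { fix Y assume "Y \<in> carrier C"
    then obtain y where y: "y \<in> tuples" "Y = proj y" using proj_surj by blast
    have xy: "(\<lambda>s. x s \<oplus>\<^bsub>M\<^esub> y s) \<in> tuples" and ry: "(\<lambda>s. r \<odot>\<^bsub>M\<^esub> y s) \<in> tuples" using x y r by auto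
    have "r \<odot>\<^bsub>C\<^esub> (X \<oplus>\<^bsub>C\<^esub> Y) = proj (\<lambda>s. r \<odot>\<^bsub>M\<^esub> x s \<oplus>\<^bsub>M\<^esub> r \<odot>\<^bsub>M\<^esub> y s)"
      unfolding x(2) y(2) proj_add[OF x(1) y(1), symmetric] proj_smult[OF r xy, symmetric]
      using x y r by (intro proj_cong) (simp add: smult_r_distr)
    then show "r \<odot>\<^bsub>C\<^esub> (X \<oplus>\<^bsub>C\<^esub> Y) = r \<odot>\<^bsub>C\<^esub> X \<oplus>\<^bsub>C\<^esub> r \<odot>\<^bsub>C\<^esub> Y"
      unfolding proj_add[OF rx ry] proj_smult[OF r x(1)] proj_smult[OF r y(1)] x(2) y(2) . }
next
  fix X assume "X \<in> carrier C"
  then obtain x where x: "x \<in> tuples" "X = proj x" using proj_surj by blast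
  show "\<one> \<odot>\<^bsub>C\<^esub> X = X"
    unfolding x(2) proj_smult[OF one_closed x(1), symmetric] using x by (intro proj_cong) simp
qed

lemma graded_cokernel: "graded_ring_module R C"
proof (intro graded_ring_module.intro graded_cring_axioms cokernel_module graded_ring_module_axioms.intro)
  interpret C: abelian_group C by (rule cokernel_group)
  fix d
  have tuple: "x \<in> tuples" if "\<forall>s<p. x s \<in> mdeg M (d + b s)" for x using that mdeg_carrier by blast
  show "additive_subgroup (mdeg C d) C"
  proof (intro additive_subgroupI subgroup.intro)
    show "mdeg C d \<subseteq> carrier (add_monoid C)"
      unfolding proj_mdeg using proj_closed[OF tuple] by auto
    show "\<one>\<^bsub>add_monoid C\<^esub> \<in> mdeg C d"
      unfolding proj_mdeg using proj_zero[symmetric] mdeg_zero by auto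
  next
    fix X Y assume "X \<in> mdeg C d" "Y \<in> mdeg C d"
    then obtain x y where x: "\<forall>s<p. x s \<in> mdeg M (d + b s)" "X = proj x"
      and y: "\<forall>s<p. y s \<in> mdeg M (d + b s)" "Y = proj y"
      unfolding proj_mdeg by blast
    have "X \<oplus>\<^bsub>C\<^esub> Y = proj (\<lambda>s. x s \<oplus>\<^bsub>M\<^esub> y s)"
      unfolding x(2) y(2) by (rule proj_add[OF tuple[OF x(1)] tuple[OF y(1)], symmetric])
    then show "X \<otimes>\<^bsub>add_monoid C\<^esub> Y \<in> mdeg C d"
      unfolding proj_mdeg using x y mdeg_add by auto
  next
    fix X assume "X \<in> mdeg C d"
    then obtain x where x: "\<forall>s<p. x s \<in> mdeg M (d + b s)" "X = proj x"
      unfolding proj_mdeg by blast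
    have mx: "(\<lambda>s. \<ominus>\<^bsub>M\<^esub> x s) \<in> tuples" using tuple[OF x(1)] by auto
    have "\<ominus>\<^bsub>C\<^esub> X = proj (\<lambda>s. \<ominus>\<^bsub>M\<^esub> x s)"
      unfolding x(2) using proj_minus[OF tuple[OF x(1)]] proj_closed[OF tuple[OF x(1)]] proj_closed[OF mx]
      by (rule C.minus_equality)
    then show "inv\<^bsub>add_monoid C\<^esub> X \<in> mdeg C d"
      unfolding a_inv_def[symmetric] proj_mdeg using x mdeg_minus by auto
  qed
next
  fix r d X e assume r: "r \<in> rdeg R d" and "X \<in> mdeg C e"
  then obtain x where x: "\<forall>s<p. x s \<in> mdeg M (e + b s)" "X = proj x" unfolding proj_mdeg by blast
  have "r \<odot>\<^bsub>C\<^esub> X = proj (\<lambda>s. r \<odot>\<^bsub>M\<^esub> x s)"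
    unfolding x(2) using x(1) mdeg_carrier rdeg_carrier[OF r] by (intro proj_smult[symmetric]) blast+
  moreover have "r \<odot>\<^bsub>M\<^esub> x s \<in> mdeg M (d + e + b s)" if "s < p" for s
    using mdeg_smult[OF r, of "x s" "e + b s"] x(1) that by (simp add: add.assoc)
  ultimately show "r \<odot>\<^bsub>C\<^esub> X \<in> mdeg C (d + e)" unfolding proj_mdeg by blast
qed

end

section \<open>The weighted polynomial ring\<close>

lemma weight_superset:
  assumes "finite B" "Poly_Mapping.keys \<mu> \<subseteq> B"
  shows "weight a \<mu> = (\<Sum>i\<in>B. a i * Poly_Mapping.lookup \<mu> i)"
  unfolding weight_def using assms by (intro sum.mono_neutral_left) (auto simp: in_keys_iff)

lemma weight_add: "weight a (\<mu> + \<nu>) = weight a \<mu> + weight a \<nu>"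
proof -
  let ?B = "Poly_Mapping.keys \<mu> \<union> Poly_Mapping.keys \<nu>"
  have "weight a (\<mu> + \<nu>) = (\<Sum>i\<in>?B. a i * Poly_Mapping.lookup (\<mu> + \<nu>) i)"
    by (rule weight_superset) (simp_all add: keys_add)
  also have "\<dots> = weight a \<mu> + weight a \<nu>"
    using weight_superset[of ?B \<mu> a] weight_superset[of ?B \<nu> a]
    by (simp add: lookup_add algebra_simps sum.distrib)
  finally show ?thesis .
qed

lemma weight_zero [simp]: "weight a 0 = 0"
  by (simp add: weight_def)

lemma keys_multE:
  assumes "\<mu> \<in> Poly_Mapping.keys (f * g)"
  obtains \<alpha> \<beta> where "\<alpha> \<in> Poly_Mapping.keys f" "\<beta> \<in> Poly_Mapping.keys g" "\<mu> = \<alpha> + \<beta>"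
  using assms keys_mult[of f g] by blast

lemma sum_monomials: "f = (\<Sum>\<mu>\<in>Poly_Mapping.keys f. Poly_Mapping.single \<mu> (Poly_Mapping.lookup f \<mu>))"
  by (rule poly_mapping_eqI) (simp add: lookup_sum lookup_single when_def in_keys_iff)

text \<open>Polynomials have ordinary type class sums as well as sums in a ring record; the
  presentation data are computed with the former and handed over in the latter form.\<close>

lemma finsum_eq_sum:
  assumes "abelian_monoid G" "add G = (+)" "\<zero>\<^bsub>G\<^esub> = 0" "finite I" "\<And>i. i \<in> I \<Longrightarrow> f i \<in> carrier G"
  shows "finsum G f I = sum f I"
proof -
  interpret abelian_monoid G by fact
  show ?thesis using assms(4,5)
    by (induction I rule: finite_induct) (auto simp: assms(2,3) Pi_iff)
qed

context
  fixes n :: nat and a :: "nat \<Rightarrow> nat"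
begin

abbreviation "S \<equiv> weighted_poly_ring n a :: 'k::field polynomial graded_ring"

lemma poly_ring_simps [simp]:
  "x \<otimes>\<^bsub>S\<^esub> y = x * y" "\<one>\<^bsub>S\<^esub> = 1" "\<zero>\<^bsub>S\<^esub> = 0" "x \<oplus>\<^bsub>S\<^esub> y = x + y"
  by (simp_all add: weighted_poly_ring_def)

lemma poly_carrier_iff: "f \<in> carrier S \<longleftrightarrow> (\<forall>\<mu>\<in>Poly_Mapping.keys f. Poly_Mapping.keys \<mu> \<subseteq> {..n})"
  by (simp add: weighted_poly_ring_def)

lemma poly_rdeg_iff: "f \<in> rdeg S d \<longleftrightarrow>
    (\<forall>\<mu>\<in>Poly_Mapping.keys f. Poly_Mapping.keys \<mu> \<subseteq> {..n} \<and> int (weight a \<mu>) = d)"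
  by (simp add: weighted_poly_ring_def)

lemma poly_rdeg_carrier: "f \<in> rdeg S d \<Longrightarrow> f \<in> carrier S"
  by (simp add: poly_carrier_iff poly_rdeg_iff)

lemma poly_add_closed: "\<lbrakk>f \<in> carrier S; g \<in> carrier S\<rbrakk> \<Longrightarrow> f + g \<in> carrier S"
  unfolding poly_carrier_iff using keys_add[of f g] by blast

lemma poly_mult_closed:
  assumes "f \<in> carrier S" "g \<in> carrier S"
  shows "f * g \<in> carrier S"
  unfolding poly_carrier_iff
proof
  fix \<mu> assume "\<mu> \<in> Poly_Mapping.keys (f * g)"
  then obtain \<alpha> \<beta> where "\<alpha> \<in> Poly_Mapping.keys f" "\<beta> \<in> Poly_Mapping.keys g" "\<mu> = \<alpha> + \<beta>"
    by (rule keys_multE)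
  then show "Poly_Mapping.keys \<mu> \<subseteq> {..n}"
    using assms keys_add[of \<alpha> \<beta>] unfolding poly_carrier_iff by blast
qed

lemma poly_uminus_closed: "f \<in> carrier S \<Longrightarrow> - f \<in> carrier S"
  unfolding poly_carrier_iff by (simp add: in_keys_iff)

lemma poly_abelian_group: "abelian_group S"
proof (rule abelian_groupI)
  show "\<exists>g\<in>carrier S. g \<oplus>\<^bsub>S\<^esub> f = \<zero>\<^bsub>S\<^esub>" if "f \<in> carrier S" for f :: "'k::field polynomial"
    using poly_uminus_closed[OF that] by (intro bexI[of _ "- f"]) simp_all
qed (auto simp: poly_add_closed poly_carrier_iff[of 0] add_ac)

lemma poly_cring: "cring S"
  by (rule cringI[OF poly_abelian_group])
    (auto intro!: comm_monoidI simp: poly_mult_closed poly_carrier_iff[of 1] algebra_simps)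

lemma poly_a_inv: "f \<in> carrier S \<Longrightarrow> \<ominus>\<^bsub>S\<^esub> f = - f"
  by (rule abelian_group.minus_equality[OF poly_abelian_group]) (simp_all add: poly_uminus_closed)

lemma poly_graded: "graded_cring S"
proof (intro graded_cring.intro poly_cring graded_cring_axioms.intro)
  fix d
  show "additive_subgroup (rdeg S d) S"
  proof (intro additive_subgroupI subgroup.intro)
    show "rdeg S d \<subseteq> carrier (add_monoid S)" using poly_rdeg_carrier by auto
    show "\<one>\<^bsub>add_monoid S\<^esub> \<in> rdeg S d" by (simp add: poly_rdeg_iff)
    show "f \<otimes>\<^bsub>add_monoid S\<^esub> g \<in> rdeg S d" if "f \<in> rdeg S d" "g \<in> rdeg S d" for f g :: "'k::field polynomial"
      using that keys_add[of f g] by (auto simp: poly_rdeg_iff)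
    show "inv\<^bsub>add_monoid S\<^esub> f \<in> rdeg S d" if "f \<in> rdeg S d" for f :: "'k::field polynomial"
    proof -
      have "inv\<^bsub>add_monoid S\<^esub> f = - f"
        using poly_a_inv[OF poly_rdeg_carrier[OF that]] by (simp add: a_inv_def)
      then show ?thesis using that by (simp add: poly_rdeg_iff in_keys_iff)
    qed
  qed
next
  fix f g :: "'k::field polynomial" and d e
  assume f: "f \<in> rdeg S d" and g: "g \<in> rdeg S e"
  have "\<forall>\<mu>\<in>Poly_Mapping.keys (f * g). Poly_Mapping.keys \<mu> \<subseteq> {..n} \<and> int (weight a \<mu>) = d + e"
  proof
    fix \<mu> assume "\<mu> \<in> Poly_Mapping.keys (f * g)"
    then obtain \<alpha> \<beta> where "\<alpha> \<in> Poly_Mapping.keys f" "\<beta> \<in> Poly_Mapping.keys g" "\<mu> = \<alpha> + \<beta>"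
      by (rule keys_multE)
    moreover from this f g have "Poly_Mapping.keys \<alpha> \<subseteq> {..n}" "Poly_Mapping.keys \<beta> \<subseteq> {..n}"
      "int (weight a \<alpha>) = d" "int (weight a \<beta>) = e"
      by (simp_all add: poly_rdeg_iff)
    ultimately show "Poly_Mapping.keys \<mu> \<subseteq> {..n} \<and> int (weight a \<mu>) = d + e"
      using subset_trans[OF keys_add[of \<alpha> \<beta>], of "{..n}"] by (simp add: weight_add)
  qed
  then show "f \<otimes>\<^bsub>S\<^esub> g \<in> rdeg S (d + e)" by (simp add: poly_rdeg_iff)
next
  show "\<one>\<^bsub>S\<^esub> \<in> rdeg S 0" by (simp add: poly_rdeg_iff)
qed

interpretation S: graded_cring S
  by (rule poly_graded)

lemma poly_finsum: "\<lbrakk>finite I; \<And>i. i \<in> I \<Longrightarrow> f i \<in> carrier S\<rbrakk> \<Longrightarrow> finsum S f I = sum f I"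
  by (rule finsum_eq_sum[OF S.abelian_monoid_axioms])
    (simp_all add: weighted_poly_ring_def)

subsection \<open>Points of Proj avoid some variable\<close>

definition var :: "nat \<Rightarrow> 'k::field polynomial" where
  "var i = Poly_Mapping.single (Poly_Mapping.single i 1) 1"

lemma var_rdeg: "i \<le> n \<Longrightarrow> var i \<in> rdeg S (int (a i))"
  by (simp add: var_def poly_rdeg_iff weight_def)

text \<open>A nonzero exponent vector involves some variable, and the monomial is a multiple of that
  variable.\<close>

lemma monomial_in_ideal:
  assumes P: "ideal P S" and var: "\<And>i. i \<le> n \<Longrightarrow> var i \<in> P"
    and \<mu>: "Poly_Mapping.keys \<mu> \<subseteq> {..n}" "\<mu> \<noteq> 0"
  shows "Poly_Mapping.single \<mu> x \<in> P"
proof -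
  obtain i where i: "i \<in> Poly_Mapping.keys \<mu>" using \<mu>(2) by fastforce
  define \<nu> where "\<nu> = \<mu> - Poly_Mapping.single i 1"
  have "\<mu> = \<nu> + Poly_Mapping.single i 1"
    unfolding \<nu>_def using i
    by (intro poly_mapping_eqI) (auto simp: lookup_add lookup_minus lookup_single when_def in_keys_iff)
  then have eq: "Poly_Mapping.single \<mu> x = Poly_Mapping.single \<nu> x * var i"
    by (simp add: var_def mult_single)
  have "Poly_Mapping.keys \<nu> \<subseteq> Poly_Mapping.keys \<mu>"
    unfolding \<nu>_def by (auto simp: in_keys_iff lookup_minus)
  then have "Poly_Mapping.single \<nu> x \<in> carrier S" using \<mu>(1) by (auto simp: poly_carrier_iff)
  then show ?thesis
    using ideal.I_l_closed[OF P var, of i "Poly_Mapping.single \<nu> x"] i \<mu>(1) unfolding eq by auto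
qed

text \<open>A prime containing all variables contains every nonconstant monomial. Homogeneous
  elements of positive degree are sums of such monomials, so the prime would contain the irrelevant
  ideal.\<close>

lemma Proj_var:
  assumes P: "P \<in> Proj_set S"
  shows "\<exists>i\<le>n. var i \<notin> P"
proof (rule ccontr)
  assume "\<not> (\<exists>i\<le>n. var i \<notin> P)"
  then have var: "\<And>i. i \<le> n \<Longrightarrow> var i \<in> P" by blast
  interpret primeideal P S using Proj_set_prime[OF P] .
  have "f \<in> P" if d: "0 < d" and f: "f \<in> rdeg S d" for d f
  proof -
    have "(\<Sum>\<mu>\<in>I. Poly_Mapping.single \<mu> (Poly_Mapping.lookup f \<mu>)) \<in> P"
      if "finite I" "I \<subseteq> Poly_Mapping.keys f" for I
      using that
    proof (induction I rule: finite_induct)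
      case empty
      then show ?case using additive_subgroup.zero_closed[OF additive_subgroup_axioms] by simp
    next
      case (insert \<mu> I)
      have "Poly_Mapping.keys \<mu> \<subseteq> {..n}" "int (weight a \<mu>) = d"
        using insert.prems f by (auto simp: poly_rdeg_iff)
      moreover from this d have "\<mu> \<noteq> 0" by auto
      ultimately have "Poly_Mapping.single \<mu> (Poly_Mapping.lookup f \<mu>) \<in> P"
        using monomial_in_ideal[OF ideal_axioms var] by blast
      then show ?case
        using insert a_closed[of "Poly_Mapping.single \<mu> (Poly_Mapping.lookup f \<mu>)"] by simp
    qed
    then show ?thesis using sum_monomials[of f] by (metis finite_keys order_refl)
  qed
  then have "(\<Union>d\<in>{0<..}. rdeg S d) \<subseteq> P" by blast
  then have "irrelevant_ideal S \<subseteq> P"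
    unfolding irrelevant_ideal_def by (rule S.genideal_minimal[OF ideal_axioms])
  then show False using P unfolding Proj_set_def by blast
qed

lemma Proj_unit:
  assumes P: "P \<in> Proj_set S"
  shows "\<exists>u\<in>rdeg S (int (Lcm (a ` {..n}))). u \<notin> P"
proof -
  obtain i where i: "i \<le> n" "var i \<notin> P" using Proj_var[OF P] by blast
  have "a i dvd Lcm (a ` {..n})" using i(1) by (intro dvd_Lcm) simp
  \<comment> \<open>With this k the k-th power of \<open>var i\<close>, a variable of weight a i,
    has degree exactly the least common multiple.\<close>
  then obtain k where k: "Lcm (a ` {..n}) = a i * k" by (rule dvdE)
  have "var i [^]\<^bsub>S\<^esub> k \<in> rdeg S (int k * int (a i)) - P"
    using S.den_pow[OF Proj_set_prime[OF P], of "var i" "int (a i)" k] var_rdeg[OF i(1)] i(2) by blast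
  then show ?thesis unfolding k by (intro bexI[of _ "var i [^]\<^bsub>S\<^esub> k"]) (simp_all add: mult.commute)
qed

subsection \<open>Homogeneous components\<close>

text \<open>The projection to one degree, given by filtering monomials by weight. It serves to
  replace coefficients obtained from surjectivity of a presentation by homogeneous ones.\<close>

definition part :: "int \<Rightarrow> 'k::field polynomial \<Rightarrow> 'k polynomial" where
  "part d f = Poly_Mapping.mapp (\<lambda>\<mu> x. if int (weight a \<mu>) = d then x else 0) f"

lemma lookup_part: "Poly_Mapping.lookup (part d f) \<mu> =
    (if int (weight a \<mu>) = d then Poly_Mapping.lookup f \<mu> else 0)"
  by (simp add: part_def lookup_mapp when_def in_keys_iff)

lemma part_add: "part d (f + g) = part d f + part d g"
  by (rule poly_mapping_eqI) (simp add: lookup_part lookup_add)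

lemma part_zero: "part d 0 = 0"
  by (rule poly_mapping_eqI) (simp add: lookup_part)

lemma part_sum: "finite I \<Longrightarrow> part d (sum f I) = (\<Sum>i\<in>I. part d (f i))"
  by (induction I rule: finite_induct) (simp_all add: part_add part_zero)

lemma part_rdeg: "f \<in> carrier S \<Longrightarrow> part d f \<in> rdeg S d"
  by (auto simp: poly_carrier_iff poly_rdeg_iff in_keys_iff lookup_part split: if_splits)

lemma part_homogeneous: "f \<in> rdeg S d \<Longrightarrow> part d f = f"
  by (rule poly_mapping_eqI) (auto simp: poly_rdeg_iff lookup_part in_keys_iff)

text \<open>Split f into its part of degree d - k and a remainder h without monomials of that
  weight. As g is homogeneous of degree k, no monomial of h * g has weight d.\<close>

lemma part_mult:
  assumes g: "g \<in> rdeg S k" and f: "f \<in> carrier S"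
  shows "part d (f * g) = part (d - k) f * g"
proof -
  define h where "h = f - part (d - k) f"
  have h: "int (weight a \<mu>) \<noteq> d - k" if "\<mu> \<in> Poly_Mapping.keys h" for \<mu>
    using that by (auto simp: h_def in_keys_iff lookup_minus lookup_part split: if_splits)
  have "part d (h * g) = 0"
  proof (rule poly_mapping_eqI)
    fix \<mu>
    show "Poly_Mapping.lookup (part d (h * g)) \<mu> = Poly_Mapping.lookup 0 \<mu>"
    proof (cases "\<mu> \<in> Poly_Mapping.keys (h * g)")
      case True
      then obtain \<alpha> \<beta> where \<alpha>\<beta>: "\<alpha> \<in> Poly_Mapping.keys h" "\<beta> \<in> Poly_Mapping.keys g" "\<mu> = \<alpha> + \<beta>"
        by (rule keys_multE)
      then have "int (weight a \<beta>) = k" using g by (simp add: poly_rdeg_iff)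
      then have "int (weight a \<mu>) \<noteq> d" using h[OF \<alpha>\<beta>(1)] \<alpha>\<beta>(3) by (simp add: weight_add)
      then show ?thesis by (simp add: lookup_part)
    qed (simp add: lookup_part in_keys_iff)
  qed
  moreover have "f * g = part (d - k) f * g + h * g" by (simp add: h_def algebra_simps)
  moreover have "part d (part (d - k) f * g) = part (d - k) f * g"
    using S.rdeg_mult[OF part_rdeg[OF f, of "d - k"] g] by (intro part_homogeneous) simp
  ultimately show ?thesis by (simp add: part_add)
qed

subsection \<open>Presentations of Veronese modules\<close>

text \<open>The generated subgroup becomes a condition on single monomials, from which closure under
  products can be read off. One inclusion holds because the condition defines a subgroup, the other
  because each monomial lies in a generating piece.\<close>

lemma veronese_ring_carrier:
  "carrier (veronese_ring l (S :: 'k::field polynomial graded_ring)) =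
    {f \<in> carrier S. \<forall>\<mu>\<in>Poly_Mapping.keys f. \<exists>e. int (weight a \<mu>) = e * int l}" (is "carrier ?V = ?H")
proof
  have V: "carrier ?V = generate (add_monoid S) (\<Union>e. rdeg S (e * int l))"
    by (simp add: veronese_ring_def)
  have H: "subgroup ?H (add_monoid S)"
  proof (rule subgroup.intro)
    show "f \<otimes>\<^bsub>add_monoid S\<^esub> g \<in> ?H" if "f \<in> ?H" "g \<in> ?H" for f g
      using that keys_add[of f g] poly_add_closed[of f g] by auto
    show "inv\<^bsub>add_monoid S\<^esub> f \<in> ?H" if "f \<in> ?H" for f
    proof -
      have "inv\<^bsub>add_monoid S\<^esub> f = - f" using poly_a_inv[of f] that by (simp add: a_inv_def)
      then show ?thesis using that poly_uminus_closed[of f] by (simp add: in_keys_iff)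
    qed
  qed (auto simp: poly_carrier_iff)
  have "(\<Union>e. rdeg S (e * int l)) \<subseteq> ?H"
  proof
    fix f :: "'k polynomial" assume "f \<in> (\<Union>e. rdeg S (e * int l))"
    then obtain e where f: "f \<in> rdeg S (e * int l)" by blast
    show "f \<in> ?H" using poly_rdeg_carrier[OF f] f[unfolded poly_rdeg_iff] by blast
  qed
  then show "carrier ?V \<subseteq> ?H"
    unfolding V by (rule S.add.generate_subgroup_incl[OF _ H])
  show "?H \<subseteq> carrier ?V"
  proof
    fix f assume f: "f \<in> ?H"
    have "(\<Sum>\<mu>\<in>I. Poly_Mapping.single \<mu> (Poly_Mapping.lookup f \<mu>)) \<in> carrier ?V"
      if "finite I" "I \<subseteq> Poly_Mapping.keys f" for I
      using that
    proof (induction I rule: finite_induct)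
      case empty
      then show ?case unfolding V using generate.one[of "add_monoid S"] by simp
    next
      case (insert \<mu> I)
      obtain e where e: "int (weight a \<mu>) = e * int l" using f insert.prems by blast
      have "Poly_Mapping.single \<mu> (Poly_Mapping.lookup f \<mu>) \<in> rdeg S (e * int l)"
        using f insert.prems e by (auto simp: poly_rdeg_iff poly_carrier_iff)
      then have "Poly_Mapping.single \<mu> (Poly_Mapping.lookup f \<mu>) \<in> generate (add_monoid S) (\<Union>e. rdeg S (e * int l))"
        by (blast intro: generate.incl)
      then show ?case
        using insert generate.eng[of _ "add_monoid S"] unfolding V by fastforce
    qed
    from this[OF finite_keys order_refl] show "f \<in> carrier ?V"
      unfolding sum_monomials[of f, symmetric] .
  qed
qed

context
  fixes l :: nat
begin

abbreviation "V \<equiv> veronese_ring l S :: 'k::field polynomial graded_ring"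

lemma veronese_simps [simp]:
  "x \<otimes>\<^bsub>V\<^esub> y = x * y" "\<one>\<^bsub>V\<^esub> = 1" "\<zero>\<^bsub>V\<^esub> = 0" "x \<oplus>\<^bsub>V\<^esub> y = x + y"
  "rdeg V d = rdeg S (d * int l)"
  by (simp_all add: veronese_ring_def)

lemma V_carrier: "f \<in> carrier V \<Longrightarrow> f \<in> carrier S"
  unfolding veronese_ring_carrier by blast

lemma V_rdeg: "f \<in> rdeg S (e * int l) \<Longrightarrow> f \<in> carrier V"
  unfolding veronese_ring_carrier by (auto simp: poly_rdeg_iff poly_carrier_iff)

lemma V_zero: "0 \<in> carrier V" and V_one: "1 \<in> carrier V"
  unfolding veronese_ring_carrier by (auto simp: poly_carrier_iff intro: exI[of _ 0])

lemma V_add: "\<lbrakk>f \<in> carrier V; g \<in> carrier V\<rbrakk> \<Longrightarrow> f + g \<in> carrier V"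
  unfolding veronese_ring_carrier using poly_add_closed[of f g] keys_add[of f g] by blast

lemma V_mult:
  assumes "f \<in> carrier V" "g \<in> carrier V"
  shows "f * g \<in> carrier V"
  unfolding veronese_ring_carrier
proof (intro CollectI conjI ballI)
  show "f * g \<in> carrier S" using assms V_carrier poly_mult_closed by blast
  fix \<mu> assume "\<mu> \<in> Poly_Mapping.keys (f * g)"
  then obtain \<alpha> \<beta> where \<alpha>\<beta>: "\<alpha> \<in> Poly_Mapping.keys f" "\<beta> \<in> Poly_Mapping.keys g" "\<mu> = \<alpha> + \<beta>"
    by (rule keys_multE)
  then obtain e e' where "int (weight a \<alpha>) = e * int l" "int (weight a \<beta>) = e' * int l"
    using assms unfolding veronese_ring_carrier by blast
  then have "int (weight a \<mu>) = (e + e') * int l" using \<alpha>\<beta>(3) by (simp add: weight_add algebra_simps)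
  then show "\<exists>e. int (weight a \<mu>) = e * int l" ..
qed

lemma V_finsum: "\<lbrakk>finite I; \<And>i. i \<in> I \<Longrightarrow> f i \<in> carrier V\<rbrakk> \<Longrightarrow> finsum V f I = sum f I"
proof (rule finsum_eq_sum)
  show "abelian_monoid V"
    by (rule abelian_monoidI) (auto simp: V_zero V_add add_ac)
qed (simp_all add: veronese_ring_def weighted_poly_ring_def)

context
  fixes j :: int and p q :: nat and b c :: "nat \<Rightarrow> int" and A :: "nat \<Rightarrow> nat \<Rightarrow> 'k::field polynomial"
  assumes presentation: "presentation_matrix V (veronese l (shift (self_module S) j)) p b q c A"
begin

abbreviation "Nv \<equiv> veronese l (shift (self_module S) j) :: ('k polynomial, 'k polynomial) graded_module"

lemma Nv_simps [simp]:
  "x \<oplus>\<^bsub>Nv\<^esub> y = x + y" "\<zero>\<^bsub>Nv\<^esub> = 0" "r \<odot>\<^bsub>Nv\<^esub> x = r * x" "mdeg Nv d = rdeg S (j + d * int l)"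
  by (simp_all add: veronese_def shift_def self_module_def weighted_poly_ring_def)

lemma A_carrier: "\<lbrakk>s < p; t < q\<rbrakk> \<Longrightarrow> A s t \<in> carrier V"
  using presentation unfolding presentation_matrix_def by blast

lemma matrix_at_unit:
  assumes "s < p" "t < q"
  shows "matrix_map V p q A (unit_vector V q t) s = A s t"
proof -
  have "matrix_map V p q A (unit_vector V q t) s = finsum V (\<lambda>t'. A s t' * unit_vector V q t t') {..<q}"
    unfolding matrix_map_def using assms(1) by simp
  also have "\<dots> = (\<Sum>t'<q. A s t' * unit_vector V q t t')"
    using A_carrier[OF assms(1)] V_zero V_one by (intro V_finsum V_mult) (auto simp: unit_vector_def)
  also have "\<dots> = (\<Sum>t'<q. if t = t' then A s t' else 0)"
    by (intro sum.cong) (auto simp: unit_vector_def)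
  also have "\<dots> = A s t" using assms(2) by (simp add: sum.delta')
  finally show ?thesis .
qed

lemma unit_vector_mdeg: "s < r \<Longrightarrow> unit_vector V r s \<in> mdeg (free_module V r b') (- b' s)"
  using S.rdeg_one S.rdeg_zero by (auto simp: unit_vector_def)

text \<open>\<open>m s\<close> is the image of the s-th basis vector. That vector has degree - b s,
  which in the Veronese module means degree j - b s * l in the polynomial ring. The columns of A are
  images of basis vectors of degree - c t, and exactness of the presentation becomes the last three
  facts.\<close>

lemma presentation_generators:
  obtains m where
    "\<And>s. s < p \<Longrightarrow> m s \<in> rdeg S (j - b s * int l)"
    "\<And>s t. \<lbrakk>s < p; t < q\<rbrakk> \<Longrightarrow> A s t \<in> rdeg S ((b s - c t) * int l)"
    "\<And>t. t < q \<Longrightarrow> (\<Sum>s<p. A s t * m s) = 0"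
    "\<And>g e. g \<in> rdeg S (j + e * int l) \<Longrightarrow>
      \<exists>r. (\<forall>s<p. r s \<in> rdeg S ((e + b s) * int l)) \<and> g = (\<Sum>s<p. r s * m s)"
    "\<And>v e. \<lbrakk>\<forall>s<p. v s \<in> rdeg S ((e + b s) * int l); (\<Sum>s<p. v s * m s) = 0\<rbrakk> \<Longrightarrow>
      \<exists>w. (\<forall>t<q. w t \<in> carrier S) \<and> (\<forall>s<p. v s = (\<Sum>t<q. A s t * w t))"
proof -
  let ?F = "free_module V p b" and ?G = "free_module V q c"
  have mat: "matrix_map V p q A \<in> graded_hom V ?G ?F"
    using presentation unfolding presentation_matrix_def by blast
  obtain \<pi> where \<pi>: "\<pi> \<in> graded_hom V ?F Nv" "\<pi> ` carrier ?F = carrier Nv"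
    "{v \<in> carrier ?F. \<pi> v = \<zero>\<^bsub>Nv\<^esub>} = matrix_map V p q A ` carrier ?G"
    using presentation unfolding presentation_matrix_def by blast
  have \<pi>_add: "\<pi> (v \<oplus>\<^bsub>?F\<^esub> w) = \<pi> v + \<pi> w" if "v \<in> carrier ?F" "w \<in> carrier ?F" for v w
    using \<pi>(1) that unfolding graded_hom_def mod_hom_def by simp
  have \<pi>_smult: "\<pi> (r \<odot>\<^bsub>?F\<^esub> v) = r * \<pi> v" if "r \<in> carrier V" "v \<in> carrier ?F" for r v
    using \<pi>(1) that unfolding graded_hom_def mod_hom_def by simp
  define m where "m s = \<pi> (unit_vector V p s)" for s
  have m: "m s \<in> rdeg S (j - b s * int l)" if "s < p" for s
  proof -
    have "\<pi> ` mdeg ?F (- b s) \<subseteq> mdeg Nv (- b s)" using \<pi>(1) unfolding graded_hom_def by blast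
    then show ?thesis using unit_vector_mdeg[OF that, of b] unfolding m_def by (auto simp del: free_module_simps)
  qed
  have unit: "unit_vector V r s \<in> carrier (free_module V r b')" for r s b'
    using V_zero V_one by (auto simp: unit_vector_def)
  have \<pi>_sum: "\<pi> v = (\<Sum>s<p. v s * m s)" if v: "v \<in> carrier ?F" for v
  proof -
    have vc: "v s \<in> carrier V" if "s < p" for s using v that by (auto simp: PiE_iff)
    \<comment> \<open>Truncations of v: passing from \<open>tr k\<close> to
      \<open>tr (Suc k)\<close> adds one multiple of a basis vector, so additivity and linearity of
      \<pi> yield the formula by induction.\<close>
    define tr where "tr k = (\<lambda>s\<in>{..<p}. if s < k then v s else 0)" for k
    have tr: "tr k \<in> carrier ?F" for k using vc V_zero by (auto simp: tr_def)
    have "\<pi> (tr k) = (\<Sum>s<k. v s * m s)" if "k \<le> p" for k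
      using that
    proof (induction k)
      case 0
      have eq: "tr 0 \<oplus>\<^bsub>?F\<^esub> tr 0 = tr 0" by (auto simp: tr_def intro!: restrict_ext)
      have "\<pi> (tr 0) = \<pi> (tr 0) + \<pi> (tr 0)" using \<pi>_add[OF tr tr, of 0 0] unfolding eq .
      then have "\<pi> (tr 0) = 0" by (simp only: add_cancel_right_right)
      then show ?case by simp
    next
      case (Suc k)
      then have k: "k < p" by simp
      have vk: "v k \<odot>\<^bsub>?F\<^esub> unit_vector V p k \<in> carrier ?F"
        using vc[OF k] V_zero by (auto simp: unit_vector_def)
      have eq: "tr (Suc k) = tr k \<oplus>\<^bsub>?F\<^esub> v k \<odot>\<^bsub>?F\<^esub> unit_vector V p k"
        using k by (auto simp: tr_def unit_vector_def less_Suc_eq intro!: restrict_ext)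
      show ?case
        unfolding eq \<pi>_add[OF tr vk] \<pi>_smult[OF vc[OF k] unit] Suc.IH[OF less_imp_le[OF k]]
        by (simp add: m_def)
    qed
    moreover have "tr p = v" using v by (auto simp: tr_def PiE_iff extensional_def)
    ultimately show ?thesis by force
  qed
  have mat_unit: "matrix_map V p q A (unit_vector V q t) \<in> mdeg ?F (- c t)" if "t < q" for t
    using mat unit_vector_mdeg[OF that, of c] unfolding graded_hom_def by blast
  have A: "A s t \<in> rdeg S ((b s - c t) * int l)" if "s < p" "t < q" for s t
  proof -
    have "matrix_map V p q A (unit_vector V q t) s \<in> rdeg V (b s + (- c t))"
      using mat_unit[OF that(2)] that(1) unfolding free_module_simps PiE_iff by blast
    then show ?thesis unfolding matrix_at_unit[OF that] by simp
  qed
  have A_m: "(\<Sum>s<p. A s t * m s) = 0" if t: "t < q" for t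
  proof -
    have "matrix_map V p q A (unit_vector V q t) \<in> {v \<in> carrier ?F. \<pi> v = \<zero>\<^bsub>Nv\<^esub>}"
      unfolding \<pi>(3) using unit by blast
    then show ?thesis
      using \<pi>_sum[of "matrix_map V p q A (unit_vector V q t)"] matrix_at_unit[OF _ t] by simp
  qed
  have gen: "\<exists>r. (\<forall>s<p. r s \<in> rdeg S ((e + b s) * int l)) \<and> g = (\<Sum>s<p. r s * m s)"
    if g: "g \<in> rdeg S (j + e * int l)" for g e
  proof -
    have "g \<in> carrier Nv"
      unfolding veronese_def using g by (auto intro!: generate.incl simp: shift_def self_module_def)
    then obtain v where v: "v \<in> carrier ?F" "g = \<pi> v" unfolding \<pi>(2)[symmetric] by blast
    have vc: "v s \<in> carrier S" if "s < p" for s using v(1) that V_carrier by (auto simp: PiE_iff)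
    \<comment> \<open>The v supplied by surjectivity may be inhomogeneous. As g and every
      \<open>m s\<close> are homogeneous, each v s can be replaced by its part in the complementary
      degree, which is (e + b s) * l.\<close>
    have "g = part (j + e * int l) (\<Sum>s<p. v s * m s)"
      using part_homogeneous[OF g] v(2) \<pi>_sum[OF v(1)] by simp
    also have "\<dots> = (\<Sum>s<p. part (j + e * int l - (j - b s * int l)) (v s) * m s)"
      using part_mult[OF m vc] by (simp add: part_sum)
    also have "\<dots> = (\<Sum>s<p. part ((e + b s) * int l) (v s) * m s)" by (simp add: algebra_simps)
    finally show ?thesis
      using part_rdeg[OF vc] by (intro exI[of _ "\<lambda>s. part ((e + b s) * int l) (v s)"]) blast
  qed
  have syz: "\<exists>w. (\<forall>t<q. w t \<in> carrier S) \<and> (\<forall>s<p. v s = (\<Sum>t<q. A s t * w t))"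
    if v: "\<forall>s<p. v s \<in> rdeg S ((e + b s) * int l)" and zero: "(\<Sum>s<p. v s * m s) = 0" for v e
  proof -
    let ?v = "restrict v {..<p}"
    \<comment> \<open>Homogeneous elements of degree divisible by l lie in the Veronese ring, and
      \<open>restrict\<close> supplies the extensionality that tuples in a free module must
      have.\<close>
    have vF: "?v \<in> carrier ?F" using v V_rdeg by auto
    then have "?v \<in> {v \<in> carrier ?F. \<pi> v = \<zero>\<^bsub>Nv\<^esub>}"
      using \<pi>_sum[OF vF] zero by simp
    then obtain w where w: "w \<in> carrier ?G" "?v = matrix_map V p q A w" unfolding \<pi>(3) by blast
    have wc: "w t \<in> carrier V" if "t < q" for t using w(1) that by (auto simp: PiE_iff)
    have "v s = (\<Sum>t<q. A s t * w t)" if s: "s < p" for s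
    proof -
      have "v s = finsum V (\<lambda>t. A s t * w t) {..<q}"
        using fun_cong[OF w(2), of s] s by (simp add: matrix_map_def)
      also have "\<dots> = (\<Sum>t<q. A s t * w t)"
        using A_carrier[OF s] wc V_mult by (intro V_finsum) auto
      finally show ?thesis .
    qed
    then show ?thesis using wc V_carrier by blast
  qed
  show thesis by (rule that[OF m A A_m gen syz])
qed

end

end

end

lemma (in graded_cring) graded_module_imp: "graded_module R M \<Longrightarrow> graded_ring_module R M"
  by (intro graded_ring_module.intro graded_cring_axioms graded_ring_module_axioms.intro)
    (auto simp: graded_module_def graded_module_axioms_def)

theorem proposition5p5:
  fixes n :: nat and a :: "nat \<Rightarrow> nat" and l :: nat
    and S :: "('k::field) polynomial graded_ring"
    and M :: "('k polynomial, 'm) graded_module"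
    and j :: int and p q :: nat and b c :: "nat \<Rightarrow> int"
    and A :: "nat \<Rightarrow> nat \<Rightarrow> 'k polynomial"
    and G F :: "('k polynomial, nat \<Rightarrow> 'k polynomial) graded_module"
    and \<Phi> M'
  defines "S \<equiv> weighted_poly_ring n a"
    and "l \<equiv> Lcm (a ` {..n})"
    and "G \<equiv> free_module S q (\<lambda>t. c t * int l)"
    and "F \<equiv> free_module S p (\<lambda>s. b s * int l)"
    and "\<Phi> \<equiv> matrix_map S p q A"
    and "M' \<equiv> graded_coker (graded_tensor S M G) (graded_tensor S M F) (tensor_map S M F id \<Phi>)"
  assumes "\<And>i. i \<le> n \<Longrightarrow> a i \<ge> 1"
    and "graded_module S M"
    and "presentation_matrix (veronese_ring l S) (veronese l (shift (self_module S) j)) p b q c A"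
  shows "sheaf_isomorphic (Proj S) (tilde S M') (twist S (tilde S M) j)"
proof -
  have S: "graded_cring S" unfolding S_def by (rule poly_graded)
  interpret S: graded_cring S by (rule S)
  interpret M: graded_ring_module S M by (rule S.graded_module_imp[OF assms(8)])
  interpret gM: graded_module S M by (rule assms(8))
  from presentation_generators[OF assms(9)[unfolded S_def]]
  obtain m where m_deg: "\<And>s. s < p \<Longrightarrow> m s \<in> rdeg S (j - b s * int l)"
    and A_deg: "\<And>s t. \<lbrakk>s < p; t < q\<rbrakk> \<Longrightarrow> A s t \<in> rdeg S ((b s - c t) * int l)"
    and A_m: "\<And>t. t < q \<Longrightarrow> (\<Sum>s<p. A s t * m s) = 0"
    and gen: "\<And>g e. g \<in> rdeg S (j + e * int l) \<Longrightarrow>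
      \<exists>r. (\<forall>s<p. r s \<in> rdeg S ((e + b s) * int l)) \<and> g = (\<Sum>s<p. r s * m s)"
    and syz: "\<And>v e. \<lbrakk>\<forall>s<p. v s \<in> rdeg S ((e + b s) * int l); (\<Sum>s<p. v s * m s) = 0\<rbrakk> \<Longrightarrow>
      \<exists>w. (\<forall>t<q. w t \<in> carrier S) \<and> (\<forall>s<p. v s = (\<Sum>t<q. A s t * w t))"
    unfolding S_def[symmetric] by blast
  have mult: "x \<otimes>\<^bsub>S\<^esub> y = x * y" and zero: "\<zero>\<^bsub>S\<^esub> = 0" for x y unfolding S_def by simp_all
  have finsum: "finsum S f I = sum f I" if "finite I" "\<And>i. i \<in> I \<Longrightarrow> f i \<in> carrier S" for f and I :: "nat set"
    using that unfolding S_def by (rule poly_finsum)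
  have mc: "m s \<in> carrier S" if "s < p" for s using S.rdeg_carrier[OF m_deg[OF that]] .
  have Ac: "A s t \<in> carrier S" if "s < p" "t < q" for s t using S.rdeg_carrier[OF A_deg[OF that]] .
  have comb: "finsum S (\<lambda>s. v s \<otimes>\<^bsub>S\<^esub> m s) {..<p} = (\<Sum>s<p. v s * m s)"
    if "\<And>s. s < p \<Longrightarrow> v s \<in> carrier S" for v
    using that mc S.m_closed by (subst finsum) (auto simp: mult)
  \<comment> \<open>The summands of F and G are twisted by b s * l and c t * l, and
    \<open>A s t\<close> has degree (b s - c t) * l, the difference of the two.\<close>
  interpret coker: graded_cokernel S M p q "\<lambda>s. b s * int l" "\<lambda>t. c t * int l" A
    by (intro graded_cokernel.intro M.graded_ring_module_axioms gM.graded_module_axioms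
        graded_cokernel_axioms.intro) (simp add: A_deg left_diff_distrib[symmetric])
  have M': "M' = coker.C" unfolding M'_def G_def F_def \<Phi>_def ..
  interpret N: graded_ring_module S M' unfolding M' by (rule coker.graded_cokernel)
  interpret twisted_presentation S M M' l j p q b c A m coker.proj
  proof (intro twisted_presentation.intro M.graded_ring_module_axioms N.graded_ring_module_axioms
      twisted_presentation_axioms.intro, unfold M')
    show "0 < l"
    proof -
      \<comment> \<open>A set containing 0 has least common multiple 0; positivity of the weights
        excludes this case.\<close>
      have "0 \<notin> a ` {..n}" using assms(7) by force
      moreover have "finite (a ` {..n})" by simp
      ultimately have "l \<noteq> 0" unfolding l_def using Lcm_0_iff by blast
      then show ?thesis by (rule neq0_conv[THEN iffD1])
    qed
    show "\<exists>u\<in>rdeg S (int l). u \<notin> P" if "P \<in> Proj_set S" for P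
      using that unfolding S_def l_def by (rule Proj_unit)
    show "finsum S (\<lambda>s. A s t \<otimes>\<^bsub>S\<^esub> m s) {..<p} = \<zero>\<^bsub>S\<^esub>" if "t < q" for t
      using comb[of "\<lambda>s. A s t"] Ac that A_m zero by simp
    show "\<exists>r. (\<forall>s<p. r s \<in> rdeg S ((e + b s) * int l)) \<and> g = finsum S (\<lambda>s. r s \<otimes>\<^bsub>S\<^esub> m s) {..<p}"
      if "g \<in> rdeg S (j + e * int l)" for g e
    proof -
      obtain r where r: "\<forall>s<p. r s \<in> rdeg S ((e + b s) * int l)" "g = (\<Sum>s<p. r s * m s)"
        using gen[OF \<open>g \<in> rdeg S (j + e * int l)\<close>] by blast
      have "r s \<in> carrier S" if "s < p" for s using r(1) that S.rdeg_carrier by blast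
      from comb[OF this] r show ?thesis by (intro exI[of _ r] conjI) simp_all
    qed
    show "\<exists>w. (\<forall>t<q. w t \<in> carrier S) \<and> (\<forall>s<p. v s = finsum S (\<lambda>t. A s t \<otimes>\<^bsub>S\<^esub> w t) {..<q})"
      if v: "\<forall>s<p. v s \<in> rdeg S ((e + b s) * int l)"
        and 0: "finsum S (\<lambda>s. v s \<otimes>\<^bsub>S\<^esub> m s) {..<p} = \<zero>\<^bsub>S\<^esub>" for v e
    proof -
      have "v s \<in> carrier S" if "s < p" for s using v that S.rdeg_carrier by blast
      from comb[OF this] 0 zero have "(\<Sum>s<p. v s * m s) = 0" by simp
      then obtain w where w: "\<forall>t<q. w t \<in> carrier S" "\<forall>s<p. v s = (\<Sum>t<q. A s t * w t)"
        using syz[OF v] by blast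
      have "finsum S (\<lambda>t. A s t \<otimes>\<^bsub>S\<^esub> w t) {..<q} = (\<Sum>t<q. A s t * w t)" if "s < p" for s
        using w(1) Ac[OF that] S.m_closed by (subst finsum) (auto simp: mult)
      then show ?thesis using w by (intro exI[of _ w]) simp
    qed
    show "coker.proj x = coker.proj y" if "\<And>s. s < p \<Longrightarrow> x s = y s" for x y
      using that by (rule coker.proj_cong)
    show "\<exists>w. (\<forall>t<q. w t \<in> mdeg M (d + c t * int l)) \<and>
        (\<forall>s<p. x s = finsum M (\<lambda>t. A s t \<odot>\<^bsub>M\<^esub> w t) {..<q})"
      if "\<forall>s<p. x s \<in> mdeg M (d + b s * int l)" "coker.proj x = \<zero>\<^bsub>coker.C\<^esub>" for x d
      using that by (rule coker.proj_eq_zero_homogeneousD)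
  qed (simp_all add: m_deg A_deg coker.proj_add coker.proj_smult coker.proj_closed coker.proj_mdeg
      coker.proj_rel)
  show ?thesis by (rule tilde_iso_twist)
qed

end
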